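(* Let $X^\varepsilon$ be the solution of $$dX^\varepsilon_t = f(X^\varepsilon_t)\,dt+\sqrt{\varepsilon\,\sigma(X^\varepsilon_t)}\,dB_t,\qquad X^\varepsilon_0=\varepsilon>0,$$ and set $T_\varepsilon:=\frac{1}{f'(0)}\log\frac1\varepsilon$. Then for every $T>0$, $$\sup_{t\in[0,T]}\big|X^\varepsilon_{T_\varepsilon+t}-x_t\big|\xrightarrow[\varepsilon\to0]{\mathbb P}0,$$ where $x_t$ is the solution of the ODE $\dot x_t=f(x_t)$ with random initial condition $x_0=H(W)$. Here $$H(x):=\lim_{t\to\infty}\phi_t\big(x e^{-f'(0)t}\big),\quad x\ge 0$$ (this limit exists), and $W:=\lim_{t\to\infty}e^{-f'(0)t}Y_t$ (almost sure limit, which exists) where $Y$ solves, with the same Brownian motion $B$, $$Y_t=1+\int_0^t f'(0)Y_s\,ds+\int_0^t\sqrt{\sigma'(0)Y_s}\,dB_s.$$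
   Context: Standing assumptions: $B$ is a standard Brownian motion; $f:\mathbb R_+\to\mathbb R$ and $\sigma:\mathbb R_+\to\mathbb R_+$ are twice continuously differentiable with bounded second derivatives; $f(0)=\sigma(0)=0$, $f'(0)>0$, $\sigma'(0)>0$; $\sigma$ and $\sigma'$ are bounded; and $f$ satisfies the drift condition $(y-x)(f(y)-f(x))\le f'(0)(y-x)^2$ for all $x,y\in\mathbb R_+$. Under these assumptions the SDE has a unique strong solution in $\mathbb R_+$ for every initial point in $\mathbb R_+$. $\phi_t(x)$ denotes the flow of the ODE $\dot x_t=f(x_t)$, i.e. the value at time $t$ of the solution started at $x$. *)

theory Defs
  imports "HOL-Probability.Probability"
begin

definition brownian_motion :: "'a measure \<Rightarrow> (real \<Rightarrow> 'a \<Rightarrow> real) \<Rightarrow> bool" where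
  "brownian_motion M B \<longleftrightarrow>
     prob_space M \<and>
     (\<forall>t. B t \<in> borel_measurable M) \<and>
     (\<forall>\<omega>\<in>space M. B 0 \<omega> = 0 \<and> continuous_on {0..} (\<lambda>t. B t \<omega>)) \<and>
     (\<forall>s t. 0 \<le> s \<longrightarrow> s < t \<longrightarrow>
        distributed M lborel (\<lambda>\<omega>. B t \<omega> - B s \<omega>) (normal_density 0 (sqrt (t - s)))) \<and>
     (\<forall>(n::nat) (ts::nat \<Rightarrow> real). 0 \<le> ts 0 \<and> (\<forall>i<n. ts i \<le> ts (Suc i)) \<longrightarrow>
        prob_space.indep_vars M (\<lambda>_. borel) (\<lambda>i \<omega>. B (ts (Suc i)) \<omega> - B (ts i) \<omega>) {..<n})"

definition bm_filtration :: "'a measure \<Rightarrow> (real \<Rightarrow> 'a \<Rightarrow> real) \<Rightarrow> real \<Rightarrow> 'a measure" where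
  "bm_filtration M B t = sigma (space M)
     ((\<Union>s\<in>{0..t}. {B s -` A \<inter> space M | A. A \<in> sets borel}) \<union> null_sets M)"

definition adapted_to_bm :: "'a measure \<Rightarrow> (real \<Rightarrow> 'a \<Rightarrow> real) \<Rightarrow> (real \<Rightarrow> 'a \<Rightarrow> real) \<Rightarrow> bool" where
  "adapted_to_bm M B X \<longleftrightarrow> (\<forall>t\<ge>0. X t \<in> borel_measurable (bm_filtration M B t))"

definition conv_in_prob :: "'a measure \<Rightarrow> ('i \<Rightarrow> 'a \<Rightarrow> real) \<Rightarrow> ('a \<Rightarrow> real) \<Rightarrow> 'i filter \<Rightarrow> bool" where
  "conv_in_prob M Z L F \<longleftrightarrow>
     (\<forall>\<delta>>0. ((\<lambda>i. measure M {\<omega>\<in>space M. \<delta> < \<bar>Z i \<omega> - L \<omega>\<bar>}) \<longlongrightarrow> 0) F)"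

text \<open>I is the Ito integral of the (continuous, adapted) integrand H against B over [0,t]:
  the limit in probability of the left-point Riemann sums along dyadic partitions.\<close>
definition ito_integral_is :: "'a measure \<Rightarrow> (real \<Rightarrow> 'a \<Rightarrow> real) \<Rightarrow> (real \<Rightarrow> 'a \<Rightarrow> real)
     \<Rightarrow> real \<Rightarrow> ('a \<Rightarrow> real) \<Rightarrow> bool" where
  "ito_integral_is M B H t I \<longleftrightarrow>
     I \<in> borel_measurable M \<and>
     conv_in_prob M
       (\<lambda>n \<omega>. \<Sum>k<(2::nat)^n. H (t * real k / 2^n) \<omega> *
                 (B (t * real (Suc k) / 2^n) \<omega> - B (t * real k / 2^n) \<omega>)) I sequentially"

definition sde_solution :: "'a measure \<Rightarrow> (real \<Rightarrow> 'a \<Rightarrow> real) \<Rightarrow> (real \<Rightarrow> real) \<Rightarrow> (real \<Rightarrow> real)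
     \<Rightarrow> real \<Rightarrow> (real \<Rightarrow> 'a \<Rightarrow> real) \<Rightarrow> bool" where
  "sde_solution M B b s x0 X \<longleftrightarrow>
     adapted_to_bm M B X \<and>
     (\<forall>\<omega>\<in>space M. continuous_on {0..} (\<lambda>t. X t \<omega>) \<and> (\<forall>t\<ge>0. 0 \<le> X t \<omega>)) \<and>
     (\<forall>t\<ge>0. \<exists>I. ito_integral_is M B (\<lambda>r \<omega>. s (X r \<omega>)) t I \<and>
        (AE \<omega> in M. X t \<omega> = x0 + integral {0..t} (\<lambda>r. b (X r \<omega>)) + I \<omega>))"

definition ode_flow :: "(real \<Rightarrow> real) \<Rightarrow> real \<Rightarrow> real \<Rightarrow> real" where
  "ode_flow f t x = (THE y. \<exists>u. u 0 = x \<and> (\<forall>s\<ge>0. 0 \<le> u s) \<and>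
      (\<forall>s\<ge>0. (u has_real_derivative f (u s)) (at s within {0..})) \<and> u t = y)"

end

theory Submission
  imports Defs "HOL-Real_Asymp.Real_Asymp"
begin

text \<open>
  Write \<open>\<lambda> = f'(0)\<close>.  For an equation with drift at most \<open>\<lambda> x\<close> and squared diffusion coefficient at most
  \<open>c x\<close>, let \<open>N\<close> be the solution minus its integrated drift.  Up to time \<open>s\<close> the variance of \<open>N\<close> is of
  order \<open>e\<^bsup>\<lambda>s\<^esup>\<close>, so by a maximal inequality \<open>|N\<^sub>s - x\<^sub>0| \<le> \<kappa> x\<^sub>0 e\<^bsup>3\<lambda>s/4\<^esup>\<close> for all \<open>s \<ge> n\<close>, outside an event
  whose probability is small for large \<open>n\<close> or \<open>\<kappa>\<close>, uniformly in \<open>\<epsilon>\<close>.  On the good event everything is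
  deterministic: \<open>e\<^bsup>-\<lambda>t\<^esup> Y\<^sub>t\<close> is Cauchy, and after time \<open>n\<close> the path of \<open>X\<close> stays within \<open>O(e\<^bsup>-\<lambda>n/4\<^esup>)\<close> of the
  flow started at \<open>X\<^sub>n\<close> up to time \<open>T\<^sub>\<epsilon> + T\<close>, because \<open>f\<close> is one-sided Lipschitz with constant \<open>\<lambda>\<close>.
  At the fixed time \<open>n\<close>, the Yamada-Watanabe argument gives \<open>X\<^sub>n / \<epsilon> \<rightarrow> Y\<^sub>n\<close> in probability.  Finally
  \<open>\<phi>\<^sub>t(x e\<^bsup>-\<lambda>t\<^esup>)\<close> decreases in \<open>t\<close> and is 1-Lipschitz in \<open>x\<close>, hence converges locally uniformly to \<open>H\<close>.

  The stochastic integral enters only through its defining Riemann sums: Ito's formula is replaced by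
  Taylor's formula on a grid, and stopping times by indicators of \<open>{R \<le> K on [0,t]}\<close> multiplying the
  integrands.
\<close>

section \<open>Brownian filtration and independence of increments\<close>

locale brownian =
  fixes M :: "'a measure" and B :: "real \<Rightarrow> 'a \<Rightarrow> real"
  assumes BM: "brownian_motion M B"

sublocale brownian \<subseteq> prob_space M
  using BM by (simp add: brownian_motion_def)

context brownian begin

abbreviation F where "F \<equiv> bm_filtration M B"

lemma B_meas [measurable]: "B t \<in> borel_measurable M"
  using BM by (simp add: brownian_motion_def)

lemma B_zero: "\<omega> \<in> space M \<Longrightarrow> B 0 \<omega> = 0"
  using BM by (simp add: brownian_motion_def)

lemma F_generator_sub:
  "(\<Union>s\<in>{0..t}. {B s -` A \<inter> space M | A. A \<in> sets borel}) \<union> null_sets M \<subseteq> sets M"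
  by (auto intro!: measurable_sets[OF B_meas])

lemma F_generator_Pow:
  "(\<Union>s\<in>{0..t}. {B s -` A \<inter> space M | A. A \<in> sets borel}) \<union> null_sets M \<subseteq> Pow (space M)"
  using F_generator_sub[of t] sets.sets_into_space by fast

lemma space_F [simp]: "space (F t) = space M"
  unfolding bm_filtration_def by (rule space_measure_of[OF F_generator_Pow])

lemma sets_F: "sets (F t) = sigma_sets (space M)
   ((\<Union>s\<in>{0..t}. {B s -` A \<inter> space M | A. A \<in> sets borel}) \<union> null_sets M)"
  unfolding bm_filtration_def by (rule sets_measure_of[OF F_generator_Pow])

lemma sets_F_sub: "sets (F t) \<subseteq> sets M"
  unfolding sets_F using F_generator_sub by (rule sets.sigma_sets_subset)

lemma sets_F_mono: "s \<le> t \<Longrightarrow> sets (F s) \<subseteq> sets (F t)"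
  unfolding sets_F by (intro sigma_sets_mono' Un_mono UN_mono) auto

lemma meas_F_M: "Z \<in> borel_measurable (F t) \<Longrightarrow> Z \<in> borel_measurable M"
  by (rule measurable_from_subalg[of M "F t"]) (auto simp: subalgebra_def sets_F_sub subsetD[OF sets_F_sub])

lemma meas_F_mono: "Z \<in> borel_measurable (F s) \<Longrightarrow> s \<le> t \<Longrightarrow> Z \<in> borel_measurable (F t)"
  by (rule measurable_from_subalg[of "F t" "F s"]) (auto simp: subalgebra_def subsetD[OF sets_F_mono])

lemma B_meas_F: "0 \<le> s \<Longrightarrow> s \<le> t \<Longrightarrow> B s \<in> borel_measurable (F t)"
  by (rule measurableI) (auto simp: sets_F intro!: sigma_sets.Basic)

lemma indep_cylinder:
  assumes J: "finite J" "J \<subseteq> {0..s}" and A: "\<And>r. A r \<in> sets borel" and C: "C \<in> sets borel"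
    and su: "0 \<le> s" "s \<le> u"
  shows "prob ({\<omega>\<in>space M. \<forall>r\<in>J. B r \<omega> \<in> A r} \<inter> ((\<lambda>\<omega>. B u \<omega> - B s \<omega>) -` C \<inter> space M)) =
    prob {\<omega>\<in>space M. \<forall>r\<in>J. B r \<omega> \<in> A r} * prob ((\<lambda>\<omega>. B u \<omega> - B s \<omega>) -` C \<inter> space M)"
proof -
  define xs where "xs = sorted_list_of_set (insert 0 (insert s J))"
  define n where "n = length xs"
  define ts where "ts i = (if i < n then xs ! i else u)" for i
  have set_xs: "set xs = insert 0 (insert s J)" unfolding xs_def by (rule set_sorted_list_of_set) (use J in simp)
  have srt: "sorted xs" by (simp add: xs_def)
  have n0: "0 < n" using set_xs by (auto simp: n_def)
  have rng: "x \<in> {0..s}" if "x \<in> set xs" for x using that set_xs J su by auto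
  have ts0: "ts 0 = 0"
  proof -
    obtain i where i: "i < n" "xs ! i = 0" using set_xs by (metis in_set_conv_nth insertI1 n_def)
    have "xs ! 0 \<le> xs ! i" using srt i n0 by (intro sorted_nth_mono) (auto simp: n_def)
    moreover have "0 \<le> xs ! 0" using rng[of "xs ! 0"] n0 by (auto simp: n_def)
    ultimately show ?thesis using i n0 by (simp add: ts_def)
  qed
  have tsl: "ts (n - 1) = s"
  proof -
    obtain i where i: "i < n" "xs ! i = s" using set_xs by (metis in_set_conv_nth insertI1 insertI2 n_def)
    have "xs ! i \<le> xs ! (n - 1)" using srt i n0 by (intro sorted_nth_mono) (auto simp: n_def)
    moreover have "xs ! (n - 1) \<le> s" using rng[of "xs ! (n - 1)"] n0 by (auto simp: n_def)
    ultimately show ?thesis using i n0 by (simp add: ts_def)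
  qed
  have tsn: "ts n = u" by (simp add: ts_def)
  have mono: "ts i \<le> ts (Suc i)" if "i < n" for i
  proof (cases "Suc i < n")
    case True then show ?thesis using srt by (simp add: ts_def sorted_nth_mono n_def)
  next
    case False
    then have "i = n - 1" "Suc i = n" using that by auto
    then show ?thesis using tsl tsn su by simp
  qed
  let ?X = "\<lambda>i \<omega>. B (ts (Suc i)) \<omega> - B (ts i) \<omega>"
  have ind: "indep_vars (\<lambda>_. borel) ?X {..<n}"
    using BM ts0 mono unfolding brownian_motion_def by auto
  have iv: "indep_var (PiM {..<n-1} (\<lambda>_. borel)) (\<lambda>\<omega>. restrict (\<lambda>i. ?X i \<omega>) {..<n-1})
      (PiM {n-1} (\<lambda>_. borel)) (\<lambda>\<omega>. restrict (\<lambda>i. ?X i \<omega>) {n-1})"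
    by (rule indep_var_restrict[OF ind]) (use n0 in auto)
  define idx where "idx r = (SOME i. i < n \<and> xs ! i = r)" for r
  have idx: "idx r < n" "xs ! idx r = r" if "r \<in> J" for r
  proof -
    have "\<exists>i. i < n \<and> xs ! i = r" using set_xs that by (metis in_set_conv_nth insertI2 n_def)
    from someI_ex[OF this] show "idx r < n" "xs ! idx r = r" by (auto simp: idx_def)
  qed
  have Bsum: "B (ts k) \<omega> = (\<Sum>l<k. ?X l \<omega>)" if "\<omega> \<in> space M" for k \<omega>
    using sum_lessThan_telescope[of "\<lambda>l. B (ts l) \<omega>" k] ts0 B_zero[OF that] by simp
  define S1 where "S1 = {x \<in> space (PiM {..<n-1} (\<lambda>_. borel::real measure)). \<forall>r\<in>J. (\<Sum>l<idx r. x l) \<in> A r}"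
  have S1: "S1 \<in> sets (PiM {..<n-1} (\<lambda>_. borel))"
    unfolding S1_def
  proof (rule sets.sets_Collect_finite_All[OF _ J(1)])
    fix r assume r: "r \<in> J"
    have sub: "\<And>l. l < idx r \<Longrightarrow> l \<in> {..<n-1}" using idx[OF r] by auto
    have m: "(\<lambda>x. \<Sum>l<idx r. x l) \<in> borel_measurable (PiM {..<n-1} (\<lambda>_. borel::real measure))"
      by (intro borel_measurable_sum measurable_component_singleton sub) simp
    show "{x \<in> space (PiM {..<n-1} (\<lambda>_. borel)). (\<Sum>l<idx r. x l) \<in> A r} \<in> sets (PiM {..<n-1} (\<lambda>_. borel))"
      using measurable_sets[OF m A[of r]] by (simp add: vimage_def Int_def conj_commute)
  qed
  define S2 where "S2 = {x \<in> space (PiM {n-1} (\<lambda>_. borel::real measure)). x (n-1) \<in> C}"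
  have S2: "S2 \<in> sets (PiM {n-1} (\<lambda>_. borel))"
  proof -
    have m: "(\<lambda>x. x (n-1)) \<in> borel_measurable (PiM {n-1} (\<lambda>_. borel::real measure))"
      by (intro measurable_component_singleton) simp
    show ?thesis unfolding S2_def using measurable_sets[OF m C] by (simp add: vimage_def Int_def conj_commute)
  qed
  have e1: "(\<lambda>\<omega>. restrict (\<lambda>i. ?X i \<omega>) {..<n-1}) -` S1 \<inter> space M = {\<omega>\<in>space M. \<forall>r\<in>J. B r \<omega> \<in> A r}"
  proof -
    have "(\<Sum>l<idx r. restrict (\<lambda>i. ?X i \<omega>) {..<n-1} l) = B r \<omega>" if "r \<in> J" "\<omega> \<in> space M" for r \<omega>
    proof -
      have "(\<Sum>l<idx r. restrict (\<lambda>i. ?X i \<omega>) {..<n-1} l) = (\<Sum>l<idx r. ?X l \<omega>)"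
        using idx[OF that(1)] by (intro sum.cong) auto
      also have "\<dots> = B (ts (idx r)) \<omega>" by (rule Bsum[OF that(2), symmetric])
      also have "ts (idx r) = r" using idx[OF that(1)] by (simp add: ts_def)
      finally show ?thesis .
    qed
    moreover have "restrict (\<lambda>i. ?X i \<omega>) {..<n-1} \<in> space (PiM {..<n-1} (\<lambda>_. borel))" for \<omega>
      by (simp add: space_PiM)
    ultimately show ?thesis unfolding S1_def by auto
  qed
  have e2: "(\<lambda>\<omega>. restrict (\<lambda>i. ?X i \<omega>) {n-1}) -` S2 \<inter> space M = (\<lambda>\<omega>. B u \<omega> - B s \<omega>) -` C \<inter> space M"
    using n0 tsl tsn unfolding S2_def by (intro set_eqI) (simp add: space_PiM)
  have e3: "(\<lambda>\<omega>. (restrict (\<lambda>i. ?X i \<omega>) {..<n-1}, restrict (\<lambda>i. ?X i \<omega>) {n-1})) -` (S1 \<times> S2) \<inter> space M =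
     {\<omega>\<in>space M. \<forall>r\<in>J. B r \<omega> \<in> A r} \<inter> ((\<lambda>\<omega>. B u \<omega> - B s \<omega>) -` C \<inter> space M)"
    unfolding e1[symmetric] e2[symmetric] by blast
  from indep_varD[OF iv S1 S2] show ?thesis unfolding e1 e2 e3 .
qed

lemma indep_F_increment:
  assumes su: "0 \<le> s" "s \<le> u" and Z: "Z \<in> borel_measurable (F s)"
  shows "indep_var borel Z borel (\<lambda>\<omega>. B u \<omega> - B s \<omega>)"
proof -
  define cyl where "cyl = {{\<omega>\<in>space M. \<forall>r\<in>J. B r \<omega> \<in> A r} | J A. finite J \<and> J \<subseteq> {0..s} \<and> (\<forall>r. A r \<in> sets borel)}"
  define D where "D = (\<lambda>\<omega>. B u \<omega> - B s \<omega>)"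
  have Dm [measurable]: "D \<in> borel_measurable M" by (simp add: D_def)
  let ?D = "{D -` C \<inter> space M | C. C \<in> sets borel}"
  have cylM: "cyl \<subseteq> sets M"
  proof
    fix a assume "a \<in> cyl"
    then obtain J A where a: "a = {\<omega>\<in>space M. \<forall>r\<in>J. B r \<omega> \<in> A r}" "finite J" "\<And>r. A r \<in> sets borel"
      by (auto simp: cyl_def)
    show "a \<in> sets M" unfolding a(1)
      by (intro sets.sets_Collect_finite_All a(2)) (use measurable_sets[OF B_meas a(3)] in \<open>simp add: vimage_def Int_def conj_commute\<close>)
  qed
  have "indep_set (cyl \<union> null_sets M) ?D"
  proof (rule indep_setI)
    show "cyl \<union> null_sets M \<subseteq> events" using cylM by auto
    show "?D \<subseteq> events" by (auto intro: measurable_sets[OF Dm])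
  next
    fix a b assume a: "a \<in> cyl \<union> null_sets M" and "b \<in> ?D"
    then obtain C where b: "b = D -` C \<inter> space M" and C: "C \<in> sets borel" by auto
    have bM: "b \<in> sets M" using C b by (auto intro: measurable_sets[OF Dm])
    show "prob (a \<inter> b) = prob a * prob b"
    proof (cases "a \<in> null_sets M")
      case True
      then have "a \<inter> b \<in> null_sets M" using bM by (rule null_set_Int2)
      then show ?thesis using True by (simp add: measure_eq_0_null_sets)
    next
      case False
      then obtain J A where "a = {\<omega>\<in>space M. \<forall>r\<in>J. B r \<omega> \<in> A r}" "finite J" "J \<subseteq> {0..s}" "\<And>r. A r \<in> sets borel"
        using a by (auto simp: cyl_def)
      then show ?thesis unfolding b D_def using indep_cylinder[of J s A C u] su C by simp
    qed
  qed
  then have ind: "indep_set (sigma_sets (space M) (cyl \<union> null_sets M)) (sigma_sets (space M) ?D)"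
  proof (rule indep_set_sigma_sets)
    show "Int_stable (cyl \<union> null_sets M)"
    proof (rule Int_stableI)
      fix a b assume ab: "a \<in> cyl \<union> null_sets M" "b \<in> cyl \<union> null_sets M"
      show "a \<inter> b \<in> cyl \<union> null_sets M"
      proof (cases "a \<in> cyl \<and> b \<in> cyl")
        case True
        then obtain J A J' A' where 1: "a = {\<omega>\<in>space M. \<forall>r\<in>J. B r \<omega> \<in> A r}" "finite J" "J \<subseteq> {0..s}" "\<And>r. A r \<in> sets borel"
          "b = {\<omega>\<in>space M. \<forall>r\<in>J'. B r \<omega> \<in> A' r}" "finite J'" "J' \<subseteq> {0..s}" "\<And>r. A' r \<in> sets borel"
          by (auto simp: cyl_def)
        define A'' where "A'' r = (if r \<in> J then A r else UNIV) \<inter> (if r \<in> J' then A' r else UNIV)" for r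
        have "a \<inter> b = {\<omega>\<in>space M. \<forall>r\<in>J \<union> J'. B r \<omega> \<in> A'' r}" unfolding 1 A''_def by (auto split: if_splits)
        moreover have "\<And>r. A'' r \<in> sets borel" using 1 by (auto simp: A''_def)
        ultimately have "a \<inter> b \<in> cyl" unfolding cyl_def using 1
          by (intro CollectI exI[of _ "J \<union> J'"] exI[of _ A'']) auto
        then show ?thesis by simp
      next
        case False
        have "a \<in> sets M" "b \<in> sets M" using ab cylM by auto
        then have "a \<inter> b \<in> null_sets M" using False ab by (auto intro: null_set_Int1 null_set_Int2)
        then show ?thesis by simp
      qed
    qed
    show "Int_stable ?D"
    proof (rule Int_stableI)
      fix a b assume "a \<in> ?D" "b \<in> ?D"
      then obtain C C' where "a = D -` C \<inter> space M" "b = D -` C' \<inter> space M" "C \<in> sets borel" "C' \<in> sets borel" by auto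
      then show "a \<inter> b \<in> ?D" by (intro CollectI exI[of _ "C \<inter> C'"]) auto
    qed
  qed
  have sub: "sigma_sets (space M) {Z -` A \<inter> space M | A. A \<in> sets borel} \<subseteq> sigma_sets (space M) (cyl \<union> null_sets M)"
  proof -
    have "sets (F s) \<subseteq> sigma_sets (space M) (cyl \<union> null_sets M)"
      unfolding sets_F
    proof (rule sigma_sets_mono', rule Un_mono)
      show "(\<Union>r\<in>{0..s}. {B r -` A \<inter> space M | A. A \<in> sets borel}) \<subseteq> cyl"
      proof safe
        fix r A assume "r \<in> {0..s}" "A \<in> sets (borel::real measure)"
        then show "B r -` A \<inter> space M \<in> cyl" unfolding cyl_def
          by (intro CollectI exI[of _ "{r}"] exI[of _ "\<lambda>_. A"]) auto
      qed
    qed simp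
    moreover have "{Z -` A \<inter> space M | A. A \<in> sets borel} \<subseteq> sets (F s)"
      using measurable_sets[OF Z] by auto
    ultimately show ?thesis
      using sets.sigma_sets_subset[of "{Z -` A \<inter> space M | A. A \<in> sets borel}" "F s"] unfolding space_F by (meson subset_trans)
  qed
  from ind have "indep_set (sigma_sets (space M) {Z -` A \<inter> space M | A. A \<in> sets borel}) (sigma_sets (space M) ?D)"
    unfolding indep_set_def by (rule indep_sets_mono_sets) (use sub in \<open>auto split: bool.split\<close>)
  then show ?thesis unfolding indep_var_eq D_def[symmetric] using meas_F_M[OF Z] by simp
qed

end

section \<open>Isometry for sums over two grids\<close>

context brownian begin

lemma increment_moments:
  assumes "0 \<le> s" "s \<le> u"
  shows "integrable M (\<lambda>\<omega>. (B u \<omega> - B s \<omega>))" "expectation (\<lambda>\<omega>. (B u \<omega> - B s \<omega>)) = 0"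
    "integrable M (\<lambda>\<omega>. (B u \<omega> - B s \<omega>)\<^sup>2)" "expectation (\<lambda>\<omega>. (B u \<omega> - B s \<omega>)\<^sup>2) = u - s"
    "integrable M (\<lambda>\<omega>. (B u \<omega> - B s \<omega>)^4)" "expectation (\<lambda>\<omega>. (B u \<omega> - B s \<omega>)^4) = 3 * (u - s)\<^sup>2"
proof -
  have "integrable M (\<lambda>\<omega>. (B u \<omega> - B s \<omega>)) \<and> expectation (\<lambda>\<omega>. (B u \<omega> - B s \<omega>)) = 0 \<and>
    integrable M (\<lambda>\<omega>. (B u \<omega> - B s \<omega>)\<^sup>2) \<and> expectation (\<lambda>\<omega>. (B u \<omega> - B s \<omega>)\<^sup>2) = u - s \<and>
    integrable M (\<lambda>\<omega>. (B u \<omega> - B s \<omega>)^4) \<and> expectation (\<lambda>\<omega>. (B u \<omega> - B s \<omega>)^4) = 3 * (u - s)\<^sup>2"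
  proof (cases "s = u")
    case True then show ?thesis by simp
  next
    case False
    then have su: "s < u" using assms by simp
    let ?d = "normal_density 0 (sqrt (u - s))"
    have D: "distributed M lborel (\<lambda>\<omega>. B u \<omega> - B s \<omega>) ?d"
      using BM assms su by (simp add: brownian_motion_def)
    have nn: "\<And>x. x \<in> space lborel \<Longrightarrow> 0 \<le> ?d x" by (simp add: normal_density_nonneg)
    have i: "integrable M (\<lambda>\<omega>. (B u \<omega> - B s \<omega>) ^ k) \<longleftrightarrow> integrable lborel (\<lambda>x. ?d x * x ^ k)" for k
      using distributed_integrable[OF D _ nn, of "\<lambda>x. x ^ k"] by simp
    have e: "expectation (\<lambda>\<omega>. (B u \<omega> - B s \<omega>) ^ k) = (\<integral>x. ?d x * x ^ k \<partial>lborel)" for k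
      using distributed_integral[OF D _ nn, of "\<lambda>x. x ^ k"] by simp
    have h1: "has_bochner_integral lborel (\<lambda>x. ?d x * x ^ 1) 0"
      using normal_moment_odd[of "sqrt (u - s)" 0 0] su by simp
    have h2: "has_bochner_integral lborel (\<lambda>x. ?d x * x ^ 2) (u - s)"
      using normal_moment_even[of "sqrt (u - s)" 0 1] su by (simp add: fact_numeral diff_divide_distrib)
    have h4: "has_bochner_integral lborel (\<lambda>x. ?d x * x ^ 4) (3 * (u - s)\<^sup>2)"
      using normal_moment_even[of "sqrt (u - s)" 0 2] su by (simp add: fact_numeral power_divide)
    show ?thesis
      using i[of 1] e[of 1] h1 i[of 2] e[of 2] h2 i[of 4] e[of 4] h4
      by (simp add: has_bochner_integral_iff)
  qed
  then show "integrable M (\<lambda>\<omega>. (B u \<omega> - B s \<omega>))" "expectation (\<lambda>\<omega>. (B u \<omega> - B s \<omega>)) = 0"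
    "integrable M (\<lambda>\<omega>. (B u \<omega> - B s \<omega>)\<^sup>2)" "expectation (\<lambda>\<omega>. (B u \<omega> - B s \<omega>)\<^sup>2) = u - s"
    "integrable M (\<lambda>\<omega>. (B u \<omega> - B s \<omega>)^4)" "expectation (\<lambda>\<omega>. (B u \<omega> - B s \<omega>)^4) = 3 * (u - s)\<^sup>2"
    by auto
qed

lemma adapted_times_increment:
  assumes "0 \<le> s" "s \<le> u" "Z \<in> borel_measurable (F s)" "integrable M Z"
  shows "integrable M (\<lambda>\<omega>. Z \<omega> * (B u \<omega> - B s \<omega>))" "expectation (\<lambda>\<omega>. Z \<omega> * (B u \<omega> - B s \<omega>)) = 0"
    "integrable M (\<lambda>\<omega>. Z \<omega> * (B u \<omega> - B s \<omega>)\<^sup>2)"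
    "expectation (\<lambda>\<omega>. Z \<omega> * (B u \<omega> - B s \<omega>)\<^sup>2) = expectation Z * (u - s)"
proof -
  note iv = indep_F_increment[OF assms(1-3)]
  note m = increment_moments[OF assms(1,2)]
  show "integrable M (\<lambda>\<omega>. Z \<omega> * (B u \<omega> - B s \<omega>))" "expectation (\<lambda>\<omega>. Z \<omega> * (B u \<omega> - B s \<omega>)) = 0"
    using indep_var_integrable[OF iv assms(4) m(1)] indep_var_lebesgue_integral[OF iv assms(4) m(1)] m by auto
  have iv2: "indep_var borel Z borel (\<lambda>\<omega>. (B u \<omega> - B s \<omega>)\<^sup>2)"
    using indep_var_compose[OF iv, of "\<lambda>x. x" borel "\<lambda>x. x\<^sup>2" borel] by (simp add: o_def)
  show "integrable M (\<lambda>\<omega>. Z \<omega> * (B u \<omega> - B s \<omega>)\<^sup>2)"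
    "expectation (\<lambda>\<omega>. Z \<omega> * (B u \<omega> - B s \<omega>)\<^sup>2) = expectation Z * (u - s)"
    using indep_var_integrable[OF iv2 assms(4) m(3)] indep_var_lebesgue_integral[OF iv2 assms(4) m(3)] m by auto
qed

lemma integrable_bounded:
  fixes Z :: "'a \<Rightarrow> real"
  assumes "Z \<in> borel_measurable M" "\<And>\<omega>. \<omega> \<in> space M \<Longrightarrow> \<bar>Z \<omega>\<bar> \<le> C"
  shows "integrable M Z"
  by (rule integrable_const_bound[where B = C]) (use assms in auto)

definition overlap :: "real \<Rightarrow> real \<Rightarrow> real \<Rightarrow> real \<Rightarrow> real" where
  "overlap u u' v v' = max 0 (min u' v' - max u v)"

lemma increment_covariance_le:
  assumes u: "0 \<le> u" "u \<le> u'" and v: "u \<le> v" "v \<le> v'"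
    and G: "G \<in> borel_measurable (F u)" "\<And>\<omega>. \<omega> \<in> space M \<Longrightarrow> \<bar>G \<omega>\<bar> \<le> C"
    and G': "G' \<in> borel_measurable (F v)" "\<And>\<omega>. \<omega> \<in> space M \<Longrightarrow> \<bar>G' \<omega>\<bar> \<le> C'"
  shows "integrable M (\<lambda>\<omega>. (G \<omega> * (B u' \<omega> - B u \<omega>)) * (G' \<omega> * (B v' \<omega> - B v \<omega>))) \<and>
    expectation (\<lambda>\<omega>. (G \<omega> * (B u' \<omega> - B u \<omega>)) * (G' \<omega> * (B v' \<omega> - B v \<omega>)))
      = expectation (\<lambda>\<omega>. G \<omega> * G' \<omega>) * overlap u u' v v'"
proof -
  have GF: "G \<in> borel_measurable (F v)" using meas_F_mono[OF G(1) v(1)] .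
  have GG: "(\<lambda>\<omega>. G \<omega> * G' \<omega>) \<in> borel_measurable (F v)" using GF G' by simp
  have GGb: "\<bar>G \<omega> * G' \<omega>\<bar> \<le> C * C'" if "\<omega> \<in> space M" for \<omega>
    unfolding abs_mult using G(2)[OF that] G'(2)[OF that] by (intro mult_mono) auto
  have GGi: "integrable M (\<lambda>\<omega>. G \<omega> * G' \<omega>)"
    by (rule integrable_bounded[OF meas_F_M[OF GG] GGb])
  have disj: "integrable M (\<lambda>\<omega>. G \<omega> * G' \<omega> * (B w \<omega> - B u \<omega>) * (B v' \<omega> - B v \<omega>)) \<and>
     expectation (\<lambda>\<omega>. G \<omega> * G' \<omega> * (B w \<omega> - B u \<omega>) * (B v' \<omega> - B v \<omega>)) = 0" if w: "u \<le> w" "w \<le> v" for w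
  proof -
    have m: "(\<lambda>\<omega>. G \<omega> * G' \<omega> * (B w \<omega> - B u \<omega>)) \<in> borel_measurable (F v)"
      using GG B_meas_F[of w v] B_meas_F[of u v] u v w by simp
    have i: "integrable M (\<lambda>\<omega>. G \<omega> * G' \<omega> * (B w \<omega> - B u \<omega>))"
    proof (rule Bochner_Integration.integrable_bound)
      show "integrable M (\<lambda>\<omega>. (C * C') * (B w \<omega> - B u \<omega>))" using increment_moments(1)[of u w] u w by simp
      show "AE \<omega> in M. norm (G \<omega> * G' \<omega> * (B w \<omega> - B u \<omega>)) \<le> norm ((C * C') * (B w \<omega> - B u \<omega>))"
      proof (rule AE_I2)
        fix \<omega> assume "\<omega> \<in> space M"
        from GGb[OF this] have "\<bar>G \<omega> * G' \<omega>\<bar> \<le> \<bar>C * C'\<bar>" by linarith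
        then show "norm (G \<omega> * G' \<omega> * (B w \<omega> - B u \<omega>)) \<le> norm ((C * C') * (B w \<omega> - B u \<omega>))"
          by (simp only: real_norm_def abs_mult[of _ "B w \<omega> - B u \<omega>"] mult_right_mono abs_ge_zero)
      qed
    qed (use meas_F_M[OF m] in simp)
    from adapted_times_increment[OF _ v(2) m i] u v show ?thesis by simp
  qed
  show ?thesis
  proof (cases "u' \<le> v")
    case True
    then have "overlap u u' v v' = 0" using v by (simp add: overlap_def)
    then show ?thesis using disj[of u'] u True by (simp add: mult_ac)
  next
    case False
    then have vu: "v < u'" by simp
    define w where "w = min u' v'"
    define w' where "w' = max u' v'"
    have wv: "v \<le> w" "w \<le> w'" using vu v by (auto simp: w_def w'_def)
    have m1: "(\<lambda>\<omega>. G \<omega> * G' \<omega> * (B w \<omega> - B v \<omega>)) \<in> borel_measurable (F w)"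
      using meas_F_mono[OF GG wv(1)] B_meas_F[of w w] B_meas_F[of v w] u v wv by simp
    have i2: "integrable M (\<lambda>\<omega>. G \<omega> * G' \<omega> * (B w \<omega> - B v \<omega>)\<^sup>2)"
      "expectation (\<lambda>\<omega>. G \<omega> * G' \<omega> * (B w \<omega> - B v \<omega>)\<^sup>2) = expectation (\<lambda>\<omega>. G \<omega> * G' \<omega>) * (w - v)"
      "integrable M (\<lambda>\<omega>. G \<omega> * G' \<omega> * (B w \<omega> - B v \<omega>))"
      using adapted_times_increment[OF _ wv(1) GG GGi] u v by auto
    have i3: "integrable M (\<lambda>\<omega>. G \<omega> * G' \<omega> * (B w \<omega> - B v \<omega>) * (B w' \<omega> - B w \<omega>))"
      "expectation (\<lambda>\<omega>. G \<omega> * G' \<omega> * (B w \<omega> - B v \<omega>) * (B w' \<omega> - B w \<omega>)) = 0"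
      using adapted_times_increment[OF _ wv(2) m1 i2(3)] u v wv by auto
    have eq: "(G \<omega> * (B u' \<omega> - B u \<omega>)) * (G' \<omega> * (B v' \<omega> - B v \<omega>)) =
       G \<omega> * G' \<omega> * (B v \<omega> - B u \<omega>) * (B v' \<omega> - B v \<omega>) +
       (G \<omega> * G' \<omega> * (B w \<omega> - B v \<omega>)\<^sup>2 + G \<omega> * G' \<omega> * (B w \<omega> - B v \<omega>) * (B w' \<omega> - B w \<omega>))" for \<omega>
    proof -
      have "(B u' \<omega> - B v \<omega>) * (B v' \<omega> - B v \<omega>) = (B w \<omega> - B v \<omega>) * (B w' \<omega> - B v \<omega>)"
        by (simp add: w_def w'_def min_def max_def)
      then have "G \<omega> * G' \<omega> * ((B u' \<omega> - B v \<omega>) * (B v' \<omega> - B v \<omega>)) = G \<omega> * G' \<omega> * ((B w \<omega> - B v \<omega>) * (B w' \<omega> - B v \<omega>))" by simp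
      then show ?thesis by (simp add: algebra_simps power2_eq_square)
    qed
    have "overlap u u' v v' = w - v" using wv v by (simp add: overlap_def w_def)
    then show ?thesis unfolding eq using i2 i3 disj[of v] v by simp
  qed
qed

lemma increment_covariance:
  assumes u: "0 \<le> u" "u \<le> u'" and v: "0 \<le> v" "v \<le> v'"
    and G: "G \<in> borel_measurable (F u)" "\<And>\<omega>. \<omega> \<in> space M \<Longrightarrow> \<bar>G \<omega>\<bar> \<le> C"
    and G': "G' \<in> borel_measurable (F v)" "\<And>\<omega>. \<omega> \<in> space M \<Longrightarrow> \<bar>G' \<omega>\<bar> \<le> C'"
  shows "integrable M (\<lambda>\<omega>. (G \<omega> * (B u' \<omega> - B u \<omega>)) * (G' \<omega> * (B v' \<omega> - B v \<omega>)))"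
    "expectation (\<lambda>\<omega>. (G \<omega> * (B u' \<omega> - B u \<omega>)) * (G' \<omega> * (B v' \<omega> - B v \<omega>)))
      = expectation (\<lambda>\<omega>. G \<omega> * G' \<omega>) * overlap u u' v v'"
proof -
  have "integrable M (\<lambda>\<omega>. (G \<omega> * (B u' \<omega> - B u \<omega>)) * (G' \<omega> * (B v' \<omega> - B v \<omega>))) \<and>
    expectation (\<lambda>\<omega>. (G \<omega> * (B u' \<omega> - B u \<omega>)) * (G' \<omega> * (B v' \<omega> - B v \<omega>)))
      = expectation (\<lambda>\<omega>. G \<omega> * G' \<omega>) * overlap u u' v v'"
  proof (cases "u \<le> v")
    case True
    then show ?thesis using increment_covariance_le[OF u(1,2) True v(2) G G'] by blast
  next
    case False
    then have "v \<le> u" by simp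
    from increment_covariance_le[OF v(1,2) this u(2) G' G] show ?thesis
      by (simp add: mult.commute overlap_def min.commute max.commute)
  qed
  then show "integrable M (\<lambda>\<omega>. (G \<omega> * (B u' \<omega> - B u \<omega>)) * (G' \<omega> * (B v' \<omega> - B v \<omega>)))"
    "expectation (\<lambda>\<omega>. (G \<omega> * (B u' \<omega> - B u \<omega>)) * (G' \<omega> * (B v' \<omega> - B v \<omega>)))
      = expectation (\<lambda>\<omega>. G \<omega> * G' \<omega>) * overlap u u' v v'" by auto
qed

definition grid_sum :: "(nat \<Rightarrow> 'a \<Rightarrow> real) \<Rightarrow> real \<Rightarrow> nat \<Rightarrow> 'a \<Rightarrow> real" where
  "grid_sum \<xi> h N \<omega> = (\<Sum>j<N. \<xi> j \<omega> * (B (real (Suc j) * h) \<omega> - B (real j * h) \<omega>))"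

definition grid_step :: "(nat \<Rightarrow> 'a \<Rightarrow> real) \<Rightarrow> real \<Rightarrow> nat \<Rightarrow> real \<Rightarrow> 'a \<Rightarrow> real" where
  "grid_step \<xi> h N r \<omega> = (\<Sum>j<N. \<xi> j \<omega> * indicator {real j * h..<real (Suc j) * h} r)"

definition grid_adapted :: "(nat \<Rightarrow> 'a \<Rightarrow> real) \<Rightarrow> real \<Rightarrow> real \<Rightarrow> bool" where
  "grid_adapted \<xi> h C \<longleftrightarrow> (\<forall>j. \<xi> j \<in> borel_measurable (F (real j * h)) \<and> (\<forall>\<omega>\<in>space M. \<bar>\<xi> j \<omega>\<bar> \<le> C))"

lemma grid_adapted_meas: "grid_adapted \<xi> h C \<Longrightarrow> \<xi> j \<in> borel_measurable M"
  by (auto simp: grid_adapted_def intro: meas_F_M)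

lemma grid_adapted_integrable_mult:
  assumes "grid_adapted \<xi> h C" "grid_adapted \<xi>' h' C'"
  shows "integrable M (\<lambda>\<omega>. \<xi> j \<omega> * \<xi>' k \<omega>)"
proof (rule integrable_bounded)
  show "(\<lambda>\<omega>. \<xi> j \<omega> * \<xi>' k \<omega>) \<in> borel_measurable M" using assms[THEN grid_adapted_meas] by simp
  fix \<omega> assume "\<omega> \<in> space M"
  then have "\<bar>\<xi> j \<omega>\<bar> \<le> C" "\<bar>\<xi>' k \<omega>\<bar> \<le> C'" using assms by (auto simp: grid_adapted_def)
  then show "\<bar>\<xi> j \<omega> * \<xi>' k \<omega>\<bar> \<le> C * C'" unfolding abs_mult by (intro mult_mono) auto
qed

lemma grid_sum_meas: "grid_adapted \<xi> h C \<Longrightarrow> grid_sum \<xi> h N \<in> borel_measurable M"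
  unfolding grid_sum_def using grid_adapted_meas by measurable

lemma interval_overlap:
  assumes "u \<le> u'" "v \<le> v'"
  shows "has_bochner_integral lborel (\<lambda>r. indicator {u..<u'} r * indicator {v..<v'} r :: real) (overlap u u' v v')"
proof -
  have eq: "indicator {u..<u'} r * indicator {v..<v'} r = (indicator {max u v..<max (max u v) (min u' v')} r :: real)" for r
    by (auto simp: indicator_def)
  have "has_bochner_integral lborel (indicator {max u v..<max (max u v) (min u' v')} :: real \<Rightarrow> real) (measure lborel {max u v..<max (max u v) (min u' v')})"
    by (rule has_bochner_integral_real_indicator) auto
  moreover have "measure lborel {max u v..<max (max u v) (min u' v')} = overlap u u' v v'"
    by (simp add: overlap_def)
  ultimately show ?thesis unfolding eq by simp
qed

lemma grid_sum_product:
  assumes h: "0 < h" "0 < h'" and \<xi>: "grid_adapted \<xi> h C" and \<xi>': "grid_adapted \<xi>' h' C'"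
  shows "integrable M (\<lambda>\<omega>. grid_sum \<xi> h N \<omega> * grid_sum \<xi>' h' N' \<omega>)"
    "has_bochner_integral lborel (\<lambda>r. expectation (\<lambda>\<omega>. grid_step \<xi> h N r \<omega> * grid_step \<xi>' h' N' r \<omega>))
       (expectation (\<lambda>\<omega>. grid_sum \<xi> h N \<omega> * grid_sum \<xi>' h' N' \<omega>))"
    "integrable M (\<lambda>\<omega>. grid_step \<xi> h N r \<omega> * grid_step \<xi>' h' N' r \<omega>)"
proof -
  let ?p = "\<lambda>j k \<omega>. (\<xi> j \<omega> * (B (real (Suc j) * h) \<omega> - B (real j * h) \<omega>)) * (\<xi>' k \<omega> * (B (real (Suc k) * h') \<omega> - B (real k * h') \<omega>))"
  let ?o = "\<lambda>j k. overlap (real j * h) (real (Suc j) * h) (real k * h') (real (Suc k) * h')"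
  have cov: "integrable M (?p j k)" "expectation (?p j k) = expectation (\<lambda>\<omega>. \<xi> j \<omega> * \<xi>' k \<omega>) * ?o j k" for j k
    using increment_covariance[of "real j * h" "real (Suc j) * h" "real k * h'" "real (Suc k) * h'" "\<xi> j" C "\<xi>' k" C']
      h \<xi> \<xi>' unfolding grid_adapted_def by (auto simp: algebra_simps)
  have gs: "grid_sum \<xi> h N \<omega> * grid_sum \<xi>' h' N' \<omega> = (\<Sum>j<N. \<Sum>k<N'. ?p j k \<omega>)" for \<omega>
    unfolding grid_sum_def sum_product ..
  show "integrable M (\<lambda>\<omega>. grid_sum \<xi> h N \<omega> * grid_sum \<xi>' h' N' \<omega>)"
    unfolding gs by (intro Bochner_Integration.integrable_sum cov)
  have E: "expectation (\<lambda>\<omega>. grid_sum \<xi> h N \<omega> * grid_sum \<xi>' h' N' \<omega>) = (\<Sum>j<N. \<Sum>k<N'. expectation (\<lambda>\<omega>. \<xi> j \<omega> * \<xi>' k \<omega>) * ?o j k)"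
  proof -
    have "has_bochner_integral M (\<lambda>\<omega>. \<Sum>j<N. \<Sum>k<N'. ?p j k \<omega>) (\<Sum>j<N. \<Sum>k<N'. expectation (\<lambda>\<omega>. \<xi> j \<omega> * \<xi>' k \<omega>) * ?o j k)"
      by (intro has_bochner_integral_sum) (simp add: has_bochner_integral_iff cov del: of_nat_Suc)
    then show ?thesis unfolding gs by (rule has_bochner_integral_integral_eq)
  qed
  have st: "grid_step \<xi> h N r \<omega> * grid_step \<xi>' h' N' r \<omega> =
     (\<Sum>j<N. \<Sum>k<N'. \<xi> j \<omega> * \<xi>' k \<omega> * (indicator {real j * h..<real (Suc j) * h} r * indicator {real k * h'..<real (Suc k) * h'} r))" for r \<omega>
    unfolding grid_step_def sum_product by (intro sum.cong refl) (simp add: mult_ac)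
  note im = grid_adapted_integrable_mult[OF \<xi> \<xi>']
  show "integrable M (\<lambda>\<omega>. grid_step \<xi> h N r \<omega> * grid_step \<xi>' h' N' r \<omega>)"
    unfolding st by (intro Bochner_Integration.integrable_sum integrable_mult_left im)
  have Est: "expectation (\<lambda>\<omega>. grid_step \<xi> h N r \<omega> * grid_step \<xi>' h' N' r \<omega>) =
     (\<Sum>j<N. \<Sum>k<N'. expectation (\<lambda>\<omega>. \<xi> j \<omega> * \<xi>' k \<omega>) * (indicator {real j * h..<real (Suc j) * h} r * indicator {real k * h'..<real (Suc k) * h'} r))" for r
    unfolding st by (subst Bochner_Integration.integral_sum; (intro Bochner_Integration.integrable_sum integrable_mult_left im)?)
      (simp add: im)
  show "has_bochner_integral lborel (\<lambda>r. expectation (\<lambda>\<omega>. grid_step \<xi> h N r \<omega> * grid_step \<xi>' h' N' r \<omega>))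
       (expectation (\<lambda>\<omega>. grid_sum \<xi> h N \<omega> * grid_sum \<xi>' h' N' \<omega>))"
    unfolding Est E using h
    by (intro has_bochner_integral_sum has_bochner_integral_mult_right interval_overlap) (auto simp: algebra_simps)
qed

lemma grid_isometry:
  assumes h: "0 < h" "0 < h'" and \<xi>: "grid_adapted \<xi> h C" and \<xi>': "grid_adapted \<xi>' h' C'"
  shows "integrable M (\<lambda>\<omega>. (grid_sum \<xi> h N \<omega> - grid_sum \<xi>' h' N' \<omega>)\<^sup>2)"
    "has_bochner_integral lborel (\<lambda>r. expectation (\<lambda>\<omega>. (grid_step \<xi> h N r \<omega> - grid_step \<xi>' h' N' r \<omega>)\<^sup>2))
       (expectation (\<lambda>\<omega>. (grid_sum \<xi> h N \<omega> - grid_sum \<xi>' h' N' \<omega>)\<^sup>2))"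
proof -
  have sq: "(x - y)\<^sup>2 = x * x + y * y - 2 * (x * y)" for x y :: real
    by (simp add: power2_eq_square algebra_simps)
  note p1 = grid_sum_product[OF h(1) h(1) \<xi> \<xi>] and p2 = grid_sum_product[OF h(2) h(2) \<xi>' \<xi>'] and p3 = grid_sum_product[OF h \<xi> \<xi>']
  show "integrable M (\<lambda>\<omega>. (grid_sum \<xi> h N \<omega> - grid_sum \<xi>' h' N' \<omega>)\<^sup>2)"
    unfolding sq by (intro Bochner_Integration.integrable_diff Bochner_Integration.integrable_add integrable_mult_right p1 p2 p3)
  show "has_bochner_integral lborel (\<lambda>r. expectation (\<lambda>\<omega>. (grid_step \<xi> h N r \<omega> - grid_step \<xi>' h' N' r \<omega>)\<^sup>2))
       (expectation (\<lambda>\<omega>. (grid_sum \<xi> h N \<omega> - grid_sum \<xi>' h' N' \<omega>)\<^sup>2))"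
    unfolding sq using p1 p2 p3
    by (simp add: has_bochner_integral_add has_bochner_integral_diff has_bochner_integral_mult_right)
qed

end

section \<open>Left-continuous integrands\<close>

lemma (in prob_space) conv_in_prob_AE_subseq:
  assumes Zm [measurable]: "\<And>n::nat. Z n \<in> borel_measurable M" and Lm [measurable]: "L \<in> borel_measurable M"
    and conv: "conv_in_prob M Z L sequentially"
  obtains \<kappa> where "strict_mono \<kappa>" "AE \<omega> in M. (\<lambda>i. Z (\<kappa> i) \<omega>) \<longlonglongrightarrow> L \<omega>"
proof -
  define u where "u n \<omega> = min 1 \<bar>Z n \<omega> - L \<omega>\<bar>" for n \<omega>
  have um [measurable]: "u n \<in> borel_measurable M" for n unfolding u_def by measurable
  have ui: "integrable M (u n)" for n
    by (rule integrable_const_bound[where B = 1]) (auto simp: u_def)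
  have le: "expectation (u n) \<le> \<delta> + prob {\<omega>\<in>space M. \<delta> < \<bar>Z n \<omega> - L \<omega>\<bar>}" if "\<delta> > 0" for \<delta> n
  proof -
    let ?A = "{\<omega>\<in>space M. \<delta> < \<bar>Z n \<omega> - L \<omega>\<bar>}"
    have A [measurable]: "?A \<in> sets M" by measurable
    have "expectation (u n) \<le> expectation (\<lambda>\<omega>. \<delta> + indicator ?A \<omega>)"
    proof (rule integral_mono[OF ui])
      show "integrable M (\<lambda>\<omega>. \<delta> + indicator ?A \<omega>)" by (intro Bochner_Integration.integrable_add integrable_real_indicator) (auto simp: less_top[symmetric])
    qed (use that in \<open>auto simp: u_def indicator_def\<close>)
    also have "\<dots> = \<delta> + prob ?A"
      by (subst Bochner_Integration.integral_add) (auto simp: prob_space less_top[symmetric] intro!: integrable_real_indicator)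
    finally show ?thesis .
  qed
  have "(\<lambda>n. expectation (\<lambda>\<omega>. norm (u n \<omega>))) \<longlonglongrightarrow> 0"
  proof (rule LIMSEQ_I)
    fix r :: real assume r: "0 < r"
    then have "(\<lambda>n. prob {\<omega>\<in>space M. r/2 < \<bar>Z n \<omega> - L \<omega>\<bar>}) \<longlonglongrightarrow> 0"
      using conv[unfolded conv_in_prob_def, rule_format, of "r/2"] r by simp
    from LIMSEQ_D[OF this, of "r/2"] r obtain no where "\<And>n. n \<ge> no \<Longrightarrow> prob {\<omega>\<in>space M. r/2 < \<bar>Z n \<omega> - L \<omega>\<bar>} < r/2"
      by auto
    note no = this
    have eq: "norm (u n \<omega>) = u n \<omega>" for n \<omega> by (simp add: u_def)
    have "norm (expectation (u n) - 0) < r" if "n \<ge> no" for n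
    proof -
      have "0 \<le> expectation (u n)" by (intro Bochner_Integration.integral_nonneg) (simp add: u_def)
      then show ?thesis using le[of "r/2" n] no[OF that] r by simp
    qed
    then show "\<exists>no. \<forall>n\<ge>no. norm (expectation (\<lambda>\<omega>. norm (u n \<omega>)) - 0) < r"
      unfolding eq by blast
  qed
  from tendsto_L1_AE_subseq[OF ui this] obtain \<kappa> where k: "strict_mono \<kappa>" "AE \<omega> in M. (\<lambda>n. u (\<kappa> n) \<omega>) \<longlonglongrightarrow> 0" by auto
  have "AE \<omega> in M. (\<lambda>i. Z (\<kappa> i) \<omega>) \<longlonglongrightarrow> L \<omega>"
    using k(2)
  proof eventually_elim
    case (elim \<omega>)
    then have "\<forall>\<^sub>F n in sequentially. u (\<kappa> n) \<omega> < 1" by (rule order_tendstoD) simp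
    then have "\<forall>\<^sub>F n in sequentially. u (\<kappa> n) \<omega> = \<bar>Z (\<kappa> n) \<omega> - L \<omega>\<bar>" by eventually_elim (auto simp: u_def)
    then have "(\<lambda>n. \<bar>Z (\<kappa> n) \<omega> - L \<omega>\<bar>) \<longlonglongrightarrow> 0" using elim by (rule Lim_transform_eventually[rotated])
    then show ?case by (simp add: LIM_zero_iff tendsto_rabs_zero_iff)
  qed
  with k(1) show thesis by (rule that)
qed

lemma grid_floor:
  assumes "0 < h" "0 \<le> (r::real)"
  shows "real (nat \<lfloor>r / h\<rfloor>) * h \<le> r" "r < (real (nat \<lfloor>r / h\<rfloor>) + 1) * h"
proof -
  have "real (nat \<lfloor>r / h\<rfloor>) \<le> r / h" "r / h < real (nat \<lfloor>r / h\<rfloor>) + 1" using assms by auto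
  then show "real (nat \<lfloor>r / h\<rfloor>) * h \<le> r" "r < (real (nat \<lfloor>r / h\<rfloor>) + 1) * h"
    using assms(1) by (simp_all only: pos_le_divide_eq pos_divide_less_eq)
qed

context brownian begin

definition lc_process :: "real \<Rightarrow> (real \<Rightarrow> 'a \<Rightarrow> real) \<Rightarrow> bool" where
  "lc_process C G \<longleftrightarrow> (\<forall>t\<ge>0. G t \<in> borel_measurable (F t)) \<and>
     (\<forall>t\<ge>0. \<forall>\<omega>\<in>space M. \<bar>G t \<omega>\<bar> \<le> C \<and> continuous (at t within {0..t}) (\<lambda>s. G s \<omega>))"

definition on_grid :: "(real \<Rightarrow> 'a \<Rightarrow> real) \<Rightarrow> real \<Rightarrow> nat \<Rightarrow> 'a \<Rightarrow> real" where
  "on_grid G h j = G (real j * h)"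

lemma lc_grid_adapted: "lc_process C G \<Longrightarrow> 0 \<le> h \<Longrightarrow> grid_adapted (on_grid G h) h C"
  by (simp add: lc_process_def grid_adapted_def on_grid_def)

lemma grid_step_eq:
  assumes h: "0 < h"
  shows "grid_step \<xi> h N r \<omega> = (if 0 \<le> r \<and> r < real N * h then \<xi> (nat \<lfloor>r / h\<rfloor>) \<omega> else 0)"
proof (cases "0 \<le> r \<and> r < real N * h")
  case True
  let ?k = "nat \<lfloor>r / h\<rfloor>"
  have fl: "real ?k * h \<le> r" "r < (real ?k + 1) * h" using grid_floor[OF h, of r] True by auto
  then have "real ?k * h < real N * h" using True by linarith
  then have kN: "?k < N" using h by simp
  have ind: "indicator {real j * h..<real (Suc j) * h} r = (if j = ?k then 1 else (0::real))" for j
  proof (cases "j = ?k")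
    case True then show ?thesis using fl by (simp add: algebra_simps)
  next
    case False
    have "\<not> (real j * h \<le> r \<and> r < real (Suc j) * h)"
    proof
      assume a: "real j * h \<le> r \<and> r < real (Suc j) * h"
      then have "real j * h < (real ?k + 1) * h" "real ?k * h < real (Suc j) * h" using fl by linarith+
      then have "real j < real ?k + 1" "real ?k < real (Suc j)" using h by auto
      then show False using False by linarith
    qed
    then show ?thesis using False by (auto simp: indicator_def)
  qed
  have "grid_step \<xi> h N r \<omega> = (\<Sum>j<N. if j = ?k then \<xi> j \<omega> else 0)"
    unfolding grid_step_def ind by (intro sum.cong) auto
  then show ?thesis using True kN by simp
next
  case False
  have "indicator {real j * h..<real (Suc j) * h} r = (0::real)" if "j < N" for j
  proof -
    have "0 \<le> real j * h" "real (Suc j) * h \<le> real N * h" using h that by (auto intro!: mult_right_mono)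
    then show ?thesis using False by (auto simp: indicator_def)
  qed
  then have "grid_step \<xi> h N r \<omega> = (\<Sum>j<N. 0)"
    unfolding grid_step_def by (intro sum.cong refl) simp
  then show ?thesis using False by auto
qed

lemma lc_step_tendsto:
  assumes lc: "lc_process C G" and \<omega>: "\<omega> \<in> space M" and h: "\<And>m::nat. 0 < h m" "h \<longlonglongrightarrow> 0"
    and N: "\<And>m. real (N m) * h m = t"
  shows "(\<lambda>m. grid_step (on_grid G (h m)) (h m) (N m) r \<omega>) \<longlonglongrightarrow> indicator {0..<t} r * G r \<omega>"
proof (cases "0 \<le> r \<and> r < t")
  case True
  let ?x = "\<lambda>m. real (nat \<lfloor>r / h m\<rfloor>) * h m"
  have x: "?x m \<le> r" "r - h m \<le> ?x m" for m
    using grid_floor[OF h(1), of r m] True unfolding distrib_right by linarith+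
  have lim: "?x \<longlonglongrightarrow> r"
  proof (rule tendsto_sandwich[of "\<lambda>m. r - h m" _ _ "\<lambda>_. r"])
    show "(\<lambda>m. r - h m) \<longlonglongrightarrow> r" using tendsto_diff[OF tendsto_const h(2), of r] by simp
  qed (use x in auto)
  have "(\<lambda>m. G (?x m) \<omega>) \<longlonglongrightarrow> G r \<omega>"
  proof (rule continuous_within_tendsto_compose'[OF _ _ lim])
    show "continuous (at r within {0..r}) (\<lambda>s. G s \<omega>)" using lc \<omega> True by (simp add: lc_process_def)
    show "?x m \<in> {0..r}" for m using x h(1)[of m] by (simp add: less_imp_le)
  qed
  then show ?thesis using True by (simp add: grid_step_eq[OF h(1)] N on_grid_def)
next
  case False
  then show ?thesis by (auto simp: grid_step_eq[OF h(1)] N indicator_def)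
qed

lemma lc_bound_nonneg: "lc_process C G \<Longrightarrow> 0 \<le> C"
proof -
  assume lc: "lc_process C G"
  obtain \<omega> where "\<omega> \<in> space M" using not_empty by blast
  then have "\<bar>G 0 \<omega>\<bar> \<le> C" using lc by (auto simp: lc_process_def)
  then show ?thesis by linarith
qed

lemma lc_step_bound:
  assumes "lc_process C G" "\<omega> \<in> space M" "0 < h"
  shows "\<bar>grid_step (on_grid G h) h N r \<omega>\<bar> \<le> C * indicator {0..<real N * h} r"
    "\<bar>indicator {0..<t} r * G r \<omega>\<bar> \<le> C * indicator {0..<t} r"
  using assms lc_bound_nonneg[OF assms(1)]
  by (auto simp: grid_step_eq on_grid_def lc_process_def indicator_def)

lemma lc_meas: "lc_process C G \<Longrightarrow> 0 \<le> r \<Longrightarrow> G r \<in> borel_measurable M"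
  by (auto simp: lc_process_def intro: meas_F_M)

lemma lc_ind_meas: "lc_process C G \<Longrightarrow> (\<lambda>\<omega>. indicator {0..<t} r * G r \<omega>) \<in> borel_measurable M"
  using lc_meas[of C G r] by (cases "r < 0") (auto simp: indicator_def)

lemma grid_step_meas: "lc_process C G \<Longrightarrow> 0 < h \<Longrightarrow> grid_step (on_grid G h) h N r \<in> borel_measurable M"
  unfolding grid_step_def by (intro borel_measurable_sum borel_measurable_times grid_adapted_meas[OF lc_grid_adapted]) auto

definition grid_err :: "(real \<Rightarrow> 'a \<Rightarrow> real) \<Rightarrow> real \<Rightarrow> nat \<Rightarrow> real \<Rightarrow> real" where
  "grid_err G h N r = expectation (\<lambda>\<omega>. (grid_step (on_grid G h) h N r \<omega> - indicator {0..<real N * h} r * G r \<omega>)\<^sup>2)"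

lemma sq_diff_bound: "\<bar>x\<bar> \<le> c \<Longrightarrow> \<bar>y\<bar> \<le> c \<Longrightarrow> (x - y)\<^sup>2 \<le> (2 * c)\<^sup>2" for x y c :: real
  by (rule abs_le_square_iff[THEN iffD1]) linarith

lemma dyadic_step: "0 < t \<Longrightarrow> (\<lambda>m. t / 2 ^ m) \<longlonglongrightarrow> (0::real)"
  using LIMSEQ_divide_realpow_zero[of 2 t] by simp

lemma grid_err_limit:
  assumes lc: "lc_process C G" and h: "0 < h" and t: "real N * h = t" "0 < t"
  shows "(\<lambda>k. expectation (\<lambda>\<omega>. (grid_sum (on_grid G h) h N \<omega> - grid_sum (on_grid G (t / 2^k)) (t / 2^k) (2^k) \<omega>)\<^sup>2))
     \<longlonglongrightarrow> integral\<^sup>L lborel (grid_err G h N)" (is "?lim")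
    and "integrable lborel (grid_err G h N)" (is "?int")
proof -
  define g where "g k r = expectation (\<lambda>\<omega>. (grid_step (on_grid G h) h N r \<omega> - grid_step (on_grid G (t / 2^k)) (t / 2^k) (2^k) r \<omega>)\<^sup>2)" for k r
  have hk: "0 < t / 2 ^ k" for k :: nat using t by simp
  have iso: "has_bochner_integral lborel (g k) (expectation (\<lambda>\<omega>. (grid_sum (on_grid G h) h N \<omega> - grid_sum (on_grid G (t / 2^k)) (t / 2^k) (2^k) \<omega>)\<^sup>2))" for k
    unfolding g_def using grid_isometry(2)[OF h hk lc_grid_adapted[OF lc] lc_grid_adapted[OF lc], of k N "2^k"] h hk[of k] by simp
  have bd: "(grid_step (on_grid G h) h N r \<omega> - grid_step (on_grid G (t / 2^k)) (t / 2^k) (2^k) r \<omega>)\<^sup>2 \<le> (2 * C)\<^sup>2 * indicator {0..<t} r"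
    if "\<omega> \<in> space M" for k r \<omega>
  proof -
    have "\<bar>grid_step (on_grid G h) h N r \<omega>\<bar> \<le> C * indicator {0..<t} r"
      "\<bar>grid_step (on_grid G (t / 2^k)) (t / 2^k) (2^k) r \<omega>\<bar> \<le> C * indicator {0..<t} r"
      using lc_step_bound(1)[OF lc that h, of N r] lc_step_bound(1)[OF lc that hk, of k "2^k" r] t by auto
    from sq_diff_bound[OF this] show ?thesis by (auto simp: indicator_def split: if_splits)
  qed
  have lim: "(\<lambda>k. g k r) \<longlonglongrightarrow> grid_err G h N r" for r
    unfolding g_def grid_err_def
  proof (rule integral_dominated_convergence[where w = "\<lambda>_. (2 * C)\<^sup>2"])
    have [measurable]: "grid_step (on_grid G h) h N r \<in> borel_measurable M" "(\<lambda>\<omega>. indicator {0..<real N * h} r * G r \<omega>) \<in> borel_measurable M"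
      "\<And>k. grid_step (on_grid G (t / 2^k)) (t / 2^k) (2^k) r \<in> borel_measurable M"
      using grid_step_meas[OF lc] lc_ind_meas[OF lc] h hk by auto
    show "(\<lambda>\<omega>. (grid_step (on_grid G h) h N r \<omega> - indicator {0..<real N * h} r * G r \<omega>)\<^sup>2) \<in> borel_measurable M" by measurable
    show "(\<lambda>\<omega>. (grid_step (on_grid G h) h N r \<omega> - grid_step (on_grid G (t / 2^k)) (t / 2^k) (2^k) r \<omega>)\<^sup>2) \<in> borel_measurable M" for k by measurable
    show "AE \<omega> in M. (\<lambda>k. (grid_step (on_grid G h) h N r \<omega> - grid_step (on_grid G (t / 2^k)) (t / 2^k) (2^k) r \<omega>)\<^sup>2)
       \<longlonglongrightarrow> (grid_step (on_grid G h) h N r \<omega> - indicator {0..<real N * h} r * G r \<omega>)\<^sup>2"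
    proof (rule AE_I2)
      fix \<omega> assume w: "\<omega> \<in> space M"
      show "(\<lambda>k. (grid_step (on_grid G h) h N r \<omega> - grid_step (on_grid G (t / 2^k)) (t / 2^k) (2^k) r \<omega>)\<^sup>2)
       \<longlonglongrightarrow> (grid_step (on_grid G h) h N r \<omega> - indicator {0..<real N * h} r * G r \<omega>)\<^sup>2"
        unfolding t(1) by (intro tendsto_intros lc_step_tendsto[OF lc w hk dyadic_step]) (use t in auto)
    qed
    show "AE \<omega> in M. norm ((grid_step (on_grid G h) h N r \<omega> - grid_step (on_grid G (t / 2^k)) (t / 2^k) (2^k) r \<omega>)\<^sup>2) \<le> (2 * C)\<^sup>2" for k
    proof (rule AE_I2)
      fix \<omega> assume "\<omega> \<in> space M"
      from bd[OF this, of r k] show "norm ((grid_step (on_grid G h) h N r \<omega> - grid_step (on_grid G (t / 2^k)) (t / 2^k) (2^k) r \<omega>)\<^sup>2) \<le> (2 * C)\<^sup>2"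
        by (auto simp: indicator_def split: if_splits intro: order_trans)
    qed
  qed simp
  have gm: "g k \<in> borel_measurable lborel" for k using iso[of k] by (auto simp: has_bochner_integral_iff)
  have em: "grid_err G h N \<in> borel_measurable lborel"
    by (rule borel_measurable_LIMSEQ_real[OF _ gm]) (rule lim)
  have gb: "norm (g k r) \<le> (2 * C)\<^sup>2 * indicator {0..<t} r" for k r
  proof -
    have "g k r \<le> expectation (\<lambda>\<omega>. (2 * C)\<^sup>2 * indicator {0..<t} r)"
      unfolding g_def
    proof (rule integral_mono')
      show "integrable M (\<lambda>\<omega>. (2 * C)\<^sup>2 * indicator {0..<t} r)" by simp
    qed (use bd in auto)
    moreover have "0 \<le> g k r" unfolding g_def by (intro Bochner_Integration.integral_nonneg) simp
    ultimately show ?thesis by (simp add: prob_space)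
  qed
  have wi: "integrable lborel (\<lambda>r. (2 * C)\<^sup>2 * indicator {0..<t} r :: real)"
    using t by (intro integrable_mult_right integrable_real_indicator) auto
  have "(\<lambda>k. integral\<^sup>L lborel (g k)) \<longlonglongrightarrow> integral\<^sup>L lborel (grid_err G h N)"
    by (rule integral_dominated_convergence[OF em gm wi]) (use lim gb in auto)
  then show ?lim using iso by (simp add: has_bochner_integral_iff)
  show ?int by (rule integrable_dominated_convergence[where s = g, OF em gm wi]) (use lim gb in auto)
qed

lemma ito_zero:
  assumes "ito_integral_is M B H 0 I"
  shows "AE \<omega> in M. I \<omega> = 0"
proof -
  have Im [measurable]: "I \<in> borel_measurable M" and c: "conv_in_prob M (\<lambda>n \<omega>. 0) I sequentially"
    using assms by (auto simp: ito_integral_is_def)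
  obtain \<kappa> :: "nat \<Rightarrow> nat" where "AE \<omega> in M. (\<lambda>i::nat. 0) \<longlonglongrightarrow> I \<omega>"
    using conv_in_prob_AE_subseq[OF _ Im c] by (metis borel_measurable_const)
  then show ?thesis by eventually_elim (auto simp: LIMSEQ_const_iff)
qed

text \<open>The Riemann sums defining the integral live on the dyadic grid of \<open>[0,t]\<close>, which differs from
  the grid of mesh \<open>h\<close>; the isometry across two grids and Fatou's lemma bridge the difference.\<close>

lemma grid_sum_approximates_ito:
  assumes lc: "lc_process C G" and h: "0 < h" and t: "t = real N * h"
    and ito: "ito_integral_is M B H t I" and Hm: "\<And>r. 0 \<le> r \<Longrightarrow> H r \<in> borel_measurable M" and A: "A \<in> sets M"
    and eq: "\<And>\<omega> r. \<omega> \<in> A \<Longrightarrow> 0 \<le> r \<Longrightarrow> r \<le> t \<Longrightarrow> G r \<omega> = H r \<omega>"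
  shows "integrable M (\<lambda>\<omega>. indicator A \<omega> * (grid_sum (on_grid G h) h N \<omega> - I \<omega>)\<^sup>2)"
    "expectation (\<lambda>\<omega>. indicator A \<omega> * (grid_sum (on_grid G h) h N \<omega> - I \<omega>)\<^sup>2) \<le> integral\<^sup>L lborel (grid_err G h N)"
proof -
  have Im [measurable]: "I \<in> borel_measurable M" using ito by (simp add: ito_integral_is_def)
  note A [measurable]
  let ?S = "grid_sum (on_grid G h) h N"
  have Sm [measurable]: "?S \<in> borel_measurable M" by (rule grid_sum_meas[OF lc_grid_adapted[OF lc]]) (use h in simp)
  have err0: "0 \<le> integral\<^sup>L lborel (grid_err G h N)"
    by (intro Bochner_Integration.integral_nonneg) (simp add: grid_err_def)
  have nn: "(\<integral>\<^sup>+\<omega>. ennreal (indicator A \<omega> * (?S \<omega> - I \<omega>)\<^sup>2) \<partial>M) \<le> ennreal (integral\<^sup>L lborel (grid_err G h N))"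
  proof (cases "N = 0")
    case True
    then have "AE \<omega> in M. I \<omega> = 0" using ito t by (intro ito_zero[of H]) simp
    then have "AE \<omega> in M. ennreal (indicator A \<omega> * (?S \<omega> - I \<omega>)\<^sup>2) = 0"
      by eventually_elim (simp add: grid_sum_def True)
    then have "(\<integral>\<^sup>+\<omega>. ennreal (indicator A \<omega> * (?S \<omega> - I \<omega>)\<^sup>2) \<partial>M) = 0"
      by (subst nn_integral_0_iff_AE) auto
    then show ?thesis by simp
  next
    case False
    then have t0: "0 < t" using h t by simp
    define R where "R k = grid_sum (on_grid G (t / 2^k)) (t / 2^k) (2^k)" for k :: nat
    have Rm [measurable]: "R k \<in> borel_measurable M" for k
      unfolding R_def by (rule grid_sum_meas[OF lc_grid_adapted[OF lc]]) (use t0 in simp)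
    let ?T = "\<lambda>n \<omega>. \<Sum>k<(2::nat)^n. H (t * real k / 2^n) \<omega> * (B (t * real (Suc k) / 2^n) \<omega> - B (t * real k / 2^n) \<omega>)"
    have RT: "R n \<omega> = ?T n \<omega>" if "\<omega> \<in> A" for n \<omega>
    proof -
      have "G (real k * (t / 2^n)) \<omega> = H (t * real k / 2^n) \<omega>" if k: "k < 2^n" for k
      proof -
        have "real k \<le> 2^n" using k by (metis less_imp_le of_nat_le_iff of_nat_numeral of_nat_power)
        then have "t * real k / 2^n \<le> t" using t0 by (simp add: divide_le_eq)
        then show ?thesis using eq[OF \<open>\<omega> \<in> A\<close>, of "t * real k / 2^n"] t0 by (simp add: mult.commute)
      qed
      then show ?thesis unfolding R_def grid_sum_def on_grid_def by (intro sum.cong refl) (simp add: mult.commute)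
    qed
    have cT: "conv_in_prob M ?T I sequentially" using ito unfolding ito_integral_is_def by blast
    have "conv_in_prob M (\<lambda>n \<omega>. indicator A \<omega> * R n \<omega>) (\<lambda>\<omega>. indicator A \<omega> * I \<omega>) sequentially"
      unfolding conv_in_prob_def
    proof (intro allI impI)
      fix \<delta> :: real assume d: "0 < \<delta>"
      have lim0: "(\<lambda>n. prob {\<omega>\<in>space M. \<delta> < \<bar>?T n \<omega> - I \<omega>\<bar>}) \<longlonglongrightarrow> 0"
        using cT d unfolding conv_in_prob_def by auto
      have [measurable]: "H (t * real k / 2 ^ n) \<in> borel_measurable M" for k n
        using t0 by (intro Hm) simp
      show "(\<lambda>n. prob {\<omega>\<in>space M. \<delta> < \<bar>indicator A \<omega> * R n \<omega> - indicator A \<omega> * I \<omega>\<bar>}) \<longlonglongrightarrow> 0"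
      proof (rule tendsto_sandwich[OF _ _ tendsto_const lim0])
        show "\<forall>\<^sub>F n in sequentially. prob {\<omega>\<in>space M. \<delta> < \<bar>indicator A \<omega> * R n \<omega> - indicator A \<omega> * I \<omega>\<bar>}
           \<le> prob {\<omega>\<in>space M. \<delta> < \<bar>?T n \<omega> - I \<omega>\<bar>}"
          using RT d by (intro always_eventually allI finite_measure_mono) (auto simp: indicator_def split: if_splits)
      qed simp
    qed
    then obtain \<kappa> where \<kappa>: "strict_mono \<kappa>" "AE \<omega> in M. (\<lambda>i. indicator A \<omega> * R (\<kappa> i) \<omega>) \<longlonglongrightarrow> indicator A \<omega> * I \<omega>"
      by (rule conv_in_prob_AE_subseq[rotated 2]) auto
    have lim: "(\<lambda>k. expectation (\<lambda>\<omega>. (?S \<omega> - R k \<omega>)\<^sup>2)) \<longlonglongrightarrow> integral\<^sup>L lborel (grid_err G h N)"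
      unfolding R_def by (rule grid_err_limit(1)[OF lc h t[symmetric] t0])
    have Ri: "integrable M (\<lambda>\<omega>. (?S \<omega> - R k \<omega>)\<^sup>2)" for k
      unfolding R_def using h t0 by (intro grid_isometry(1)[OF _ _ lc_grid_adapted[OF lc] lc_grid_adapted[OF lc]]) auto
    have "(\<integral>\<^sup>+\<omega>. ennreal (indicator A \<omega> * (?S \<omega> - I \<omega>)\<^sup>2) \<partial>M) =
      (\<integral>\<^sup>+\<omega>. liminf (\<lambda>i. ennreal (indicator A \<omega> * (?S \<omega> - R (\<kappa> i) \<omega>)\<^sup>2)) \<partial>M)"
    proof (rule nn_integral_cong_AE)
      show "AE \<omega> in M. ennreal (indicator A \<omega> * (?S \<omega> - I \<omega>)\<^sup>2) = liminf (\<lambda>i. ennreal (indicator A \<omega> * (?S \<omega> - R (\<kappa> i) \<omega>)\<^sup>2))"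
        using \<kappa>(2)
      proof eventually_elim
        case (elim \<omega>)
        have "(\<lambda>i. indicator A \<omega> * (?S \<omega> - R (\<kappa> i) \<omega>)\<^sup>2) \<longlonglongrightarrow> indicator A \<omega> * (?S \<omega> - I \<omega>)\<^sup>2"
          using elim by (cases "\<omega> \<in> A") (auto intro!: tendsto_intros)
        then have "(\<lambda>i. ennreal (indicator A \<omega> * (?S \<omega> - R (\<kappa> i) \<omega>)\<^sup>2)) \<longlonglongrightarrow> ennreal (indicator A \<omega> * (?S \<omega> - I \<omega>)\<^sup>2)"
          by (rule tendsto_ennrealI)
        then show ?case by (intro lim_imp_Liminf[symmetric]) simp_all
      qed
    qed
    also have "\<dots> \<le> liminf (\<lambda>i. \<integral>\<^sup>+\<omega>. ennreal (indicator A \<omega> * (?S \<omega> - R (\<kappa> i) \<omega>)\<^sup>2) \<partial>M)"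
      by (rule nn_integral_liminf) measurable
    also have "\<dots> \<le> liminf (\<lambda>i. ennreal (expectation (\<lambda>\<omega>. (?S \<omega> - R (\<kappa> i) \<omega>)\<^sup>2)))"
    proof (rule Liminf_mono, rule always_eventually, rule allI)
      fix i
      have "(\<integral>\<^sup>+\<omega>. ennreal (indicator A \<omega> * (?S \<omega> - R (\<kappa> i) \<omega>)\<^sup>2) \<partial>M) \<le> (\<integral>\<^sup>+\<omega>. ennreal ((?S \<omega> - R (\<kappa> i) \<omega>)\<^sup>2) \<partial>M)"
        by (rule nn_integral_mono) (auto simp: indicator_def)
      also have "\<dots> = ennreal (expectation (\<lambda>\<omega>. (?S \<omega> - R (\<kappa> i) \<omega>)\<^sup>2))"
        by (rule nn_integral_eq_integral[OF Ri]) simp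
      finally show "(\<integral>\<^sup>+\<omega>. ennreal (indicator A \<omega> * (?S \<omega> - R (\<kappa> i) \<omega>)\<^sup>2) \<partial>M) \<le> ennreal (expectation (\<lambda>\<omega>. (?S \<omega> - R (\<kappa> i) \<omega>)\<^sup>2))" .
    qed
    also have "\<dots> = ennreal (integral\<^sup>L lborel (grid_err G h N))"
      by (rule lim_imp_Liminf) (auto intro!: tendsto_ennrealI LIMSEQ_subseq_LIMSEQ[OF lim \<kappa>(1), unfolded o_def])
    finally show ?thesis .
  qed
  show int: "integrable M (\<lambda>\<omega>. indicator A \<omega> * (?S \<omega> - I \<omega>)\<^sup>2)"
    by (rule integrableI_nonneg) (use nn in \<open>auto intro: le_less_trans\<close>)
  show "expectation (\<lambda>\<omega>. indicator A \<omega> * (?S \<omega> - I \<omega>)\<^sup>2) \<le> integral\<^sup>L lborel (grid_err G h N)"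
    using nn nn_integral_eq_integral[OF int] err0 by simp
qed

end

section \<open>Test functions along an Euler scheme\<close>

lemma discrete_gronwall:
  fixes q :: "nat \<Rightarrow> real"
  assumes q: "\<And>j. j \<le> N \<Longrightarrow> q j \<le> c + \<kappa> * (\<Sum>i<j. q i)" and \<kappa>: "0 \<le> \<kappa>" and j: "j \<le> N"
  shows "q j \<le> c * (1 + \<kappa>) ^ j"
  using j
proof (induction j rule: less_induct)
  case (less j)
  have geo: "c + \<kappa> * (\<Sum>i<k. c * (1 + \<kappa>) ^ i) = c * (1 + \<kappa>) ^ k" for k
    by (induction k) (auto simp: algebra_simps)
  have "q j \<le> c + \<kappa> * (\<Sum>i<j. q i)" using q less by simp
  also have "\<dots> \<le> c + \<kappa> * (\<Sum>i<j. c * (1 + \<kappa>) ^ i)"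
    using less \<kappa> by (intro add_left_mono mult_left_mono sum_mono) auto
  finally show ?case unfolding geo .
qed

locale test_function =
  fixes \<phi> \<phi>1 \<phi>2 :: "real \<Rightarrow> real" and C2 C3 :: real
  assumes d1: "\<And>x. (\<phi> has_real_derivative \<phi>1 x) (at x)"
    and d2: "\<And>x. (\<phi>1 has_real_derivative \<phi>2 x) (at x)"
    and \<phi>2_nonneg: "\<And>x. 0 \<le> \<phi>2 x" and \<phi>2_le: "\<And>x. \<phi>2 x \<le> C2"
    and \<phi>2_lip: "\<And>x y. \<bar>\<phi>2 x - \<phi>2 y\<bar> \<le> C3 * \<bar>x - y\<bar>"
    and \<phi>_nonneg: "\<And>x. 0 \<le> \<phi> x" and \<phi>0: "\<phi> 0 = 0" and \<phi>10: "\<phi>1 0 = 0"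
begin

lemma C2_nonneg: "0 \<le> C2" using \<phi>2_nonneg[of 0] \<phi>2_le[of 0] by linarith
lemma C3_nonneg: "0 \<le> C3" using \<phi>2_lip[of 0 1] by (simp add: order_trans[OF abs_ge_zero])

lemma \<phi>1_lip: "\<bar>\<phi>1 x - \<phi>1 y\<bar> \<le> C2 * \<bar>x - y\<bar>"
proof -
  have "\<phi>1 y - \<phi>1 x \<le> C2 * (y - x) \<and> 0 \<le> \<phi>1 y - \<phi>1 x" if xy: "x < y" for x y
  proof -
    obtain z where "\<phi>1 y - \<phi>1 x = (y - x) * \<phi>2 z" using MVT2[OF xy, of \<phi>1 \<phi>2] d2 by blast
    then show ?thesis using xy \<phi>2_le[of z] \<phi>2_nonneg[of z] by (simp add: mult.commute mult_mono)
  qed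
  from this[of x y] this[of y x] show ?thesis by (cases x y rule: linorder_cases) auto
qed

lemma taylor2: "\<exists>z. \<bar>z - x\<bar> \<le> \<bar>y - x\<bar> \<and> \<phi> y = \<phi> x + \<phi>1 x * (y - x) + \<phi>2 z / 2 * (y - x)\<^sup>2"
proof (cases "y = x")
  case True then show ?thesis by (intro exI[of _ x]) simp
next
  case False
  define df where "df m = (if m = 0 then \<phi> else if m = Suc 0 then \<phi>1 else \<phi>2)" for m :: nat
  have "\<forall>m t. m < 2 \<and> min x y \<le> t \<and> t \<le> max x y \<longrightarrow> DERIV (df m) t :> df (Suc m) t"
  proof (intro allI impI, goal_cases)
    case (1 m t)
    then have "m = 0 \<or> m = 1" by auto
    then show ?case using d1 d2 by (auto simp: df_def)
  qed
  then obtain t where t: "if y < x then y < t \<and> t < x else x < t \<and> t < y"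
    "\<phi> y = (\<Sum>m<2. (df m x / fact m) * (y - x) ^ m) + (df 2 t / fact 2) * (y - x) ^ 2"
    using Taylor[of 2 df \<phi> "min x y" "max x y" x y] False by (auto simp: df_def)
  then show ?thesis by (intro exI[of _ t]) (auto simp: df_def numeral_2_eq_2 split: if_splits)
qed

lemma taylor3: "\<phi> (x + z) \<le> \<phi> x + \<phi>1 x * z + \<phi>2 x / 2 * z\<^sup>2 + C3 / 2 * \<bar>z\<bar> ^ 3"
proof -
  obtain w where w: "\<bar>w - x\<bar> \<le> \<bar>z\<bar>" "\<phi> (x + z) = \<phi> x + \<phi>1 x * z + \<phi>2 w / 2 * z\<^sup>2"
    using taylor2[of x "x + z"] by auto
  have "\<phi>2 w - \<phi>2 x \<le> C3 * \<bar>w - x\<bar>" using \<phi>2_lip[of w x] by linarith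
  also have "\<dots> \<le> C3 * \<bar>z\<bar>" using w(1) C3_nonneg by (rule mult_left_mono)
  finally have "(\<phi>2 w - \<phi>2 x) * z\<^sup>2 \<le> C3 * \<bar>z\<bar> * z\<^sup>2" by (intro mult_right_mono) auto
  then have "(\<phi>2 w - \<phi>2 x) * z\<^sup>2 \<le> C3 * \<bar>z\<bar> ^ 3" by (simp add: power3_eq_cube power2_eq_square abs_mult_self_eq mult.assoc)
  then show ?thesis unfolding w(2) by (simp add: algebra_simps)
qed

lemma convex_bound: "\<phi> x - \<phi> y \<le> \<phi>1 x * (x - y)"
proof -
  obtain w where "\<phi> y = \<phi> x + \<phi>1 x * (y - x) + \<phi>2 w / 2 * (y - x)\<^sup>2" using taylor2[of x y] by auto
  moreover have "0 \<le> \<phi>2 w / 2 * (y - x)\<^sup>2" using \<phi>2_nonneg by simp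
  ultimately show ?thesis by (simp add: algebra_simps)
qed

lemma \<phi>1_bound: "\<bar>\<phi>1 x\<bar> \<le> C2 * \<bar>x\<bar>" using \<phi>1_lip[of x 0] \<phi>10 by simp

lemma \<phi>_bound: "\<phi> x \<le> C2 * x\<^sup>2"
proof -
  have "\<phi> x \<le> \<phi>1 x * x" using convex_bound[of x 0] \<phi>0 by simp
  also have "\<dots> \<le> \<bar>\<phi>1 x\<bar> * \<bar>x\<bar>" by (simp add: abs_mult[symmetric])
  also have "\<dots> \<le> C2 * \<bar>x\<bar> * \<bar>x\<bar>" by (intro mult_right_mono \<phi>1_bound) simp
  finally show ?thesis by (simp add: power2_eq_square mult.assoc)
qed

lemma \<phi>_meas [measurable]: "\<phi> \<in> borel_measurable borel" "\<phi>1 \<in> borel_measurable borel" "\<phi>2 \<in> borel_measurable borel"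
proof -
  show "\<phi> \<in> borel_measurable borel" "\<phi>1 \<in> borel_measurable borel"
    by (rule borel_measurable_continuous_onI, rule DERIV_continuous_on,
      rule has_field_derivative_at_within, rule d1 d2)+
  have "C3-lipschitz_on UNIV \<phi>2" using \<phi>2_lip C3_nonneg by (intro lipschitz_onI) (auto simp: dist_real_def)
  then show "\<phi>2 \<in> borel_measurable borel"
    by (intro borel_measurable_continuous_onI lipschitz_on_continuous_on)
qed

end

lemma abs_cube_bound: "0 < h \<Longrightarrow> \<bar>x\<bar> ^ 3 \<le> (sqrt h * x\<^sup>2 + x ^ 4 / sqrt h) / 2" for x h :: real
proof -
  assume h: "0 < h"
  have "0 \<le> (sqrt h - \<bar>x\<bar>)\<^sup>2 * x\<^sup>2 / sqrt h" using h by simp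
  also have "\<dots> = ((sqrt h)\<^sup>2 * x\<^sup>2 - 2 * sqrt h * \<bar>x\<bar> * x\<^sup>2 + \<bar>x\<bar>\<^sup>2 * x\<^sup>2) / sqrt h"
    by (simp add: power2_diff algebra_simps)
  also have "\<dots> = sqrt h * x\<^sup>2 - 2 * \<bar>x\<bar> ^ 3 + x ^ 4 / sqrt h"
    using h by (simp add: field_simps power2_eq_square power3_eq_cube power4_eq_xxxx abs_mult_self_eq)
  finally show ?thesis by simp
qed

lemma abs_add_cube: "\<bar>x + y\<bar> ^ 3 \<le> 4 * (\<bar>x\<bar> ^ 3 + \<bar>y\<bar> ^ 3)" for x y :: real
proof -
  define a where "a = \<bar>x\<bar>"
  define b where "b = \<bar>y\<bar>"
  have ab: "0 \<le> a" "0 \<le> b" by (auto simp: a_def b_def)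
  have "\<bar>x + y\<bar> ^ 3 \<le> (a + b) ^ 3" unfolding a_def b_def by (intro power_mono) auto
  also have "(a + b) ^ 3 \<le> 4 * (a ^ 3 + b ^ 3)"
  proof -
    have "4 * (a ^ 3 + b ^ 3) - (a + b) ^ 3 = 3 * ((a + b) * (a - b)\<^sup>2)" by (simp add: power3_eq_cube power2_eq_square algebra_simps)
    moreover have "0 \<le> (a + b) * (a - b)\<^sup>2" using ab by simp
    ultimately show ?thesis by linarith
  qed
  finally show ?thesis by (simp add: a_def b_def)
qed

context brownian begin

lemma euler_step:
  assumes tf: "test_function \<phi> \<phi>1 \<phi>2 C2 C3"
    and s: "0 \<le> s" and h: "0 < h"
    and Em: "E \<in> borel_measurable (F s)" and E2: "integrable M (\<lambda>\<omega>. (E \<omega>)\<^sup>2)"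
    and am: "a \<in> borel_measurable (F s)" "\<And>\<omega>. \<omega> \<in> space M \<Longrightarrow> \<bar>a \<omega>\<bar> \<le> A"
    and gm: "g \<in> borel_measurable (F s)" "\<And>\<omega>. \<omega> \<in> space M \<Longrightarrow> \<bar>g \<omega>\<bar> \<le> A"
  defines "E' \<equiv> \<lambda>\<omega>. E \<omega> + a \<omega> * h + g \<omega> * (B (s + h) \<omega> - B s \<omega>)"
  shows "E' \<in> borel_measurable (F (s + h))" "integrable M (\<lambda>\<omega>. (E' \<omega>)\<^sup>2)"
    "integrable M (\<lambda>\<omega>. \<phi> (E \<omega>))" "integrable M (\<lambda>\<omega>. \<phi>1 (E \<omega>) * a \<omega> + \<phi>2 (E \<omega>) / 2 * (g \<omega>)\<^sup>2)"
    "expectation (\<lambda>\<omega>. \<phi> (E' \<omega>)) \<le> expectation (\<lambda>\<omega>. \<phi> (E \<omega>))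
       + h * expectation (\<lambda>\<omega>. \<phi>1 (E \<omega>) * a \<omega> + \<phi>2 (E \<omega>) / 2 * (g \<omega>)\<^sup>2)
       + h * (C2 / 2 * A\<^sup>2 * h + 2 * C3 * A ^ 3 * (h\<^sup>2 + 2 * sqrt h))"
proof -
  interpret test_function \<phi> \<phi>1 \<phi>2 C2 C3 by (rule tf)
  let ?d = "\<lambda>\<omega>. B (s + h) \<omega> - B s \<omega>"
  obtain \<omega>0 where "\<omega>0 \<in> space M" using not_empty by blast
  then have A0: "0 \<le> A" using am(2)[of \<omega>0] by linarith
  have [measurable]: "E \<in> borel_measurable M" "a \<in> borel_measurable M" "g \<in> borel_measurable M"
    using Em am gm by (auto intro: meas_F_M)
  have fm: "f \<in> borel_measurable borel \<Longrightarrow> (\<lambda>\<omega>. f (E \<omega>)) \<in> borel_measurable (F s)" for f :: "real \<Rightarrow> real"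
    using Em by (rule measurable_compose)
  note mom = increment_moments[of s "s + h"]
  have mom': "integrable M ?d" "integrable M (\<lambda>\<omega>. (?d \<omega>)\<^sup>2)" "integrable M (\<lambda>\<omega>. (?d \<omega>)^4)"
    "expectation (\<lambda>\<omega>. (?d \<omega>)\<^sup>2) = h" "expectation (\<lambda>\<omega>. (?d \<omega>)^4) = 3 * h\<^sup>2"
    using mom s h by auto
  note adi = adapted_times_increment[of s "s + h"]
  show "E' \<in> borel_measurable (F (s + h))"
    unfolding E'_def using meas_F_mono[OF Em, of "s + h"] meas_F_mono[OF am(1), of "s + h"] meas_F_mono[OF gm(1), of "s + h"]
      B_meas_F[of s "s + h"] B_meas_F[of "s + h" "s + h"] s h by simp
  then have E'm [measurable]: "E' \<in> borel_measurable M" by (rule meas_F_M)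
  show E'2: "integrable M (\<lambda>\<omega>. (E' \<omega>)\<^sup>2)"
  proof (rule Bochner_Integration.integrable_bound)
    show "integrable M (\<lambda>\<omega>. 3 * (E \<omega>)\<^sup>2 + 3 * (A * h)\<^sup>2 + 3 * A\<^sup>2 * (?d \<omega>)\<^sup>2)"
      using E2 mom'(2) by simp
    show "AE \<omega> in M. norm ((E' \<omega>)\<^sup>2) \<le> norm (3 * (E \<omega>)\<^sup>2 + 3 * (A * h)\<^sup>2 + 3 * A\<^sup>2 * (?d \<omega>)\<^sup>2)"
    proof (rule AE_I2)
      fix \<omega> assume w: "\<omega> \<in> space M"
      have 3: "(x + y + z)\<^sup>2 \<le> 3 * x\<^sup>2 + 3 * y\<^sup>2 + 3 * z\<^sup>2" for x y z :: real
      proof -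
        have "3 * x\<^sup>2 + 3 * y\<^sup>2 + 3 * z\<^sup>2 - (x + y + z)\<^sup>2 = (x - y)\<^sup>2 + (y - z)\<^sup>2 + (x - z)\<^sup>2"
          by (simp add: power2_eq_square algebra_simps)
        then show ?thesis by (smt (verit) zero_le_power2)
      qed
      have "(a \<omega> * h)\<^sup>2 \<le> (A * h)\<^sup>2" "(g \<omega> * ?d \<omega>)\<^sup>2 \<le> A\<^sup>2 * (?d \<omega>)\<^sup>2"
        using am(2)[OF w] gm(2)[OF w] h A0 by (auto simp: power_mult_distrib abs_le_square_iff[symmetric] intro!: mult_right_mono)
      then show "norm ((E' \<omega>)\<^sup>2) \<le> norm (3 * (E \<omega>)\<^sup>2 + 3 * (A * h)\<^sup>2 + 3 * A\<^sup>2 * (?d \<omega>)\<^sup>2)"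
        using 3[of "E \<omega>" "a \<omega> * h" "g \<omega> * ?d \<omega>"] unfolding E'_def by simp
    qed
  qed simp
  have phi_int: "integrable M (\<lambda>\<omega>. \<phi> (Z \<omega>))" if "Z \<in> borel_measurable M" "integrable M (\<lambda>\<omega>. (Z \<omega>)\<^sup>2)" for Z
    by (rule Bochner_Integration.integrable_bound[where f = "\<lambda>\<omega>. C2 * (Z \<omega>)\<^sup>2"])
      (use that \<phi>_bound \<phi>_nonneg C2_nonneg in \<open>auto simp: abs_mult\<close>)
  show phiE: "integrable M (\<lambda>\<omega>. \<phi> (E \<omega>))" using E2 by (intro phi_int) auto
  have E1: "integrable M (\<lambda>\<omega>. \<bar>E \<omega>\<bar>)"
    using square_integrable_imp_integrable[OF _ E2] by auto
  have phi1: "integrable M (\<lambda>\<omega>. \<phi>1 (E \<omega>))"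
    by (rule Bochner_Integration.integrable_bound[where f = "\<lambda>\<omega>. C2 * \<bar>E \<omega>\<bar>"])
      (use E1 \<phi>1_bound C2_nonneg in \<open>auto simp: abs_mult\<close>)
  have multb: "integrable M (\<lambda>\<omega>. Z \<omega> * b \<omega>)" if "integrable M Z" "b \<in> borel_measurable M" "\<And>\<omega>. \<omega> \<in> space M \<Longrightarrow> \<bar>b \<omega>\<bar> \<le> K" for Z b :: "'a \<Rightarrow> real" and K
  proof (rule Bochner_Integration.integrable_bound[where f = "\<lambda>\<omega>. K * \<bar>Z \<omega>\<bar>"])
    show "AE \<omega> in M. norm (Z \<omega> * b \<omega>) \<le> norm (K * \<bar>Z \<omega>\<bar>)"
    proof (rule AE_I2)
      fix \<omega> assume "\<omega> \<in> space M"
      from that(3)[OF this] show "norm (Z \<omega> * b \<omega>) \<le> norm (K * \<bar>Z \<omega>\<bar>)"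
        by (simp add: abs_mult mult.commute[of "\<bar>Z \<omega>\<bar>"] mult_right_mono)
    qed
  qed (use that in auto)
  have p2b: "\<bar>\<phi>2 x\<bar> \<le> C2" for x using \<phi>2_nonneg[of x] \<phi>2_le[of x] by simp
  have sqb: "(g \<omega>)\<^sup>2 \<le> A\<^sup>2" "(a \<omega>)\<^sup>2 \<le> A\<^sup>2" "\<bar>a \<omega> * g \<omega>\<bar> \<le> A\<^sup>2" if "\<omega> \<in> space M" for \<omega>
  proof -
    show "\<bar>a \<omega> * g \<omega>\<bar> \<le> A\<^sup>2"
      unfolding abs_mult power2_eq_square using am(2)[OF that] gm(2)[OF that] A0 by (intro mult_mono) auto
  qed (use am(2)[OF that] gm(2)[OF that] A0 in \<open>auto simp: abs_le_square_iff[symmetric]\<close>)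
  have bint: "integrable M (\<lambda>\<omega>. \<phi>2 (E \<omega>) * b \<omega>)" if "b \<in> borel_measurable M" "\<And>\<omega>. \<omega> \<in> space M \<Longrightarrow> \<bar>b \<omega>\<bar> \<le> K" for b K
  proof (rule integrable_bounded[where C = "C2 * K"])
    fix \<omega> assume "\<omega> \<in> space M"
    from that(2)[OF this] p2b[of "E \<omega>"] C2_nonneg show "\<bar>\<phi>2 (E \<omega>) * b \<omega>\<bar> \<le> C2 * K"
      unfolding abs_mult by (intro mult_mono) auto
  qed (use that in auto)
  have i1: "integrable M (\<lambda>\<omega>. \<phi>1 (E \<omega>) * a \<omega>)" by (rule multb[OF phi1 _ am(2)]) auto
  have i2: "integrable M (\<lambda>\<omega>. \<phi>2 (E \<omega>) * (g \<omega>)\<^sup>2)" by (rule bint[of _ "A\<^sup>2"]) (use sqb in auto)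
  have i3: "integrable M (\<lambda>\<omega>. \<phi>2 (E \<omega>) * (a \<omega>)\<^sup>2)" by (rule bint[of _ "A\<^sup>2"]) (use sqb in auto)
  have i4: "integrable M (\<lambda>\<omega>. \<phi>2 (E \<omega>) * (a \<omega> * g \<omega>))" by (rule bint[of _ "A\<^sup>2"]) (use sqb in auto)
  have i5: "integrable M (\<lambda>\<omega>. \<phi>1 (E \<omega>) * g \<omega>)" by (rule multb[OF phi1 _ gm(2)]) auto
  show i6: "integrable M (\<lambda>\<omega>. \<phi>1 (E \<omega>) * a \<omega> + \<phi>2 (E \<omega>) / 2 * (g \<omega>)\<^sup>2)" using i1 i2 by simp
  define m1 where "m1 \<omega> = \<phi>1 (E \<omega>) * g \<omega> + h * (\<phi>2 (E \<omega>) * (a \<omega> * g \<omega>))" for \<omega>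
  define m2 where "m2 \<omega> = \<phi>2 (E \<omega>) * (g \<omega>)\<^sup>2" for \<omega>
  have m1: "m1 \<in> borel_measurable (F s)" "integrable M m1"
    unfolding m1_def using fm[of \<phi>1] fm[of \<phi>2] am(1) gm(1) i4 i5 by auto
  have m2: "m2 \<in> borel_measurable (F s)" "integrable M m2"
    unfolding m2_def using fm[of \<phi>2] gm(1) i2 by auto
  have q1: "integrable M (\<lambda>\<omega>. m1 \<omega> * ?d \<omega>)" "expectation (\<lambda>\<omega>. m1 \<omega> * ?d \<omega>) = 0"
    using adi[OF _ _ m1] s h by auto
  have q2: "integrable M (\<lambda>\<omega>. m2 \<omega> * (?d \<omega>)\<^sup>2)" "expectation (\<lambda>\<omega>. m2 \<omega> * (?d \<omega>)\<^sup>2) = expectation m2 * h"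
    using adi[OF _ _ m2] s h by auto
  let ?R = "\<lambda>\<omega>. \<phi> (E \<omega>) + h * (\<phi>1 (E \<omega>) * a \<omega>) + m1 \<omega> * ?d \<omega> + (m2 \<omega> * (?d \<omega>)\<^sup>2) / 2 +
     (C2 / 2 * A\<^sup>2 * h\<^sup>2 + 2 * C3 * A ^ 3 * h ^ 3) + C3 * A ^ 3 * (sqrt h * (?d \<omega>)\<^sup>2 + (?d \<omega>) ^ 4 / sqrt h)"
  have pw: "\<phi> (E' \<omega>) \<le> ?R \<omega>" if w: "\<omega> \<in> space M" for \<omega>
  proof -
    define z where "z = a \<omega> * h + g \<omega> * ?d \<omega>"
    have "\<bar>z\<bar> ^ 3 \<le> 4 * (\<bar>a \<omega> * h\<bar> ^ 3 + \<bar>g \<omega> * ?d \<omega>\<bar> ^ 3)" unfolding z_def by (rule abs_add_cube)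
    also have "\<dots> \<le> 4 * (A ^ 3 * h ^ 3 + A ^ 3 * \<bar>?d \<omega>\<bar> ^ 3)"
      using am(2)[OF w] gm(2)[OF w] h A0
      by (intro mult_left_mono add_mono) (auto simp: abs_mult power_mult_distrib intro!: mult_right_mono power_mono)
    also have "\<dots> \<le> 4 * (A ^ 3 * h ^ 3 + A ^ 3 * ((sqrt h * (?d \<omega>)\<^sup>2 + (?d \<omega>) ^ 4 / sqrt h) / 2))"
      using A0 by (intro mult_left_mono add_mono abs_cube_bound h) auto
    finally have "C3 / 2 * \<bar>z\<bar> ^ 3 \<le> C3 / 2 * (4 * (A ^ 3 * h ^ 3 + A ^ 3 * ((sqrt h * (?d \<omega>)\<^sup>2 + (?d \<omega>) ^ 4 / sqrt h) / 2)))"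
      using C3_nonneg by (intro mult_left_mono) auto
    moreover have "C3 / 2 * (4 * (p * q + p * (y / 2))) = 2 * C3 * p * q + C3 * p * y" for p q y
      by (simp add: algebra_simps)
    ultimately have c: "C3 / 2 * \<bar>z\<bar> ^ 3 \<le> 2 * C3 * A ^ 3 * h ^ 3 + C3 * A ^ 3 * (sqrt h * (?d \<omega>)\<^sup>2 + (?d \<omega>) ^ 4 / sqrt h)"
      by (simp only:)
    have "\<phi>2 (E \<omega>) * (a \<omega>)\<^sup>2 * h\<^sup>2 \<le> C2 * A\<^sup>2 * h\<^sup>2"
      using \<phi>2_le[of "E \<omega>"] \<phi>2_nonneg sqb(2)[OF w] C2_nonneg by (intro mult_right_mono mult_mono) auto
    moreover have "p / 2 * (x * h + y * d)\<^sup>2 = p * x\<^sup>2 * h\<^sup>2 / 2 + h * (p * (x * y)) * d + (p * y\<^sup>2 * d\<^sup>2) / 2" for p x y d :: real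
      by (simp add: power2_eq_square field_simps)
    ultimately have d: "\<phi>2 (E \<omega>) / 2 * z\<^sup>2 \<le> C2 / 2 * A\<^sup>2 * h\<^sup>2 + h * (\<phi>2 (E \<omega>) * (a \<omega> * g \<omega>)) * ?d \<omega> + (m2 \<omega> * (?d \<omega>)\<^sup>2) / 2"
      unfolding z_def m2_def by (simp only:)
    have "E' \<omega> = E \<omega> + z" by (simp add: E'_def z_def)
    then have "\<phi> (E' \<omega>) \<le> \<phi> (E \<omega>) + \<phi>1 (E \<omega>) * z + \<phi>2 (E \<omega>) / 2 * z\<^sup>2 + C3 / 2 * \<bar>z\<bar> ^ 3" using taylor3 by simp
    then have "\<phi> (E' \<omega>) \<le> \<phi> (E \<omega>) + \<phi>1 (E \<omega>) * z +
       (C2 / 2 * A\<^sup>2 * h\<^sup>2 + h * (\<phi>2 (E \<omega>) * (a \<omega> * g \<omega>)) * ?d \<omega> + (m2 \<omega> * (?d \<omega>)\<^sup>2) / 2) +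
       (2 * C3 * A ^ 3 * h ^ 3 + C3 * A ^ 3 * (sqrt h * (?d \<omega>)\<^sup>2 + (?d \<omega>) ^ 4 / sqrt h))" using c d by linarith
    moreover have "\<phi>1 (E \<omega>) * z + h * (\<phi>2 (E \<omega>) * (a \<omega> * g \<omega>)) * ?d \<omega> = h * (\<phi>1 (E \<omega>) * a \<omega>) + m1 \<omega> * ?d \<omega>"
      by (simp add: z_def m1_def algebra_simps)
    ultimately show ?thesis by linarith
  qed
  have R: "has_bochner_integral M ?R (expectation (\<lambda>\<omega>. \<phi> (E \<omega>)) + h * expectation (\<lambda>\<omega>. \<phi>1 (E \<omega>) * a \<omega>) + 0 + (expectation m2 * h) / 2 +
     (C2 / 2 * A\<^sup>2 * h\<^sup>2 + 2 * C3 * A ^ 3 * h ^ 3) + C3 * A ^ 3 * (sqrt h * h + 3 * h\<^sup>2 / sqrt h))"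
  proof -
    have 1: "has_bochner_integral M (\<lambda>\<omega>. \<phi> (E \<omega>)) (expectation (\<lambda>\<omega>. \<phi> (E \<omega>)))" using phiE by (simp add: has_bochner_integral_iff)
    have 2: "has_bochner_integral M (\<lambda>\<omega>. h * (\<phi>1 (E \<omega>) * a \<omega>)) (h * expectation (\<lambda>\<omega>. \<phi>1 (E \<omega>) * a \<omega>))"
      using i1 by (simp add: has_bochner_integral_iff)
    have 3: "has_bochner_integral M (\<lambda>\<omega>. m1 \<omega> * ?d \<omega>) 0" using q1 by (simp add: has_bochner_integral_iff)
    have 4: "has_bochner_integral M (\<lambda>\<omega>. (m2 \<omega> * (?d \<omega>)\<^sup>2) / 2) ((expectation m2 * h) / 2)"
      using q2 by (simp add: has_bochner_integral_iff)
    have 5: "has_bochner_integral M (\<lambda>\<omega>. k) k" for k :: real by (simp add: has_bochner_integral_iff prob_space)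
    have 6: "has_bochner_integral M (\<lambda>\<omega>. C3 * A ^ 3 * (sqrt h * (?d \<omega>)\<^sup>2 + (?d \<omega>) ^ 4 / sqrt h)) (C3 * A ^ 3 * (sqrt h * h + 3 * h\<^sup>2 / sqrt h))"
      using mom' by (intro has_bochner_integral_mult_right) (simp add: has_bochner_integral_iff)
    show ?thesis
      by (intro has_bochner_integral_add[OF has_bochner_integral_add[OF has_bochner_integral_add[OF
         has_bochner_integral_add[OF has_bochner_integral_add[OF 1 2] 3] 4] 5] 6])
  qed
  have "expectation (\<lambda>\<omega>. \<phi> (E' \<omega>)) \<le> expectation ?R"
    by (rule integral_mono) (use phi_int[OF E'm E'2] R pw in \<open>auto simp: has_bochner_integral_iff\<close>)
  also have "\<dots> = expectation (\<lambda>\<omega>. \<phi> (E \<omega>)) + h * expectation (\<lambda>\<omega>. \<phi>1 (E \<omega>) * a \<omega>) + 0 + (expectation m2 * h) / 2 +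
     (C2 / 2 * A\<^sup>2 * h\<^sup>2 + 2 * C3 * A ^ 3 * h ^ 3) + C3 * A ^ 3 * (sqrt h * h + 3 * (h * sqrt h))"
  proof -
    have "h / sqrt h = sqrt h" using h by (simp add: real_div_sqrt)
    then have "3 * h\<^sup>2 / sqrt h = 3 * (h * sqrt h)" by (simp add: power2_eq_square flip: times_divide_eq_right)
    then show ?thesis using has_bochner_integral_integral_eq[OF R] by (simp only:)
  qed
  finally have fin: "expectation (\<lambda>\<omega>. \<phi> (E' \<omega>)) \<le> expectation (\<lambda>\<omega>. \<phi> (E \<omega>)) + h * expectation (\<lambda>\<omega>. \<phi>1 (E \<omega>) * a \<omega>) + 0 + (expectation m2 * h) / 2 +
     (C2 / 2 * A\<^sup>2 * h\<^sup>2 + 2 * C3 * A ^ 3 * h ^ 3) + C3 * A ^ 3 * (sqrt h * h + 3 * (h * sqrt h))" .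
  have "expectation (\<lambda>\<omega>. \<phi>1 (E \<omega>) * a \<omega> + \<phi>2 (E \<omega>) / 2 * (g \<omega>)\<^sup>2) = expectation (\<lambda>\<omega>. \<phi>1 (E \<omega>) * a \<omega>) + expectation m2 / 2"
    using i1 i2 unfolding m2_def by simp
  with fin show "expectation (\<lambda>\<omega>. \<phi> (E' \<omega>)) \<le> expectation (\<lambda>\<omega>. \<phi> (E \<omega>))
       + h * expectation (\<lambda>\<omega>. \<phi>1 (E \<omega>) * a \<omega> + \<phi>2 (E \<omega>) / 2 * (g \<omega>)\<^sup>2)
       + h * (C2 / 2 * A\<^sup>2 * h + 2 * C3 * A ^ 3 * (h\<^sup>2 + 2 * sqrt h))"
    by (simp add: algebra_simps power2_eq_square power3_eq_cube)
qed

lemma lc_jointly_measurable: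
  assumes lc: "lc_process C a" and t: "0 < t" and h: "0 < h"
  shows "(\<lambda>(\<omega>, r). indicator {0..<t} r * a r \<omega>) \<in> borel_measurable (M \<Otimes>\<^sub>M lborel)"
    "(\<lambda>(\<omega>, r). grid_step (on_grid a h) h N r \<omega>) \<in> borel_measurable (M \<Otimes>\<^sub>M lborel)"
proof -
  have step: "(\<lambda>(\<omega>, r). grid_step (on_grid a h) h N r \<omega>) \<in> borel_measurable (M \<Otimes>\<^sub>M lborel)" if "0 < h" for h N
  proof -
    have [measurable]: "on_grid a h j \<in> borel_measurable M" for j
      by (rule grid_adapted_meas[OF lc_grid_adapted[OF lc]]) (use that in simp)
    show ?thesis unfolding grid_step_def by measurable
  qed
  then show "(\<lambda>(\<omega>, r). grid_step (on_grid a h) h N r \<omega>) \<in> borel_measurable (M \<Otimes>\<^sub>M lborel)" using h by blast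
  show "(\<lambda>(\<omega>, r). indicator {0..<t} r * a r \<omega>) \<in> borel_measurable (M \<Otimes>\<^sub>M lborel)"
  proof (rule borel_measurable_LIMSEQ_real[OF _ step])
    fix x :: "'a \<times> real" assume "x \<in> space (M \<Otimes>\<^sub>M lborel)"
    then have "fst x \<in> space M" by (auto simp: space_pair_measure)
    from lc_step_tendsto[OF lc this, of "\<lambda>m. t / 2^m" "\<lambda>m. 2^m" t "snd x"] dyadic_step[OF t] t
    show "(\<lambda>m. case x of (\<omega>, r) \<Rightarrow> grid_step (on_grid a (t / 2^m)) (t / 2^m) (2^m) r \<omega>) \<longlonglongrightarrow> (case x of (\<omega>, r) \<Rightarrow> indicator {0..<t} r * a r \<omega>)"
      by (simp add: case_prod_unfold)
  qed (use t in simp)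
qed

lemma lc_path_measurable:
  assumes lc: "lc_process C a" and t: "0 < t" and w: "\<omega> \<in> space M"
  shows "(\<lambda>r. indicator {0..<t} r * a r \<omega>) \<in> borel_measurable lborel"
  using measurable_Pair2[OF lc_jointly_measurable(1)[OF lc t zero_less_one] w] by simp

lemma grid_step_integral:
  assumes "0 < h"
  shows "has_bochner_integral lborel (\<lambda>r. grid_step \<xi> h j r \<omega>) (h * (\<Sum>i<j. \<xi> i \<omega>))"
proof -
  have "has_bochner_integral lborel (indicator {real i * h..<real (Suc i) * h} :: real \<Rightarrow> real) h" for i
    using has_bochner_integral_real_indicator[of "{real i * h..<real (Suc i) * h}" lborel] assms
    by (simp add: algebra_simps)
  then have "has_bochner_integral lborel (\<lambda>r. grid_step \<xi> h j r \<omega>) (\<Sum>i<j. \<xi> i \<omega> * h)"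
    unfolding grid_step_def by (intro has_bochner_integral_sum has_bochner_integral_mult_right)
  then show ?thesis by (simp add: sum_distrib_left mult.commute)
qed

definition drift_dev :: "(real \<Rightarrow> 'a \<Rightarrow> real) \<Rightarrow> real \<Rightarrow> nat \<Rightarrow> 'a \<Rightarrow> real" where
  "drift_dev a h N \<omega> = (\<integral>r. \<bar>grid_step (on_grid a h) h N r \<omega> - indicator {0..<real N * h} r * a r \<omega>\<bar> \<partial>lborel)"

lemma interval_indicator_integrable: fixes c t :: real shows "integrable lborel (\<lambda>r. c * indicator {0..<t} r :: real)"
proof (intro integrable_mult_right integrable_real_indicator)
  show "emeasure lborel {0..<t} < \<infinity>" by (cases "0 \<le> t") auto
qed simp

lemma drift_dev:
  assumes lc: "lc_process C a" and t: "0 < t"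
  shows "\<And>h N. 0 < h \<Longrightarrow> real N * h = t \<Longrightarrow> integrable M (drift_dev a h N)"
    "(\<lambda>m. expectation (drift_dev a (t / 2^m) (2^m))) \<longlonglongrightarrow> 0"
proof -
  have C0: "0 \<le> C" by (rule lc_bound_nonneg[OF lc])
  have m [measurable]: "drift_dev a h N \<in> borel_measurable M" if h: "0 < h" and N: "real N * h = t" for h N
    unfolding drift_dev_def N using lc_jointly_measurable[OF lc t h]
    by (intro lborel.borel_measurable_lebesgue_integral) (simp add: case_prod_unfold)
  have bd: "\<bar>grid_step (on_grid a h) h N r \<omega> - indicator {0..<real N * h} r * a r \<omega>\<bar> \<le> 2 * C * indicator {0..<t} r"
    if h: "0 < h" and N: "real N * h = t" and w: "\<omega> \<in> space M" for h N r \<omega>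
    using lc_step_bound(1)[OF lc w h, of N r] lc_step_bound(2)[OF lc w h, of t r] N by simp
  have b: "\<bar>drift_dev a h N \<omega>\<bar> \<le> 2 * C * t" if h: "0 < h" and N: "real N * h = t" and w: "\<omega> \<in> space M" for h N \<omega>
  proof -
    have "drift_dev a h N \<omega> \<le> (\<integral>r. 2 * C * indicator {0..<t} r \<partial>lborel)"
      unfolding drift_dev_def by (rule integral_mono'[OF interval_indicator_integrable]) (use bd[OF h N w] C0 in auto)
    also have "\<dots> = 2 * C * t" using t by simp
    finally show ?thesis unfolding drift_dev_def by (simp add: abs_of_nonneg)
  qed
  show int: "\<And>h N. 0 < h \<Longrightarrow> real N * h = t \<Longrightarrow> integrable M (drift_dev a h N)"
    by (rule integrable_bounded[OF m b])
  have "(\<lambda>k. expectation (drift_dev a (t / 2^k) (2^k))) \<longlonglongrightarrow> expectation (\<lambda>_. 0)"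
  proof (rule integral_dominated_convergence[where w = "\<lambda>_. 2 * C * t"])
    show "AE \<omega> in M. (\<lambda>k. drift_dev a (t / 2^k) (2^k) \<omega>) \<longlonglongrightarrow> 0"
    proof (rule AE_I2)
      fix \<omega> assume w: "\<omega> \<in> space M"
      have "(\<lambda>k. drift_dev a (t / 2^k) (2^k) \<omega>) \<longlonglongrightarrow> (\<integral>r. \<bar>indicator {0..<t} r * a r \<omega> - indicator {0..<t} r * a r \<omega>\<bar> \<partial>lborel)"
        unfolding drift_dev_def
      proof (rule integral_dominated_convergence[where w = "\<lambda>r. 2 * C * indicator {0..<t} r"])
        have [measurable]: "(\<lambda>r. indicator {0..<t} r * a r \<omega>) \<in> borel_measurable lborel" by (rule lc_path_measurable[OF lc t w])
        show "(\<lambda>r. \<bar>indicator {0..<t} r * a r \<omega> - indicator {0..<t} r * a r \<omega>\<bar>) \<in> borel_measurable lborel" by simp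
        show "(\<lambda>r. \<bar>grid_step (on_grid a (t / 2^k)) (t / 2^k) (2^k) r \<omega> - indicator {0..<real (2^k) * (t / 2^k)} r * a r \<omega>\<bar>) \<in> borel_measurable lborel" for k
        proof -
          have [measurable]: "(\<lambda>r. grid_step (on_grid a (t / 2^k)) (t / 2^k) (2^k) r \<omega>) \<in> borel_measurable lborel"
            using grid_step_integral[of "t / 2^k" "on_grid a (t / 2^k)" "2^k" \<omega>] t by (auto simp: has_bochner_integral_iff)
          show ?thesis by simp
        qed
        show "AE r in lborel. (\<lambda>k. \<bar>grid_step (on_grid a (t / 2^k)) (t / 2^k) (2^k) r \<omega> - indicator {0..<real (2^k) * (t / 2^k)} r * a r \<omega>\<bar>)
          \<longlonglongrightarrow> \<bar>indicator {0..<t} r * a r \<omega> - indicator {0..<t} r * a r \<omega>\<bar>"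
          using lc_step_tendsto[OF lc w, of "\<lambda>m. t / 2^m" "\<lambda>m. 2^m" t] dyadic_step[OF t] t
          by (intro AE_I2 tendsto_intros) simp_all
        show "AE r in lborel. norm \<bar>grid_step (on_grid a (t / 2^k)) (t / 2^k) (2^k) r \<omega> - indicator {0..<real (2^k) * (t / 2^k)} r * a r \<omega>\<bar> \<le> 2 * C * indicator {0..<t} r" for k
          using bd[of "t / 2^k" "2^k" \<omega>] t w by (intro AE_I2) simp
      qed (rule interval_indicator_integrable)
      then show "(\<lambda>k. drift_dev a (t / 2^k) (2^k) \<omega>) \<longlonglongrightarrow> 0" by simp
    qed
    show "drift_dev a (t / 2^k) (2^k) \<in> borel_measurable M" for k using t by (intro m) auto
    show "AE \<omega> in M. norm (drift_dev a (t / 2^k) (2^k) \<omega>) \<le> 2 * C * t" for k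
      using b[of "t / 2^k" "2^k"] t by (intro AE_I2) simp
  qed auto
  then show "(\<lambda>m. expectation (drift_dev a (t / 2^m) (2^m))) \<longlonglongrightarrow> 0" by simp
qed

lemma drift_dev_bound:
  assumes lc: "lc_process C a" and h: "0 < h" and N: "real N * h = t" "0 < t" and j: "j \<le> N" and w: "\<omega> \<in> space M"
  shows "\<bar>h * (\<Sum>i<j. a (real i * h) \<omega>) - (\<integral>r. indicator {0..<real j * h} r * a r \<omega> \<partial>lborel)\<bar> \<le> drift_dev a h N \<omega>"
proof -
  have st: "has_bochner_integral lborel (\<lambda>r. grid_step (on_grid a h) h j r \<omega>) (h * (\<Sum>i<j. a (real i * h) \<omega>))" for j
    using grid_step_integral[OF h, of "on_grid a h" j \<omega>] by (simp add: on_grid_def)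
  have jN: "real j * h \<le> t" using j h N by (auto simp: N(1)[symmetric])
  have mt: "(\<lambda>r. indicator {0..<t} r * a r \<omega>) \<in> borel_measurable lborel" by (rule lc_path_measurable[OF lc N(2) w])
  have it: "integrable lborel (\<lambda>r. indicator {0..<t} r * a r \<omega>)"
    by (rule Bochner_Integration.integrable_bound[OF interval_indicator_integrable[of C t] mt])
       (use lc_step_bound(2)[OF lc w h, of t] lc_bound_nonneg[OF lc] in auto)
  have ij: "integrable lborel (\<lambda>r. indicator {0..<real j * h} r * a r \<omega>)"
  proof -
    have "integrable lborel (\<lambda>r. indicator {0..<real j * h} r * (indicator {0..<t} r * a r \<omega>))"
      using integrable_mult_indicator[OF _ it, of "{0..<real j * h}"] by simp
    moreover have "indicator {0..<real j * h} r * (indicator {0..<t} r * a r \<omega>) = indicator {0..<real j * h} r * a r \<omega>" for r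
      using jN by (auto simp: indicator_def)
    ultimately show ?thesis by simp
  qed
  have "\<bar>h * (\<Sum>i<j. a (real i * h) \<omega>) - (\<integral>r. indicator {0..<real j * h} r * a r \<omega> \<partial>lborel)\<bar>
    = \<bar>\<integral>r. grid_step (on_grid a h) h j r \<omega> - indicator {0..<real j * h} r * a r \<omega> \<partial>lborel\<bar>"
    using st[of j] ij by (simp add: has_bochner_integral_iff)
  also have "\<dots> \<le> (\<integral>r. \<bar>grid_step (on_grid a h) h j r \<omega> - indicator {0..<real j * h} r * a r \<omega>\<bar> \<partial>lborel)"
    by (rule integral_abs_bound)
  also have "\<dots> \<le> drift_dev a h N \<omega>"
    unfolding drift_dev_def N
  proof (rule integral_mono')
    show "integrable lborel (\<lambda>r. \<bar>grid_step (on_grid a h) h N r \<omega> - indicator {0..<t} r * a r \<omega>\<bar>)"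
      using st[of N] it by (intro integrable_abs Bochner_Integration.integrable_diff) (auto simp: has_bochner_integral_iff)
    show "\<bar>grid_step (on_grid a h) h j r \<omega> - indicator {0..<real j * h} r * a r \<omega>\<bar> \<le> \<bar>grid_step (on_grid a h) h N r \<omega> - indicator {0..<t} r * a r \<omega>\<bar>" for r
      using jN N by (auto simp: grid_step_eq[OF h] indicator_def)
  qed simp
  finally show ?thesis .
qed

lemma grid_err_integral_mono:
  assumes lc: "lc_process C G" and h: "0 < h" and N: "0 < N" and j: "j \<le> N"
  shows "integral\<^sup>L lborel (grid_err G h j) \<le> integral\<^sup>L lborel (grid_err G h N)"
proof (rule integral_mono')
  show "integrable lborel (grid_err G h N)" by (rule grid_err_limit(2)[OF lc h refl]) (use h N in simp)
  fix r
  show "0 \<le> grid_err G h N r" unfolding grid_err_def by (intro Bochner_Integration.integral_nonneg) simp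
  have jN: "real j * h \<le> real N * h" using j h by simp
  show "grid_err G h j r \<le> grid_err G h N r"
  proof (cases "0 \<le> r \<and> r < real j * h")
    case True
    then show ?thesis using jN by (simp add: grid_err_def grid_step_eq[OF h])
  next
    case False
    then have "grid_err G h j r = 0" by (auto simp: grid_err_def grid_step_eq[OF h])
    then show ?thesis unfolding grid_err_def[of _ _ N] by (auto intro!: Bochner_Integration.integral_nonneg)
  qed
qed

lemma grid_err_tendsto:
  assumes lc: "lc_process C G" and t: "0 < t"
  shows "(\<lambda>m. integral\<^sup>L lborel (grid_err G (t / 2^m) (2^m))) \<longlonglongrightarrow> 0"
proof -
  have C0: "0 \<le> C" by (rule lc_bound_nonneg[OF lc])
  have hm: "0 < t / 2^m" "real (2^m) * (t / 2^m) = t" for m :: nat using t by auto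
  have bd: "(grid_step (on_grid G (t / 2^m)) (t / 2^m) (2^m) r \<omega> - indicator {0..<t} r * G r \<omega>)\<^sup>2 \<le> (2 * C)\<^sup>2 * indicator {0..<t} r"
    if w: "\<omega> \<in> space M" for m r \<omega>
    using lc_step_bound(1)[OF lc w hm(1), of m "2^m" r] lc_step_bound(2)[OF lc w hm(1), of t r]
      sq_diff_bound[of _ "C * indicator {0..<t} r"] hm(2)
    by (auto simp: indicator_def split: if_splits)
  have lim: "(\<lambda>m. grid_err G (t / 2^m) (2^m) r) \<longlonglongrightarrow> 0" for r
  proof -
    have "(\<lambda>m. grid_err G (t / 2^m) (2^m) r) \<longlonglongrightarrow> expectation (\<lambda>_. 0)"
      unfolding grid_err_def hm(2)
    proof (rule integral_dominated_convergence[where w = "\<lambda>_. (2 * C)\<^sup>2"])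
      have [measurable]: "(\<lambda>\<omega>. indicator {0..<t} r * G r \<omega>) \<in> borel_measurable M"
        "\<And>m. grid_step (on_grid G (t / 2^m)) (t / 2^m) (2^m) r \<in> borel_measurable M"
        using grid_step_meas[OF lc] lc_ind_meas[OF lc] hm by auto
      show "(\<lambda>\<omega>. (grid_step (on_grid G (t / 2^m)) (t / 2^m) (2^m) r \<omega> - indicator {0..<t} r * G r \<omega>)\<^sup>2) \<in> borel_measurable M" for m by measurable
      show "AE \<omega> in M. (\<lambda>m. (grid_step (on_grid G (t / 2^m)) (t / 2^m) (2^m) r \<omega> - indicator {0..<t} r * G r \<omega>)\<^sup>2) \<longlonglongrightarrow> 0"
      proof (rule AE_I2)
        fix \<omega> assume w: "\<omega> \<in> space M"
        have "(\<lambda>m. (grid_step (on_grid G (t / 2^m)) (t / 2^m) (2^m) r \<omega> - indicator {0..<t} r * G r \<omega>)\<^sup>2)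
          \<longlonglongrightarrow> (indicator {0..<t} r * G r \<omega> - indicator {0..<t} r * G r \<omega>)\<^sup>2"
          using lc_step_tendsto[OF lc w, of "\<lambda>m. t / 2^m" "\<lambda>m. 2^m" t] dyadic_step[OF t] t
          by (intro tendsto_intros) simp_all
        then show "(\<lambda>m. (grid_step (on_grid G (t / 2^m)) (t / 2^m) (2^m) r \<omega> - indicator {0..<t} r * G r \<omega>)\<^sup>2) \<longlonglongrightarrow> 0" by simp
      qed
      show "AE \<omega> in M. norm ((grid_step (on_grid G (t / 2^m)) (t / 2^m) (2^m) r \<omega> - indicator {0..<t} r * G r \<omega>)\<^sup>2) \<le> (2 * C)\<^sup>2" for m
      proof (rule AE_I2)
        fix \<omega> assume "\<omega> \<in> space M"
        from bd[OF this, of m r] show "norm ((grid_step (on_grid G (t / 2^m)) (t / 2^m) (2^m) r \<omega> - indicator {0..<t} r * G r \<omega>)\<^sup>2) \<le> (2 * C)\<^sup>2"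
          by (auto simp: indicator_def split: if_splits intro: order_trans)
      qed
    qed auto
    then show ?thesis by simp
  qed
  have "(\<lambda>m. integral\<^sup>L lborel (grid_err G (t / 2^m) (2^m))) \<longlonglongrightarrow> integral\<^sup>L lborel (\<lambda>r::real. 0)"
  proof (rule integral_dominated_convergence[where w = "\<lambda>r. (2 * C)\<^sup>2 * indicator {0..<t} r"])
    show "grid_err G (t / 2^m) (2^m) \<in> borel_measurable lborel" for m
      using grid_err_limit(2)[OF lc hm(1) hm(2) t] by auto
    show "AE r in lborel. norm (grid_err G (t / 2^m) (2^m) r) \<le> (2 * C)\<^sup>2 * indicator {0..<t} r" for m
    proof (rule AE_I2)
      fix r
      have "grid_err G (t / 2^m) (2^m) r \<le> expectation (\<lambda>\<omega>. (2 * C)\<^sup>2 * indicator {0..<t} r)"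
        unfolding grid_err_def hm(2) by (rule integral_mono') (use bd in auto)
      moreover have "0 \<le> grid_err G (t / 2^m) (2^m) r" unfolding grid_err_def by (intro Bochner_Integration.integral_nonneg) simp
      ultimately show "norm (grid_err G (t / 2^m) (2^m) r) \<le> (2 * C)\<^sup>2 * indicator {0..<t} r" by (simp add: prob_space)
    qed
  qed (use lim interval_indicator_integrable in auto)
  then show ?thesis by simp
qed

definition euler :: "real \<Rightarrow> (real \<Rightarrow> 'a \<Rightarrow> real) \<Rightarrow> (real \<Rightarrow> 'a \<Rightarrow> real) \<Rightarrow> real \<Rightarrow> nat \<Rightarrow> 'a \<Rightarrow> real" where
  "euler d0 a G h j \<omega> = d0 + h * (\<Sum>i<j. a (real i * h) \<omega>) + grid_sum (on_grid G h) h j \<omega>"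

lemma euler_0: "euler d0 a G h 0 \<omega> = d0" by (simp add: euler_def grid_sum_def)

lemma euler_Suc: "euler d0 a G h (Suc j) \<omega> = euler d0 a G h j \<omega> + a (real j * h) \<omega> * h + G (real j * h) \<omega> * (B (real j * h + h) \<omega> - B (real j * h) \<omega>)"
  by (simp add: euler_def grid_sum_def on_grid_def algebra_simps)

lemma expectation_le_sqrt:
  assumes "f \<in> borel_measurable M" "integrable M (\<lambda>\<omega>. (f \<omega>)\<^sup>2)" "expectation (\<lambda>\<omega>. (f \<omega>)\<^sup>2) \<le> e"
  shows "integrable M f" "expectation f \<le> sqrt e"
proof -
  show i: "integrable M f" by (rule square_integrable_imp_integrable[OF assms(1,2)])
  have "0 \<le> variance f" by (rule variance_positive)
  then have "(expectation f)\<^sup>2 \<le> expectation (\<lambda>\<omega>. (f \<omega>)\<^sup>2)" using variance_eq[OF i assms(2)] by simp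
  then show "expectation f \<le> sqrt e" using assms(3) by (intro real_le_rsqrt) linarith
qed

lemma euler_error:
  assumes T: "0 < T" and lca: "lc_process A a" and lcG: "lc_process A G" and h: "0 < h" and N: "real N * h = T"
    and j: "j \<le> N" and t: "t = real j * h" and S: "S \<in> sets M" and Dm: "D \<in> borel_measurable M"
    and ito: "ito_integral_is M B H t I" and Hm: "\<And>r. 0 \<le> r \<Longrightarrow> H r \<in> borel_measurable M"
    and eq: "\<And>\<omega> r. \<omega> \<in> S \<Longrightarrow> 0 \<le> r \<Longrightarrow> r \<le> t \<Longrightarrow> G r \<omega> = H r \<omega>"
    and D: "AE \<omega> in M. \<omega> \<in> S \<longrightarrow> D \<omega> = d0 + (\<integral>r. indicator {0..<t} r * a r \<omega> \<partial>lborel) + I \<omega>"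
    and em: "euler d0 a G h j \<in> borel_measurable M"
  shows "integrable M (\<lambda>\<omega>. indicator S \<omega> * \<bar>euler d0 a G h j \<omega> - D \<omega>\<bar>)"
    "expectation (\<lambda>\<omega>. indicator S \<omega> * \<bar>euler d0 a G h j \<omega> - D \<omega>\<bar>) \<le>
       expectation (drift_dev a h N) + sqrt (integral\<^sup>L lborel (grid_err G h N))"
proof -
  have Im [measurable]: "I \<in> borel_measurable M" using ito by (simp add: ito_integral_is_def)
  note S [measurable] Dm [measurable] em [measurable]
  let ?S = "grid_sum (on_grid G h) h j"
  have [measurable]: "?S \<in> borel_measurable M" by (rule grid_sum_meas[OF lc_grid_adapted[OF lcG]]) (use h in simp)
  define f where "f \<omega> = indicator S \<omega> * \<bar>?S \<omega> - I \<omega>\<bar>" for \<omega>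
  have f2: "(f \<omega>)\<^sup>2 = indicator S \<omega> * (?S \<omega> - I \<omega>)\<^sup>2" for \<omega> by (auto simp: f_def indicator_def)
  have N0: "0 < N" using T h N by (metis gr0I mult_zero_left of_nat_0 order_less_irrefl)
  have f2i: "integrable M (\<lambda>\<omega>. (f \<omega>)\<^sup>2)"
    unfolding f2 by (rule grid_sum_approximates_ito(1)[OF lcG h t ito Hm S eq])
  have f2e: "expectation (\<lambda>\<omega>. (f \<omega>)\<^sup>2) \<le> integral\<^sup>L lborel (grid_err G h N)"
    unfolding f2 by (rule order_trans[OF grid_sum_approximates_ito(2)[OF lcG h t ito Hm S eq] grid_err_integral_mono[OF lcG h N0 j]])
  have fm: "f \<in> borel_measurable M" unfolding f_def by measurable
  note fe = expectation_le_sqrt[OF fm f2i f2e]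
  have ddi: "integrable M (drift_dev a h N)" by (rule drift_dev(1)[OF lca T h N])
  have dd0: "0 \<le> drift_dev a h N \<omega>" for \<omega> unfolding drift_dev_def by (intro Bochner_Integration.integral_nonneg) simp
  have f0: "0 \<le> f \<omega>" for \<omega> by (simp add: f_def)
  have le: "AE \<omega> in M. indicator S \<omega> * \<bar>euler d0 a G h j \<omega> - D \<omega>\<bar> \<le> drift_dev a h N \<omega> + f \<omega>"
    using D AE_space
  proof eventually_elim
    case (elim \<omega>)
    have b: "\<bar>h * (\<Sum>i<j. a (real i * h) \<omega>) - (\<integral>r. indicator {0..<t} r * a r \<omega> \<partial>lborel)\<bar> \<le> drift_dev a h N \<omega>"
      unfolding t by (rule drift_dev_bound[OF lca h N T j elim(2)])
    show ?case
    proof (cases "\<omega> \<in> S")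
      case True
      then have "euler d0 a G h j \<omega> - D \<omega> = (h * (\<Sum>i<j. a (real i * h) \<omega>) - (\<integral>r. indicator {0..<t} r * a r \<omega> \<partial>lborel)) + (?S \<omega> - I \<omega>)"
        using elim(1) by (simp add: euler_def)
      then show ?thesis using b True by (simp add: f_def)
    next
      case False
      then show ?thesis using dd0[of \<omega>] f0[of \<omega>] by simp
    qed
  qed
  show i: "integrable M (\<lambda>\<omega>. indicator S \<omega> * \<bar>euler d0 a G h j \<omega> - D \<omega>\<bar>)"
  proof (rule Bochner_Integration.integrable_bound[OF Bochner_Integration.integrable_add[OF ddi fe(1)]])
    show "AE \<omega> in M. norm (indicator S \<omega> * \<bar>euler d0 a G h j \<omega> - D \<omega>\<bar>) \<le> norm (drift_dev a h N \<omega> + f \<omega>)"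
      using le by eventually_elim (use dd0 f0 in \<open>auto simp: abs_mult\<close>)
  qed simp
  have "expectation (\<lambda>\<omega>. indicator S \<omega> * \<bar>euler d0 a G h j \<omega> - D \<omega>\<bar>) \<le> expectation (\<lambda>\<omega>. drift_dev a h N \<omega> + f \<omega>)"
    by (rule integral_mono_AE[OF i _ le]) (use ddi fe in simp)
  also have "\<dots> = expectation (drift_dev a h N) + expectation f" using ddi fe by simp
  finally show "expectation (\<lambda>\<omega>. indicator S \<omega> * \<bar>euler d0 a G h j \<omega> - D \<omega>\<bar>) \<le>
       expectation (drift_dev a h N) + sqrt (integral\<^sup>L lborel (grid_err G h N))" using fe by linarith
qed

text \<open>Ito's formula in expectation, stopped and combined with Gronwall's lemma: it is obtained on a
  grid, from Taylor's formula and the independence of the increments, before the mesh tends to zero.\<close>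

lemma stopped_test_function_bound:
  assumes tf: "test_function \<phi> \<phi>1 \<phi>2 C2 C3" and T: "0 < T"
    and lca: "lc_process A a" and lcG: "lc_process A G"
    and S: "\<And>t. 0 \<le> t \<Longrightarrow> S t \<in> sets M"
    and off: "\<And>t \<omega>. 0 \<le> t \<Longrightarrow> \<omega> \<in> space M \<Longrightarrow> \<omega> \<notin> S t \<Longrightarrow> a t \<omega> = 0 \<and> G t \<omega> = 0"
    and Dm: "\<And>t. 0 \<le> t \<Longrightarrow> D t \<in> borel_measurable M"
    and DK: "\<And>t \<omega>. 0 \<le> t \<Longrightarrow> \<omega> \<in> S t \<Longrightarrow> \<bar>D t \<omega>\<bar> \<le> K"
    and sol: "\<And>t. 0 \<le> t \<Longrightarrow> \<exists>H I. ito_integral_is M B H t I \<and> (\<forall>r\<ge>0. H r \<in> borel_measurable M) \<and>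
        (\<forall>\<omega>\<in>S t. \<forall>r. 0 \<le> r \<and> r \<le> t \<longrightarrow> G r \<omega> = H r \<omega>) \<and>
        (AE \<omega> in M. \<omega> \<in> S t \<longrightarrow> D t \<omega> = d0 + (\<integral>r. indicator {0..<t} r * a r \<omega> \<partial>lborel) + I \<omega>)"
    and gen: "\<And>t \<omega>. 0 \<le> t \<Longrightarrow> \<omega> \<in> S t \<Longrightarrow> \<phi>1 (D t \<omega>) * a t \<omega> + \<phi>2 (D t \<omega>) / 2 * (G t \<omega>)\<^sup>2 \<le> l * \<phi> (D t \<omega>) + \<eta>"
    and l: "0 \<le> l" and \<eta>: "0 \<le> \<eta>"
  shows "expectation (\<lambda>\<omega>. indicator (S T) \<omega> * \<phi> (D T \<omega>)) \<le> (\<phi> d0 + T * \<eta>) * exp (l * T)"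
proof -
  interpret test_function \<phi> \<phi>1 \<phi>2 C2 C3 by (rule tf)
  have A0: "0 \<le> A" by (rule lc_bound_nonneg[OF lca])
  define \<rho> where "\<rho> h = C2 / 2 * A\<^sup>2 * h + 2 * C3 * A ^ 3 * (h\<^sup>2 + 2 * sqrt h)" for h
  define e where "e m = expectation (drift_dev a (T / 2^m) (2^m)) + sqrt (integral\<^sup>L lborel (grid_err G (T / 2^m) (2^m)))" for m :: nat
  define c1 where "c1 = C2 * A + C3 * A\<^sup>2 / 2"
  define c where "c m = \<phi> d0 + C2 * \<bar>K\<bar> * e m + T * (\<eta> + c1 * e m + \<rho> (T / 2^m))" for m :: nat
  define q where "q t = expectation (\<lambda>\<omega>. indicator (S t) \<omega> * \<phi> (D t \<omega>))" for t
  have c10: "0 \<le> c1" using C2_nonneg C3_nonneg A0 by (simp add: c1_def)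
  have main: "q T \<le> c m * exp (l * T)" for m
  proof -
    define h where "h = T / 2^m"
    define N :: nat where "N = 2^m"
    have h: "0 < h" and N: "real N * h = T" using T by (auto simp: h_def N_def)
    let ?E = "euler d0 a G h"
    have st: "?E j \<in> borel_measurable (F (real j * h)) \<and> integrable M (\<lambda>\<omega>. (?E j \<omega>)\<^sup>2)" for j
    proof (induction j)
      case 0 show ?case by (simp add: euler_0)
    next
      case (Suc j)
      have tj: "0 \<le> real j * h" using h by simp
      have "a (real j * h) \<in> borel_measurable (F (real j * h))" "\<And>\<omega>. \<omega> \<in> space M \<Longrightarrow> \<bar>a (real j * h) \<omega>\<bar> \<le> A"
        "G (real j * h) \<in> borel_measurable (F (real j * h))" "\<And>\<omega>. \<omega> \<in> space M \<Longrightarrow> \<bar>G (real j * h) \<omega>\<bar> \<le> A"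
        using lca lcG tj by (auto simp: lc_process_def)
      from euler_step(1,2)[OF tf tj h Suc[THEN conjunct1] Suc[THEN conjunct2] this]
      show ?case unfolding euler_Suc by (simp add: algebra_simps)
    qed
    define p where "p j = expectation (\<lambda>\<omega>. \<phi> (?E j \<omega>))" for j
    have e0: "0 \<le> e m" unfolding e_def
      by (intro add_nonneg_nonneg Bochner_Integration.integral_nonneg real_sqrt_ge_zero) (auto simp: drift_dev_def grid_err_def)
    have phiD: "\<phi> (D t \<omega>) \<le> C2 * K\<^sup>2" if "0 \<le> t" "\<omega> \<in> S t" for t \<omega>
    proof -
      have "(D t \<omega>)\<^sup>2 \<le> K\<^sup>2" using DK[OF that] by (simp add: abs_le_square_iff[symmetric])
      then show ?thesis using \<phi>_bound[of "D t \<omega>"] C2_nonneg by (meson mult_left_mono order_trans)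
    qed
    have qi: "integrable M (\<lambda>\<omega>. indicator (S t) \<omega> * \<phi> (D t \<omega>))" if t: "0 \<le> t" for t
    proof (rule integrable_bounded[where C = "C2 * K\<^sup>2"])
      have [measurable]: "D t \<in> borel_measurable M" "S t \<in> sets M" using S Dm t by auto
      show "(\<lambda>\<omega>. indicator (S t) \<omega> * \<phi> (D t \<omega>)) \<in> borel_measurable M" by measurable
      show "\<bar>indicator (S t) \<omega> * \<phi> (D t \<omega>)\<bar> \<le> C2 * K\<^sup>2" for \<omega>
        using phiD[OF t] \<phi>_nonneg C2_nonneg by (auto simp: indicator_def)
    qed
    have q0: "0 \<le> q t" for t unfolding q_def by (intro Bochner_Integration.integral_nonneg) (simp add: \<phi>_nonneg)
    have per: "q (real j * h) \<le> p j + C2 * \<bar>K\<bar> * e m \<and>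
       p (Suc j) \<le> p j + h * (l * q (real j * h) + \<eta> + c1 * e m + \<rho> h)" if j: "j \<le> N" for j
    proof -
      define t where "t = real j * h"
      have t0: "0 \<le> t" using h by (simp add: t_def)
      have [measurable]: "D t \<in> borel_measurable M" "S t \<in> sets M" using S Dm t0 by auto
      have Em: "?E j \<in> borel_measurable M" using st[of j] by (auto intro: meas_F_M)
      note Em [measurable]
      obtain H I where HI: "ito_integral_is M B H t I" "\<And>r. 0 \<le> r \<Longrightarrow> H r \<in> borel_measurable M"
        "\<And>\<omega> r. \<omega> \<in> S t \<Longrightarrow> 0 \<le> r \<Longrightarrow> r \<le> t \<Longrightarrow> G r \<omega> = H r \<omega>"
        "AE \<omega> in M. \<omega> \<in> S t \<longrightarrow> D t \<omega> = d0 + (\<integral>r. indicator {0..<t} r * a r \<omega> \<partial>lborel) + I \<omega>"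
        using sol[OF t0] by blast
      let ?x = "\<lambda>\<omega>. indicator (S t) \<omega> * \<bar>?E j \<omega> - D t \<omega>\<bar>"
      have xi: "integrable M ?x" and xe: "expectation ?x \<le> e m"
        using euler_error[OF T lca lcG h N j t_def S[OF t0] Dm[OF t0] HI Em] unfolding e_def h_def N_def by auto
      have at: "a t \<in> borel_measurable (F t)" "\<And>\<omega>. \<omega> \<in> space M \<Longrightarrow> \<bar>a t \<omega>\<bar> \<le> A"
        "G t \<in> borel_measurable (F t)" "\<And>\<omega>. \<omega> \<in> space M \<Longrightarrow> \<bar>G t \<omega>\<bar> \<le> A"
        using lca lcG t0 by (auto simp: lc_process_def)
      note es = euler_step[OF tf t0 h st[of j, folded t_def, THEN conjunct1] st[of j, THEN conjunct2] at]
      have "q t \<le> expectation (\<lambda>\<omega>. \<phi> (?E j \<omega>) + C2 * \<bar>K\<bar> * ?x \<omega>)"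
        unfolding q_def
      proof (rule integral_mono[OF qi[OF t0]])
        show "integrable M (\<lambda>\<omega>. \<phi> (?E j \<omega>) + C2 * \<bar>K\<bar> * ?x \<omega>)" using es(3) xi by simp
        fix \<omega> assume "\<omega> \<in> space M"
        show "indicator (S t) \<omega> * \<phi> (D t \<omega>) \<le> \<phi> (?E j \<omega>) + C2 * \<bar>K\<bar> * ?x \<omega>"
        proof (cases "\<omega> \<in> S t")
          case True
          have "\<phi> (D t \<omega>) - \<phi> (?E j \<omega>) \<le> \<phi>1 (D t \<omega>) * (D t \<omega> - ?E j \<omega>)" by (rule convex_bound)
          also have "\<dots> \<le> \<bar>\<phi>1 (D t \<omega>)\<bar> * \<bar>?E j \<omega> - D t \<omega>\<bar>" by (metis abs_ge_self abs_minus_commute abs_mult)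
          also have "\<dots> \<le> (C2 * \<bar>K\<bar>) * \<bar>?E j \<omega> - D t \<omega>\<bar>"
          proof (rule mult_right_mono)
            have "\<bar>\<phi>1 (D t \<omega>)\<bar> \<le> C2 * \<bar>D t \<omega>\<bar>" by (rule \<phi>1_bound)
            also have "\<dots> \<le> C2 * \<bar>K\<bar>" using DK[OF t0 True] C2_nonneg by (intro mult_left_mono) auto
            finally show "\<bar>\<phi>1 (D t \<omega>)\<bar> \<le> C2 * \<bar>K\<bar>" .
          qed simp
          finally show ?thesis using True by simp
        next
          case False then show ?thesis by (simp add: \<phi>_nonneg)
        qed
      qed
      also have "\<dots> = p j + C2 * \<bar>K\<bar> * expectation ?x" unfolding p_def using es(3) xi by simp
      also have "\<dots> \<le> p j + C2 * \<bar>K\<bar> * e m" using xe C2_nonneg by (intro add_left_mono mult_left_mono) auto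
      finally have r1: "q t \<le> p j + C2 * \<bar>K\<bar> * e m" .
      have "expectation (\<lambda>\<omega>. \<phi>1 (?E j \<omega>) * a t \<omega> + \<phi>2 (?E j \<omega>) / 2 * (G t \<omega>)\<^sup>2)
        \<le> expectation (\<lambda>\<omega>. l * (indicator (S t) \<omega> * \<phi> (D t \<omega>)) + \<eta> + c1 * ?x \<omega>)"
      proof (rule integral_mono[OF es(4)])
        show "integrable M (\<lambda>\<omega>. l * (indicator (S t) \<omega> * \<phi> (D t \<omega>)) + \<eta> + c1 * ?x \<omega>)"
          using qi[OF t0] xi by simp
        fix \<omega> assume w: "\<omega> \<in> space M"
        show "\<phi>1 (?E j \<omega>) * a t \<omega> + \<phi>2 (?E j \<omega>) / 2 * (G t \<omega>)\<^sup>2 \<le> l * (indicator (S t) \<omega> * \<phi> (D t \<omega>)) + \<eta> + c1 * ?x \<omega>"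
        proof (cases "\<omega> \<in> S t")
          case True
          let ?y = "\<bar>?E j \<omega> - D t \<omega>\<bar>"
          have "(\<phi>1 (?E j \<omega>) - \<phi>1 (D t \<omega>)) * a t \<omega> \<le> \<bar>\<phi>1 (?E j \<omega>) - \<phi>1 (D t \<omega>)\<bar> * \<bar>a t \<omega>\<bar>" by (metis abs_ge_self abs_mult)
          also have "\<dots> \<le> (C2 * ?y) * A" using at(2)[OF w] C2_nonneg by (intro mult_mono \<phi>1_lip) auto
          finally have 1: "(\<phi>1 (?E j \<omega>) - \<phi>1 (D t \<omega>)) * a t \<omega> \<le> (C2 * ?y) * A" .
          have "(G t \<omega>)\<^sup>2 \<le> A\<^sup>2" using at(4)[OF w] A0 by (simp add: abs_le_square_iff[symmetric])
          then have "(\<phi>2 (?E j \<omega>) - \<phi>2 (D t \<omega>)) * (G t \<omega>)\<^sup>2 \<le> (C3 * ?y) * A\<^sup>2"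
            using \<phi>2_lip[of "?E j \<omega>" "D t \<omega>"] C3_nonneg by (intro mult_mono) auto
          then have 2: "(\<phi>2 (?E j \<omega>) - \<phi>2 (D t \<omega>)) / 2 * (G t \<omega>)\<^sup>2 \<le> C3 * A\<^sup>2 / 2 * ?y" by (simp add: algebra_simps)
          have "\<phi>1 (D t \<omega>) * a t \<omega> + \<phi>2 (D t \<omega>) / 2 * (G t \<omega>)\<^sup>2 \<le> l * \<phi> (D t \<omega>) + \<eta>" by (rule gen[OF t0 True])
          moreover have "\<phi>1 (?E j \<omega>) * a t \<omega> + \<phi>2 (?E j \<omega>) / 2 * (G t \<omega>)\<^sup>2 = (\<phi>1 (D t \<omega>) * a t \<omega> + \<phi>2 (D t \<omega>) / 2 * (G t \<omega>)\<^sup>2)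
            + (\<phi>1 (?E j \<omega>) - \<phi>1 (D t \<omega>)) * a t \<omega> + (\<phi>2 (?E j \<omega>) - \<phi>2 (D t \<omega>)) / 2 * (G t \<omega>)\<^sup>2"
            by (simp add: left_diff_distrib diff_divide_distrib)
          moreover have "c1 * ?x \<omega> = (C2 * ?y) * A + C3 * A\<^sup>2 / 2 * ?y" using True by (simp add: c1_def algebra_simps)
          moreover have "l * (indicator (S t) \<omega> * \<phi> (D t \<omega>)) = l * \<phi> (D t \<omega>)" using True by simp
          ultimately show ?thesis using 1 2 by linarith
        next
          case False
          then show ?thesis using off[OF t0 w] \<eta> by simp
        qed
      qed
      also have "\<dots> = l * q t + \<eta> + c1 * expectation ?x" unfolding q_def using qi[OF t0] xi by (simp add: prob_space)
      also have "\<dots> \<le> l * q t + \<eta> + c1 * e m" using xe c10 by (intro add_left_mono mult_left_mono) auto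
      finally have "h * expectation (\<lambda>\<omega>. \<phi>1 (?E j \<omega>) * a t \<omega> + \<phi>2 (?E j \<omega>) / 2 * (G t \<omega>)\<^sup>2) \<le> h * (l * q t + \<eta> + c1 * e m)"
        using h by (intro mult_left_mono) auto
      moreover have "p (Suc j) \<le> p j + h * expectation (\<lambda>\<omega>. \<phi>1 (?E j \<omega>) * a t \<omega> + \<phi>2 (?E j \<omega>) / 2 * (G t \<omega>)\<^sup>2) + h * \<rho> h"
        unfolding p_def euler_Suc t_def[symmetric] \<rho>_def by (rule es(5))
      ultimately have "p (Suc j) \<le> p j + h * (l * q t + \<eta> + c1 * e m + \<rho> h)" by (simp add: distrib_left)
      with r1 show ?thesis by (simp add: t_def)
    qed
    have \<rho>0: "0 \<le> \<rho> h" unfolding \<rho>_def using C2_nonneg C3_nonneg A0 h by simp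
    have psum: "p j \<le> \<phi> d0 + (\<Sum>i<j. h * (l * q (real i * h) + \<eta> + c1 * e m + \<rho> h))" if "j \<le> N" for j
      using that
    proof (induction j)
      case 0 show ?case by (simp add: p_def euler_0 prob_space)
    next
      case (Suc j)
      then show ?case using per[of j] by simp
    qed
    have "q (real j * h) \<le> c m + (h * l) * (\<Sum>i<j. q (real i * h))" if j: "j \<le> N" for j
    proof -
      have "(\<Sum>i<j. h * (l * q (real i * h) + \<eta> + c1 * e m + \<rho> h)) = (h * l) * (\<Sum>i<j. q (real i * h)) + (real j * h) * (\<eta> + c1 * e m + \<rho> h)"
        by (simp add: sum_distrib_left sum.distrib algebra_simps)
      also have "\<dots> \<le> (h * l) * (\<Sum>i<j. q (real i * h)) + T * (\<eta> + c1 * e m + \<rho> h)"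
        using j h \<eta> c10 e0 \<rho>0 by (intro add_left_mono mult_right_mono) (auto simp: N[symmetric])
      finally show ?thesis using per[OF j] psum[OF j] unfolding c_def h_def[symmetric] by linarith
    qed
    from discrete_gronwall[of N "\<lambda>j. q (real j * h)", OF this _ order_refl] h l
    have "q T \<le> c m * (1 + h * l) ^ N" by (simp add: N)
    also have "\<dots> \<le> c m * exp (h * l) ^ N"
    proof (intro mult_left_mono power_mono)
      show "0 \<le> c m" unfolding c_def using \<phi>_nonneg C2_nonneg e0 T \<eta> c10 \<rho>0 by (simp add: h_def)
    qed (use h l exp_ge_add_one_self in auto)
    also have "exp (h * l) ^ N = exp (l * T)" by (simp add: exp_of_nat_mult[symmetric] N[symmetric] mult_ac)
    finally show ?thesis .
  qed
  have "e \<longlonglongrightarrow> 0 + sqrt 0"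
    unfolding e_def by (intro tendsto_add tendsto_real_sqrt drift_dev(2)[OF lca T] grid_err_tendsto[OF lcG T])
  then have e: "e \<longlonglongrightarrow> 0" by simp
  have "(\<lambda>m. \<rho> (T / 2^m)) \<longlonglongrightarrow> C2 / 2 * A\<^sup>2 * 0 + 2 * C3 * A ^ 3 * (0\<^sup>2 + 2 * sqrt 0)"
    unfolding \<rho>_def by (intro tendsto_intros dyadic_step T)
  then have \<rho>l: "(\<lambda>m. \<rho> (T / 2^m)) \<longlonglongrightarrow> 0" by simp
  have "(\<lambda>m. c m * exp (l * T)) \<longlonglongrightarrow> (\<phi> d0 + C2 * \<bar>K\<bar> * 0 + T * (\<eta> + c1 * 0 + 0)) * exp (l * T)"
    unfolding c_def by (intro tendsto_intros e \<rho>l)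
  from LIMSEQ_le_const[OF this] main have "q T \<le> (\<phi> d0 + T * \<eta>) * exp (l * T)" by auto
  then show ?thesis by (simp add: q_def)
qed

end

text \<open>A smoothed absolute value: as \<open>\<delta> \<rightarrow> 0\<close> it tends to \<open>|x|\<close>, while \<open>|x| yw2 \<delta> x \<le> 1 / ln (1 + 1/\<delta>) \<rightarrow> 0\<close>,
  which kills the second-order term of a square-root diffusion.\<close>

definition yw :: "real \<Rightarrow> real \<Rightarrow> real" where
  "yw \<delta> x = ((\<bar>x\<bar> + \<delta>) * ln (1 + \<bar>x\<bar> / \<delta>) - \<bar>x\<bar>) / ln (1 + 1 / \<delta>)"
definition yw1 :: "real \<Rightarrow> real \<Rightarrow> real" where
  "yw1 \<delta> x = sgn x * ln (1 + \<bar>x\<bar> / \<delta>) / ln (1 + 1 / \<delta>)"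
definition yw2 :: "real \<Rightarrow> real \<Rightarrow> real" where
  "yw2 \<delta> x = 1 / ((\<bar>x\<bar> + \<delta>) * ln (1 + 1 / \<delta>))"

lemma DERIV_glue_zero:
  fixes f f' :: "real \<Rightarrow> real"
  assumes "\<And>x. 0 \<le> x \<Longrightarrow> (f has_real_derivative f' x) (at x within {0..})"
    and "\<And>x. x \<le> 0 \<Longrightarrow> (f has_real_derivative f' x) (at x within {..0})"
  shows "(f has_real_derivative f' x) (at x)"
proof (cases x "0::real" rule: linorder_cases)
  case less
  then have "at x within {..0} = at x" by (intro at_within_interior) simp
  then show ?thesis using assms(2)[of x] less by simp
next
  case equal
  have "at 0 = at (0::real) within ({0..} \<union> {..0})" by (rule arg_cong2[where f = at_within]) auto
  then show ?thesis using assms[of 0] equal by (simp add: has_field_derivative_iff Lim_Un)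
next
  case greater
  then have "at x within {0..} = at x" by (intro at_within_interior) simp
  then show ?thesis using assms(1)[of x] greater by simp
qed

lemma yw_test_function:
  assumes \<delta>: "0 < \<delta>"
  defines "L \<equiv> ln (1 + 1 / \<delta>)"
  shows "test_function (yw \<delta>) (yw1 \<delta>) (yw2 \<delta>) (1 / (\<delta> * L)) (1 / (\<delta>\<^sup>2 * L))"
proof
  have L: "0 < L" unfolding L_def by (rule ln_gt_zero) (use \<delta> in simp)
  show "(yw \<delta> has_real_derivative yw1 \<delta> x) (at x)" for x
  proof (rule DERIV_glue_zero)
    fix x :: real assume x: "0 \<le> x"
    have "((\<lambda>x. ((x + \<delta>) * ln (1 + x / \<delta>) - x) / L) has_real_derivative ln (1 + x / \<delta>) / L) (at x within {0..})"
    proof -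
      have "1 + x / \<delta> > 0" using x \<delta> by (simp add: add_pos_nonneg)
      then have g: "((\<lambda>x. ln (1 + x / \<delta>)) has_real_derivative 1 / (x + \<delta>)) (at x within {0..})"
        using \<delta> x by (auto intro!: derivative_eq_intros simp: field_simps)
      have i: "((\<lambda>x. x + \<delta>) has_real_derivative 1) (at x within {0..})" by (auto intro!: derivative_eq_intros)
      have "((\<lambda>x. ((x + \<delta>) * ln (1 + x / \<delta>) - x) / L) has_real_derivative ((1 * ln (1 + x / \<delta>) + 1 / (x + \<delta>) * (x + \<delta>)) - 1) / L) (at x within {0..})"
        by (intro DERIV_cdivide DERIV_diff DERIV_mult g i DERIV_ident)
      then show ?thesis using x \<delta> by simp
    qed
    then have "(yw \<delta> has_real_derivative ln (1 + x / \<delta>) / L) (at x within {0..})"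
      by (rule has_field_derivative_transform_within[where d = 1]) (use x in \<open>auto simp: yw_def L_def\<close>)
    moreover have "ln (1 + x / \<delta>) / L = yw1 \<delta> x" using x by (cases "x = 0") (auto simp: yw1_def L_def)
    ultimately show "(yw \<delta> has_real_derivative yw1 \<delta> x) (at x within {0..})" by simp
  next
    fix x :: real assume x: "x \<le> 0"
    have "((\<lambda>x. ((- x + \<delta>) * ln (1 - x / \<delta>) + x) / L) has_real_derivative - ln (1 - x / \<delta>) / L) (at x within {..0})"
    proof -
      have "1 - x / \<delta> > 0" using x \<delta> by (simp add: divide_nonpos_pos add_pos_nonneg order.strict_trans2)
      then have g: "((\<lambda>x. ln (1 - x / \<delta>)) has_real_derivative - 1 / (- x + \<delta>)) (at x within {..0})"
        using \<delta> x by (auto intro!: derivative_eq_intros simp: field_simps)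
      have i: "((\<lambda>x. - x + \<delta>) has_real_derivative - 1) (at x within {..0})" by (auto intro!: derivative_eq_intros)
      have "((\<lambda>x. ((- x + \<delta>) * ln (1 - x / \<delta>) + x) / L) has_real_derivative ((- 1 * ln (1 - x / \<delta>) + - 1 / (- x + \<delta>) * (- x + \<delta>)) + 1) / L) (at x within {..0})"
        by (intro DERIV_cdivide DERIV_add DERIV_mult g i DERIV_ident)
      then show ?thesis using x \<delta> by simp
    qed
    then have "(yw \<delta> has_real_derivative - ln (1 - x / \<delta>) / L) (at x within {..0})"
      by (rule has_field_derivative_transform_within[where d = 1]) (use x in \<open>auto simp: yw_def L_def\<close>)
    moreover have "- ln (1 - x / \<delta>) / L = yw1 \<delta> x" using x by (cases "x = 0") (auto simp: yw1_def L_def)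
    ultimately show "(yw \<delta> has_real_derivative yw1 \<delta> x) (at x within {..0})" by simp
  qed
  show "(yw1 \<delta> has_real_derivative yw2 \<delta> x) (at x)" for x
  proof (rule DERIV_glue_zero)
    fix x :: real assume x: "0 \<le> x"
    have "((\<lambda>x. ln (1 + x / \<delta>) / L) has_real_derivative 1 / ((x + \<delta>) * L)) (at x within {0..})"
    proof -
      have "1 + x / \<delta> > 0" using x \<delta> by (simp add: add_pos_nonneg)
      then have g: "((\<lambda>x. ln (1 + x / \<delta>)) has_real_derivative 1 / (x + \<delta>)) (at x within {0..})"
        using \<delta> x by (auto intro!: derivative_eq_intros simp: field_simps)
      from DERIV_cdivide[OF g, of L] show ?thesis by simp
    qed
    then have "(yw1 \<delta> has_real_derivative 1 / ((x + \<delta>) * L)) (at x within {0..})"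
      by (rule has_field_derivative_transform_within[where d = 1]) (use x in \<open>auto simp: yw1_def L_def sgn_if\<close>)
    then show "(yw1 \<delta> has_real_derivative yw2 \<delta> x) (at x within {0..})" using x by (simp add: yw2_def L_def)
  next
    fix x :: real assume x: "x \<le> 0"
    have "((\<lambda>x. - ln (1 - x / \<delta>) / L) has_real_derivative 1 / ((- x + \<delta>) * L)) (at x within {..0})"
    proof -
      have "1 - x / \<delta> > 0" using x \<delta> by (simp add: divide_nonpos_pos add_pos_nonneg order.strict_trans2)
      then have g: "((\<lambda>x. - ln (1 - x / \<delta>)) has_real_derivative 1 / (- x + \<delta>)) (at x within {..0})"
        using \<delta> x by (auto intro!: derivative_eq_intros simp: field_simps)
      from DERIV_cdivide[OF g, of L] show ?thesis by simp
    qed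
    then have "(yw1 \<delta> has_real_derivative 1 / ((- x + \<delta>) * L)) (at x within {..0})"
      by (rule has_field_derivative_transform_within[where d = 1]) (use x in \<open>auto simp: yw1_def L_def sgn_if\<close>)
    then show "(yw1 \<delta> has_real_derivative yw2 \<delta> x) (at x within {..0})" using x by (simp add: yw2_def L_def)
  qed
  show "0 \<le> yw2 \<delta> x" for x using \<delta> L by (simp add: yw2_def L_def[symmetric])
  show "yw2 \<delta> x \<le> 1 / (\<delta> * L)" for x using \<delta> L
    unfolding yw2_def L_def[symmetric] by (intro divide_left_mono mult_right_mono) auto
  show "\<bar>yw2 \<delta> x - yw2 \<delta> y\<bar> \<le> 1 / (\<delta>\<^sup>2 * L) * \<bar>x - y\<bar>" for x y
  proof -
    have d: "0 < \<bar>x\<bar> + \<delta>" "0 < \<bar>y\<bar> + \<delta>" using \<delta> by auto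
    have "\<bar>yw2 \<delta> x - yw2 \<delta> y\<bar> = \<bar>(\<bar>y\<bar> - \<bar>x\<bar>) / ((\<bar>x\<bar> + \<delta>) * (\<bar>y\<bar> + \<delta>) * L)\<bar>"
      using d L unfolding yw2_def L_def[symmetric] by (simp add: divide_simps)
    also have "\<dots> = \<bar>\<bar>y\<bar> - \<bar>x\<bar>\<bar> / ((\<bar>x\<bar> + \<delta>) * (\<bar>y\<bar> + \<delta>) * L)"
      using d L by (simp add: abs_mult)
    also have "\<dots> \<le> \<bar>x - y\<bar> / (\<delta> * \<delta> * L)"
      using d L \<delta> by (intro frac_le mult_right_mono mult_mono) auto
    finally show ?thesis by (simp add: power2_eq_square)
  qed
  show "0 \<le> yw \<delta> x" for x
  proof -
    have "1 - 1 / u \<le> ln u" if "1 \<le> u" for u :: real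
      using ln_le_minus_one[of "1 / u"] that by (simp add: ln_div)
    from this[of "1 + \<bar>x\<bar> / \<delta>"] \<delta> have "1 - 1 / (1 + \<bar>x\<bar> / \<delta>) \<le> ln (1 + \<bar>x\<bar> / \<delta>)" by simp
    then have "(\<bar>x\<bar> + \<delta>) * (1 - 1 / (1 + \<bar>x\<bar> / \<delta>)) \<le> (\<bar>x\<bar> + \<delta>) * ln (1 + \<bar>x\<bar> / \<delta>)" using \<delta> by (intro mult_left_mono) auto
    moreover have "(\<bar>x\<bar> + \<delta>) * (1 - 1 / (1 + \<bar>x\<bar> / \<delta>)) = \<bar>x\<bar>"
    proof -
      have "1 - 1 / (1 + \<bar>x\<bar> / \<delta>) = \<bar>x\<bar> / (\<bar>x\<bar> + \<delta>)" using \<delta> by (simp add: field_simps)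
      then show ?thesis using \<delta> by simp
    qed
    ultimately show ?thesis using L by (simp add: yw_def L_def[symmetric])
  qed
qed (auto simp: yw_def yw1_def)

lemma yw_log_pos: "0 < \<delta> \<Longrightarrow> 0 < ln (1 + 1 / \<delta>)" for \<delta> :: real
  by (rule ln_gt_zero) simp

lemma yw1_mult_le:
  assumes "0 < \<delta>"
  shows "x * yw1 \<delta> x \<le> yw \<delta> x + \<bar>x\<bar> / ln (1 + 1 / \<delta>)"
proof -
  have "0 \<le> \<delta> * ln (1 + \<bar>x\<bar> / \<delta>)" using assms by simp
  moreover have "x * sgn x = \<bar>x\<bar>" by (simp add: abs_sgn mult.commute)
  then have "x * yw1 \<delta> x = \<bar>x\<bar> * ln (1 + \<bar>x\<bar> / \<delta>) / ln (1 + 1 / \<delta>)" unfolding yw1_def by (metis mult.assoc times_divide_eq_right)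
  ultimately show ?thesis using yw_log_pos[OF assms] unfolding yw_def
    by (simp add: add_divide_distrib[symmetric] divide_right_mono algebra_simps)
qed

lemma yw1_nonneg: "0 < \<delta> \<Longrightarrow> 0 \<le> x \<Longrightarrow> 0 \<le> yw1 \<delta> x"
  using yw_log_pos[of \<delta>] by (simp add: yw1_def sgn_if)

lemma yw2_mult_le:
  assumes "0 < \<delta>" "0 \<le> c" "0 \<le> \<eta>"
  shows "yw2 \<delta> x * (c * \<bar>x\<bar> + \<eta>) \<le> (c + \<eta> / \<delta>) / ln (1 + 1 / \<delta>)"
proof -
  have "c * \<bar>x\<bar> + \<eta> \<le> (c + \<eta> / \<delta>) * (\<bar>x\<bar> + \<delta>)"
    using assms by (simp add: field_simps)
  then have "(c * \<bar>x\<bar> + \<eta>) / (\<bar>x\<bar> + \<delta>) \<le> c + \<eta> / \<delta>" using assms by (subst pos_divide_le_eq) auto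
  then have "(c * \<bar>x\<bar> + \<eta>) / (\<bar>x\<bar> + \<delta>) / ln (1 + 1 / \<delta>) \<le> (c + \<eta> / \<delta>) / ln (1 + 1 / \<delta>)"
    using yw_log_pos[OF assms(1)] by (intro divide_right_mono) auto
  then show ?thesis by (simp add: yw2_def)
qed

lemma yw_lower:
  assumes "0 < \<delta>" "\<theta> \<le> \<bar>x\<bar>" "0 < \<theta>"
  shows "\<bar>x\<bar> * ((ln (1 + \<theta> / \<delta>) - 1) / ln (1 + 1 / \<delta>)) \<le> yw \<delta> x"
proof -
  have pos: "0 < 1 + \<theta> / \<delta>" using assms by (simp add: add_pos_pos)
  have "ln (1 + \<theta> / \<delta>) \<le> ln (1 + \<bar>x\<bar> / \<delta>)" using assms pos by (intro ln_mono) (auto simp: divide_right_mono)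
  then have "\<bar>x\<bar> * ln (1 + \<theta> / \<delta>) \<le> \<bar>x\<bar> * ln (1 + \<bar>x\<bar> / \<delta>)" by (intro mult_left_mono) auto
  moreover have "0 \<le> \<delta> * ln (1 + \<bar>x\<bar> / \<delta>)" using assms by simp
  ultimately have "\<bar>x\<bar> * (ln (1 + \<theta> / \<delta>) - 1) \<le> (\<bar>x\<bar> + \<delta>) * ln (1 + \<bar>x\<bar> / \<delta>) - \<bar>x\<bar>" by (simp add: algebra_simps)
  then have "\<bar>x\<bar> * (ln (1 + \<theta> / \<delta>) - 1) / ln (1 + 1 / \<delta>) \<le> yw \<delta> x" unfolding yw_def
    using yw_log_pos[OF assms(1)] by (intro divide_right_mono) auto
  then show ?thesis by simp
qed

lemma yw_zero: "yw \<delta> 0 = 0" by (simp add: yw_def)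

lemma yw_limits:
  fixes x \<theta> :: real
  assumes "0 < x" "0 < \<theta>"
  shows "((\<lambda>\<delta>. yw \<delta> x) \<longlongrightarrow> x) (at_right 0)"
    "((\<lambda>\<delta>. (ln (1 + \<theta> / \<delta>) - 1) / ln (1 + 1 / \<delta>)) \<longlongrightarrow> 1) (at_right 0)"
    "((\<lambda>\<delta>. 1 / ln (1 + 1 / \<delta>)) \<longlongrightarrow> 0) (at_right (0::real))"
proof -
  have "((\<lambda>\<delta>. ((x + \<delta>) * ln (1 + x / \<delta>) - x) / ln (1 + 1 / \<delta>)) \<longlongrightarrow> x) (at_right 0)"
    using assms by real_asymp
  then show "((\<lambda>\<delta>. yw \<delta> x) \<longlongrightarrow> x) (at_right 0)" using assms by (simp add: yw_def)
  show "((\<lambda>\<delta>. (ln (1 + \<theta> / \<delta>) - 1) / ln (1 + 1 / \<delta>)) \<longlongrightarrow> 1) (at_right 0)" using assms by real_asymp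
  show "((\<lambda>\<delta>. 1 / ln (1 + 1 / \<delta>)) \<longlongrightarrow> 0) (at_right (0::real))" by real_asymp
qed

section \<open>Stopping and the maximal inequality\<close>

lemma dyadic_dense:
  fixes g :: "real \<Rightarrow> real"
  assumes g: "continuous_on {0..T} g" and le: "\<And>k j. j \<le> (2::nat)^k \<Longrightarrow> g (real j * (T / 2^k)) \<le> K"
    and x: "0 \<le> x" "x \<le> T"
  shows "g x \<le> K"
proof (cases "T = 0")
  case True
  then show ?thesis using le[of 0 0] x by simp
next
  case False
  then have T: "0 < T" using x by simp
  define h where "h k = T / 2^k" for k :: nat
  have h: "0 < h k" for k using T by (simp add: h_def)
  define y where "y k = real (nat \<lfloor>x / h k\<rfloor>) * h k" for k
  have y: "y k \<le> x" "x - h k \<le> y k" for k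
    using grid_floor[OF h, of x k] x unfolding y_def distrib_right by linarith+
  have lim: "y \<longlonglongrightarrow> x"
  proof (rule tendsto_sandwich[of "\<lambda>m. x - h m" _ _ "\<lambda>_. x"])
    show "(\<lambda>m. x - h m) \<longlonglongrightarrow> x" using tendsto_diff[OF tendsto_const LIMSEQ_divide_realpow_zero[of 2 T], of x] by (simp add: h_def)
  qed (use y in auto)
  have "(\<lambda>k. g (y k)) \<longlonglongrightarrow> g x"
  proof (rule continuous_on_tendsto_compose[OF g lim])
    have "0 \<le> y n" "y n \<le> T" for n using y(1)[of n] x less_imp_le[OF h[of n]] by (auto simp: y_def)
    then show "\<forall>\<^sub>F n in sequentially. y n \<in> {0..T}" by simp
  qed (use x in simp)
  moreover have "g (y k) \<le> K" for k
  proof -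
    have "real (nat \<lfloor>x / h k\<rfloor>) * h k \<le> 2^k * h k" using y(1)[of k] x by (simp add: y_def h_def)
    then have "real (nat \<lfloor>x / h k\<rfloor>) \<le> 2^k" using h[of k] by simp
    then have "nat \<lfloor>x / h k\<rfloor> \<le> 2^k" by (metis of_nat_le_iff of_nat_numeral of_nat_power)
    then show ?thesis using le by (simp add: y_def h_def)
  qed
  ultimately show ?thesis by (intro LIMSEQ_le_const2) auto
qed

lemma lebesgue_eq_integral_continuous:
  fixes u :: "real \<Rightarrow> real"
  assumes "continuous_on {0..t} u" "0 \<le> t"
  shows "(\<integral>r. indicator {0..<t} r * u r \<partial>lborel) = integral {0..t} u"
proof -
  have s: "set_integrable lborel {0..t} u" by (rule borel_integrable_atLeastAtMost'[OF assms(1)])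
  have "(\<integral>r. indicator {0..<t} r * u r \<partial>lborel) = (\<integral>r. indicator {0..t} r *\<^sub>R u r \<partial>lborel)"
  proof (rule integral_cong_AE)
    have m: "(\<lambda>r. indicator {0..t} r *\<^sub>R u r) \<in> borel_measurable lborel" using s by (auto simp: set_integrable_def)
    then show "(\<lambda>r. indicator {0..t} r *\<^sub>R u r) \<in> borel_measurable lborel" .
    have "(\<lambda>r. indicator {0..<t} r * (indicator {0..t} r *\<^sub>R u r)) \<in> borel_measurable lborel" using m by measurable
    moreover have "indicator {0..<t} r * (indicator {0..t} r *\<^sub>R u r) = indicator {0..<t} r * u r" for r by (auto simp: indicator_def)
    ultimately show "(\<lambda>r. indicator {0..<t} r * u r) \<in> borel_measurable lborel" by (simp only:)
    show "AE r in lborel. indicator {0..<t} r * u r = indicator {0..t} r *\<^sub>R u r"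
      using AE_lborel_singleton[of t] by eventually_elim (auto simp: indicator_def)
  qed
  then show ?thesis using set_borel_integral_eq_integral(2)[OF s] by (simp add: set_lebesgue_integral_def)
qed

context brownian begin

definition below :: "(real \<Rightarrow> 'a \<Rightarrow> real) \<Rightarrow> real \<Rightarrow> real \<Rightarrow> 'a set" where
  "below R K t = {\<omega>\<in>space M. \<forall>r\<in>{0..t}. R r \<omega> \<le> K}"

definition continuous_adapted :: "(real \<Rightarrow> 'a \<Rightarrow> real) \<Rightarrow> bool" where
  "continuous_adapted R \<longleftrightarrow> (\<forall>t\<ge>0. R t \<in> borel_measurable (F t)) \<and> (\<forall>\<omega>\<in>space M. continuous_on {0..} (\<lambda>t. R t \<omega>))"

lemma below_F:
  assumes R: "continuous_adapted R" and t: "0 \<le> t"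
  shows "below R K t \<in> sets (F t)"
proof -
  have eq: "below R K t = (\<Inter>k. \<Inter>j\<in>{..(2::nat)^k}. {\<omega>\<in>space (F t). R (real j * (t / 2^k)) \<omega> \<le> K})"
  proof (intro equalityI subsetI)
    fix \<omega> assume w: "\<omega> \<in> below R K t"
    have "R (real j * (t / 2^k)) \<omega> \<le> K" if "j \<le> 2^k" for j k
    proof -
      have "real j \<le> 2^k" using that by (metis of_nat_le_iff of_nat_numeral of_nat_power)
      then have "real j * (t / 2^k) \<le> t" using t by (simp add: divide_le_eq mult.commute mult_left_mono)
      then show ?thesis using w t by (auto simp: below_def)
    qed
    then show "\<omega> \<in> (\<Inter>k. \<Inter>j\<in>{..(2::nat)^k}. {\<omega>\<in>space (F t). R (real j * (t / 2^k)) \<omega> \<le> K})"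
      using w by (auto simp: below_def)
  next
    fix \<omega> assume w: "\<omega> \<in> (\<Inter>k. \<Inter>j\<in>{..(2::nat)^k}. {\<omega>\<in>space (F t). R (real j * (t / 2^k)) \<omega> \<le> K})"
    then have sp: "\<omega> \<in> space M" by auto
    have c: "continuous_on {0..t} (\<lambda>r. R r \<omega>)"
      using R sp by (auto simp: continuous_adapted_def intro: continuous_on_subset)
    have "R r \<omega> \<le> K" if "r \<in> {0..t}" for r
      using dyadic_dense[OF c, of K r] w that by auto
    then show "\<omega> \<in> below R K t" using sp by (auto simp: below_def)
  qed
  have "{\<omega>\<in>space (F t). R (real j * (t / 2^k)) \<omega> \<le> K} \<in> sets (F t)" if "j \<le> 2^k" for j k
  proof -
    have "real j \<le> 2^k" using that by (metis of_nat_le_iff of_nat_numeral of_nat_power)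
    then have le: "real j * (t / 2^k) \<le> t" using t by (simp add: divide_le_eq mult.commute mult_left_mono)
    have "R (real j * (t / 2^k)) \<in> borel_measurable (F t)"
      by (rule meas_F_mono[of _ "real j * (t / 2^k)"]) (use R t le in \<open>auto simp: continuous_adapted_def\<close>)
    then show ?thesis unfolding borel_measurable_iff_le by blast
  qed
  then show ?thesis unfolding eq by (intro sets.countable_INT sets.finite_INT) auto
qed

lemma below_M: "continuous_adapted R \<Longrightarrow> 0 \<le> t \<Longrightarrow> below R K t \<in> sets M"
  using below_F sets_F_sub by blast

lemma below_antimono: "s \<le> t \<Longrightarrow> below R K t \<subseteq> below R K s"
  by (auto simp: below_def)

lemma lc_stopped:
  assumes R: "continuous_adapted R" and H: "continuous_adapted H" and C: "0 \<le> C"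
    and b: "\<And>t \<omega>. 0 \<le> t \<Longrightarrow> \<omega> \<in> below R K t \<Longrightarrow> \<bar>H t \<omega>\<bar> \<le> C"
  shows "lc_process C (\<lambda>t \<omega>. indicator (below R K t) \<omega> * H t \<omega>)"
  unfolding lc_process_def
proof (intro conjI allI impI ballI)
  fix t :: real assume t: "0 \<le> t"
  have [measurable]: "below R K t \<in> sets (F t)" "H t \<in> borel_measurable (F t)"
    using below_F[OF R t] H t by (auto simp: continuous_adapted_def)
  show "(\<lambda>\<omega>. indicator (below R K t) \<omega> * H t \<omega>) \<in> borel_measurable (F t)" by measurable
  fix \<omega> assume w: "\<omega> \<in> space M"
  show "\<bar>indicator (below R K t) \<omega> * H t \<omega>\<bar> \<le> C" using b[OF t] C by (auto simp: indicator_def)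
  show "continuous (at t within {0..t}) (\<lambda>s. indicator (below R K s) \<omega> * H s \<omega>)"
  proof (cases "\<omega> \<in> below R K t")
    case True
    have "continuous_on {0..} (\<lambda>s. H s \<omega>)" using H w by (auto simp: continuous_adapted_def)
    then have "continuous (at t within {0..t}) (\<lambda>s. H s \<omega>)" using t
      by (auto simp: continuous_on_eq_continuous_within intro: continuous_within_subset)
    then show ?thesis
    proof (rule continuous_transform_within[where \<delta> = 1])
      fix s assume "s \<in> {0..t}"
      then have "\<omega> \<in> below R K s" using True below_antimono[of s t R K] by auto
      then show "H s \<omega> = indicator (below R K s) \<omega> * H s \<omega>" by simp
    qed (use t in auto)
  next
    case False
    show ?thesis
    proof (cases "t = 0")
      case True
      then show ?thesis by (auto simp: continuous_within_eps_delta)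
    next
      case f: False
      then have t0: "0 < t" using t by simp
      have c: "continuous_on {0..t} (\<lambda>s. R s \<omega>)" using R w by (auto simp: continuous_adapted_def intro: continuous_on_subset)
      have "\<exists>r. 0 \<le> r \<and> r < t \<and> K < R r \<omega>"
      proof (rule ccontr)
        assume "\<not> ?thesis"
        then have le: "R r \<omega> \<le> K" if "r \<in> {0..<t}" for r using that by force
        have "R r \<omega> \<le> K" if "r \<in> {0..t}" for r
          using continuous_le_on_closure[of "{0..<t}" "\<lambda>s. R s \<omega>" r K] c le t0 that by simp
        then show False using False w by (auto simp: below_def)
      qed
      then obtain r where r: "0 \<le> r" "r < t" "K < R r \<omega>" by blast
      have "\<forall>\<^sub>F s in at t within {0..t}. indicator (below R K s) \<omega> * H s \<omega> = 0"
        unfolding eventually_at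
      proof (intro exI[of _ "t - r"] conjI ballI impI)
        fix s assume "s \<in> {0..t}" "s \<noteq> t \<and> dist s t < t - r"
        then have "r \<in> {0..s}" using r by (auto simp: dist_real_def)
        then have "\<omega> \<notin> below R K s" using r by (force simp: below_def)
        then show "indicator (below R K s) \<omega> * H s \<omega> = 0" by simp
      qed (use r in simp)
      then show ?thesis using False unfolding continuous_within by (simp add: tendsto_eventually)
    qed
  qed
qed

primrec stopped_sum :: "(nat \<Rightarrow> 'a \<Rightarrow> real) \<Rightarrow> real \<Rightarrow> real \<Rightarrow> nat \<Rightarrow> 'a \<Rightarrow> real" where
  "stopped_sum \<xi> h \<delta> 0 = (\<lambda>\<omega>. 0)"
| "stopped_sum \<xi> h \<delta> (Suc j) = (\<lambda>\<omega>. stopped_sum \<xi> h \<delta> j \<omega> +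
     indicator {x. \<bar>x\<bar> \<le> \<delta>} (stopped_sum \<xi> h \<delta> j \<omega>) * \<xi> j \<omega> * (B (real (Suc j) * h) \<omega> - B (real j * h) \<omega>))"

text \<open>Kolmogorov's maximal inequality follows from Chebyshev's inequality for the sum that is
  stopped as soon as it exceeds the level.\<close>

lemma grid_maximal_inequality:
  assumes h: "0 < h" and \<xi>: "grid_adapted \<xi> h C" and v: "\<And>j. j < N \<Longrightarrow> expectation (\<lambda>\<omega>. (\<xi> j \<omega>)\<^sup>2) \<le> v" and \<delta>: "0 < \<delta>"
  shows "prob {\<omega>\<in>space M. \<exists>j\<le>N. \<delta> < \<bar>grid_sum \<xi> h j \<omega>\<bar>} \<le> real N * h * v / \<delta>\<^sup>2"
proof -
  let ?S = "stopped_sum \<xi> h \<delta>"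
  have st: "?S j \<in> borel_measurable (F (real j * h)) \<and> integrable M (\<lambda>\<omega>. (?S j \<omega>)\<^sup>2) \<and> expectation (\<lambda>\<omega>. (?S j \<omega>)\<^sup>2) \<le> real j * h * v" if "j \<le> N" for j
    using that
  proof (induction j)
    case 0 show ?case by simp
  next
    case (Suc j)
    define s where "s = real j * h"
    have s0: "0 \<le> s" using h by (simp add: s_def)
    have sh: "real (Suc j) * h = s + h" by (simp add: s_def algebra_simps)
    have IH: "?S j \<in> borel_measurable (F s)" "integrable M (\<lambda>\<omega>. (?S j \<omega>)\<^sup>2)" "expectation (\<lambda>\<omega>. (?S j \<omega>)\<^sup>2) \<le> s * v"
      using Suc by (auto simp: s_def)
    have xm: "\<xi> j \<in> borel_measurable (F s)" and xb: "\<And>\<omega>. \<omega> \<in> space M \<Longrightarrow> \<bar>\<xi> j \<omega>\<bar> \<le> C"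
      using \<xi> by (auto simp: grid_adapted_def s_def)
    define i where "i \<omega> = (indicator {x. \<bar>x\<bar> \<le> \<delta>} (?S j \<omega>) :: real)" for \<omega>
    have im: "i \<in> borel_measurable (F s)" unfolding i_def using IH(1) by measurable
    have i01: "0 \<le> i \<omega>" "i \<omega> \<le> 1" "i \<omega> * i \<omega> = i \<omega>" for \<omega> by (auto simp: i_def indicator_def)
    let ?d = "\<lambda>\<omega>. B (s + h) \<omega> - B s \<omega>"
    have [measurable]: "?S j \<in> borel_measurable M" "i \<in> borel_measurable M" "\<xi> j \<in> borel_measurable M"
      using IH im xm by (auto intro: meas_F_M)
    have S1: "integrable M (\<lambda>\<omega>. \<bar>?S j \<omega>\<bar>)" using square_integrable_imp_integrable[OF _ IH(2)] by auto
    have zb: "integrable M (\<lambda>\<omega>. 2 * ?S j \<omega> * (i \<omega> * \<xi> j \<omega>))"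
    proof (rule Bochner_Integration.integrable_bound[where f = "\<lambda>\<omega>. 2 * C * \<bar>?S j \<omega>\<bar>"])
      show "AE \<omega> in M. norm (2 * ?S j \<omega> * (i \<omega> * \<xi> j \<omega>)) \<le> norm (2 * C * \<bar>?S j \<omega>\<bar>)"
      proof (rule AE_I2)
        fix \<omega> assume "\<omega> \<in> space M"
        then have "\<bar>i \<omega> * \<xi> j \<omega>\<bar> \<le> 1 * C" unfolding abs_mult using xb[of \<omega>] i01[of \<omega>] by (intro mult_mono) auto
        then have "\<bar>i \<omega> * \<xi> j \<omega>\<bar> \<le> \<bar>C\<bar>" by linarith
        then have "2 * \<bar>?S j \<omega>\<bar> * \<bar>i \<omega> * \<xi> j \<omega>\<bar> \<le> 2 * \<bar>?S j \<omega>\<bar> * \<bar>C\<bar>" by (intro mult_left_mono) auto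
        then show "norm (2 * ?S j \<omega> * (i \<omega> * \<xi> j \<omega>)) \<le> norm (2 * C * \<bar>?S j \<omega>\<bar>)" by (simp add: abs_mult mult_ac)
      qed
    qed (use S1 in auto)
    have zm: "(\<lambda>\<omega>. 2 * ?S j \<omega> * (i \<omega> * \<xi> j \<omega>)) \<in> borel_measurable (F s)" using IH(1) im xm by simp
    have x2: "(\<xi> j \<omega>)\<^sup>2 \<le> C\<^sup>2" if "\<omega> \<in> space M" for \<omega> using xb[OF that] by (simp add: abs_le_square_iff[symmetric])
    have x2i: "integrable M (\<lambda>\<omega>. (\<xi> j \<omega>)\<^sup>2)" by (rule integrable_bounded[where C = "C\<^sup>2"]) (use x2 in auto)
    have xim: "(\<lambda>\<omega>. i \<omega> * (\<xi> j \<omega>)\<^sup>2) \<in> borel_measurable (F s)" using im xm by simp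
    have xii: "integrable M (\<lambda>\<omega>. i \<omega> * (\<xi> j \<omega>)\<^sup>2)"
    proof (rule integrable_bounded[where C = "1 * C\<^sup>2"])
      fix \<omega> assume "\<omega> \<in> space M"
      then show "\<bar>i \<omega> * (\<xi> j \<omega>)\<^sup>2\<bar> \<le> 1 * C\<^sup>2" unfolding abs_mult using x2[of \<omega>] i01[of \<omega>] by (intro mult_mono) auto
    qed simp
    have q1: "integrable M (\<lambda>\<omega>. 2 * ?S j \<omega> * (i \<omega> * \<xi> j \<omega>) * ?d \<omega>)" "expectation (\<lambda>\<omega>. 2 * ?S j \<omega> * (i \<omega> * \<xi> j \<omega>) * ?d \<omega>) = 0"
      using adapted_times_increment[OF s0 _ zm zb, of "s + h"] h by auto
    have q2: "integrable M (\<lambda>\<omega>. i \<omega> * (\<xi> j \<omega>)\<^sup>2 * (?d \<omega>)\<^sup>2)" "expectation (\<lambda>\<omega>. i \<omega> * (\<xi> j \<omega>)\<^sup>2 * (?d \<omega>)\<^sup>2) = expectation (\<lambda>\<omega>. i \<omega> * (\<xi> j \<omega>)\<^sup>2) * h"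
      using adapted_times_increment[OF s0 _ xim xii, of "s + h"] h by auto
    have eq: "(?S (Suc j) \<omega>)\<^sup>2 = (?S j \<omega>)\<^sup>2 + 2 * ?S j \<omega> * (i \<omega> * \<xi> j \<omega>) * ?d \<omega> + i \<omega> * (\<xi> j \<omega>)\<^sup>2 * (?d \<omega>)\<^sup>2" for \<omega>
    proof -
      have 1: "?S (Suc j) \<omega> = ?S j \<omega> + i \<omega> * \<xi> j \<omega> * ?d \<omega>" unfolding stopped_sum.simps sh s_def[symmetric] i_def ..
      have 2: "(i \<omega> * \<xi> j \<omega> * ?d \<omega>)\<^sup>2 = i \<omega> * (\<xi> j \<omega>)\<^sup>2 * (?d \<omega>)\<^sup>2"
        using i01(3)[of \<omega>] by (auto simp: power_mult_distrib power2_eq_square)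
      show ?thesis unfolding 1 power2_sum 2 by (simp only: mult.assoc ac_simps(1) add.commute add.left_commute)
    qed
    have m: "?S (Suc j) \<in> borel_measurable (F (s + h))"
      unfolding stopped_sum.simps sh s_def[symmetric] i_def[symmetric]
      using meas_F_mono[OF IH(1), of "s + h"] meas_F_mono[OF im, of "s + h"] meas_F_mono[OF xm, of "s + h"] B_meas_F[of s "s + h"] B_meas_F[of "s + h" "s + h"] s0 h
      by simp
    have "expectation (\<lambda>\<omega>. i \<omega> * (\<xi> j \<omega>)\<^sup>2) \<le> expectation (\<lambda>\<omega>. (\<xi> j \<omega>)\<^sup>2)"
      by (rule integral_mono[OF xii x2i]) (use i01 in \<open>simp add: mult_left_le_one_le\<close>)
    also have "\<dots> \<le> v" using v Suc by simp
    finally have "expectation (\<lambda>\<omega>. i \<omega> * (\<xi> j \<omega>)\<^sup>2) * h \<le> v * h" using h by simp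
    then have e: "expectation (\<lambda>\<omega>. (?S (Suc j) \<omega>)\<^sup>2) \<le> s * v + v * h"
      unfolding eq using IH q1 q2 by simp
    have ii: "integrable M (\<lambda>\<omega>. (?S (Suc j) \<omega>)\<^sup>2)"
      unfolding eq by (intro Bochner_Integration.integrable_add IH q1 q2)
    have "(s + h) * v = s * v + v * h" by (simp add: algebra_simps)
    with m ii e show ?case unfolding sh by presburger
  qed
  have inv: "(\<forall>i\<le>j. \<bar>grid_sum \<xi> h i \<omega>\<bar> \<le> \<delta>) \<and> ?S j \<omega> = grid_sum \<xi> h j \<omega> \<or> \<delta> < \<bar>?S j \<omega>\<bar>" for j \<omega>
  proof (induction j)
    case 0 then show ?case using \<delta> by (simp add: grid_sum_def)
  next
    case (Suc j)
    show ?case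
    proof (cases "\<delta> < \<bar>?S j \<omega>\<bar>")
      case True then show ?thesis by simp
    next
      case False
      then have "\<forall>i\<le>j. \<bar>grid_sum \<xi> h i \<omega>\<bar> \<le> \<delta>" "?S j \<omega> = grid_sum \<xi> h j \<omega>" using Suc by auto
      moreover have "?S (Suc j) \<omega> = grid_sum \<xi> h (Suc j) \<omega>"
        using False calculation by (simp add: grid_sum_def)
      ultimately show ?thesis by (metis le_Suc_eq linorder_not_le)
    qed
  qed
  have SN: "?S N \<in> borel_measurable M" "integrable M (\<lambda>\<omega>. (?S N \<omega>)\<^sup>2)" "expectation (\<lambda>\<omega>. (?S N \<omega>)\<^sup>2) \<le> real N * h * v"
    using st[of N] by (auto intro: meas_F_M)
  note SN(1) [measurable]
  have "prob {\<omega>\<in>space M. \<exists>j\<le>N. \<delta> < \<bar>grid_sum \<xi> h j \<omega>\<bar>} \<le> prob {\<omega>\<in>space M. (?S N \<omega>)\<^sup>2 \<ge> \<delta>\<^sup>2}"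
  proof (rule finite_measure_mono)
    show "{\<omega>\<in>space M. \<exists>j\<le>N. \<delta> < \<bar>grid_sum \<xi> h j \<omega>\<bar>} \<subseteq> {\<omega>\<in>space M. (?S N \<omega>)\<^sup>2 \<ge> \<delta>\<^sup>2}"
    proof safe
      fix \<omega> j assume "j \<le> N" "\<delta> < \<bar>grid_sum \<xi> h j \<omega>\<bar>"
      then have "\<delta> < \<bar>?S N \<omega>\<bar>" using inv[of N \<omega>] by force
      then show "\<delta>\<^sup>2 \<le> (?S N \<omega>)\<^sup>2" using \<delta> by (simp add: abs_le_square_iff[symmetric])
    qed
  qed measurable
  also have "\<dots> \<le> expectation (\<lambda>\<omega>. (?S N \<omega>)\<^sup>2) / \<delta>\<^sup>2"
    by (rule integral_Markov_inequality_measure[OF SN(2), of "{}"]) (use \<delta> in auto)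
  also have "\<dots> \<le> real N * h * v / \<delta>\<^sup>2" using SN(3) by (intro divide_right_mono) auto
  finally show ?thesis .
qed

end

section \<open>Moment and tail bounds for dissipative equations\<close>

lemma yw_generator_bound:
  assumes \<delta>: "0 < \<delta>" and nn: "0 \<le> l" "0 \<le> c" "0 \<le> \<eta>0" "0 \<le> \<eta>1"
    and D: "\<bar>D\<bar> \<le> K" and a: "D * a \<le> l * D\<^sup>2 + \<eta>0 * \<bar>D\<bar>" and g: "G\<^sup>2 \<le> c * \<bar>D\<bar> + \<eta>1"
  shows "yw1 \<delta> D * a + yw2 \<delta> D / 2 * G\<^sup>2 \<le> l * yw \<delta> D + (l * K + \<eta>0 * K / \<delta> + (c + \<eta>1 / \<delta>)) / ln (1 + 1 / \<delta>)"
proof -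
  interpret test_function "yw \<delta>" "yw1 \<delta>" "yw2 \<delta>" "1 / (\<delta> * ln (1 + 1 / \<delta>))" "1 / (\<delta>\<^sup>2 * ln (1 + 1 / \<delta>))"
    by (rule yw_test_function[OF \<delta>])
  define L where "L = ln (1 + 1 / \<delta>)"
  have L: "0 < L" unfolding L_def by (rule yw_log_pos[OF \<delta>])
  have "yw1 \<delta> D * a \<le> l * (D * yw1 \<delta> D) + \<eta>0 * \<bar>yw1 \<delta> D\<bar>"
  proof (cases "D = 0")
    case True then show ?thesis by (simp add: yw1_def)
  next
    case False
    define y where "y = yw1 \<delta> \<bar>D\<bar>"
    define k where "k = y / \<bar>D\<bar>"
    have y: "0 \<le> y" "yw1 \<delta> D = sgn D * y"
      using yw1_nonneg[OF \<delta>, of "\<bar>D\<bar>"] by (auto simp: y_def yw1_def sgn_if)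
    have k: "0 \<le> k" "yw1 \<delta> D = k * D" "\<bar>yw1 \<delta> D\<bar> = k * \<bar>D\<bar>"
      using False y by (auto simp: k_def sgn_if)
    have "k * (D * a) \<le> k * (l * D\<^sup>2 + \<eta>0 * \<bar>D\<bar>)" using a k(1) by (rule mult_left_mono)
    then show ?thesis unfolding k(3) unfolding k(2) by (simp add: algebra_simps power2_eq_square)
  qed
  also have "l * (D * yw1 \<delta> D) \<le> l * (yw \<delta> D + K / L)"
  proof -
    have "D * yw1 \<delta> D \<le> yw \<delta> D + \<bar>D\<bar> / L" using yw1_mult_le[OF \<delta>, of D] by (simp add: L_def)
    moreover have "\<bar>D\<bar> / L \<le> K / L" using D L by (intro divide_right_mono) auto
    ultimately show ?thesis using nn by (intro mult_left_mono) auto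
  qed
  also have "\<eta>0 * \<bar>yw1 \<delta> D\<bar> \<le> \<eta>0 * (1 / (\<delta> * L) * K)"
  proof (rule mult_left_mono[OF _ nn(3)])
    have "\<bar>yw1 \<delta> D\<bar> \<le> 1 / (\<delta> * L) * \<bar>D\<bar>" unfolding L_def by (rule \<phi>1_bound)
    also have "\<dots> \<le> 1 / (\<delta> * L) * K" using D \<delta> L by (intro mult_left_mono) auto
    finally show "\<bar>yw1 \<delta> D\<bar> \<le> 1 / (\<delta> * L) * K" .
  qed
  finally have 1: "yw1 \<delta> D * a \<le> l * (yw \<delta> D + K / L) + \<eta>0 * (1 / (\<delta> * L) * K)" by simp
  have "yw2 \<delta> D * G\<^sup>2 \<le> yw2 \<delta> D * (c * \<bar>D\<bar> + \<eta>1)" using g \<phi>2_nonneg by (rule mult_left_mono)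
  also have "\<dots> \<le> (c + \<eta>1 / \<delta>) / L" unfolding L_def by (rule yw2_mult_le[OF \<delta> nn(2,4)])
  finally have "yw2 \<delta> D / 2 * G\<^sup>2 \<le> (c + \<eta>1 / \<delta>) / L / 2" unfolding times_divide_eq_left by (rule divide_right_mono) simp
  also have "\<dots> \<le> (c + \<eta>1 / \<delta>) / L" using nn \<delta> L by (simp add: field_simps)
  finally have "yw1 \<delta> D * a + yw2 \<delta> D / 2 * G\<^sup>2 \<le> l * (yw \<delta> D + K / L) + \<eta>0 * (1 / (\<delta> * L) * K) + (c + \<eta>1 / \<delta>) / L" using 1 by linarith
  also have "\<dots> = l * yw \<delta> D + (l * K + \<eta>0 * K / \<delta> + (c + \<eta>1 / \<delta>)) / L" by (simp add: add_divide_distrib distrib_left)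
  finally show ?thesis by (simp add: L_def)
qed

context brownian begin

lemma continuous_adapted_meas: "continuous_adapted R \<Longrightarrow> 0 \<le> t \<Longrightarrow> R t \<in> borel_measurable M"
  by (auto simp: continuous_adapted_def intro: meas_F_M)

lemma yw_stopped_bound:
  assumes R: "continuous_adapted R" and \<alpha>: "continuous_adapted \<alpha>" and \<gamma>: "continuous_adapted \<gamma>" and D: "continuous_adapted D"
    and A: "0 \<le> A" and bd: "\<And>t \<omega>. 0 \<le> t \<Longrightarrow> \<omega> \<in> below R K t \<Longrightarrow> \<bar>\<alpha> t \<omega>\<bar> \<le> A \<and> \<bar>\<gamma> t \<omega>\<bar> \<le> A \<and> \<bar>D t \<omega>\<bar> \<le> K'"
    and sol: "\<And>t. 0 \<le> t \<Longrightarrow> \<exists>I. ito_integral_is M B \<gamma> t I \<and> (AE \<omega> in M. D t \<omega> = d0 + integral {0..t} (\<lambda>r. \<alpha> r \<omega>) + I \<omega>)"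
    and T: "0 < T" and nn: "0 \<le> l" "0 \<le> c" "0 \<le> \<eta>0" "0 \<le> \<eta>1" and \<delta>: "0 < \<delta>" and K': "0 \<le> K'"
    and drift: "\<And>t \<omega>. 0 \<le> t \<Longrightarrow> \<omega> \<in> below R K t \<Longrightarrow> D t \<omega> * \<alpha> t \<omega> \<le> l * (D t \<omega>)\<^sup>2 + \<eta>0 * \<bar>D t \<omega>\<bar>"
    and diff: "\<And>t \<omega>. 0 \<le> t \<Longrightarrow> \<omega> \<in> below R K t \<Longrightarrow> (\<gamma> t \<omega>)\<^sup>2 \<le> c * \<bar>D t \<omega>\<bar> + \<eta>1"
  shows "expectation (\<lambda>\<omega>. indicator (below R K T) \<omega> * yw \<delta> (D T \<omega>)) \<le>
     (yw \<delta> d0 + T * ((l * K' + \<eta>0 * K' / \<delta> + (c + \<eta>1 / \<delta>)) / ln (1 + 1 / \<delta>))) * exp (l * T)"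
proof (rule stopped_test_function_bound[OF yw_test_function[OF \<delta>] T, where S = "below R K" and A = A and K = K'
      and a = "\<lambda>t \<omega>. indicator (below R K t) \<omega> * \<alpha> t \<omega>" and G = "\<lambda>t \<omega>. indicator (below R K t) \<omega> * \<gamma> t \<omega>"])
  show "lc_process A (\<lambda>t \<omega>. indicator (below R K t) \<omega> * \<alpha> t \<omega>)"
    by (rule lc_stopped[OF R \<alpha> A]) (use bd in blast)
  show "lc_process A (\<lambda>t \<omega>. indicator (below R K t) \<omega> * \<gamma> t \<omega>)"
    by (rule lc_stopped[OF R \<gamma> A]) (use bd in blast)
  fix t :: real assume t: "0 \<le> t"
  show "below R K t \<in> sets M" by (rule below_M[OF R t])
  show "D t \<in> borel_measurable M" by (rule continuous_adapted_meas[OF D t])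
  obtain I where I: "ito_integral_is M B \<gamma> t I" "AE \<omega> in M. D t \<omega> = d0 + integral {0..t} (\<lambda>r. \<alpha> r \<omega>) + I \<omega>"
    using sol[OF t] by blast
  have in_below: "\<omega> \<in> below R K r" if "\<omega> \<in> below R K t" "r \<le> t" for \<omega> r
    using below_antimono[OF that(2)] that(1) by blast
  have "AE \<omega> in M. \<omega> \<in> below R K t \<longrightarrow> D t \<omega> = d0 + (\<integral>r. indicator {0..<t} r * (indicator (below R K r) \<omega> * \<alpha> r \<omega>) \<partial>lborel) + I \<omega>"
    using I(2) AE_space
  proof eventually_elim
    case (elim \<omega>)
    show ?case
    proof
      assume w: "\<omega> \<in> below R K t"
      have "indicator {0..<t} r * (indicator (below R K r) \<omega> * \<alpha> r \<omega>) = indicator {0..<t} r * \<alpha> r \<omega>" for r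
        using in_below[OF w, of r] by (auto simp: indicator_def)
      moreover have "(\<integral>r. indicator {0..<t} r * \<alpha> r \<omega> \<partial>lborel) = integral {0..t} (\<lambda>r. \<alpha> r \<omega>)"
        using \<alpha> elim(2) t by (intro lebesgue_eq_integral_continuous) (auto simp: continuous_adapted_def intro: continuous_on_subset)
      ultimately show "D t \<omega> = d0 + (\<integral>r. indicator {0..<t} r * (indicator (below R K r) \<omega> * \<alpha> r \<omega>) \<partial>lborel) + I \<omega>"
        using elim(1) by (simp only:)
    qed
  qed
  then show "\<exists>H I. ito_integral_is M B H t I \<and> (\<forall>r\<ge>0. H r \<in> borel_measurable M) \<and>
        (\<forall>\<omega>\<in>below R K t. \<forall>r. 0 \<le> r \<and> r \<le> t \<longrightarrow> indicator (below R K r) \<omega> * \<gamma> r \<omega> = H r \<omega>) \<and>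
        (AE \<omega> in M. \<omega> \<in> below R K t \<longrightarrow> D t \<omega> = d0 + (\<integral>r. indicator {0..<t} r * (indicator (below R K r) \<omega> * \<alpha> r \<omega>) \<partial>lborel) + I \<omega>)"
    using I(1) continuous_adapted_meas[OF \<gamma>] in_below by (intro exI[of _ \<gamma>] exI[of _ I]) auto
  fix \<omega>
  show "indicator (below R K t) \<omega> * \<alpha> t \<omega> = 0 \<and> indicator (below R K t) \<omega> * \<gamma> t \<omega> = 0" if "\<omega> \<in> space M" "\<omega> \<notin> below R K t"
    using that by simp
  assume w: "\<omega> \<in> below R K t"
  show "\<bar>D t \<omega>\<bar> \<le> K'" using bd[OF t w] by blast
  show "yw1 \<delta> (D t \<omega>) * (indicator (below R K t) \<omega> * \<alpha> t \<omega>) + yw2 \<delta> (D t \<omega>) / 2 * (indicator (below R K t) \<omega> * \<gamma> t \<omega>)\<^sup>2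
     \<le> l * yw \<delta> (D t \<omega>) + (l * K' + \<eta>0 * K' / \<delta> + (c + \<eta>1 / \<delta>)) / ln (1 + 1 / \<delta>)"
    using yw_generator_bound[OF \<delta> nn _ drift[OF t w] diff[OF t w], of K'] bd[OF t w] w by simp
next
  show "0 \<le> (l * K' + \<eta>0 * K' / \<delta> + (c + \<eta>1 / \<delta>)) / ln (1 + 1 / \<delta>)"
    using nn K' \<delta> yw_log_pos[OF \<delta>] by (intro divide_nonneg_pos add_nonneg_nonneg) auto
qed (use nn in simp)

lemma continuous_adapted_compose:
  assumes Z: "continuous_adapted Z" and Z0: "\<And>t \<omega>. 0 \<le> t \<Longrightarrow> \<omega> \<in> space M \<Longrightarrow> 0 \<le> Z t \<omega>" and b: "continuous_on {0..} b"
  shows "continuous_adapted (\<lambda>t \<omega>. b (Z t \<omega>))"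
  unfolding continuous_adapted_def
proof (intro conjI allI impI ballI)
  fix t :: real assume t: "0 \<le> t"
  have "continuous_on UNIV (\<lambda>x. b (max 0 x))"
    by (rule continuous_on_compose2[OF b]) (auto intro!: continuous_intros)
  then have bm: "(\<lambda>x. b (max 0 x)) \<in> borel_measurable borel" by (rule borel_measurable_continuous_onI)
  have "(\<lambda>\<omega>. b (max 0 (Z t \<omega>))) \<in> borel_measurable (F t)"
    by (rule measurable_compose[OF _ bm]) (use Z t in \<open>auto simp: continuous_adapted_def\<close>)
  moreover have eq: "b (max 0 (Z t \<omega>)) = b (Z t \<omega>)" if "\<omega> \<in> space (F t)" for \<omega> using Z0[OF t] that by (simp add: max_def)
  ultimately show "(\<lambda>\<omega>. b (Z t \<omega>)) \<in> borel_measurable (F t)" 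
    by (subst measurable_cong[where g = "\<lambda>\<omega>. b (max 0 (Z t \<omega>))"]) auto
next
  fix \<omega> assume w: "\<omega> \<in> space M"
  show "continuous_on {0..} (\<lambda>t. b (Z t \<omega>))"
    by (rule continuous_on_compose2[OF b]) (use Z Z0[OF _ w] w in \<open>auto simp: continuous_adapted_def\<close>)
qed

lemma sde_continuous_adapted: "sde_solution M B b g x0 Z \<Longrightarrow> continuous_adapted Z"
  by (auto simp: sde_solution_def adapted_to_bm_def continuous_adapted_def)

lemma sde_nonneg: "sde_solution M B b g x0 Z \<Longrightarrow> \<omega> \<in> space M \<Longrightarrow> 0 \<le> t \<Longrightarrow> 0 \<le> Z t \<omega>"
  by (auto simp: sde_solution_def)

end

locale sde = brownian +
  fixes b g :: "real \<Rightarrow> real" and x0 lam c :: real and Z :: "real \<Rightarrow> 'a \<Rightarrow> real"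
  assumes Zsol: "sde_solution M B b g x0 Z"
    and b_cont: "continuous_on {0..} b" and g_cont: "continuous_on {0..} g"
    and b_le: "\<And>x. 0 \<le> x \<Longrightarrow> b x \<le> lam * x" and g_le: "\<And>x. 0 \<le> x \<Longrightarrow> (g x)\<^sup>2 \<le> c * x"
    and lam: "0 < lam" and x0: "0 < x0" and c: "0 \<le> c"
begin

lemmas Z_ca = sde_continuous_adapted[OF Zsol]
lemmas Z_nonneg = sde_nonneg[OF Zsol]
lemmas bZ_ca = continuous_adapted_compose[OF Z_ca Z_nonneg b_cont]
lemmas gZ_ca = continuous_adapted_compose[OF Z_ca Z_nonneg g_cont]
lemmas Z_meas = continuous_adapted_meas[OF Z_ca]

lemma Z_eq: "0 \<le> t \<Longrightarrow> \<exists>I. ito_integral_is M B (\<lambda>r \<omega>. g (Z r \<omega>)) t I \<and> (AE \<omega> in M. Z t \<omega> = x0 + integral {0..t} (\<lambda>r. b (Z r \<omega>)) + I \<omega>)"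
  using Zsol by (simp add: sde_solution_def)

lemma coeff_bound: "\<exists>A\<ge>0. \<forall>t\<ge>0. \<forall>\<omega>\<in>below Z K t. \<bar>b (Z t \<omega>)\<bar> \<le> A \<and> \<bar>g (Z t \<omega>)\<bar> \<le> A \<and> \<bar>Z t \<omega>\<bar> \<le> \<bar>K\<bar>"
proof -
  have "bounded (b ` {0..K})" "bounded (g ` {0..K})"
    using b_cont g_cont by (auto intro!: compact_imp_bounded compact_continuous_image intro: continuous_on_subset)
  then obtain A1 A2 where A: "\<And>x. x \<in> {0..K} \<Longrightarrow> \<bar>b x\<bar> \<le> A1" "\<And>x. x \<in> {0..K} \<Longrightarrow> \<bar>g x\<bar> \<le> A2"
    unfolding bounded_iff by (metis imageI real_norm_def)
  have "Z t \<omega> \<in> {0..K}" if "0 \<le> t" "\<omega> \<in> below Z K t" for t \<omega>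
    using that Z_nonneg[of \<omega> t] by (auto simp: below_def)
  then show ?thesis using A by (intro exI[of _ "max 0 (max A1 A2)"]) (fastforce simp: le_max_iff_disj)
qed

lemma stopped_integrable: "0 \<le> t \<Longrightarrow> integrable M (\<lambda>\<omega>. indicator (below Z K t) \<omega> * Z t \<omega>)"
proof (rule integrable_bounded[where C = "\<bar>K\<bar>"])
  assume t: "0 \<le> t"
  have [measurable]: "below Z K t \<in> sets M" "Z t \<in> borel_measurable M" using below_M[OF Z_ca t] Z_meas[OF t] by auto
  show "(\<lambda>\<omega>. indicator (below Z K t) \<omega> * Z t \<omega>) \<in> borel_measurable M" by measurable
  show "\<bar>indicator (below Z K t) \<omega> * Z t \<omega>\<bar> \<le> \<bar>K\<bar>" for \<omega>
    using t Z_nonneg[of \<omega> t] by (cases "\<omega> \<in> below Z K t") (force simp: below_def)+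
qed

lemma Z_at_0: "AE \<omega> in M. Z 0 \<omega> = x0"
proof -
  obtain I where I: "ito_integral_is M B (\<lambda>r \<omega>. g (Z r \<omega>)) 0 I" "AE \<omega> in M. Z 0 \<omega> = x0 + integral {0..0} (\<lambda>r. b (Z r \<omega>)) + I \<omega>"
    using Z_eq[of 0] by auto
  from I(2) ito_zero[OF I(1)] show ?thesis by eventually_elim simp
qed

lemma stopped_first_moment:
  assumes t: "0 \<le> t"
  shows "expectation (\<lambda>\<omega>. indicator (below Z K t) \<omega> * Z t \<omega>) \<le> x0 * exp (lam * t)"
proof (cases "t = 0")
  case True
  have "expectation (\<lambda>\<omega>. indicator (below Z K 0) \<omega> * Z 0 \<omega>) \<le> expectation (\<lambda>\<omega>. x0)"
    by (rule integral_mono_AE[OF stopped_integrable]) (use Z_at_0 x0 in \<open>auto elim!: eventually_mono simp: indicator_def\<close>)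
  then show ?thesis using True by (simp add: prob_space)
next
  case False
  then have t0: "0 < t" using t by simp
  obtain A where A: "0 \<le> A" "\<And>t \<omega>. 0 \<le> t \<Longrightarrow> \<omega> \<in> below Z K t \<Longrightarrow> \<bar>b (Z t \<omega>)\<bar> \<le> A \<and> \<bar>g (Z t \<omega>)\<bar> \<le> A \<and> \<bar>Z t \<omega>\<bar> \<le> \<bar>K\<bar>"
    using coeff_bound[of K] by blast
  define S where "S = below Z K t"
  have Sm [measurable]: "S \<in> sets M" unfolding S_def by (rule below_M[OF Z_ca t])
  note Zm [measurable] = Z_meas[OF t]
  define \<eta> where "\<eta> \<delta> = (lam * \<bar>K\<bar> + 0 * \<bar>K\<bar> / \<delta> + (c + 0 / \<delta>)) / ln (1 + 1 / \<delta>)" for \<delta> :: real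
  have yb: "expectation (\<lambda>\<omega>. indicator S \<omega> * yw \<delta> (Z t \<omega>)) \<le> (yw \<delta> x0 + t * \<eta> \<delta>) * exp (lam * t)" if \<delta>: "0 < \<delta>" for \<delta>
    unfolding S_def \<eta>_def
  proof (rule yw_stopped_bound[OF Z_ca bZ_ca gZ_ca Z_ca A Z_eq t0])
    fix s \<omega> assume s: "0 \<le> s" "\<omega> \<in> below Z K s"
    then have z: "0 \<le> Z s \<omega>" using Z_nonneg[of \<omega> s] by (auto simp: below_def)
    then have "Z s \<omega> * b (Z s \<omega>) \<le> Z s \<omega> * (lam * Z s \<omega>)" by (intro mult_left_mono b_le)
    then show "Z s \<omega> * b (Z s \<omega>) \<le> lam * (Z s \<omega>)\<^sup>2 + 0 * \<bar>Z s \<omega>\<bar>" by (simp add: power2_eq_square mult_ac)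
    show "(g (Z s \<omega>))\<^sup>2 \<le> c * \<bar>Z s \<omega>\<bar> + 0" using g_le[OF z] z by simp
  qed (use lam c \<delta> in auto)
  show ?thesis
  proof (rule field_le_epsilon)
    fix \<theta> :: real assume \<theta>: "0 < \<theta>"
    define w where "w \<delta> = (ln (1 + \<theta> / \<delta>) - 1) / ln (1 + 1 / \<delta>)" for \<delta> :: real
    have le: "expectation (\<lambda>\<omega>. indicator S \<omega> * Z t \<omega>) \<le> \<theta> + (yw \<delta> x0 + t * \<eta> \<delta>) * exp (lam * t) / w \<delta>" if \<delta>: "0 < \<delta>" and w: "0 < w \<delta>" for \<delta>
    proof -
      interpret test_function "yw \<delta>" "yw1 \<delta>" "yw2 \<delta>" "1 / (\<delta> * ln (1 + 1 / \<delta>))" "1 / (\<delta>\<^sup>2 * ln (1 + 1 / \<delta>))"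
        by (rule yw_test_function[OF \<delta>])
      have yi: "integrable M (\<lambda>\<omega>. indicator S \<omega> * yw \<delta> (Z t \<omega>))"
      proof (rule integrable_bounded[where C = "1 / (\<delta> * ln (1 + 1 / \<delta>)) * K\<^sup>2"])
        fix \<omega>
        show "\<bar>indicator S \<omega> * yw \<delta> (Z t \<omega>)\<bar> \<le> 1 / (\<delta> * ln (1 + 1 / \<delta>)) * K\<^sup>2"
        proof (cases "\<omega> \<in> S")
          case True
          then have "(Z t \<omega>)\<^sup>2 \<le> K\<^sup>2" using A(2)[OF t, of \<omega>] by (simp add: S_def abs_le_square_iff[symmetric])
          then have "1 / (\<delta> * ln (1 + 1 / \<delta>)) * (Z t \<omega>)\<^sup>2 \<le> 1 / (\<delta> * ln (1 + 1 / \<delta>)) * K\<^sup>2"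
            using C2_nonneg by (rule mult_left_mono)
          then show ?thesis using \<phi>_bound[of "Z t \<omega>"] \<phi>_nonneg[of "Z t \<omega>"] True by simp
        qed (use C2_nonneg in simp)
      qed measurable
      have "expectation (\<lambda>\<omega>. indicator S \<omega> * Z t \<omega>) \<le> expectation (\<lambda>\<omega>. \<theta> + (indicator S \<omega> * yw \<delta> (Z t \<omega>)) / w \<delta>)"
      proof (rule integral_mono)
        show "integrable M (\<lambda>\<omega>. indicator S \<omega> * Z t \<omega>)" unfolding S_def by (rule stopped_integrable[OF t])
        show "integrable M (\<lambda>\<omega>. \<theta> + (indicator S \<omega> * yw \<delta> (Z t \<omega>)) / w \<delta>)" using yi by simp
        fix \<omega> assume sp: "\<omega> \<in> space M"
        show "indicator S \<omega> * Z t \<omega> \<le> \<theta> + (indicator S \<omega> * yw \<delta> (Z t \<omega>)) / w \<delta>"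
        proof (cases "\<omega> \<in> S \<and> \<theta> \<le> Z t \<omega>")
          case True
          then have "Z t \<omega> * w \<delta> \<le> yw \<delta> (Z t \<omega>)" using yw_lower[OF \<delta>, of \<theta> "Z t \<omega>"] \<theta> Z_nonneg[OF sp t] by (simp add: w_def)
          then have "Z t \<omega> \<le> yw \<delta> (Z t \<omega>) / w \<delta>" using w by (simp add: pos_le_divide_eq)
          then show ?thesis using True \<theta> by simp
        next
          case False
          have "0 \<le> (indicator S \<omega> * yw \<delta> (Z t \<omega>)) / w \<delta>" using \<phi>_nonneg w by simp
          then show ?thesis using False \<theta> by (cases "\<omega> \<in> S") auto
        qed
      qed
      also have "\<dots> = \<theta> + expectation (\<lambda>\<omega>. indicator S \<omega> * yw \<delta> (Z t \<omega>)) / w \<delta>" using yi by (simp add: prob_space)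
      also have "\<dots> \<le> \<theta> + (yw \<delta> x0 + t * \<eta> \<delta>) * exp (lam * t) / w \<delta>" using yb[OF \<delta>] w by (intro add_left_mono divide_right_mono) auto
      finally show ?thesis .
    qed
    have wl: "(w \<longlongrightarrow> 1) (at_right 0)" unfolding w_def by (rule yw_limits(2)[OF x0 \<theta>])
    have \<eta>l: "(\<eta> \<longlongrightarrow> 0) (at_right 0)"
    proof -
      have "((\<lambda>\<delta>. (lam * \<bar>K\<bar> + c) * (1 / ln (1 + 1 / \<delta>))) \<longlongrightarrow> (lam * \<bar>K\<bar> + c) * 0) (at_right 0)"
        by (intro tendsto_intros yw_limits(3)[OF x0 \<theta>])
      then show ?thesis unfolding \<eta>_def by simp
    qed
    have lim: "((\<lambda>\<delta>. \<theta> + (yw \<delta> x0 + t * \<eta> \<delta>) * exp (lam * t) / w \<delta>) \<longlongrightarrow> \<theta> + (x0 + t * 0) * exp (lam * t) / 1) (at_right 0)"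
      by (intro tendsto_intros wl \<eta>l yw_limits(1)[OF x0 \<theta>]) simp
    have "\<forall>\<^sub>F \<delta> in at_right 0. expectation (\<lambda>\<omega>. indicator S \<omega> * Z t \<omega>) \<le> \<theta> + (yw \<delta> x0 + t * \<eta> \<delta>) * exp (lam * t) / w \<delta>"
      using order_tendstoD(1)[OF wl, of 0] eventually_at_right_less[of "0::real"]
      by (auto elim: eventually_elim2 intro: le)
    from tendsto_lowerbound[OF lim this] show "expectation (\<lambda>\<omega>. indicator (below Z K t) \<omega> * Z t \<omega>) \<le> x0 * exp (lam * t) + \<theta>"
      by (simp add: S_def)
  qed
qed

lemma below_exhausts:
  assumes R: "continuous_adapted R" and t: "0 \<le> t"
  shows "(\<lambda>n. prob (space M - below R (real n) t)) \<longlonglongrightarrow> 0"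
    and "\<omega> \<in> space M \<Longrightarrow> \<exists>n0. \<forall>n\<ge>n0. \<omega> \<in> below R (real n) t"
proof -
  have ex: "\<exists>n0. \<forall>n\<ge>n0. \<omega> \<in> below R (real n) t" if w: "\<omega> \<in> space M" for \<omega>
  proof -
    have "bounded ((\<lambda>r. R r \<omega>) ` {0..t})"
      using R w by (intro compact_imp_bounded compact_continuous_image) (auto simp: continuous_adapted_def intro: continuous_on_subset)
    then obtain C where "\<forall>x\<in>(\<lambda>r. R r \<omega>) ` {0..t}. norm x \<le> C" unfolding bounded_iff by blast
    then have C: "R r \<omega> \<le> C" if "r \<in> {0..t}" for r using that by (fastforce simp: abs_le_iff)
    obtain n0 where "C \<le> real n0" using real_arch_simple by blast
    then have "\<forall>n\<ge>n0. \<omega> \<in> below R (real n) t" using C w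
      by (auto simp: below_def) (meson atLeastAtMost_iff of_nat_le_iff order_trans)
    then show ?thesis by blast
  qed
  then show "\<omega> \<in> space M \<Longrightarrow> \<exists>n0. \<forall>n\<ge>n0. \<omega> \<in> below R (real n) t" .
  have "(\<lambda>n. prob (space M - below R (real n) t)) \<longlonglongrightarrow> prob (\<Inter>n. space M - below R (real n) t)"
  proof (rule finite_Lim_measure_decseq)
    show "range (\<lambda>n. space M - below R (real n) t) \<subseteq> events" using below_M[OF R t] by auto
    show "decseq (\<lambda>n. space M - below R (real n) t)"
      by (rule decseq_SucI) (force simp: below_def)
  qed
  moreover have "(\<Inter>n. space M - below R (real n) t) = {}" using ex by fastforce
  ultimately show "(\<lambda>n. prob (space M - below R (real n) t)) \<longlonglongrightarrow> 0" by (simp only: measure_empty)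
qed

definition noise :: "real \<Rightarrow> 'a \<Rightarrow> real" where
  "noise t \<omega> = Z t \<omega> - integral {0..t} (\<lambda>r. b (Z r \<omega>))"

lemma bZ_cont: "\<omega> \<in> space M \<Longrightarrow> continuous_on {0..T} (\<lambda>r. b (Z r \<omega>))"
  using bZ_ca by (auto simp: continuous_adapted_def intro: continuous_on_subset)

lemma Z_cont: "\<omega> \<in> space M \<Longrightarrow> continuous_on {0..T} (\<lambda>r. Z r \<omega>)"
  using Z_ca by (auto simp: continuous_adapted_def intro: continuous_on_subset)

lemma noise_cont: "\<omega> \<in> space M \<Longrightarrow> continuous_on {0..T} (\<lambda>t. noise t \<omega>)"
  unfolding noise_def
  by (intro continuous_on_diff Z_cont indefinite_integral_continuous_1 integrable_continuous_interval bZ_cont)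

lemma lc_stopped_coeff: "\<exists>A. lc_process A (\<lambda>t \<omega>. indicator (below Z K t) \<omega> * b (Z t \<omega>)) \<and> lc_process A (\<lambda>t \<omega>. indicator (below Z K t) \<omega> * g (Z t \<omega>))"
proof -
  obtain A where "0 \<le> A" "\<And>t \<omega>. 0 \<le> t \<Longrightarrow> \<omega> \<in> below Z K t \<Longrightarrow> \<bar>b (Z t \<omega>)\<bar> \<le> A \<and> \<bar>g (Z t \<omega>)\<bar> \<le> A \<and> \<bar>Z t \<omega>\<bar> \<le> \<bar>K\<bar>"
    using coeff_bound[of K] by blast
  then show ?thesis using lc_stopped[OF Z_ca bZ_ca, of A K] lc_stopped[OF Z_ca gZ_ca, of A K] by blast
qed

lemma noise_meas: assumes t: "0 \<le> t" shows "noise t \<in> borel_measurable M"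
proof (cases "t = 0")
  case True
  then show ?thesis using Z_meas[of 0] by (simp add: noise_def[abs_def])
next
  case False
  then have t0: "0 < t" using t by simp
  define J where "J n \<omega> = (\<integral>r. indicator {0..<t} r * (indicator (below Z (real n) r) \<omega> * b (Z r \<omega>)) \<partial>lborel)" for n :: nat and \<omega>
  have Jm: "J n \<in> borel_measurable M" for n
  proof -
    obtain A where A: "lc_process A (\<lambda>t \<omega>. indicator (below Z (real n) t) \<omega> * b (Z t \<omega>))" using lc_stopped_coeff by blast
    show ?thesis unfolding J_def
      using lc_jointly_measurable(1)[OF A t0 zero_less_one] by (intro lborel.borel_measurable_lebesgue_integral)
  qed
  have "(\<lambda>\<omega>. integral {0..t} (\<lambda>r. b (Z r \<omega>))) \<in> borel_measurable M"
  proof (rule borel_measurable_LIMSEQ_real[OF _ Jm])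
    fix \<omega> assume w: "\<omega> \<in> space M"
    obtain n0 where n0: "\<And>n. n \<ge> n0 \<Longrightarrow> \<omega> \<in> below Z (real n) t" using below_exhausts(2)[OF Z_ca t w] by blast
    have "J n \<omega> = integral {0..t} (\<lambda>r. b (Z r \<omega>))" if "n \<ge> n0" for n
    proof -
      have "indicator {0..<t} r * (indicator (below Z (real n) r) \<omega> * b (Z r \<omega>)) = indicator {0..<t} r * b (Z r \<omega>)" for r
        using n0[OF that] below_antimono[of r t Z "real n"] by (auto simp: indicator_def)
      then show ?thesis unfolding J_def using lebesgue_eq_integral_continuous[OF bZ_cont[OF w] t] by (simp only:)
    qed
    then show "(\<lambda>n. J n \<omega>) \<longlonglongrightarrow> integral {0..t} (\<lambda>r. b (Z r \<omega>))"
      by (intro tendsto_eventually) (auto simp: eventually_sequentially)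
  qed
  then show ?thesis using Z_meas[OF t] unfolding noise_def[abs_def] by measurable
qed

lemma noise_ito: "0 \<le> t \<Longrightarrow> \<exists>I. ito_integral_is M B (\<lambda>r \<omega>. g (Z r \<omega>)) t I \<and> (AE \<omega> in M. noise t \<omega> - x0 = I \<omega>)"
  using Z_eq[of t] by (auto simp: noise_def elim!: eventually_mono)

lemma maximal_stopped_grid:
  assumes T: "0 < T" and \<delta>': "0 < \<delta>'" "\<delta>' < \<delta>"
  shows "prob {\<omega>\<in>below Z K T. \<exists>k\<le>(2::nat)^n. \<delta> < \<bar>noise (real k * (T / 2^n)) \<omega> - x0\<bar>} \<le> c * x0 * T * exp (lam * T) / \<delta>'\<^sup>2"
proof -
  obtain A where lcG: "lc_process A (\<lambda>t \<omega>. indicator (below Z K t) \<omega> * g (Z t \<omega>))" using lc_stopped_coeff by blast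
  define G where "G = (\<lambda>t \<omega>. indicator (below Z K t) \<omega> * g (Z t \<omega>))"
  note lcG = lcG[folded G_def]
  define S where "S = below Z K T"
  have Sm [measurable]: "S \<in> sets M" unfolding S_def by (rule below_M[OF Z_ca]) (use T in simp)
  define tk where "tk k = real k * (T / 2^n)" for k :: nat
  have tk0: "0 \<le> tk k" for k using T by (simp add: tk_def)
  have tkT: "tk k \<le> T" if "k \<le> 2^n" for k
  proof -
    have "real k \<le> 2^n" using that by (metis of_nat_le_iff of_nat_numeral of_nat_power)
    then show ?thesis using T by (simp add: tk_def divide_le_eq mult.commute mult_left_mono)
  qed
  obtain I where I: "\<And>k. ito_integral_is M B (\<lambda>r \<omega>. g (Z r \<omega>)) (tk k) (I k)" "\<And>k. AE \<omega> in M. noise (tk k) \<omega> - x0 = I k \<omega>"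
    using choice[of "\<lambda>k I. ito_integral_is M B (\<lambda>r \<omega>. g (Z r \<omega>)) (tk k) I \<and> (AE \<omega> in M. noise (tk k) \<omega> - x0 = I \<omega>)"] noise_ito[OF tk0] by blast
  have Im [measurable]: "I k \<in> borel_measurable M" for k using I(1)[of k] by (simp add: ito_integral_is_def)
  define e where "e m = integral\<^sup>L lborel (grid_err G (T / 2^m) (2^m))" for m :: nat
  define An where "An = {\<omega>\<in>S. \<exists>k\<le>(2::nat)^n. \<delta> < \<bar>noise (tk k) \<omega> - x0\<bar>}"
  have main: "prob An \<le> c * x0 * T * exp (lam * T) / \<delta>'\<^sup>2 + (2^n + 1) * (e m / (\<delta> - \<delta>')\<^sup>2)" if mn: "n \<le> m" for m
  proof -
    define h where "h = T / 2^m"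
    have h: "0 < h" using T by (simp add: h_def)
    define \<xi> where "\<xi> = on_grid G h"
    have \<xi>: "grid_adapted \<xi> h A" unfolding \<xi>_def by (rule lc_grid_adapted[OF lcG]) (use h in simp)
    have gsm [measurable]: "grid_sum \<xi> h j \<in> borel_measurable M" for j by (rule grid_sum_meas[OF \<xi>])
    define jj where "jj k = k * 2^(m - n)" for k :: nat
    have pw: "(2::real)^m = 2^n * 2^(m-n)" using mn by (simp flip: power_add)
    have jjt: "tk k = real (jj k) * h" for k unfolding tk_def jj_def h_def pw by simp
    have jjle: "jj k \<le> 2^m" if "k \<le> 2^n" for k
    proof -
      have "k * 2^(m-n) \<le> 2^n * 2^(m-n)" using that by simp
      then show ?thesis using mn by (simp add: jj_def flip: power_add)
    qed
    define Mx where "Mx = {\<omega>\<in>space M. \<exists>j\<le>2^m. \<delta>' < \<bar>grid_sum \<xi> h j \<omega>\<bar>}"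
    define Bd where "Bd k = {\<omega>\<in>space M. indicator S \<omega> * (grid_sum \<xi> h (jj k) \<omega> - I k \<omega>)\<^sup>2 \<ge> (\<delta> - \<delta>')\<^sup>2}" for k
    have Mxm: "Mx \<in> sets M" unfolding Mx_def by measurable
    have Bdm: "Bd k \<in> sets M" for k unfolding Bd_def by measurable
    have Mxp: "prob Mx \<le> real (2^m) * h * (c * x0 * exp (lam * T)) / \<delta>'\<^sup>2"
      unfolding Mx_def
    proof (rule grid_maximal_inequality[OF h \<xi> _ \<delta>'(1)])
      fix j :: nat assume j: "j < 2^m"
      let ?t = "real j * h"
      have t0: "0 \<le> ?t" using h by simp
      have "real j \<le> 2^m" using j by (metis less_imp_le of_nat_le_iff of_nat_numeral of_nat_power)
      then have tT: "?t \<le> T" using T by (simp add: h_def divide_le_eq mult.commute mult_left_mono)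
      have "expectation (\<lambda>\<omega>. (\<xi> j \<omega>)\<^sup>2) \<le> expectation (\<lambda>\<omega>. c * (indicator (below Z K ?t) \<omega> * Z ?t \<omega>))"
      proof (rule integral_mono')
        show "integrable M (\<lambda>\<omega>. c * (indicator (below Z K ?t) \<omega> * Z ?t \<omega>))" using stopped_integrable[OF t0] by simp
        fix \<omega> assume w: "\<omega> \<in> space M"
        show "(\<xi> j \<omega>)\<^sup>2 \<le> c * (indicator (below Z K ?t) \<omega> * Z ?t \<omega>)"
          using g_le[OF Z_nonneg[OF w t0]] by (auto simp: \<xi>_def on_grid_def G_def indicator_def)
        show "0 \<le> c * (indicator (below Z K ?t) \<omega> * Z ?t \<omega>)" using Z_nonneg[OF w t0] c by simp
      qed
      also have "\<dots> = c * expectation (\<lambda>\<omega>. indicator (below Z K ?t) \<omega> * Z ?t \<omega>)" by simp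
      also have "\<dots> \<le> c * (x0 * exp (lam * ?t))" by (intro mult_left_mono stopped_first_moment t0 c)
      also have "\<dots> \<le> c * (x0 * exp (lam * T))" using lam x0 c tT by (intro mult_left_mono) auto
      finally show "expectation (\<lambda>\<omega>. (\<xi> j \<omega>)\<^sup>2) \<le> c * x0 * exp (lam * T)" by simp
    qed
    have Bdp: "prob (Bd k) \<le> e m / (\<delta> - \<delta>')\<^sup>2" if k: "k \<le> 2^n" for k
    proof -
      have eq: "G r \<omega> = g (Z r \<omega>)" if "\<omega> \<in> S" "0 \<le> r" "r \<le> tk k" for \<omega> r
        using that tkT[OF k] below_antimono[of r T Z K] unfolding G_def S_def by auto
      have gm: "\<And>r. 0 \<le> r \<Longrightarrow> (\<lambda>\<omega>. g (Z r \<omega>)) \<in> borel_measurable M" by (rule continuous_adapted_meas[OF gZ_ca])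
      note ap = grid_sum_approximates_ito[OF lcG h jjt[of k] I(1)[of k] gm Sm eq, folded \<xi>_def]
      have "prob (Bd k) \<le> expectation (\<lambda>\<omega>. indicator S \<omega> * (grid_sum \<xi> h (jj k) \<omega> - I k \<omega>)\<^sup>2) / (\<delta> - \<delta>')\<^sup>2"
        unfolding Bd_def by (rule integral_Markov_inequality_measure[OF ap(1), where A = "{}"]) (use \<delta>' in auto)
      also have "\<dots> \<le> e m / (\<delta> - \<delta>')\<^sup>2"
      proof (rule divide_right_mono)
        have "integral\<^sup>L lborel (grid_err G h (jj k)) \<le> e m"
          unfolding e_def h_def[symmetric] by (rule grid_err_integral_mono[OF lcG h _ jjle[OF k]]) simp
        with ap(2) show "expectation (\<lambda>\<omega>. indicator S \<omega> * (grid_sum \<xi> h (jj k) \<omega> - I k \<omega>)\<^sup>2) \<le> e m" by linarith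
      qed simp
      finally show ?thesis .
    qed
    have "AE \<omega> in M. \<forall>k\<in>{..2^n}. noise (tk k) \<omega> - x0 = I k \<omega>"
      by (rule AE_finite_allI) (use I(2) in auto)
    then have "AE \<omega> in M. \<omega> \<in> An \<longrightarrow> \<omega> \<in> Mx \<union> (\<Union>k\<in>{..2^n}. Bd k)"
      using AE_space
    proof eventually_elim
      case (elim \<omega>)
      show ?case
      proof
        assume a: "\<omega> \<in> An"
        then obtain k where k: "k \<le> 2^n" "\<delta> < \<bar>noise (tk k) \<omega> - x0\<bar>" "\<omega> \<in> S" by (auto simp: An_def)
        then have d: "\<delta> < \<bar>I k \<omega>\<bar>" using elim(1) by auto
        show "\<omega> \<in> Mx \<union> (\<Union>k\<in>{..2^n}. Bd k)"
        proof (cases "\<delta> - \<delta>' \<le> \<bar>grid_sum \<xi> h (jj k) \<omega> - I k \<omega>\<bar>")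
          case True
          then have "(\<delta> - \<delta>')\<^sup>2 \<le> (grid_sum \<xi> h (jj k) \<omega> - I k \<omega>)\<^sup>2" using \<delta>' by (simp add: abs_le_square_iff[symmetric])
          then have "\<omega> \<in> Bd k" using k elim(2) by (simp add: Bd_def)
          then show ?thesis using k by auto
        next
          case False
          then have "\<delta>' < \<bar>grid_sum \<xi> h (jj k) \<omega>\<bar>" using d by linarith
          then show ?thesis using jjle[OF k(1)] elim(2) by (auto simp: Mx_def)
        qed
      qed
    qed
    then have "prob An \<le> prob (Mx \<union> (\<Union>k\<in>{..2^n}. Bd k))"
      by (rule finite_measure_mono_AE) (use Mxm Bdm in auto)
    also have "\<dots> \<le> prob Mx + prob (\<Union>k\<in>{..2^n}. Bd k)" by (rule measure_Un_le) (use Mxm Bdm in auto)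
    also have "prob (\<Union>k\<in>{..2^n}. Bd k) \<le> (\<Sum>k\<in>{..2^n}. prob (Bd k))" by (rule measure_UNION_le) (use Bdm in auto)
    also have "\<dots> \<le> (\<Sum>k\<in>{..(2::nat)^n}. e m / (\<delta> - \<delta>')\<^sup>2)" by (intro sum_mono Bdp) simp
    also have "\<dots> = (2^n + 1) * (e m / (\<delta> - \<delta>')\<^sup>2)" by (simp add: add.commute)
    also have "prob Mx \<le> c * x0 * T * exp (lam * T) / \<delta>'\<^sup>2" using Mxp by (simp add: h_def mult_ac)
    finally show ?thesis by simp
  qed
  have lim: "(\<lambda>m. c * x0 * T * exp (lam * T) / \<delta>'\<^sup>2 + (2^n + 1) * (e m / (\<delta> - \<delta>')\<^sup>2)) \<longlonglongrightarrow> c * x0 * T * exp (lam * T) / \<delta>'\<^sup>2 + (2^n + 1) * (0 / (\<delta> - \<delta>')\<^sup>2)"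
    unfolding e_def by (intro tendsto_intros grid_err_tendsto[OF lcG T]) (use \<delta>' in auto)
  have "prob An \<le> c * x0 * T * exp (lam * T) / \<delta>'\<^sup>2 + (2^n + 1) * (0 / (\<delta> - \<delta>')\<^sup>2)"
    by (rule LIMSEQ_le_const[OF lim]) (use main in blast)
  then show ?thesis by (simp add: An_def S_def tk_def)
qed

lemma noise_exceed_meas:
  assumes T: "0 \<le> T"
  shows "{\<omega>\<in>space M. \<exists>s\<in>{0..T}. \<delta> < \<bar>noise s \<omega> - x0\<bar>} \<in> sets M" (is "?E \<in> _")
    and "{\<omega>\<in>space M. \<exists>s\<in>{0..T}. \<delta> < \<bar>noise s \<omega> - x0\<bar>} = (\<Union>n. {\<omega>\<in>space M. \<exists>k\<le>(2::nat)^n. \<delta> < \<bar>noise (real k * (T / 2^n)) \<omega> - x0\<bar>})" (is "?e")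
proof -
  have m: "{\<omega>\<in>space M. \<exists>k\<le>(2::nat)^n. \<delta> < \<bar>noise (real k * (T / 2^n)) \<omega> - x0\<bar>} \<in> sets M" for n
  proof -
    have [measurable]: "noise (real k * (T / 2^n)) \<in> borel_measurable M" for k using T by (intro noise_meas) simp
    show ?thesis by measurable
  qed
  show eq: ?e
  proof (intro equalityI subsetI)
    fix \<omega> assume w: "\<omega> \<in> ?E"
    then have sp: "\<omega> \<in> space M" by auto
    show "\<omega> \<in> (\<Union>n. {\<omega>\<in>space M. \<exists>k\<le>(2::nat)^n. \<delta> < \<bar>noise (real k * (T / 2^n)) \<omega> - x0\<bar>})"
    proof (rule ccontr)
      assume "\<not> ?thesis"
      then have le: "\<And>k j. j \<le> (2::nat)^k \<Longrightarrow> \<bar>noise (real j * (T / 2^k)) \<omega> - x0\<bar> \<le> \<delta>" using sp by (auto simp: not_less)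
      have ct: "continuous_on {0..T} (\<lambda>s. \<bar>noise s \<omega> - x0\<bar>)" by (intro continuous_intros noise_cont[OF sp])
      have "\<bar>noise s \<omega> - x0\<bar> \<le> \<delta>" if "s \<in> {0..T}" for s
        using dyadic_dense[OF ct le, of s] that by simp
      then show False using w by force
    qed
  next
    fix \<omega> assume "\<omega> \<in> (\<Union>n. {\<omega>\<in>space M. \<exists>k\<le>(2::nat)^n. \<delta> < \<bar>noise (real k * (T / 2^n)) \<omega> - x0\<bar>})"
    then obtain n k where k: "\<omega> \<in> space M" "k \<le> (2::nat)^n" "\<delta> < \<bar>noise (real k * (T / 2^n)) \<omega> - x0\<bar>" by auto
    have "real k \<le> 2^n" using k(2) by (metis of_nat_le_iff of_nat_numeral of_nat_power)
    then have "real k * (T / 2^n) \<in> {0..T}" using T by (simp add: divide_le_eq mult.commute mult_left_mono)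
    then show "\<omega> \<in> ?E" using k by blast
  qed
  show "?E \<in> sets M" unfolding eq by (rule sets.countable_UN) (use m in blast)
qed

lemma noise_maximal:
  assumes T: "0 < T" and \<delta>: "0 < \<delta>"
  shows "prob {\<omega>\<in>space M. \<exists>s\<in>{0..T}. \<delta> < \<bar>noise s \<omega> - x0\<bar>} \<le> c * x0 * T * exp (lam * T) / \<delta>\<^sup>2"
proof -
  define V where "V = c * x0 * T * exp (lam * T)"
  define E where "E n = {\<omega>\<in>space M. \<exists>k\<le>(2::nat)^n. \<delta> < \<bar>noise (real k * (T / 2^n)) \<omega> - x0\<bar>}" for n
  have Em: "E n \<in> sets M" for n
  proof -
    have [measurable]: "noise (real k * (T / 2^n)) \<in> borel_measurable M" for k using T by (intro noise_meas) simp
    show ?thesis unfolding E_def by measurable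
  qed
  have st: "prob (E n \<inter> below Z K T) \<le> V / \<delta>\<^sup>2" for n K
  proof -
    have eq: "E n \<inter> below Z K T = {\<omega>\<in>below Z K T. \<exists>k\<le>(2::nat)^n. \<delta> < \<bar>noise (real k * (T / 2^n)) \<omega> - x0\<bar>}"
      by (auto simp: E_def below_def)
    have "z * prob (E n \<inter> below Z K T) \<le> V / \<delta>\<^sup>2" if z: "0 < z" "z < 1" for z
    proof -
      have s: "0 < sqrt z" "sqrt z < 1" using z by auto
      have "prob (E n \<inter> below Z K T) \<le> V / (\<delta> * sqrt z)\<^sup>2"
        unfolding eq V_def by (rule maximal_stopped_grid[OF T]) (use s \<delta> in auto)
      then show ?thesis using z \<delta> by (simp add: power_mult_distrib field_simps)
    qed
    then show ?thesis by (rule field_le_mult_one_interval)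
  qed
  have En: "prob (E n) \<le> V / \<delta>\<^sup>2" for n
  proof -
    have "prob (E n) \<le> V / \<delta>\<^sup>2 + prob (space M - below Z (real K) T)" for K :: nat
    proof -
      have bm: "below Z (real K) T \<in> sets M" by (rule below_M[OF Z_ca]) (use T in simp)
      have "prob (E n) \<le> prob ((E n \<inter> below Z (real K) T) \<union> (space M - below Z (real K) T))"
        by (rule finite_measure_mono) (use sets.sets_into_space[OF Em[of n]] Em[of n] bm in auto)
      also have "\<dots> \<le> prob (E n \<inter> below Z (real K) T) + prob (space M - below Z (real K) T)"
        by (rule measure_Un_le) (use Em[of n] bm in auto)
      finally show ?thesis using st[of n "real K"] by linarith
    qed
    moreover have "(\<lambda>K. V / \<delta>\<^sup>2 + prob (space M - below Z (real K) T)) \<longlonglongrightarrow> V / \<delta>\<^sup>2 + 0"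
      by (intro tendsto_intros below_exhausts(1)[OF Z_ca]) (use T in simp)
    ultimately show ?thesis by (intro LIMSEQ_le_const[of _ "V / \<delta>\<^sup>2"]) auto
  qed
  have "(\<lambda>n. prob (E n)) \<longlonglongrightarrow> prob (\<Union>n. E n)"
  proof (rule finite_Lim_measure_incseq)
    show "range E \<subseteq> events" using Em by auto
    show "incseq E"
    proof (rule incseq_SucI, rule subsetI)
      fix n \<omega> assume "\<omega> \<in> E n"
      then obtain k where k: "\<omega> \<in> space M" "k \<le> 2^n" "\<delta> < \<bar>noise (real k * (T / 2^n)) \<omega> - x0\<bar>" by (auto simp: E_def)
      have "real (2 * k) * (T / 2^Suc n) = real k * (T / 2^n)" by simp
      then have "\<delta> < \<bar>noise (real (2 * k) * (T / 2^Suc n)) \<omega> - x0\<bar>" using k by (simp only:)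
      then show "\<omega> \<in> E (Suc n)" using k unfolding E_def by (intro CollectI conjI exI[of _ "2 * k"]) auto
    qed
  qed
  moreover have "(\<Union>n. E n) = {\<omega>\<in>space M. \<exists>s\<in>{0..T}. \<delta> < \<bar>noise s \<omega> - x0\<bar>}"
    using noise_exceed_meas(2)[of T \<delta>] T by (simp add: E_def)
  ultimately have "(\<lambda>n. prob (E n)) \<longlonglongrightarrow> prob {\<omega>\<in>space M. \<exists>s\<in>{0..T}. \<delta> < \<bar>noise s \<omega> - x0\<bar>}" by simp
  then show ?thesis using En unfolding V_def by (intro LIMSEQ_le_const2) auto
qed

end

definition tail_weight :: "real \<Rightarrow> nat \<Rightarrow> real" where
  "tail_weight lam k = real (Suc k) * exp (lam * real (Suc k)) / (exp (3/4 * lam * real k))\<^sup>2"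

lemma tail_weight_summable: "0 < lam \<Longrightarrow> summable (tail_weight lam)"
proof -
  assume l: "0 < lam"
  have "norm (exp (- lam / 2)) < 1" using l by simp
  from geometric_deriv_sums[OF this] have "summable (\<lambda>n. of_nat (Suc n) * exp (- lam / 2) ^ n)" by (rule sums_summable)
  then have "summable (\<lambda>n. exp lam * (of_nat (Suc n) * exp (- lam / 2) ^ n))" by (rule summable_mult)
  moreover have "exp lam * (of_nat (Suc n) * exp (- lam / 2) ^ n) = tail_weight lam n" for n
  proof -
    have "exp (lam * real (Suc n)) / (exp (3/4 * lam * real n))\<^sup>2 = exp (lam * real (Suc n) - 2 * (3/4 * lam * real n))"
      by (simp only: exp_diff exp_double)
    also have "lam * real (Suc n) - 2 * (3/4 * lam * real n) = lam + real n * (- lam / 2)" by (simp add: algebra_simps)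
    also have "exp \<dots> = exp lam * exp (- lam / 2) ^ n" by (simp only: exp_add exp_of_nat_mult)
    finally show ?thesis unfolding tail_weight_def by (simp add: field_simps)
  qed
  ultimately show ?thesis by (simp only:)
qed

context sde begin

lemma noise_tail:
  assumes \<kappa>: "0 < \<kappa>"
  shows "\<exists>Bad\<in>sets M. prob Bad \<le> c / x0 / \<kappa>\<^sup>2 * (\<Sum>k. tail_weight lam (k + n)) \<and>
    (\<forall>\<omega>\<in>space M - Bad. \<forall>s\<ge>real n. \<bar>noise s \<omega> - x0\<bar> \<le> \<kappa> * x0 * exp (3/4 * lam * s))"
proof -
  define \<delta> where "\<delta> k = \<kappa> * x0 * exp (3/4 * lam * real k)" for k :: nat
  have \<delta>: "0 < \<delta> k" for k using \<kappa> x0 by (simp add: \<delta>_def)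
  define E where "E k = {\<omega>\<in>space M. \<exists>s\<in>{0..real (Suc (k + n))}. \<delta> (k + n) < \<bar>noise s \<omega> - x0\<bar>}" for k
  have Em: "E k \<in> sets M" for k unfolding E_def by (rule noise_exceed_meas(1)) simp
  have Ep: "prob (E k) \<le> c / x0 / \<kappa>\<^sup>2 * tail_weight lam (k + n)" for k
  proof -
    have "prob (E k) \<le> c * x0 * real (Suc (k + n)) * exp (lam * real (Suc (k + n))) / (\<delta> (k + n))\<^sup>2"
      unfolding E_def by (rule noise_maximal[OF _ \<delta>]) simp
    also have "\<dots> = c / x0 / \<kappa>\<^sup>2 * tail_weight lam (k + n)"
      unfolding tail_weight_def \<delta>_def using x0 \<kappa> by (simp add: power_mult_distrib power2_eq_square field_simps del: of_nat_Suc)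
    finally show ?thesis .
  qed
  have sm: "summable (\<lambda>k. c / x0 / \<kappa>\<^sup>2 * tail_weight lam (k + n))"
    using tail_weight_summable[OF lam] by (intro summable_mult) simp
  have smE: "summable (\<lambda>k. prob (E k))"
    by (rule summable_comparison_test'[OF sm]) (use Ep in simp)
  show ?thesis
  proof (intro bexI[of _ "\<Union>k. E k"] conjI ballI allI impI)
    show "(\<Union>k. E k) \<in> events" using Em by auto
    have "prob (\<Union>k. E k) \<le> (\<Sum>k. prob (E k))" by (rule finite_measure_subadditive_countably) (use Em smE in auto)
    also have "\<dots> \<le> (\<Sum>k. c / x0 / \<kappa>\<^sup>2 * tail_weight lam (k + n))" by (rule suminf_le[OF Ep smE sm])
    also have "\<dots> = c / x0 / \<kappa>\<^sup>2 * (\<Sum>k. tail_weight lam (k + n))"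
      using tail_weight_summable[OF lam] by (intro suminf_mult) simp
    finally show "prob (\<Union>k. E k) \<le> c / x0 / \<kappa>\<^sup>2 * (\<Sum>k. tail_weight lam (k + n))" .
    fix \<omega> s assume w: "\<omega> \<in> space M - (\<Union>k. E k)" and s: "real n \<le> s"
    define k where "k = nat \<lfloor>s\<rfloor> - n"
    have nk: "k + n = nat \<lfloor>s\<rfloor>" using s by (simp add: k_def le_nat_floor)
    have ks: "real (k + n) \<le> s" "s \<le> real (Suc (k + n))" unfolding nk using s by linarith+
    have "\<bar>noise s \<omega> - x0\<bar> \<le> \<delta> (k + n)"
    proof (rule ccontr)
      assume "\<not> ?thesis"
      then have "\<omega> \<in> E k" unfolding E_def using w ks s by (intro CollectI conjI bexI[of _ s]) auto
      then show False using w by blast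
    qed
    also have "\<dots> \<le> \<kappa> * x0 * exp (3/4 * lam * s)" unfolding \<delta>_def using \<kappa> x0 lam ks(1) by (intro mult_left_mono) auto
    finally show "\<bar>noise s \<omega> - x0\<bar> \<le> \<kappa> * x0 * exp (3/4 * lam * s)" .
  qed
qed

end

section \<open>The flow and its rescaled limit\<close>

lemma barrier:
  fixes p p' :: "real \<Rightarrow> real"
  assumes t: "0 \<le> t" and c: "continuous_on {0..t} p" and p0: "p 0 \<le> 0"
    and d: "\<And>s. 0 < s \<Longrightarrow> s < t \<Longrightarrow> (p has_real_derivative p' s) (at s)"
    and le: "\<And>s. 0 < s \<Longrightarrow> s < t \<Longrightarrow> 0 < p s \<Longrightarrow> p' s \<le> 0"
  shows "p t \<le> 0"
proof (rule ccontr)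
  assume "\<not> p t \<le> 0"
  then have pt: "0 < p t" by simp
  define Q where "Q = {0..t} \<inter> p -` {..0}"
  have "closed Q" unfolding Q_def by (rule continuous_closed_preimage[OF c]) auto
  moreover have "bounded Q" unfolding Q_def by (rule bounded_subset[OF bounded_closed_interval[of 0 t]]) auto
  ultimately have "compact Q" by (simp add: compact_eq_bounded_closed)
  moreover have "0 \<in> Q" using p0 t by (simp add: Q_def)
  ultimately obtain s0 where s0: "s0 \<in> Q" "\<And>s. s \<in> Q \<Longrightarrow> s \<le> s0" using compact_attains_sup[of Q] by blast
  have s: "0 \<le> s0" "s0 \<le> t" "p s0 \<le> 0" using s0(1) by (auto simp: Q_def)
  then have st: "s0 < t" using pt by (cases "s0 = t") auto
  have pos: "0 < p r" if "s0 < r" "r \<le> t" for r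
  proof (rule ccontr)
    assume "\<not> 0 < p r"
    then have "r \<in> Q" using that s by (simp add: Q_def)
    then show False using s0(2)[of r] that by simp
  qed
  have "p t \<le> p s0"
  proof (rule DERIV_nonpos_imp_decreasing_open[OF less_imp_le[OF st]])
    show "\<exists>y. DERIV p r :> y \<and> y \<le> 0" if "s0 < r" "r < t" for r
      using d[of r] le[of r] pos[of r] that s by (intro exI[of _ "p' r"]) auto
    show "continuous_on {s0..t} p" using c s by (auto intro: continuous_on_subset)
  qed
  then show False using pt s by simp
qed

lemma at_within_Ici_interior: "(0::real) < s \<Longrightarrow> at s within {0..} = at s"
  by (intro at_within_interior) simp

locale dissipative_ode =
  fixes f f' :: "real \<Rightarrow> real" and lam C :: real
  assumes f_deriv: "\<And>x. 0 \<le> x \<Longrightarrow> (f has_real_derivative f' x) (at x within {0..})"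
    and f'_bound: "\<And>x. 0 \<le> x \<Longrightarrow> \<bar>f' x\<bar> \<le> lam + C * x"
    and f_zero: "f 0 = 0" and lam_pos: "0 < lam" and C_nonneg: "0 \<le> C"
    and dissip: "\<And>x y. 0 \<le> x \<Longrightarrow> 0 \<le> y \<Longrightarrow> (y - x) * (f y - f x) \<le> lam * (y - x)\<^sup>2"
begin

lemma f_cont: "continuous_on {0..} f"
  by (rule DERIV_continuous_on[of "{0..}" f f']) (use f_deriv in auto)

lemma f_le: "0 \<le> x \<Longrightarrow> f x \<le> lam * x"
  using dissip[of 0 x] f_zero by (cases "x = 0") (auto simp: power2_eq_square)

lemma f_lipschitz:
  assumes "0 \<le> x" "x \<le> R" "0 \<le> y" "y \<le> R"
  shows "\<bar>f x - f y\<bar> \<le> (lam + C * R) * \<bar>x - y\<bar>"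
proof -
  have "norm (f x - f y) \<le> (lam + C * R) * norm (x - y)"
  proof (rule field_differentiable_bound[where S = "{0..R}"])
    show "(f has_field_derivative f' z) (at z within {0..R})" if "z \<in> {0..R}" for z
      using f_deriv[of z] that by (auto intro: has_field_derivative_subset)
    show "norm (f' z) \<le> lam + C * R" if "z \<in> {0..R}" for z
    proof -
      have "\<bar>f' z\<bar> \<le> lam + C * z" using that by (intro f'_bound) simp
      also have "\<dots> \<le> lam + C * R" using that C_nonneg by (intro add_left_mono mult_left_mono) auto
      finally show ?thesis by simp
    qed
  qed (use assms in auto)
  then show ?thesis by simp
qed

definition is_sol :: "(real \<Rightarrow> real) \<Rightarrow> real \<Rightarrow> bool" where
  "is_sol u x \<longleftrightarrow> u 0 = x \<and> (\<forall>s\<ge>0. 0 \<le> u s) \<and> (\<forall>s\<ge>0. (u has_real_derivative f (u s)) (at s within {0..}))"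

lemma is_sol_cont: "is_sol u x \<Longrightarrow> continuous_on {0..} u"
  by (rule DERIV_continuous_on[of "{0..}" u "\<lambda>s. f (u s)"]) (auto simp: is_sol_def)

lemma is_sol_deriv: "is_sol u x \<Longrightarrow> 0 < s \<Longrightarrow> (u has_real_derivative f (u s)) (at s)"
  unfolding is_sol_def using at_within_Ici_interior[of s] by (metis less_imp_le)

lemma is_sol_monotone:
  assumes u: "is_sol u x" and v: "is_sol v y" and xy: "x \<le> y" and t: "0 \<le> t"
  shows "u t - v t \<le> 0"
proof -
  have "(u t - v t) * exp (- lam * t) \<le> 0"
  proof (rule barrier[OF t, where p = "\<lambda>t. (u t - v t) * exp (- lam * t)" and p' = "\<lambda>s. (f (u s) - f (v s)) * exp (- lam * s) + (u s - v s) * (exp (- lam * s) * (- lam))"])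
    have "continuous_on {0..t} u" "continuous_on {0..t} v"
      using is_sol_cont[OF u] is_sol_cont[OF v] by (auto intro: continuous_on_subset)
    then show "continuous_on {0..t} (\<lambda>t. (u t - v t) * exp (- lam * t))" by (intro continuous_intros)
    show "(u 0 - v 0) * exp (- lam * 0) \<le> 0" using u v xy by (simp add: is_sol_def)
    fix s assume s: "0 < s" "s < t"
    show "((\<lambda>t. (u t - v t) * exp (- lam * t)) has_real_derivative (f (u s) - f (v s)) * exp (- lam * s) + (u s - v s) * (exp (- lam * s) * (- lam))) (at s)"
      by (auto intro!: derivative_eq_intros is_sol_deriv[OF u s(1)] is_sol_deriv[OF v s(1)])
    assume "0 < (u s - v s) * exp (- lam * s)"
    then have pos: "0 < u s - v s" by (simp add: zero_less_mult_iff)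
    have "(u s - v s) * (f (u s) - f (v s)) \<le> (u s - v s) * (lam * (u s - v s))"
      using dissip[of "v s" "u s"] u v s by (simp add: is_sol_def power2_eq_square mult_ac)
    then have "f (u s) - f (v s) \<le> lam * (u s - v s)" using pos by simp
    then have "(f (u s) - f (v s) - lam * (u s - v s)) * exp (- lam * s) \<le> 0" by (intro mult_nonpos_nonneg) auto
    then show "(f (u s) - f (v s)) * exp (- lam * s) + (u s - v s) * (exp (- lam * s) * (- lam)) \<le> 0" by (simp add: algebra_simps)
  qed
  then show ?thesis by (simp add: mult_le_0_iff)
qed

lemma is_sol_contraction:
  assumes u: "is_sol u x" and v: "is_sol v y" and t: "0 \<le> t"
  shows "\<bar>u t - v t\<bar> \<le> exp (lam * t) * \<bar>x - y\<bar>"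
proof -
  define p where "p s = (u s - v s)\<^sup>2 * exp (- 2 * lam * s)" for s
  have "p t \<le> p 0"
  proof (rule DERIV_nonpos_imp_decreasing_open[OF t])
    have "continuous_on {0..t} u" "continuous_on {0..t} v"
      using is_sol_cont[OF u] is_sol_cont[OF v] by (auto intro: continuous_on_subset)
    then show "continuous_on {0..t} p" unfolding p_def by (intro continuous_intros)
    fix s assume s: "0 < s" "s < t"
    have d: "(p has_real_derivative 2 * (u s - v s) * (f (u s) - f (v s)) * exp (- 2 * lam * s) + (u s - v s)\<^sup>2 * (exp (- 2 * lam * s) * (- 2 * lam))) (at s)"
      unfolding p_def by (auto intro!: derivative_eq_intros is_sol_deriv[OF u s(1)] is_sol_deriv[OF v s(1)])
    have "(u s - v s) * (f (u s) - f (v s)) \<le> lam * (u s - v s)\<^sup>2"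
      using dissip[of "v s" "u s"] u v s by (simp add: is_sol_def)
    then have "2 * ((u s - v s) * (f (u s) - f (v s)) - lam * (u s - v s)\<^sup>2) \<le> 0" by simp
    then have "2 * ((u s - v s) * (f (u s) - f (v s)) - lam * (u s - v s)\<^sup>2) * exp (- 2 * lam * s) \<le> 0"
      by (rule mult_nonpos_nonneg) simp
    then have "2 * (u s - v s) * (f (u s) - f (v s)) * exp (- 2 * lam * s) + (u s - v s)\<^sup>2 * (exp (- 2 * lam * s) * (- 2 * lam)) \<le> 0"
      by (simp add: algebra_simps)
    then show "\<exists>y. DERIV p s :> y \<and> y \<le> 0" using d by blast
  qed
  then have "(u t - v t)\<^sup>2 * exp (- 2 * lam * t) \<le> (x - y)\<^sup>2" using u v by (simp add: p_def is_sol_def)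
  then have "(u t - v t)\<^sup>2 * exp (- 2 * lam * t) * exp (2 * lam * t) \<le> (x - y)\<^sup>2 * exp (2 * lam * t)" by (intro mult_right_mono) auto
  then have "(u t - v t)\<^sup>2 \<le> (x - y)\<^sup>2 * exp (2 * lam * t)" by (simp add: mult.assoc flip: exp_add)
  also have "\<dots> = (exp (lam * t) * \<bar>x - y\<bar>)\<^sup>2" by (simp add: power_mult_distrib mult.commute mult.left_commute flip: exp_double)
  finally have "\<bar>u t - v t\<bar> \<le> \<bar>exp (lam * t) * \<bar>x - y\<bar>\<bar>" by (simp only: abs_le_square_iff)
  then show ?thesis by (simp add: abs_mult)
qed

lemma zero_is_sol: "is_sol (\<lambda>_. 0) 0"
  by (simp add: is_sol_def f_zero)

lemma truncated_sol_is_sol: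
  assumes x: "0 \<le> x" and u0: "u 0 = x"
    and d: "\<And>s. 0 \<le> s \<Longrightarrow> (u has_real_derivative f (max 0 (min (u s) (x * exp (lam * s))))) (at s within {0..})"
  shows "is_sol u x"
proof -
  have c: "continuous_on {0..} u"
    by (rule DERIV_continuous_on[of "{0..}" u "\<lambda>s. f (max 0 (min (u s) (x * exp (lam * s))))"]) (use d in auto)
  have ds: "(u has_real_derivative f (max 0 (min (u s) (x * exp (lam * s))))) (at s)" if "0 < s" for s
    using d[of s] that by (simp add: at_within_Ici_interior)
  have nn: "0 \<le> u t" if t: "0 \<le> t" for t
  proof -
    have "- u t \<le> 0"
    proof (rule barrier[OF t, where p = "\<lambda>t. - u t" and p' = "\<lambda>s. - f (max 0 (min (u s) (x * exp (lam * s))))"])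
      show "continuous_on {0..t} (\<lambda>t. - u t)" using c by (auto intro!: continuous_intros intro: continuous_on_subset)
      show "- u 0 \<le> 0" using u0 x by simp
      show "((\<lambda>t. - u t) has_real_derivative - f (max 0 (min (u s) (x * exp (lam * s))))) (at s)" if "0 < s" for s
        using ds[OF that] by (rule DERIV_minus)
      show "- f (max 0 (min (u s) (x * exp (lam * s)))) \<le> 0" if "0 < - u s" for s
        using that by (simp add: max_def min_def f_zero)
    qed
    then show ?thesis by simp
  qed
  have up: "u t - x * exp (lam * t) \<le> 0" if t: "0 \<le> t" for t
  proof (rule barrier[OF t, where p = "\<lambda>t. u t - x * exp (lam * t)" and p' = "\<lambda>s. f (max 0 (min (u s) (x * exp (lam * s)))) - x * (exp (lam * s) * lam)"])
    show "continuous_on {0..t} (\<lambda>t. u t - x * exp (lam * t))" using c by (auto intro!: continuous_intros intro: continuous_on_subset)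
    show "u 0 - x * exp (lam * 0) \<le> 0" using u0 by simp
    show "((\<lambda>t. u t - x * exp (lam * t)) has_real_derivative f (max 0 (min (u s) (x * exp (lam * s)))) - x * (exp (lam * s) * lam)) (at s)" if "0 < s" for s
      by (auto intro!: derivative_eq_intros ds[OF that])
    show "f (max 0 (min (u s) (x * exp (lam * s)))) - x * (exp (lam * s) * lam) \<le> 0" if "0 < u s - x * exp (lam * s)" for s
      using that x f_le[of "x * exp (lam * s)"] by (simp add: max_def min_def mult_ac)
  qed
  have "max 0 (min (u s) (x * exp (lam * s))) = u s" if "0 \<le> s" for s using nn[OF that] up[OF that] by simp
  then show ?thesis unfolding is_sol_def using u0 nn d by simp
qed

end

lemma integral_has_real_derivative_Ici:
  fixes u :: "real \<Rightarrow> real"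
  assumes c: "continuous_on {0..} u" and t: "0 \<le> t"
  shows "((\<lambda>t. integral {0..t} u) has_real_derivative u t) (at t within {0..})"
proof -
  have "((\<lambda>t. integral {0..t} u) has_real_derivative u t) (at t within {0..t+1})"
    using c t by (intro integral_has_real_derivative) (auto intro: continuous_on_subset)
  moreover have "at t within {0..t+1} = at t within {0..}"
    by (rule at_within_nhd[of _ "{..<t+1}"]) auto
  ultimately show ?thesis by simp
qed

context dissipative_ode begin

definition rate :: "real \<Rightarrow> real \<Rightarrow> real" where "rate x s = lam + C * (x * exp (lam * s))"
definition weight :: "real \<Rightarrow> real \<Rightarrow> real" where "weight x s = 2 * (lam * s + C * x * (exp (lam * s) - 1) / lam)"
definition truncf :: "real \<Rightarrow> real \<Rightarrow> real \<Rightarrow> real" where "truncf x s v = f (max 0 (min v (x * exp (lam * s))))"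

lemma truncf_lipschitz:
  assumes x: "0 \<le> x"
  shows "\<bar>truncf x s v - truncf x s v'\<bar> \<le> rate x s * \<bar>v - v'\<bar>"
proof -
  let ?R = "x * exp (lam * s)"
  let ?k = "\<lambda>v. max 0 (min v ?R)"
  have R: "0 \<le> ?R" using x by simp
  have "\<bar>truncf x s v - truncf x s v'\<bar> \<le> (lam + C * ?R) * \<bar>?k v - ?k v'\<bar>"
    unfolding truncf_def by (rule f_lipschitz) (use R in auto)
  also have "\<dots> \<le> (lam + C * ?R) * \<bar>v - v'\<bar>"
    using R lam_pos C_nonneg by (intro mult_left_mono) (auto simp: max_def min_def)
  finally show ?thesis by (simp add: rate_def)
qed

lemma truncf_bound: "0 \<le> x \<Longrightarrow> \<bar>truncf x s v\<bar> \<le> rate x s * \<bar>v\<bar>"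
  using truncf_lipschitz[of x s v 0] by (simp add: truncf_def f_zero)

lemma truncf_cont:
  assumes "0 \<le> x" "continuous_on S v"
  shows "continuous_on S (\<lambda>s. truncf x s (v s))"
  unfolding truncf_def by (rule continuous_on_compose2[OF f_cont]) (auto intro!: continuous_intros assms)

lemma weight_integral:
  assumes "0 \<le> \<tau>"
  shows "((\<lambda>s. rate x s * exp (weight x s)) has_integral (exp (weight x \<tau>) - 1) / 2) {0..\<tau>}"
proof -
  have "((\<lambda>s. rate x s * exp (weight x s)) has_integral (exp (weight x \<tau>) / 2 - exp (weight x 0) / 2)) {0..\<tau>}"
  proof (rule fundamental_theorem_of_calculus[OF assms])
    fix s
    have "((\<lambda>s. exp (weight x s) / 2) has_real_derivative rate x s * exp (weight x s)) (at s within {0..\<tau>})"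
      unfolding weight_def rate_def using lam_pos by (auto intro!: derivative_eq_intros simp: field_simps)
    then show "((\<lambda>s. exp (weight x s) / 2) has_vector_derivative rate x s * exp (weight x s)) (at s within {0..\<tau>})"
      by (simp add: has_real_derivative_iff_has_vector_derivative)
  qed
  then show ?thesis by (simp add: weight_def diff_divide_distrib)
qed

lemma weighted_integral_bound:
  assumes \<tau>: "0 \<le> \<tau>" and h: "continuous_on {0..\<tau>} h" and le: "\<And>s. 0 \<le> s \<Longrightarrow> \<bar>h s\<bar> \<le> k * (rate x s * exp (weight x s))" and k: "0 \<le> k"
  shows "exp (- weight x \<tau>) * \<bar>integral {0..\<tau>} h\<bar> \<le> k / 2"
proof -
  note wi = weight_integral[OF \<tau>, of x]
  have "norm (integral {0..\<tau>} h) \<le> integral {0..\<tau>} (\<lambda>s. k * (rate x s * exp (weight x s)))"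
    by (rule integral_norm_bound_integral[OF integrable_continuous_interval[OF h]])
      (use le has_integral_integrable[OF has_integral_mult_right[OF wi, of k]] in auto)
  also have "\<dots> = k * ((exp (weight x \<tau>) - 1) / 2)" by (rule integral_unique[OF has_integral_mult_right[OF wi]])
  finally have "exp (- weight x \<tau>) * \<bar>integral {0..\<tau>} h\<bar> \<le> exp (- weight x \<tau>) * (k * ((exp (weight x \<tau>) - 1) / 2))"
    by (intro mult_left_mono) auto
  also have "\<dots> = k / 2 * (1 - exp (- weight x \<tau>))" by (simp add: exp_minus field_simps)
  also have "\<dots> \<le> k / 2 * 1" using k by (intro mult_left_mono) auto
  finally show ?thesis by simp
qed

definition picard :: "real \<Rightarrow> (real \<Rightarrow>\<^sub>C real) \<Rightarrow> real \<Rightarrow> real" where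
  "picard x w t = exp (- weight x (max 0 t)) * (x + integral {0..max 0 t} (\<lambda>s. truncf x s (exp (weight x s) * apply_bcontfun w s)))"

lemma weight_cont: "continuous_on S (weight x)"
  unfolding weight_def using lam_pos by (auto intro!: continuous_intros)

lemma weight_nonneg: "0 \<le> x \<Longrightarrow> 0 \<le> s \<Longrightarrow> 0 \<le> weight x s"
  unfolding weight_def using lam_pos C_nonneg by (auto intro!: add_nonneg_nonneg mult_nonneg_nonneg divide_nonneg_pos)

lemma picard_integrand_cont: "0 \<le> x \<Longrightarrow> continuous_on S (\<lambda>s. truncf x s (exp (weight x s) * apply_bcontfun w s))"
  by (intro truncf_cont continuous_intros weight_cont) auto

lemma picard_bcontfun:
  assumes x: "0 \<le> x"
  shows "picard x w \<in> bcontfun"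
  unfolding bcontfun_def
proof (intro CollectI conjI)
  let ?h = "\<lambda>s. truncf x s (exp (weight x s) * apply_bcontfun w s)"
  have "isCont (picard x w) t" for t
  proof -
    let ?T = "\<bar>t\<bar> + 1"
    have J: "continuous_on {0..?T} (\<lambda>\<tau>. exp (- weight x \<tau>) * (x + integral {0..\<tau>} ?h))"
      by (intro continuous_intros weight_cont indefinite_integral_continuous_1 integrable_continuous_interval picard_integrand_cont x)
    have "continuous_on {..<?T} (picard x w)"
      unfolding picard_def by (rule continuous_on_compose2[OF J]) (auto intro!: continuous_intros)
    then show ?thesis by (subst (asm) continuous_on_eq_continuous_at) auto
  qed
  then show "continuous_on UNIV (picard x w)" by (simp add: continuous_at_imp_continuous_on)
  obtain k where k: "\<And>s. \<bar>apply_bcontfun w s\<bar> \<le> k"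
    using bounded_apply_bcontfun[of w] unfolding bounded_iff by auto
  have k0: "0 \<le> k" using k[of 0] by linarith
  have "\<bar>picard x w t\<bar> \<le> x + k / 2" for t
  proof -
    let ?\<tau> = "max 0 t"
    have "exp (- weight x ?\<tau>) * \<bar>integral {0..?\<tau>} ?h\<bar> \<le> k / 2"
    proof (rule weighted_integral_bound[OF _ picard_integrand_cont[OF x] _ k0])
      fix s :: real assume s: "0 \<le> s"
      have "\<bar>?h s\<bar> \<le> rate x s * \<bar>exp (weight x s) * apply_bcontfun w s\<bar>" by (rule truncf_bound[OF x])
      also have "\<dots> \<le> rate x s * (exp (weight x s) * k)"
        using k[of s] x lam_pos C_nonneg by (intro mult_left_mono) (auto simp: abs_mult rate_def)
      finally show "\<bar>?h s\<bar> \<le> k * (rate x s * exp (weight x s))" by (simp add: mult_ac)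
    qed simp
    moreover have "exp (- weight x ?\<tau>) * x \<le> 1 * x" using weight_nonneg[OF x, of ?\<tau>] x by (intro mult_right_mono) auto
    moreover have "\<bar>picard x w t\<bar> \<le> exp (- weight x ?\<tau>) * x + exp (- weight x ?\<tau>) * \<bar>integral {0..?\<tau>} ?h\<bar>"
      unfolding picard_def abs_mult using x by (simp flip: distrib_left)
    ultimately show ?thesis by linarith
  qed
  then show "bounded (range (picard x w))" unfolding bounded_iff by (intro exI[of _ "x + k / 2"]) auto
qed

lemma sol_exists:
  assumes x: "0 \<le> x"
  shows "\<exists>u. is_sol u x"
proof -
  define P where "P w = Bcontfun (picard x w)" for w
  have Papp: "apply_bcontfun (P w) = picard x w" for w unfolding P_def by (rule Bcontfun_inverse[OF picard_bcontfun[OF x]])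
  have "dist (P w) (P v) \<le> 1/2 * dist w v" for w v
  proof (rule dist_bound)
    fix t :: real
    let ?\<tau> = "max 0 t"
    let ?h = "\<lambda>w s. truncf x s (exp (weight x s) * apply_bcontfun w s)"
    have hi: "?h w integrable_on {0..?\<tau>}" for w by (intro integrable_continuous_interval picard_integrand_cont x)
    have "dist (apply_bcontfun (P w) t) (apply_bcontfun (P v) t) = exp (- weight x ?\<tau>) * \<bar>integral {0..?\<tau>} (\<lambda>s. ?h w s - ?h v s)\<bar>"
    proof -
      have "picard x w t - picard x v t = exp (- weight x ?\<tau>) * integral {0..?\<tau>} (\<lambda>s. ?h w s - ?h v s)"
        unfolding picard_def Henstock_Kurzweil_Integration.integral_diff[OF hi hi] by (simp add: algebra_simps)
      then show ?thesis by (simp add: Papp dist_real_def abs_mult)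
    qed
    also have "\<dots> \<le> dist w v / 2"
    proof (rule weighted_integral_bound)
      show "continuous_on {0..?\<tau>} (\<lambda>s. ?h w s - ?h v s)" by (intro continuous_intros picard_integrand_cont x)
      fix s :: real assume s: "0 \<le> s"
      have "\<bar>?h w s - ?h v s\<bar> \<le> rate x s * \<bar>exp (weight x s) * apply_bcontfun w s - exp (weight x s) * apply_bcontfun v s\<bar>"
        by (rule truncf_lipschitz[OF x])
      also have "\<dots> = rate x s * exp (weight x s) * dist (apply_bcontfun w s) (apply_bcontfun v s)"
        by (simp add: dist_real_def abs_mult flip: right_diff_distrib)
      also have "\<dots> \<le> rate x s * exp (weight x s) * dist w v"
        using x lam_pos C_nonneg by (intro mult_left_mono dist_bounded) (auto simp: rate_def)
      finally show "\<bar>?h w s - ?h v s\<bar> \<le> dist w v * (rate x s * exp (weight x s))" by (simp add: mult_ac)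
    qed simp_all
    finally show "dist (apply_bcontfun (P w) t) (apply_bcontfun (P v) t) \<le> 1/2 * dist w v" by simp
  qed
  then have "\<exists>!w. P w = w" by (intro banach_fix_type[of "1/2"]) auto
  then obtain w where w: "P w = w" by blast
  define u where "u t = exp (weight x t) * apply_bcontfun w t" for t
  have ueq: "u t = x + integral {0..t} (\<lambda>s. truncf x s (u s))" if t: "0 \<le> t" for t
  proof -
    have "apply_bcontfun w t = picard x w t" using fun_cong[OF Papp[of w], of t] unfolding w .
    also have "picard x w t = exp (- weight x t) * (x + integral {0..t} (\<lambda>s. truncf x s (u s)))"
      using t by (simp add: picard_def u_def max_def)
    finally show ?thesis unfolding u_def[of t] by (simp add: exp_minus)
  qed
  have ic: "continuous_on {0..} (\<lambda>s. truncf x s (u s))" unfolding u_def by (rule picard_integrand_cont[OF x])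
  have "is_sol u x"
  proof (rule truncated_sol_is_sol[OF x])
    show "u 0 = x" using ueq[of 0] by simp
    fix s :: real assume s: "0 \<le> s"
    have "((\<lambda>t. x + integral {0..t} (\<lambda>s. truncf x s (u s))) has_real_derivative 0 + truncf x s (u s)) (at s within {0..})"
      by (intro DERIV_add DERIV_const integral_has_real_derivative_Ici ic s)
    then have "(u has_real_derivative 0 + truncf x s (u s)) (at s within {0..})"
      by (rule has_field_derivative_transform_within[where d = 1]) (use s ueq in auto)
    then show "(u has_real_derivative f (max 0 (min (u s) (x * exp (lam * s))))) (at s within {0..})" by (simp add: truncf_def)
  qed
  then show ?thesis by blast
qed

abbreviation flow :: "real \<Rightarrow> real \<Rightarrow> real" where "flow \<equiv> ode_flow f"

lemma flow_eq: "is_sol u x \<Longrightarrow> 0 \<le> t \<Longrightarrow> flow t x = u t"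
  unfolding ode_flow_def
proof (rule the_equality)
  assume u: "is_sol u x" and t: "0 \<le> t"
  then show "\<exists>v. v 0 = x \<and> (\<forall>s\<ge>0. 0 \<le> v s) \<and> (\<forall>s\<ge>0. (v has_real_derivative f (v s)) (at s within {0..})) \<and> v t = u t"
    by (auto simp: is_sol_def)
  fix y assume "\<exists>v. v 0 = x \<and> (\<forall>s\<ge>0. 0 \<le> v s) \<and> (\<forall>s\<ge>0. (v has_real_derivative f (v s)) (at s within {0..})) \<and> v t = y"
  then obtain v where "is_sol v x" "v t = y" by (auto simp: is_sol_def)
  then show "y = u t" using is_sol_contraction[OF u, of v x t] t by simp
qed

lemma flow_sol: assumes "0 \<le> x" shows "is_sol (\<lambda>t. flow t x) x"
proof -
  obtain u where u: "is_sol u x" using sol_exists[OF assms] by blast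
  have e: "flow t x = u t" if "0 \<le> t" for t using flow_eq[OF u that] .
  have "((\<lambda>t. flow t x) has_real_derivative f (flow s x)) (at s within {0..})" if s: "0 \<le> s" for s
  proof -
    have "(u has_real_derivative f (flow s x)) (at s within {0..})" using u s e by (simp add: is_sol_def)
    then show ?thesis by (rule has_field_derivative_transform_within[where d = 1]) (use s e in auto)
  qed
  then show ?thesis using u e by (simp add: is_sol_def)
qed

lemma flow_nonneg: "0 \<le> x \<Longrightarrow> 0 \<le> t \<Longrightarrow> 0 \<le> flow t x"
  using flow_sol[of x] by (simp add: is_sol_def)

lemma flow_0: "0 \<le> x \<Longrightarrow> flow 0 x = x"
  using flow_sol[of x] by (simp add: is_sol_def)

lemma flow_cont: "0 \<le> x \<Longrightarrow> continuous_on {0..} (\<lambda>t. flow t x)"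
  by (rule is_sol_cont[OF flow_sol])

lemma flow_contraction: "0 \<le> x \<Longrightarrow> 0 \<le> y \<Longrightarrow> 0 \<le> t \<Longrightarrow> \<bar>flow t x - flow t y\<bar> \<le> exp (lam * t) * \<bar>x - y\<bar>"
  by (rule is_sol_contraction[OF flow_sol flow_sol])

lemma flow_mono: "0 \<le> x \<Longrightarrow> x \<le> y \<Longrightarrow> 0 \<le> t \<Longrightarrow> flow t x \<le> flow t y"
  using is_sol_monotone[OF flow_sol flow_sol, of x y t] by simp

lemma flow_growth: "0 \<le> x \<Longrightarrow> 0 \<le> t \<Longrightarrow> flow t x \<le> x * exp (lam * t)"
  using is_sol_contraction[OF flow_sol zero_is_sol, of x t] by (simp add: mult.commute)

lemma flow_semigroup:
  assumes x: "0 \<le> x" and s: "0 \<le> s" and t: "0 \<le> t"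
  shows "flow (s + t) x = flow t (flow s x)"
proof -
  have "is_sol (\<lambda>r. flow (s + r) x) (flow s x)"
    unfolding is_sol_def
  proof (intro conjI allI impI)
    fix r :: real assume r: "0 \<le> r"
    show "0 \<le> flow (s + r) x" using x s r by (intro flow_nonneg) auto
    have "((\<lambda>t. flow t x) has_real_derivative f (flow (s + r) x)) (at (s + r) within {0..})"
      using flow_sol[OF x] s r by (simp add: is_sol_def)
    then have "((\<lambda>t. flow t x) has_real_derivative f (flow (s + r) x)) (at (s + r) within ((+) s ` {0..}))"
      by (rule has_field_derivative_subset) (use s in auto)
    moreover have "((+) s has_real_derivative 1) (at r within {0..})" by (auto intro!: derivative_eq_intros)
    ultimately have "((\<lambda>t. flow t x) \<circ> (+) s has_real_derivative f (flow (s + r) x) * 1) (at r within {0..})"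
      by (rule DERIV_image_chain)
    then show "((\<lambda>r. flow (s + r) x) has_real_derivative f (flow (s + r) x)) (at r within {0..})" by (simp add: o_def)
  qed simp
  from flow_eq[OF this t] show ?thesis by simp
qed

definition Hflow :: "real \<Rightarrow> real \<Rightarrow> real" where "Hflow t x = flow t (x * exp (- lam * t))"

lemma Hflow_antimono:
  assumes x: "0 \<le> x" and s: "0 \<le> s" and st: "s \<le> t"
  shows "Hflow t x \<le> Hflow s x"
proof -
  define y where "y = x * exp (- lam * t)"
  have y: "0 \<le> y" using x by (simp add: y_def)
  have "Hflow t x = flow ((t - s) + s) y" by (simp add: Hflow_def y_def)
  also have "\<dots> = flow s (flow (t - s) y)" using y s st by (intro flow_semigroup) auto
  also have "\<dots> \<le> flow s (x * exp (- lam * s))"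
  proof (rule flow_mono[OF flow_nonneg _ s])
    have "flow (t - s) y \<le> y * exp (lam * (t - s))" using y st by (intro flow_growth) auto
    also have "\<dots> = x * exp (- lam * s)" by (simp add: y_def algebra_simps flip: exp_add)
    finally show "flow (t - s) y \<le> x * exp (- lam * s)" .
  qed (use y st in auto)
  finally show ?thesis by (simp add: Hflow_def)
qed

lemma Hflow_nonneg: "0 \<le> x \<Longrightarrow> 0 \<le> t \<Longrightarrow> 0 \<le> Hflow t x"
  by (simp add: Hflow_def flow_nonneg)

lemma Hflow_lipschitz:
  assumes "0 \<le> x" "0 \<le> y" "0 \<le> t"
  shows "\<bar>Hflow t x - Hflow t y\<bar> \<le> \<bar>x - y\<bar>"
proof -
  have "\<bar>Hflow t x - Hflow t y\<bar> \<le> exp (lam * t) * \<bar>x * exp (- lam * t) - y * exp (- lam * t)\<bar>"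
    unfolding Hflow_def using assms by (intro flow_contraction) auto
  also have "\<dots> = \<bar>x - y\<bar>" by (simp add: abs_mult exp_minus field_simps flip: left_diff_distrib)
  finally show ?thesis .
qed

lemma Hflow_convergent: assumes x: "0 \<le> x" shows "\<exists>L. ((\<lambda>t. Hflow t x) \<longlongrightarrow> L) at_top"
proof -
  define L where "L = (INF t\<in>{0..}. Hflow t x)"
  have bd: "bdd_below ((\<lambda>t. Hflow t x) ` {0..})" using Hflow_nonneg[OF x] by (intro bdd_belowI[of _ 0]) auto
  have "((\<lambda>t. Hflow t x) \<longlongrightarrow> L) at_top"
  proof (rule decreasing_tendsto)
    show "\<forall>\<^sub>F t in at_top. L \<le> Hflow t x"
      using eventually_ge_at_top[of 0] by eventually_elim (auto simp: L_def intro!: cINF_lower bd)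
    fix y assume "L < y"
    then obtain s where s: "0 \<le> s" "Hflow s x < y" unfolding L_def using cINF_less_iff[of "{0..}" "\<lambda>t. Hflow t x" y] bd by auto
    show "\<forall>\<^sub>F t in at_top. Hflow t x < y"
      using eventually_ge_at_top[of s] by eventually_elim (use Hflow_antimono[OF x s(1)] s(2) in \<open>auto intro: le_less_trans\<close>)
  qed
  then show ?thesis by blast
qed

definition Hlim :: "real \<Rightarrow> real" where "Hlim x = Lim at_top (\<lambda>t. flow t (x * exp (- lam * t)))"

lemma Hflow_tendsto: "0 \<le> x \<Longrightarrow> ((\<lambda>t. Hflow t x) \<longlongrightarrow> Hlim x) at_top"
  using Hflow_convergent[of x] unfolding Hlim_def Hflow_def by (metis tendsto_Lim trivial_limit_at_top_linorder)

lemma Hlim_nonneg: "0 \<le> x \<Longrightarrow> 0 \<le> Hlim x"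
  by (rule tendsto_lowerbound[OF Hflow_tendsto]) (auto intro!: eventually_mono[OF eventually_ge_at_top[of 0]] Hflow_nonneg)

lemma Hlim_lipschitz:
  assumes "0 \<le> x" "0 \<le> y"
  shows "\<bar>Hlim x - Hlim y\<bar> \<le> \<bar>x - y\<bar>"
proof (rule tendsto_upperbound)
  show "((\<lambda>t. \<bar>Hflow t x - Hflow t y\<bar>) \<longlongrightarrow> \<bar>Hlim x - Hlim y\<bar>) at_top"
    by (intro tendsto_intros Hflow_tendsto assms)
  show "\<forall>\<^sub>F t in at_top. \<bar>Hflow t x - Hflow t y\<bar> \<le> \<bar>x - y\<bar>"
    using eventually_ge_at_top[of 0] by eventually_elim (rule Hflow_lipschitz[OF assms])
qed simp

lemma Hflow_uniform:
  assumes \<theta>: "0 < \<theta>"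
  shows "\<forall>\<^sub>F t in at_top. \<forall>x\<in>{0..K}. \<bar>Hflow t x - Hlim x\<bar> \<le> 3 * \<theta>"
proof -
  define J where "J = nat \<lceil>K / \<theta>\<rceil>"
  have "\<forall>\<^sub>F t in at_top. \<forall>j\<in>{..J}. \<bar>Hflow t (real j * \<theta>) - Hlim (real j * \<theta>)\<bar> < \<theta>"
  proof (rule eventually_ball_finite)
    show "\<forall>j\<in>{..J}. \<forall>\<^sub>F t in at_top. \<bar>Hflow t (real j * \<theta>) - Hlim (real j * \<theta>)\<bar> < \<theta>"
    proof
      fix j
      have "((\<lambda>t. Hflow t (real j * \<theta>)) \<longlongrightarrow> Hlim (real j * \<theta>)) at_top" using \<theta> by (intro Hflow_tendsto) simp
      from tendstoD[OF this \<theta>] show "\<forall>\<^sub>F t in at_top. \<bar>Hflow t (real j * \<theta>) - Hlim (real j * \<theta>)\<bar> < \<theta>" by (simp add: dist_real_def)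
    qed
  qed simp
  then show ?thesis using eventually_ge_at_top[of 0]
  proof eventually_elim
    case (elim t)
    show ?case
    proof
      fix x assume x: "x \<in> {0..K}"
      define j where "j = nat \<lfloor>x / \<theta>\<rfloor>"
      have "real j * \<theta> \<le> x" "x < (real j + 1) * \<theta>" unfolding j_def using grid_floor[OF \<theta>, of x] x by auto
      then have xj: "\<bar>x - real j * \<theta>\<bar> \<le> \<theta>" by (simp add: algebra_simps)
      have "x / \<theta> \<le> K / \<theta>" using x \<theta> by (simp add: divide_right_mono)
      then have "\<lfloor>x / \<theta>\<rfloor> \<le> \<lceil>K / \<theta>\<rceil>" by linarith
      then have "j \<le> J" unfolding j_def J_def by (rule nat_mono)
      then have 1: "\<bar>Hflow t (real j * \<theta>) - Hlim (real j * \<theta>)\<bar> < \<theta>" using elim by auto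
      have 2: "\<bar>Hflow t x - Hflow t (real j * \<theta>)\<bar> \<le> \<theta>" using Hflow_lipschitz[of x "real j * \<theta>" t] x \<theta> elim(2) xj by simp
      have 3: "\<bar>Hlim x - Hlim (real j * \<theta>)\<bar> \<le> \<theta>" using Hlim_lipschitz[of x "real j * \<theta>"] x \<theta> xj by simp
      from 1 2 3 show "\<bar>Hflow t x - Hlim x\<bar> \<le> 3 * \<theta>" by linarith
    qed
  qed
qed

end

section \<open>Convergence to the fluid limit\<close>

lemma DERIV_nonpos_imp_le:
  fixes p p' :: "real \<Rightarrow> real"
  assumes ab: "a \<le> t" and c: "continuous_on {a..t} p"
    and d: "\<And>s. a < s \<Longrightarrow> s < t \<Longrightarrow> (p has_real_derivative p' s) (at s)" and le: "\<And>s. a < s \<Longrightarrow> s < t \<Longrightarrow> p' s \<le> 0"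
  shows "p t \<le> p a"
  by (rule DERIV_nonpos_imp_decreasing_open[OF ab _ c]) (use d le in blast)

context sde begin

definition drift_part :: "real \<Rightarrow> 'a \<Rightarrow> real" where
  "drift_part t \<omega> = integral {0..t} (\<lambda>r. b (Z r \<omega>))"

lemma drift_part_deriv: "\<omega> \<in> space M \<Longrightarrow> 0 \<le> t \<Longrightarrow> ((\<lambda>t. drift_part t \<omega>) has_real_derivative b (Z t \<omega>)) (at t within {0..})"
  unfolding drift_part_def using bZ_ca by (intro integral_has_real_derivative_Ici) (auto simp: continuous_adapted_def)

lemma drift_part_deriv': "\<omega> \<in> space M \<Longrightarrow> 0 < t \<Longrightarrow> ((\<lambda>t. drift_part t \<omega>) has_real_derivative b (Z t \<omega>)) (at t)"
  using drift_part_deriv[of \<omega> t] by (simp add: at_within_Ici_interior)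

lemma drift_part_cont: "\<omega> \<in> space M \<Longrightarrow> S \<subseteq> {0..} \<Longrightarrow> continuous_on S (\<lambda>t. drift_part t \<omega>)"
  by (rule continuous_on_subset[OF DERIV_continuous_on[of "{0..}"]]) (use drift_part_deriv in auto)

lemma Z_split: "Z t \<omega> = drift_part t \<omega> + noise t \<omega>"
  by (simp add: noise_def drift_part_def)

lemma growth_bound:
  assumes w: "\<omega> \<in> space M" and \<kappa>: "0 < \<kappa>" and t: "0 \<le> t"
    and N: "\<And>s. 0 \<le> s \<Longrightarrow> s \<le> t \<Longrightarrow> \<bar>noise s \<omega> - x0\<bar> \<le> \<kappa> * x0 * exp (3/4 * lam * s)"
  shows "Z t \<omega> \<le> 5 * (1 + \<kappa>) * x0 * exp (lam * t)"
proof -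
  define m where "m = (1 + \<kappa>) * x0"
  have m0: "0 < m" using \<kappa> x0 by (simp add: m_def)
  have Nm: "noise s \<omega> \<le> m * exp (3/4 * lam * s)" if "0 \<le> s" "s \<le> t" for s
  proof -
    have "1 \<le> exp (3/4 * lam * s)" using lam that by simp
    then have "x0 * 1 \<le> x0 * exp (3/4 * lam * s)" using x0 by (intro mult_left_mono) auto
    moreover have "noise s \<omega> \<le> x0 + \<kappa> * x0 * exp (3/4 * lam * s)" using N[OF that] by linarith
    ultimately show ?thesis by (simp add: m_def algebra_simps)
  qed
  let ?V = "\<lambda>s. drift_part s \<omega>"
  define p where "p s = ?V s * exp (- lam * s) + 4 * m * exp (- lam / 4 * s)" for s
  have "p t \<le> p 0"
  proof (rule DERIV_nonpos_imp_le[OF t, where p' = "\<lambda>s. b (Z s \<omega>) * exp (- lam * s) + ?V s * (exp (- lam * s) * (- lam)) + 4 * m * (exp (- lam / 4 * s) * (- lam / 4))"])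
    show "continuous_on {0..t} p" unfolding p_def by (intro continuous_intros drift_part_cont[OF w]) auto
    fix s assume s: "0 < s" "s < t"
    show "(p has_real_derivative b (Z s \<omega>) * exp (- lam * s) + ?V s * (exp (- lam * s) * (- lam)) + 4 * m * (exp (- lam / 4 * s) * (- lam / 4))) (at s)"
      unfolding p_def by (auto intro!: derivative_eq_intros drift_part_deriv'[OF w s(1)])
    have "b (Z s \<omega>) - lam * ?V s \<le> lam * noise s \<omega>" using b_le[OF Z_nonneg[OF w, of s]] s Z_split[of s \<omega>] by (simp add: algebra_simps)
    also have "\<dots> \<le> lam * (m * exp (3/4 * lam * s))" using Nm[of s] s lam by (intro mult_left_mono) auto
    finally have "(b (Z s \<omega>) - lam * ?V s) * exp (- lam * s) \<le> lam * (m * exp (3/4 * lam * s)) * exp (- lam * s)" by (intro mult_right_mono) auto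
    also have "\<dots> = lam * m * exp (- lam / 4 * s)"
    proof -
      have "exp (3/4 * lam * s) * exp (- lam * s) = exp (- lam / 4 * s)" by (simp flip: exp_add)
      then show ?thesis by (metis mult.assoc)
    qed
    finally show "b (Z s \<omega>) * exp (- lam * s) + ?V s * (exp (- lam * s) * (- lam)) + 4 * m * (exp (- lam / 4 * s) * (- lam / 4)) \<le> 0"
      by (simp add: algebra_simps)
  qed
  moreover have "?V 0 = 0" by (simp add: drift_part_def)
  ultimately have "?V t * exp (- lam * t) + 4 * m * exp (- lam / 4 * t) \<le> 4 * m" by (simp add: p_def)
  moreover have "0 \<le> 4 * m * exp (- lam / 4 * t)" using m0 by simp
  ultimately have "?V t * exp (- lam * t) \<le> 4 * m" by linarith
  then have "?V t * exp (- lam * t) * exp (lam * t) \<le> 4 * m * exp (lam * t)" by (intro mult_right_mono) auto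
  then have "?V t \<le> 4 * m * exp (lam * t)" by (simp add: mult.assoc flip: exp_add)
  moreover have "noise t \<omega> \<le> m * exp (lam * t)"
  proof -
    have "3/4 * lam * t \<le> lam * t" using mult_nonneg_nonneg[of lam t] lam t by linarith
    then have "m * exp (3/4 * lam * t) \<le> m * exp (lam * t)" using m0 by (intro mult_left_mono) auto
    then show ?thesis using Nm[OF t order_refl] by linarith
  qed
  moreover have "5 * (1 + \<kappa>) * x0 * exp (lam * t) = 4 * m * exp (lam * t) + m * exp (lam * t)" by (simp add: m_def algebra_simps)
  ultimately show ?thesis using Z_split[of t \<omega>] by linarith
qed

lemma scaled_limit:
  assumes w: "\<omega> \<in> space M" and b: "\<And>x. b x = lam * x" and x01: "x0 = 1"
    and N: "\<And>s. real n \<le> s \<Longrightarrow> \<bar>noise s \<omega> - x0\<bar> \<le> 1 * x0 * exp (3/4 * lam * s)"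
  shows "\<exists>L. ((\<lambda>t. exp (- lam * t) * Z t \<omega>) \<longlongrightarrow> L) at_top \<and> 0 \<le> L \<and> (\<forall>u\<ge>real n. \<bar>exp (- lam * u) * Z u \<omega> - L\<bar> \<le> 12 * exp (- lam / 4 * u))"
proof -
  let ?V = "\<lambda>s. drift_part s \<omega>"
  define W where "W t = exp (- lam * t) * Z t \<omega>" for t
  have N2: "\<bar>exp (- lam * s) * noise s \<omega>\<bar> \<le> 2 * exp (- lam / 4 * s)" if s: "real n \<le> s" for s
  proof -
    have "1 \<le> exp (3/4 * lam * s)" using lam s by simp
    moreover have "\<bar>noise s \<omega> - 1\<bar> \<le> exp (3/4 * lam * s)" using N[OF s] by (simp add: x01)
    ultimately have "\<bar>noise s \<omega>\<bar> \<le> 2 * exp (3/4 * lam * s)" by linarith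
    then have "exp (- lam * s) * \<bar>noise s \<omega>\<bar> \<le> exp (- lam * s) * (2 * exp (3/4 * lam * s))" by (intro mult_left_mono) auto
    also have "\<dots> = 2 * exp (- lam / 4 * s)" by (simp flip: exp_add)
    finally show ?thesis by (simp add: abs_mult)
  qed
  have pd: "((\<lambda>s. ?V s * exp (- lam * s)) has_real_derivative lam * (exp (- lam * s) * noise s \<omega>)) (at s)" if "0 < s" for s
  proof -
    have "((\<lambda>s. ?V s * exp (- lam * s)) has_real_derivative b (Z s \<omega>) * exp (- lam * s) + exp (- lam * s) * (- lam) * ?V s) (at s)"
    proof (rule DERIV_mult[OF drift_part_deriv'[OF w that]])
      show "((\<lambda>s. exp (- lam * s)) has_real_derivative exp (- lam * s) * (- lam)) (at s)" by (auto intro!: derivative_eq_intros)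
    qed
    moreover have "b (Z s \<omega>) * exp (- lam * s) + exp (- lam * s) * (- lam) * ?V s = lam * (exp (- lam * s) * noise s \<omega>)"
    proof -
      have "b (Z s \<omega>) = lam * (?V s + noise s \<omega>)" by (simp only: b Z_split[of s \<omega>])
      then show ?thesis by (simp add: distrib_left distrib_right)
    qed
    ultimately show ?thesis by (simp only:)
  qed
  have cauchy: "\<bar>W t - W u\<bar> \<le> 12 * exp (- lam / 4 * u)" if u: "real n \<le> u" and ut: "u \<le> t" for t u
  proof -
    have u0: "0 \<le> u" using u by (meson of_nat_0_le_iff order_trans)
    have cV: "continuous_on {u..t} ?V" by (rule drift_part_cont[OF w]) (use u0 in auto)
    have ed: "((\<lambda>s. 8 * exp (- lam / 4 * s)) has_real_derivative - (2 * lam * exp (- lam / 4 * s))) (at s)" for s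
      by (auto intro!: derivative_eq_intros)
    have up: "?V t * exp (- lam * t) + 8 * exp (- lam / 4 * t) \<le> ?V u * exp (- lam * u) + 8 * exp (- lam / 4 * u)"
    proof (rule DERIV_nonpos_imp_le[OF ut, where p = "\<lambda>s. ?V s * exp (- lam * s) + 8 * exp (- lam / 4 * s)" and p' = "\<lambda>s. lam * (exp (- lam * s) * noise s \<omega>) + - (2 * lam * exp (- lam / 4 * s))"])
      show "continuous_on {u..t} (\<lambda>s. ?V s * exp (- lam * s) + 8 * exp (- lam / 4 * s))" by (intro continuous_intros cV)
      fix s assume s: "u < s" "s < t"
      show "((\<lambda>s. ?V s * exp (- lam * s) + 8 * exp (- lam / 4 * s)) has_real_derivative lam * (exp (- lam * s) * noise s \<omega>) + - (2 * lam * exp (- lam / 4 * s))) (at s)"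
        by (rule DERIV_add[OF pd ed]) (use s u0 in simp)
      have "exp (- lam * s) * noise s \<omega> \<le> 2 * exp (- lam / 4 * s)" using N2[of s] s u by linarith
      then have "lam * (exp (- lam * s) * noise s \<omega>) \<le> lam * (2 * exp (- lam / 4 * s))" using lam by (intro mult_left_mono) auto
      then show "lam * (exp (- lam * s) * noise s \<omega>) + - (2 * lam * exp (- lam / 4 * s)) \<le> 0" by simp
    qed
    have dn: "- (?V t * exp (- lam * t)) + 8 * exp (- lam / 4 * t) \<le> - (?V u * exp (- lam * u)) + 8 * exp (- lam / 4 * u)"
    proof (rule DERIV_nonpos_imp_le[OF ut, where p = "\<lambda>s. - (?V s * exp (- lam * s)) + 8 * exp (- lam / 4 * s)" and p' = "\<lambda>s. - (lam * (exp (- lam * s) * noise s \<omega>)) + - (2 * lam * exp (- lam / 4 * s))"])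
      show "continuous_on {u..t} (\<lambda>s. - (?V s * exp (- lam * s)) + 8 * exp (- lam / 4 * s))" by (intro continuous_intros cV)
      fix s assume s: "u < s" "s < t"
      show "((\<lambda>s. - (?V s * exp (- lam * s)) + 8 * exp (- lam / 4 * s)) has_real_derivative - (lam * (exp (- lam * s) * noise s \<omega>)) + - (2 * lam * exp (- lam / 4 * s))) (at s)"
        by (rule DERIV_add[OF DERIV_minus[OF pd] ed]) (use s u0 in simp)
      have "- (exp (- lam * s) * noise s \<omega>) \<le> 2 * exp (- lam / 4 * s)" using N2[of s] s u by linarith
      then have "lam * (- (exp (- lam * s) * noise s \<omega>)) \<le> lam * (2 * exp (- lam / 4 * s))" using lam by (intro mult_left_mono) auto
      then show "- (lam * (exp (- lam * s) * noise s \<omega>)) + - (2 * lam * exp (- lam / 4 * s)) \<le> 0" by simp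
    qed
    have Ws: "W s = ?V s * exp (- lam * s) + exp (- lam * s) * noise s \<omega>" for s unfolding W_def Z_split[of s \<omega>] by (simp add: distrib_left)
    have "exp (- lam / 4 * t) \<le> exp (- lam / 4 * u)" using lam ut by simp
    moreover have "0 \<le> exp (- lam / 4 * t)" by simp
    ultimately show ?thesis using up dn N2[OF u] N2[of t] u ut unfolding Ws by linarith
  qed
  have e0: "((\<lambda>u. 12 * exp (- lam / 4 * u)) \<longlongrightarrow> 0) at_top" using lam by real_asymp
  have "Cauchy (\<lambda>k. W (real k))"
  proof (rule metric_CauchyI)
    fix e :: real assume e: "0 < e"
    from order_tendstoD(2)[OF e0 e] obtain u0 where u0: "\<And>u. u \<ge> u0 \<Longrightarrow> 12 * exp (- lam / 4 * u) < e"
      unfolding eventually_at_top_linorder by blast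
    obtain K where K: "max u0 (real n) \<le> real K" using real_arch_simple by blast
    have *: "dist (W (real i)) (W (real j)) < e" if "K \<le> j" "j \<le> i" for i j
    proof -
      have "\<bar>W (real i) - W (real j)\<bar> \<le> 12 * exp (- lam / 4 * real j)" using that K by (intro cauchy) auto
      also have "\<dots> < e" using that K by (intro u0) auto
      finally show ?thesis by (simp add: dist_real_def)
    qed
    show "\<exists>K. \<forall>i\<ge>K. \<forall>j\<ge>K. dist (W (real i)) (W (real j)) < e"
      using * by (intro exI[of _ K]) (metis dist_commute nat_le_linear)
  qed
  then obtain L where L: "(\<lambda>k. W (real k)) \<longlonglongrightarrow> L" using Cauchy_convergent convergent_def by blast
  have bd: "\<bar>W u - L\<bar> \<le> 12 * exp (- lam / 4 * u)" if u: "real n \<le> u" for u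
  proof (rule LIMSEQ_le_const2)
    show "(\<lambda>k. \<bar>W u - W (real k)\<bar>) \<longlonglongrightarrow> \<bar>W u - L\<bar>" by (intro tendsto_intros L)
    obtain K where K: "u \<le> real K" using real_arch_simple by blast
    show "\<exists>N. \<forall>k\<ge>N. \<bar>W u - W (real k)\<bar> \<le> 12 * exp (- lam / 4 * u)"
    proof (intro exI[of _ K] allI impI)
      fix k assume "K \<le> k"
      then have "u \<le> real k" using K by linarith
      from cauchy[OF u this] show "\<bar>W u - W (real k)\<bar> \<le> 12 * exp (- lam / 4 * u)" by (simp add: abs_minus_commute)
    qed
  qed
  have "(W \<longlongrightarrow> L) at_top"
  proof (rule Lim_transform_bound[OF _ e0, of "\<lambda>u. W u - L", THEN LIM_zero_cancel])
    show "\<forall>\<^sub>F u in at_top. norm (W u - L) \<le> norm (12 * exp (- lam / 4 * u))"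
      using eventually_ge_at_top[of "real n"] by eventually_elim (use bd in simp)
  qed
  moreover have "0 \<le> L"
    by (rule LIMSEQ_le_const[OF L]) (use Z_nonneg[OF w] in \<open>auto simp: W_def intro!: exI[of _ 0]\<close>)
  ultimately show ?thesis using bd unfolding W_def by blast
qed

end

lemma tail_sum_tendsto:
  assumes "0 < lam"
  shows "(\<lambda>n. \<Sum>k. tail_weight lam (k + n)) \<longlonglongrightarrow> 0"
proof -
  have "(\<lambda>n. suminf (tail_weight lam) - (\<Sum>k<n. tail_weight lam k)) \<longlonglongrightarrow> suminf (tail_weight lam) - suminf (tail_weight lam)"
    by (intro tendsto_intros summable_LIMSEQ tail_weight_summable assms)
  moreover have "suminf (tail_weight lam) - (\<Sum>k<n. tail_weight lam k) = (\<Sum>k. tail_weight lam (k + n))" for n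
    using suminf_minus_initial_segment[OF tail_weight_summable[OF assms], of n] by simp
  ultimately show ?thesis by simp
qed

lemma sqrt_diff_square_le: "0 \<le> a \<Longrightarrow> 0 \<le> b \<Longrightarrow> (sqrt a - sqrt b)\<^sup>2 \<le> \<bar>a - b\<bar>"
proof -
  assume ab: "0 \<le> a" "0 \<le> b"
  have "(sqrt a - sqrt b)\<^sup>2 = \<bar>sqrt a - sqrt b\<bar> * \<bar>sqrt a - sqrt b\<bar>" by (simp add: power2_eq_square abs_mult_self_eq)
  also have "\<dots> \<le> \<bar>sqrt a - sqrt b\<bar> * (sqrt a + sqrt b)" using ab by (intro mult_left_mono) (auto simp: abs_le_iff)
  also have "\<dots> = \<bar>(sqrt a - sqrt b) * (sqrt a + sqrt b)\<bar>" using ab by (simp add: abs_mult)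
  also have "(sqrt a - sqrt b) * (sqrt a + sqrt b) = a - b" using ab by (simp add: algebra_simps)
  finally show ?thesis .
qed

locale near_critical = brownian + dissipative_ode f f' lam C for f f' lam C +
  fixes \<sigma> :: "real \<Rightarrow> real" and X :: "real \<Rightarrow> real \<Rightarrow> 'a \<Rightarrow> real" and Y :: "real \<Rightarrow> 'a \<Rightarrow> real" and s1 Cs Cq :: real
  assumes f_quad: "\<And>x. 0 \<le> x \<Longrightarrow> \<bar>f x - lam * x\<bar> \<le> Cq * x\<^sup>2"
    and \<sigma>_cont: "continuous_on {0..} \<sigma>" and \<sigma>_nonneg: "\<And>x. 0 \<le> x \<Longrightarrow> 0 \<le> \<sigma> x"
    and \<sigma>_le: "\<And>x. 0 \<le> x \<Longrightarrow> \<sigma> x \<le> Cs * x" and \<sigma>_quad: "\<And>x. 0 \<le> x \<Longrightarrow> \<bar>\<sigma> x - s1 * x\<bar> \<le> Cq * x\<^sup>2"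
    and s1: "0 < s1" "s1 \<le> Cs" and Cq: "0 \<le> Cq"
    and X_sol: "\<And>\<epsilon>. 0 < \<epsilon> \<Longrightarrow> sde_solution M B f (\<lambda>x. sqrt (\<epsilon> * \<sigma> x)) \<epsilon> (X \<epsilon>)"
    and Y_sol: "sde_solution M B (\<lambda>y. lam * y) (\<lambda>y. sqrt (s1 * y)) 1 Y"
begin

lemma X_sde: "0 < \<epsilon> \<Longrightarrow> sde M B f (\<lambda>x. sqrt (\<epsilon> * \<sigma> x)) \<epsilon> lam (Cs * \<epsilon>) (X \<epsilon>)"
proof (unfold_locales)
  assume e: "0 < \<epsilon>"
  then show "sde_solution M B f (\<lambda>x. sqrt (\<epsilon> * \<sigma> x)) \<epsilon> (X \<epsilon>)" by (rule X_sol)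
  show "continuous_on {0..} f" by (rule f_cont)
  show "continuous_on {0..} (\<lambda>x. sqrt (\<epsilon> * \<sigma> x))" by (intro continuous_intros \<sigma>_cont)
  show "f x \<le> lam * x" if "0 \<le> x" for x by (rule f_le[OF that])
  show "(sqrt (\<epsilon> * \<sigma> x))\<^sup>2 \<le> Cs * \<epsilon> * x" if "0 \<le> x" for x
    using \<sigma>_nonneg[OF that] \<sigma>_le[OF that] e by (simp add: mult_ac)
qed (use lam_pos s1 in auto)

lemma Y_sde: "sde M B (\<lambda>y. lam * y) (\<lambda>y. sqrt (s1 * y)) 1 lam Cs Y"
proof (unfold_locales)
  show "sde_solution M B (\<lambda>y. lam * y) (\<lambda>y. sqrt (s1 * y)) 1 Y" by (rule Y_sol)
  show "continuous_on {0..} (\<lambda>y. lam * y)" "continuous_on {0..} (\<lambda>y. sqrt (s1 * y))" by (intro continuous_intros)+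
  show "(sqrt (s1 * x))\<^sup>2 \<le> Cs * x" if "0 \<le> x" for x using that s1 by (simp add: mult_right_mono)
qed (use lam_pos s1 in auto)

definition tail_sum :: "nat \<Rightarrow> real" where "tail_sum n = (\<Sum>k. tail_weight lam (k + n))"

abbreviation noiseX :: "real \<Rightarrow> real \<Rightarrow> 'a \<Rightarrow> real" where "noiseX \<epsilon> \<equiv> sde.noise f (X \<epsilon>)"
abbreviation noiseY :: "real \<Rightarrow> 'a \<Rightarrow> real" where "noiseY \<equiv> sde.noise (\<lambda>y. lam * y) Y"

lemma X_tail:
  assumes "0 < \<epsilon>" "0 < \<kappa>"
  obtains Bad where "Bad \<in> sets M" "prob Bad \<le> Cs / \<kappa>\<^sup>2 * tail_sum n"
    "\<And>\<omega> s. \<omega> \<in> space M - Bad \<Longrightarrow> real n \<le> s \<Longrightarrow> \<bar>noiseX \<epsilon> s \<omega> - \<epsilon>\<bar> \<le> \<kappa> * \<epsilon> * exp (3/4 * lam * s)"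
  using sde.noise_tail[OF X_sde[OF assms(1)] assms(2), of n] assms unfolding tail_sum_def by (auto simp: that)

lemma Y_tail:
  assumes "0 < \<kappa>"
  obtains Bad where "Bad \<in> sets M" "prob Bad \<le> Cs / \<kappa>\<^sup>2 * tail_sum n"
    "\<And>\<omega> s. \<omega> \<in> space M - Bad \<Longrightarrow> real n \<le> s \<Longrightarrow> \<bar>noiseY s \<omega> - 1\<bar> \<le> \<kappa> * 1 * exp (3/4 * lam * s)"
  using sde.noise_tail[OF Y_sde assms, of n] unfolding tail_sum_def by (auto simp: that)

lemma X_growth:
  assumes e: "0 < \<epsilon>" and k: "0 < \<kappa>" and w: "\<omega> \<in> space M" and t: "0 \<le> t"
    and N: "\<And>s. 0 \<le> s \<Longrightarrow> \<bar>noiseX \<epsilon> s \<omega> - \<epsilon>\<bar> \<le> \<kappa> * \<epsilon> * exp (3/4 * lam * s)"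
  shows "X \<epsilon> t \<omega> \<le> 5 * (1 + \<kappa>) * \<epsilon> * exp (lam * t)"
  by (rule sde.growth_bound[OF X_sde[OF e] w k t N])

lemma Y_growth:
  assumes k: "0 < \<kappa>" and w: "\<omega> \<in> space M" and t: "0 \<le> t"
    and N: "\<And>s. 0 \<le> s \<Longrightarrow> \<bar>noiseY s \<omega> - 1\<bar> \<le> \<kappa> * 1 * exp (3/4 * lam * s)"
  shows "Y t \<omega> \<le> 5 * (1 + \<kappa>) * 1 * exp (lam * t)"
  by (rule sde.growth_bound[OF Y_sde w k t N])

lemma X_ca: "0 < \<epsilon> \<Longrightarrow> continuous_adapted (X \<epsilon>)" using sde_continuous_adapted[OF X_sol] .
lemma Y_ca: "continuous_adapted Y" using sde_continuous_adapted[OF Y_sol] .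
lemma X_nonneg: "0 < \<epsilon> \<Longrightarrow> \<omega> \<in> space M \<Longrightarrow> 0 \<le> t \<Longrightarrow> 0 \<le> X \<epsilon> t \<omega>" using sde_nonneg[OF X_sol] .
lemma Y_nonneg: "\<omega> \<in> space M \<Longrightarrow> 0 \<le> t \<Longrightarrow> 0 \<le> Y t \<omega>" using sde_nonneg[OF Y_sol] .

lemma ito_scaled_diff:
  assumes e: "0 < \<epsilon>" and I1: "ito_integral_is M B H1 t I1" and I2: "ito_integral_is M B H2 t I2"
    and m: "\<And>r. 0 \<le> r \<Longrightarrow> H1 r \<in> borel_measurable M" "\<And>r. 0 \<le> r \<Longrightarrow> H2 r \<in> borel_measurable M" and t: "0 \<le> t"
  shows "ito_integral_is M B (\<lambda>r \<omega>. H1 r \<omega> / \<epsilon> - H2 r \<omega>) t (\<lambda>\<omega>. I1 \<omega> / \<epsilon> - I2 \<omega>)"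
proof -
  let ?S = "\<lambda>H n \<omega>. \<Sum>k<(2::nat)^n. H (t * real k / 2^n) \<omega> * (B (t * real (Suc k) / 2^n) \<omega> - B (t * real k / 2^n) \<omega>)"
  have Im [measurable]: "I1 \<in> borel_measurable M" "I2 \<in> borel_measurable M" using I1 I2 by (auto simp: ito_integral_is_def)
  have c1: "conv_in_prob M (?S H1) I1 sequentially" and c2: "conv_in_prob M (?S H2) I2 sequentially"
    using I1 I2 unfolding ito_integral_is_def by blast+
  have [measurable]: "H1 (t * real k / 2 ^ n) \<in> borel_measurable M" "H2 (t * real k / 2 ^ n) \<in> borel_measurable M" for k n
    using t m by simp_all
  have sm [measurable]: "?S H1 n \<in> borel_measurable M" "?S H2 n \<in> borel_measurable M" for n by measurable
  have lin: "?S (\<lambda>r \<omega>. H1 r \<omega> / \<epsilon> - H2 r \<omega>) n \<omega> = ?S H1 n \<omega> / \<epsilon> - ?S H2 n \<omega>" for n \<omega>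
    by (simp add: sum_divide_distrib left_diff_distrib sum_subtractf)
  have "conv_in_prob M (?S (\<lambda>r \<omega>. H1 r \<omega> / \<epsilon> - H2 r \<omega>)) (\<lambda>\<omega>. I1 \<omega> / \<epsilon> - I2 \<omega>) sequentially"
    unfolding conv_in_prob_def lin
  proof (intro allI impI)
    fix \<delta> :: real assume d: "0 < \<delta>"
    have l1: "(\<lambda>n. prob {\<omega>\<in>space M. \<epsilon> * \<delta> / 2 < \<bar>?S H1 n \<omega> - I1 \<omega>\<bar>}) \<longlonglongrightarrow> 0"
      using c1[unfolded conv_in_prob_def, rule_format, of "\<epsilon> * \<delta> / 2"] d e by simp
    have l2: "(\<lambda>n. prob {\<omega>\<in>space M. \<delta> / 2 < \<bar>?S H2 n \<omega> - I2 \<omega>\<bar>}) \<longlonglongrightarrow> 0"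
      using c2[unfolded conv_in_prob_def, rule_format, of "\<delta> / 2"] d by simp
    have lim: "(\<lambda>n. prob {\<omega>\<in>space M. \<epsilon> * \<delta> / 2 < \<bar>?S H1 n \<omega> - I1 \<omega>\<bar>} + prob {\<omega>\<in>space M. \<delta> / 2 < \<bar>?S H2 n \<omega> - I2 \<omega>\<bar>}) \<longlonglongrightarrow> 0"
      using tendsto_add[OF l1 l2] by simp
    show "(\<lambda>n. prob {\<omega>\<in>space M. \<delta> < \<bar>?S H1 n \<omega> / \<epsilon> - ?S H2 n \<omega> - (I1 \<omega> / \<epsilon> - I2 \<omega>)\<bar>}) \<longlonglongrightarrow> 0"
    proof (rule tendsto_sandwich[OF _ _ tendsto_const lim]; (rule always_eventually, rule allI)?)
      fix n
      show "prob {\<omega>\<in>space M. \<delta> < \<bar>?S H1 n \<omega> / \<epsilon> - ?S H2 n \<omega> - (I1 \<omega> / \<epsilon> - I2 \<omega>)\<bar>}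
        \<le> prob {\<omega>\<in>space M. \<epsilon> * \<delta> / 2 < \<bar>?S H1 n \<omega> - I1 \<omega>\<bar>} + prob {\<omega>\<in>space M. \<delta> / 2 < \<bar>?S H2 n \<omega> - I2 \<omega>\<bar>}"
      proof (rule order_trans[OF finite_measure_mono measure_Un_le])
        show "{\<omega>\<in>space M. \<delta> < \<bar>?S H1 n \<omega> / \<epsilon> - ?S H2 n \<omega> - (I1 \<omega> / \<epsilon> - I2 \<omega>)\<bar>} \<subseteq>
           {\<omega>\<in>space M. \<epsilon> * \<delta> / 2 < \<bar>?S H1 n \<omega> - I1 \<omega>\<bar>} \<union> {\<omega>\<in>space M. \<delta> / 2 < \<bar>?S H2 n \<omega> - I2 \<omega>\<bar>}"
        proof (intro subsetI, elim CollectE conjE)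
          fix \<omega> assume w: "\<omega> \<in> space M" and dd: "\<delta> < \<bar>?S H1 n \<omega> / \<epsilon> - ?S H2 n \<omega> - (I1 \<omega> / \<epsilon> - I2 \<omega>)\<bar>"
          define a where "a = ?S H1 n \<omega> - I1 \<omega>"
          define a' where "a' = ?S H2 n \<omega> - I2 \<omega>"
          have "?S H1 n \<omega> / \<epsilon> - ?S H2 n \<omega> - (I1 \<omega> / \<epsilon> - I2 \<omega>) = a / \<epsilon> - a'" by (simp add: a_def a'_def diff_divide_distrib)
          then have "\<delta> < \<bar>a / \<epsilon> - a'\<bar>" using dd by (simp only:)
          then have "\<delta> / 2 < \<bar>a / \<epsilon>\<bar> \<or> \<delta> / 2 < \<bar>a'\<bar>" by linarith
          moreover have "\<bar>a / \<epsilon>\<bar> = \<bar>a\<bar> / \<epsilon>" using e by simp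
          ultimately have "\<epsilon> * \<delta> / 2 < \<bar>a\<bar> \<or> \<delta> / 2 < \<bar>a'\<bar>" using e by (auto simp: pos_less_divide_eq mult_ac)
          then show "\<omega> \<in> {\<omega>\<in>space M. \<epsilon> * \<delta> / 2 < \<bar>?S H1 n \<omega> - I1 \<omega>\<bar>} \<union> {\<omega>\<in>space M. \<delta> / 2 < \<bar>?S H2 n \<omega> - I2 \<omega>\<bar>}"
            using w unfolding a_def a'_def by blast
        qed
      qed measurable
    qed simp
  qed
  then show ?thesis unfolding ito_integral_is_def by simp
qed

lemma scaled_difference_bound:
  assumes e: "0 < \<epsilon>" and T: "0 < T" and K: "0 < K" and \<delta>: "0 < \<delta>"
  shows "expectation (\<lambda>\<omega>. indicator (below (\<lambda>t \<omega>. max (X \<epsilon> t \<omega> / \<epsilon>) (Y t \<omega>)) K T) \<omega> * yw \<delta> (X \<epsilon> T \<omega> / \<epsilon> - Y T \<omega>))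
    \<le> (yw \<delta> 0 + T * ((lam * K + Cq * \<epsilon> * K\<^sup>2 * K / \<delta> + (s1 + Cq * \<epsilon> * K\<^sup>2 / \<delta>)) / ln (1 + 1 / \<delta>))) * exp (lam * T)"
proof -
  let ?R = "\<lambda>t \<omega>. max (X \<epsilon> t \<omega> / \<epsilon>) (Y t \<omega>)"
  let ?\<alpha> = "\<lambda>t \<omega>. f (X \<epsilon> t \<omega>) / \<epsilon> - lam * Y t \<omega>"
  let ?\<gamma> = "\<lambda>t \<omega>. sqrt (\<epsilon> * \<sigma> (X \<epsilon> t \<omega>)) / \<epsilon> - sqrt (s1 * Y t \<omega>)"
  let ?D = "\<lambda>t \<omega>. X \<epsilon> t \<omega> / \<epsilon> - Y t \<omega>"
  interpret X: sde M B f "\<lambda>x. sqrt (\<epsilon> * \<sigma> x)" \<epsilon> lam "Cs * \<epsilon>" "X \<epsilon>" by (rule X_sde[OF e])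
  interpret Y: sde M B "\<lambda>y. lam * y" "\<lambda>y. sqrt (s1 * y)" 1 lam Cs Y by (rule Y_sde)
  have ca: "continuous_adapted (\<lambda>t \<omega>. u t \<omega> / \<epsilon> - v t \<omega>)" if "continuous_adapted u" "continuous_adapted v" for u v
    using that e unfolding continuous_adapted_def by (auto intro!: continuous_intros borel_measurable_diff borel_measurable_divide)
  have R: "continuous_adapted ?R"
    using X.Z_ca Y_ca e unfolding continuous_adapted_def by (auto intro!: continuous_intros borel_measurable_max borel_measurable_divide)
  have inb: "0 \<le> X \<epsilon> t \<omega>" "X \<epsilon> t \<omega> \<le> \<epsilon> * K" "0 \<le> Y t \<omega>" "Y t \<omega> \<le> K" if t: "0 \<le> t" and w: "\<omega> \<in> below ?R K t" for t \<omega>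
  proof -
    have sp: "\<omega> \<in> space M" using w by (simp add: below_def)
    have "?R t \<omega> \<le> K" using w t by (auto simp: below_def)
    then show "0 \<le> X \<epsilon> t \<omega>" "X \<epsilon> t \<omega> \<le> \<epsilon> * K" "0 \<le> Y t \<omega>" "Y t \<omega> \<le> K"
      using X_nonneg[OF e sp t] Y_nonneg[OF sp t] e by (auto simp: pos_divide_le_eq mult.commute)
  qed
  have "bounded (f ` {0..\<epsilon> * K})" "bounded (\<sigma> ` {0..\<epsilon> * K})"
    using f_cont \<sigma>_cont by (auto intro!: compact_imp_bounded compact_continuous_image intro: continuous_on_subset)
  then obtain A1 A2 where A: "\<And>x. x \<in> {0..\<epsilon> * K} \<Longrightarrow> \<bar>f x\<bar> \<le> A1" "\<And>x. x \<in> {0..\<epsilon> * K} \<Longrightarrow> \<bar>\<sigma> x\<bar> \<le> A2"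
    unfolding bounded_iff by (metis imageI real_norm_def)
  define A where "A = max (A1 / \<epsilon> + lam * K) (sqrt (\<epsilon> * A2) / \<epsilon> + sqrt (s1 * K))"
  have quad: "(X \<epsilon> t \<omega>)\<^sup>2 / \<epsilon> \<le> \<epsilon> * K\<^sup>2" if t: "0 \<le> t" and w: "\<omega> \<in> below ?R K t" for t \<omega>
  proof -
    have "(X \<epsilon> t \<omega>)\<^sup>2 \<le> (\<epsilon> * K)\<^sup>2" using inb[OF t w] by (intro power_mono) auto
    then show ?thesis using e by (simp add: pos_divide_le_eq power2_eq_square mult_ac)
  qed
  have bd: "\<bar>?\<alpha> t \<omega>\<bar> \<le> A \<and> \<bar>?\<gamma> t \<omega>\<bar> \<le> A \<and> \<bar>?D t \<omega>\<bar> \<le> K" if t: "0 \<le> t" and w: "\<omega> \<in> below ?R K t" for t \<omega>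
  proof (intro conjI)
    note i = inb[OF t w]
    have "\<bar>f (X \<epsilon> t \<omega>) / \<epsilon>\<bar> \<le> A1 / \<epsilon>" using A(1)[of "X \<epsilon> t \<omega>"] i e by (simp add: divide_right_mono)
    moreover have "\<bar>lam * Y t \<omega>\<bar> \<le> lam * K" using i lam_pos by (simp add: abs_mult)
    ultimately show "\<bar>?\<alpha> t \<omega>\<bar> \<le> A" unfolding A_def by linarith
    have "\<epsilon> * \<sigma> (X \<epsilon> t \<omega>) \<le> \<epsilon> * A2" using A(2)[of "X \<epsilon> t \<omega>"] i e by (intro mult_left_mono) auto
    then have "sqrt (\<epsilon> * \<sigma> (X \<epsilon> t \<omega>)) / \<epsilon> \<le> sqrt (\<epsilon> * A2) / \<epsilon>" using e by (intro divide_right_mono) auto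
    moreover have "0 \<le> sqrt (\<epsilon> * \<sigma> (X \<epsilon> t \<omega>)) / \<epsilon>" using \<sigma>_nonneg i e by simp
    moreover have "sqrt (s1 * Y t \<omega>) \<le> sqrt (s1 * K)" "0 \<le> sqrt (s1 * Y t \<omega>)" using i s1 by auto
    ultimately show "\<bar>?\<gamma> t \<omega>\<bar> \<le> A" unfolding A_def by linarith
    have "0 \<le> X \<epsilon> t \<omega> / \<epsilon>" "X \<epsilon> t \<omega> / \<epsilon> \<le> K" using i e by (auto simp: pos_divide_le_eq mult.commute)
    then show "\<bar>?D t \<omega>\<bar> \<le> K" using i by linarith
  qed
  show ?thesis
  proof (rule yw_stopped_bound[OF R ca[OF X.bZ_ca Y.bZ_ca] ca[OF X.gZ_ca Y.gZ_ca] ca[OF X.Z_ca Y.Z_ca], where A = "\<bar>A\<bar>"])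
    show "\<bar>?\<alpha> t \<omega>\<bar> \<le> \<bar>A\<bar> \<and> \<bar>?\<gamma> t \<omega>\<bar> \<le> \<bar>A\<bar> \<and> \<bar>?D t \<omega>\<bar> \<le> K" if "0 \<le> t" "\<omega> \<in> below ?R K t" for t \<omega>
      using bd[OF that] by linarith
    fix t :: real assume t: "0 \<le> t"
    obtain I1 where I1: "ito_integral_is M B (\<lambda>r \<omega>. sqrt (\<epsilon> * \<sigma> (X \<epsilon> r \<omega>))) t I1" "AE \<omega> in M. X \<epsilon> t \<omega> = \<epsilon> + integral {0..t} (\<lambda>r. f (X \<epsilon> r \<omega>)) + I1 \<omega>"
      using X.Z_eq[OF t] by blast
    obtain I2 where I2: "ito_integral_is M B (\<lambda>r \<omega>. sqrt (s1 * Y r \<omega>)) t I2" "AE \<omega> in M. Y t \<omega> = 1 + integral {0..t} (\<lambda>r. lam * Y r \<omega>) + I2 \<omega>"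
      using Y.Z_eq[OF t] by blast
    have "ito_integral_is M B ?\<gamma> t (\<lambda>\<omega>. I1 \<omega> / \<epsilon> - I2 \<omega>)"
      by (rule ito_scaled_diff[OF e I1(1) I2(1) continuous_adapted_meas[OF X.gZ_ca] continuous_adapted_meas[OF Y.gZ_ca] t])
    moreover have "AE \<omega> in M. ?D t \<omega> = 0 + integral {0..t} (\<lambda>r. ?\<alpha> r \<omega>) + (I1 \<omega> / \<epsilon> - I2 \<omega>)"
      using I1(2) I2(2) AE_space
    proof eventually_elim
      case (elim \<omega>)
      have i: "(\<lambda>r. f (X \<epsilon> r \<omega>) / \<epsilon>) integrable_on {0..t}" "(\<lambda>r. lam * Y r \<omega>) integrable_on {0..t}"
        using X.bZ_cont[OF elim(3), of t] Y.bZ_cont[OF elim(3), of t] e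
        by (auto intro!: integrable_continuous_interval continuous_intros)
      have "integral {0..t} (\<lambda>r. ?\<alpha> r \<omega>) = integral {0..t} (\<lambda>r. f (X \<epsilon> r \<omega>)) / \<epsilon> - integral {0..t} (\<lambda>r. lam * Y r \<omega>)"
        unfolding Henstock_Kurzweil_Integration.integral_diff[OF i] by simp
      moreover have "X \<epsilon> t \<omega> / \<epsilon> = 1 + integral {0..t} (\<lambda>r. f (X \<epsilon> r \<omega>)) / \<epsilon> + I1 \<omega> / \<epsilon>"
        unfolding elim(1) using e by (simp add: add_divide_distrib)
      ultimately show ?case using elim(2) by linarith
    qed
    ultimately show "\<exists>I. ito_integral_is M B ?\<gamma> t I \<and> (AE \<omega> in M. ?D t \<omega> = 0 + integral {0..t} (\<lambda>r. ?\<alpha> r \<omega>) + I \<omega>)" by blast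
    fix \<omega> assume w: "\<omega> \<in> below ?R K t"
    note i = inb[OF t w]
    define y where "y = X \<epsilon> t \<omega> / \<epsilon>"
    define z where "z = f (X \<epsilon> t \<omega>) / \<epsilon> - lam * y"
    have "\<bar>z\<bar> = \<bar>f (X \<epsilon> t \<omega>) - lam * X \<epsilon> t \<omega>\<bar> / \<epsilon>" unfolding z_def y_def using e by (simp add: diff_divide_distrib[symmetric] abs_divide)
    also have "\<dots> \<le> Cq * (X \<epsilon> t \<omega>)\<^sup>2 / \<epsilon>" using f_quad[OF i(1)] e by (intro divide_right_mono) auto
    also have "\<dots> \<le> Cq * \<epsilon> * K\<^sup>2" using mult_left_mono[OF quad[OF t w] Cq] by (simp add: mult_ac)
    finally have z: "\<bar>z\<bar> \<le> Cq * \<epsilon> * K\<^sup>2" .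
    have "?D t \<omega> * ?\<alpha> t \<omega> = lam * (?D t \<omega>)\<^sup>2 + ?D t \<omega> * z" by (simp add: z_def y_def power2_eq_square algebra_simps)
    also have "?D t \<omega> * z \<le> \<bar>?D t \<omega>\<bar> * \<bar>z\<bar>" by (metis abs_ge_self abs_mult)
    also have "\<dots> \<le> \<bar>?D t \<omega>\<bar> * (Cq * \<epsilon> * K\<^sup>2)" by (intro mult_left_mono z) simp
    finally show "?D t \<omega> * ?\<alpha> t \<omega> \<le> lam * (?D t \<omega>)\<^sup>2 + Cq * \<epsilon> * K\<^sup>2 * \<bar>?D t \<omega>\<bar>" by (simp add: mult_ac)
    have sq: "sqrt (\<epsilon> * \<sigma> (X \<epsilon> t \<omega>)) / \<epsilon> = sqrt (\<sigma> (X \<epsilon> t \<omega>) / \<epsilon>)"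
    proof -
      have "\<sigma> (X \<epsilon> t \<omega>) / \<epsilon> = (\<epsilon> * \<sigma> (X \<epsilon> t \<omega>)) / \<epsilon>\<^sup>2" using e by (simp add: power2_eq_square)
      then show ?thesis using e by (simp add: real_sqrt_divide)
    qed
    have "(?\<gamma> t \<omega>)\<^sup>2 \<le> \<bar>\<sigma> (X \<epsilon> t \<omega>) / \<epsilon> - s1 * Y t \<omega>\<bar>"
      unfolding sq using i \<sigma>_nonneg s1 e by (intro sqrt_diff_square_le) auto
    also have "\<dots> \<le> \<bar>\<sigma> (X \<epsilon> t \<omega>) - s1 * X \<epsilon> t \<omega>\<bar> / \<epsilon> + s1 * \<bar>?D t \<omega>\<bar>"
    proof -
      have "\<sigma> (X \<epsilon> t \<omega>) / \<epsilon> - s1 * Y t \<omega> = (\<sigma> (X \<epsilon> t \<omega>) - s1 * X \<epsilon> t \<omega>) / \<epsilon> + s1 * ?D t \<omega>"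
        by (simp add: diff_divide_distrib algebra_simps)
      moreover have "\<bar>(\<sigma> (X \<epsilon> t \<omega>) - s1 * X \<epsilon> t \<omega>) / \<epsilon>\<bar> = \<bar>\<sigma> (X \<epsilon> t \<omega>) - s1 * X \<epsilon> t \<omega>\<bar> / \<epsilon>" using e by simp
      moreover have "\<bar>s1 * ?D t \<omega>\<bar> = s1 * \<bar>?D t \<omega>\<bar>" using s1 by (simp add: abs_mult)
      ultimately show ?thesis
        using abs_triangle_ineq[of "(\<sigma> (X \<epsilon> t \<omega>) - s1 * X \<epsilon> t \<omega>) / \<epsilon>" "s1 * ?D t \<omega>"] by (simp only:)
    qed
    also have "\<bar>\<sigma> (X \<epsilon> t \<omega>) - s1 * X \<epsilon> t \<omega>\<bar> / \<epsilon> \<le> Cq * \<epsilon> * K\<^sup>2"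
    proof -
      have "\<bar>\<sigma> (X \<epsilon> t \<omega>) - s1 * X \<epsilon> t \<omega>\<bar> / \<epsilon> \<le> Cq * (X \<epsilon> t \<omega>)\<^sup>2 / \<epsilon>" using \<sigma>_quad[OF i(1)] e by (intro divide_right_mono) auto
      also have "\<dots> \<le> Cq * \<epsilon> * K\<^sup>2" using mult_left_mono[OF quad[OF t w] Cq] by (simp add: mult_ac)
      finally show ?thesis .
    qed
    finally show "(?\<gamma> t \<omega>)\<^sup>2 \<le> s1 * \<bar>?D t \<omega>\<bar> + Cq * \<epsilon> * K\<^sup>2" by simp
  qed (use T lam_pos s1 Cq e K \<delta> in auto)
qed

lemma tail_sum_lim: "tail_sum \<longlonglongrightarrow> 0"
  unfolding tail_sum_def by (rule tail_sum_tendsto[OF lam_pos])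

lemma scaled_tightness:
  assumes T: "0 \<le> T" and \<kappa>: "0 < \<kappa>" and e: "0 < \<epsilon>"
  shows "prob (space M - below (\<lambda>t \<omega>. max (X \<epsilon> t \<omega> / \<epsilon>) (Y t \<omega>)) (5 * (1 + \<kappa>) * exp (lam * T)) T) \<le> 2 * (Cs / \<kappa>\<^sup>2 * tail_sum 0)"
proof -
  obtain B1 where B1: "B1 \<in> sets M" "prob B1 \<le> Cs / \<kappa>\<^sup>2 * tail_sum 0"
    "\<And>\<omega> s. \<omega> \<in> space M - B1 \<Longrightarrow> real 0 \<le> s \<Longrightarrow> \<bar>noiseX \<epsilon> s \<omega> - \<epsilon>\<bar> \<le> \<kappa> * \<epsilon> * exp (3/4 * lam * s)"
    using X_tail[OF e \<kappa>, of 0] by blast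
  obtain B2 where B2: "B2 \<in> sets M" "prob B2 \<le> Cs / \<kappa>\<^sup>2 * tail_sum 0"
    "\<And>\<omega> s. \<omega> \<in> space M - B2 \<Longrightarrow> real 0 \<le> s \<Longrightarrow> \<bar>noiseY s \<omega> - 1\<bar> \<le> \<kappa> * 1 * exp (3/4 * lam * s)"
    using Y_tail[OF \<kappa>, of 0] by blast
  let ?K = "5 * (1 + \<kappa>) * exp (lam * T)"
  have "space M - below (\<lambda>t \<omega>. max (X \<epsilon> t \<omega> / \<epsilon>) (Y t \<omega>)) ?K T \<subseteq> B1 \<union> B2"
  proof (rule subsetI, rule ccontr)
    fix \<omega> assume a: "\<omega> \<in> space M - below (\<lambda>t \<omega>. max (X \<epsilon> t \<omega> / \<epsilon>) (Y t \<omega>)) ?K T" "\<omega> \<notin> B1 \<union> B2"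
    then have w: "\<omega> \<in> space M" "\<omega> \<in> space M - B1" "\<omega> \<in> space M - B2" by auto
    have "max (X \<epsilon> r \<omega> / \<epsilon>) (Y r \<omega>) \<le> ?K" if r: "r \<in> {0..T}" for r
    proof -
      have "5 * (1 + \<kappa>) * exp (lam * r) \<le> ?K" using r lam_pos \<kappa> by (intro mult_left_mono) auto
      moreover have "X \<epsilon> r \<omega> \<le> 5 * (1 + \<kappa>) * \<epsilon> * exp (lam * r)"
        by (rule X_growth[OF e \<kappa> w(1)]) (use B1(3)[OF w(2)] r in auto)
      then have "X \<epsilon> r \<omega> / \<epsilon> \<le> 5 * (1 + \<kappa>) * exp (lam * r)" using e by (simp add: pos_divide_le_eq mult_ac)
      moreover have "Y r \<omega> \<le> 5 * (1 + \<kappa>) * 1 * exp (lam * r)"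
        by (rule Y_growth[OF \<kappa> w(1)]) (use B2(3)[OF w(3)] r in auto)
      ultimately show ?thesis by simp
    qed
    then show False using a w by (auto simp: below_def)
  qed
  then have "prob (space M - below (\<lambda>t \<omega>. max (X \<epsilon> t \<omega> / \<epsilon>) (Y t \<omega>)) ?K T) \<le> prob (B1 \<union> B2)"
    by (rule finite_measure_mono) (use B1 B2 in auto)
  also have "\<dots> \<le> prob B1 + prob B2" by (rule measure_Un_le) (use B1 B2 in auto)
  finally show ?thesis using B1(2) B2(2) by linarith
qed

lemma scaled_convergence:
  assumes T: "0 < T" and \<theta>: "0 < \<theta>"
  shows "((\<lambda>\<epsilon>. prob {\<omega>\<in>space M. \<theta> < \<bar>X \<epsilon> T \<omega> / \<epsilon> - Y T \<omega>\<bar>}) \<longlongrightarrow> 0) (at_right 0)"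
proof (rule tendstoI)
  fix r :: real assume r: "0 < r"
  have "((\<lambda>\<kappa>. 2 * (Cs / \<kappa>\<^sup>2 * tail_sum 0)) \<longlongrightarrow> 0) at_top" by real_asymp
  then have "\<forall>\<^sub>F \<kappa> in at_top. 2 * (Cs / \<kappa>\<^sup>2 * tail_sum 0) < r / 2" by (rule order_tendstoD) (use r in simp)
  then obtain \<kappa> where \<kappa>: "0 < \<kappa>" "2 * (Cs / \<kappa>\<^sup>2 * tail_sum 0) < r / 2"
    using eventually_happens'[OF trivial_limit_at_top_linorder eventually_conj[OF eventually_gt_at_top[of 0]]] by blast
  define K where "K = 5 * (1 + \<kappa>) * exp (lam * T)"
  have K: "0 < K" using \<kappa> by (simp add: K_def)
  define w where "w \<delta> = (ln (1 + \<theta> / \<delta>) - 1) / ln (1 + 1 / \<delta>)" for \<delta> :: real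
  have wl: "(w \<longlongrightarrow> 1) (at_right 0)" unfolding w_def by (rule yw_limits(2)[OF T \<theta>])
  have "((\<lambda>\<delta>. T * ((lam * K + s1 + 1) * (1 / ln (1 + 1 / \<delta>))) * exp (lam * T) / (\<theta> * w \<delta>)) \<longlongrightarrow> T * ((lam * K + s1 + 1) * 0) * exp (lam * T) / (\<theta> * 1)) (at_right 0)"
    by (intro tendsto_intros wl yw_limits(3)[OF T \<theta>]) (use \<theta> in auto)
  then have "((\<lambda>\<delta>. T * ((lam * K + s1 + 1) * (1 / ln (1 + 1 / \<delta>))) * exp (lam * T) / (\<theta> * w \<delta>)) \<longlongrightarrow> 0) (at_right 0)" by simp
  then have "\<forall>\<^sub>F \<delta> in at_right 0. T * ((lam * K + s1 + 1) * (1 / ln (1 + 1 / \<delta>))) * exp (lam * T) / (\<theta> * w \<delta>) < r / 2"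
    by (rule order_tendstoD) (use r in simp)
  moreover have "\<forall>\<^sub>F \<delta> in at_right 0. 0 < w \<delta>" by (rule order_tendstoD[OF wl]) simp
  ultimately have "\<forall>\<^sub>F \<delta> in at_right 0. 0 < \<delta> \<and> 0 < w \<delta> \<and> T * ((lam * K + s1 + 1) * (1 / ln (1 + 1 / \<delta>))) * exp (lam * T) / (\<theta> * w \<delta>) < r / 2"
    using eventually_at_right_less[of "0::real"] by eventually_elim auto
  then obtain \<delta> where \<delta>: "0 < \<delta>" "0 < w \<delta>" "T * ((lam * K + s1 + 1) * (1 / ln (1 + 1 / \<delta>))) * exp (lam * T) / (\<theta> * w \<delta>) < r / 2"
    using eventually_happens'[OF trivial_limit_at_right_real] by blast
  define L where "L = ln (1 + 1 / \<delta>)"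
  have L: "0 < L" unfolding L_def by (rule yw_log_pos[OF \<delta>(1)])
  have "((\<lambda>\<epsilon>. Cq * \<epsilon> * K\<^sup>2 * K / \<delta> + Cq * \<epsilon> * K\<^sup>2 / \<delta>) \<longlongrightarrow> Cq * 0 * K\<^sup>2 * K / \<delta> + Cq * 0 * K\<^sup>2 / \<delta>) (at_right 0)"
    using \<delta> by (intro tendsto_intros) auto
  then have "((\<lambda>\<epsilon>. Cq * \<epsilon> * K\<^sup>2 * K / \<delta> + Cq * \<epsilon> * K\<^sup>2 / \<delta>) \<longlongrightarrow> 0) (at_right 0)" by simp
  then have "\<forall>\<^sub>F \<epsilon> in at_right 0. Cq * \<epsilon> * K\<^sup>2 * K / \<delta> + Cq * \<epsilon> * K\<^sup>2 / \<delta> < 1" by (rule order_tendstoD) simp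
  then show "\<forall>\<^sub>F \<epsilon> in at_right 0. dist (prob {\<omega>\<in>space M. \<theta> < \<bar>X \<epsilon> T \<omega> / \<epsilon> - Y T \<omega>\<bar>}) 0 < r"
    using eventually_at_right_less[of "0::real"]
  proof eventually_elim
    case (elim \<epsilon>)
    note e = elim(2)
    interpret tf: test_function "yw \<delta>" "yw1 \<delta>" "yw2 \<delta>" "1 / (\<delta> * ln (1 + 1 / \<delta>))" "1 / (\<delta>\<^sup>2 * ln (1 + 1 / \<delta>))"
      by (rule yw_test_function[OF \<delta>(1)])
    let ?R = "\<lambda>t \<omega>. max (X \<epsilon> t \<omega> / \<epsilon>) (Y t \<omega>)"
    let ?D = "\<lambda>\<omega>. X \<epsilon> T \<omega> / \<epsilon> - Y T \<omega>"
    define S where "S = below ?R K T"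
    have R: "continuous_adapted ?R"
      using X_ca[OF e] Y_ca e unfolding continuous_adapted_def by (auto intro!: continuous_intros borel_measurable_max borel_measurable_divide)
    have Sm [measurable]: "S \<in> sets M" unfolding S_def by (rule below_M[OF R]) (use T in simp)
    have [measurable]: "X \<epsilon> T \<in> borel_measurable M" "Y T \<in> borel_measurable M"
      using continuous_adapted_meas[OF X_ca[OF e]] continuous_adapted_meas[OF Y_ca] T by auto
    have Db: "\<bar>?D \<omega>\<bar> \<le> K" if "\<omega> \<in> S" for \<omega>
    proof -
      have sp: "\<omega> \<in> space M" using that by (simp add: S_def below_def)
      have "?R T \<omega> \<le> K" using that T by (auto simp: S_def below_def)
      moreover have "0 \<le> X \<epsilon> T \<omega> / \<epsilon>" "0 \<le> Y T \<omega>" using X_nonneg[OF e sp, of T] Y_nonneg[OF sp, of T] T e by auto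
      ultimately show ?thesis by (simp add: abs_le_iff)
    qed
    have yi: "integrable M (\<lambda>\<omega>. indicator S \<omega> * yw \<delta> (?D \<omega>))"
    proof (rule integrable_bounded[where C = "1 / (\<delta> * ln (1 + 1 / \<delta>)) * K\<^sup>2"])
      fix \<omega>
      show "\<bar>indicator S \<omega> * yw \<delta> (?D \<omega>)\<bar> \<le> 1 / (\<delta> * ln (1 + 1 / \<delta>)) * K\<^sup>2"
      proof (cases "\<omega> \<in> S")
        case True
        then have "(?D \<omega>)\<^sup>2 \<le> K\<^sup>2" using Db[OF True] K by (simp add: abs_le_square_iff[symmetric])
        then have "1 / (\<delta> * ln (1 + 1 / \<delta>)) * (?D \<omega>)\<^sup>2 \<le> 1 / (\<delta> * ln (1 + 1 / \<delta>)) * K\<^sup>2"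
          using tf.C2_nonneg by (rule mult_left_mono)
        then show ?thesis using tf.\<phi>_bound[of "?D \<omega>"] tf.\<phi>_nonneg[of "?D \<omega>"] True by simp
      qed (use tf.C2_nonneg in simp)
    qed measurable
    have "prob {\<omega>\<in>space M. \<theta> < \<bar>?D \<omega>\<bar>} \<le> prob ((space M - S) \<union> {\<omega>\<in>space M. \<theta> * w \<delta> \<le> indicator S \<omega> * yw \<delta> (?D \<omega>)})"
    proof (rule finite_measure_mono)
      show "{\<omega>\<in>space M. \<theta> < \<bar>?D \<omega>\<bar>} \<subseteq> (space M - S) \<union> {\<omega>\<in>space M. \<theta> * w \<delta> \<le> indicator S \<omega> * yw \<delta> (?D \<omega>)}"
      proof (intro subsetI)
        fix \<omega> assume a: "\<omega> \<in> {\<omega>\<in>space M. \<theta> < \<bar>?D \<omega>\<bar>}"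
        have "\<theta> * w \<delta> \<le> \<bar>?D \<omega>\<bar> * w \<delta>" using a \<delta>(2) by (intro mult_right_mono) auto
        also have "\<dots> \<le> yw \<delta> (?D \<omega>)" unfolding w_def by (rule yw_lower[OF \<delta>(1) _ \<theta>]) (use a in simp)
        finally show "\<omega> \<in> (space M - S) \<union> {\<omega>\<in>space M. \<theta> * w \<delta> \<le> indicator S \<omega> * yw \<delta> (?D \<omega>)}" using a by (cases "\<omega> \<in> S") auto
      qed
    qed measurable
    also have "\<dots> \<le> prob (space M - S) + prob {\<omega>\<in>space M. \<theta> * w \<delta> \<le> indicator S \<omega> * yw \<delta> (?D \<omega>)}"
      by (rule measure_Un_le) measurable
    also have "prob {\<omega>\<in>space M. \<theta> * w \<delta> \<le> indicator S \<omega> * yw \<delta> (?D \<omega>)} \<le> expectation (\<lambda>\<omega>. indicator S \<omega> * yw \<delta> (?D \<omega>)) / (\<theta> * w \<delta>)"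
      by (rule integral_Markov_inequality_measure[OF yi, where A = "{}"]) (use \<theta> \<delta> tf.\<phi>_nonneg in auto)
    also have "\<dots> \<le> T * ((lam * K + s1 + 1) * (1 / L)) * exp (lam * T) / (\<theta> * w \<delta>)"
    proof (rule divide_right_mono)
      have "expectation (\<lambda>\<omega>. indicator S \<omega> * yw \<delta> (?D \<omega>)) \<le> (yw \<delta> 0 + T * ((lam * K + Cq * \<epsilon> * K\<^sup>2 * K / \<delta> + (s1 + Cq * \<epsilon> * K\<^sup>2 / \<delta>)) / L)) * exp (lam * T)"
        unfolding S_def L_def by (rule scaled_difference_bound[OF e T K \<delta>(1)])
      also have "\<dots> \<le> (T * ((lam * K + s1 + 1) / L)) * exp (lam * T)"
        unfolding yw_zero add_0_left using elim(1) L T by (intro mult_right_mono mult_left_mono divide_right_mono) auto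
      finally show "expectation (\<lambda>\<omega>. indicator S \<omega> * yw \<delta> (?D \<omega>)) \<le> T * ((lam * K + s1 + 1) * (1 / L)) * exp (lam * T)" by simp
    qed (use \<theta> \<delta> in simp)
    also have "prob (space M - S) \<le> 2 * (Cs / \<kappa>\<^sup>2 * tail_sum 0)"
      unfolding S_def K_def by (rule scaled_tightness[OF _ \<kappa>(1) e]) (use T in simp)
    finally have "prob {\<omega>\<in>space M. \<theta> < \<bar>?D \<omega>\<bar>} < r" using \<kappa>(2) \<delta>(3) unfolding L_def by linarith
    then show ?case by simp
  qed
qed

lemma Y_limit:
  assumes w: "\<omega> \<in> space M" and N: "\<And>s. real n \<le> s \<Longrightarrow> \<bar>noiseY s \<omega> - 1\<bar> \<le> 1 * 1 * exp (3/4 * lam * s)"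
  shows "\<exists>L. ((\<lambda>t. exp (- lam * t) * Y t \<omega>) \<longlongrightarrow> L) at_top \<and> 0 \<le> L \<and> (\<forall>u\<ge>real n. \<bar>exp (- lam * u) * Y u \<omega> - L\<bar> \<le> 12 * exp (- lam / 4 * u))"
  by (rule sde.scaled_limit[OF Y_sde w _ _ N]) auto

lemma Y_converges_AE: "AE \<omega> in M. \<exists>L. ((\<lambda>t. exp (- lam * t) * Y t \<omega>) \<longlongrightarrow> L) at_top"
proof -
  have "\<exists>Bad\<in>sets M. prob Bad \<le> Cs / 1\<^sup>2 * tail_sum n \<and> (\<forall>\<omega>\<in>space M - Bad. \<exists>L. ((\<lambda>t. exp (- lam * t) * Y t \<omega>) \<longlongrightarrow> L) at_top)" for n
  proof -
    obtain B2 where B2: "B2 \<in> sets M" "prob B2 \<le> Cs / 1\<^sup>2 * tail_sum n"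
      "\<And>\<omega> s. \<omega> \<in> space M - B2 \<Longrightarrow> real n \<le> s \<Longrightarrow> \<bar>noiseY s \<omega> - 1\<bar> \<le> 1 * 1 * exp (3/4 * lam * s)"
      using Y_tail[of 1 n] by (metis zero_less_one)
    then show ?thesis using Y_limit by blast
  qed
  then obtain Bad where Bad: "\<And>n. Bad n \<in> sets M" "\<And>n. prob (Bad n) \<le> Cs / 1\<^sup>2 * tail_sum n"
    "\<And>n \<omega>. \<omega> \<in> space M - Bad n \<Longrightarrow> \<exists>L. ((\<lambda>t. exp (- lam * t) * Y t \<omega>) \<longlongrightarrow> L) at_top"
    by metis
  let ?N = "\<Inter>n. Bad n"
  have Nm: "?N \<in> sets M" using Bad(1) by (intro sets.countable_INT) auto
  have "prob ?N \<le> Cs / 1\<^sup>2 * tail_sum n" for n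
    by (rule order_trans[OF finite_measure_mono Bad(2)]) (use Bad(1) in auto)
  moreover have "(\<lambda>n. Cs / 1\<^sup>2 * tail_sum n) \<longlonglongrightarrow> Cs / 1\<^sup>2 * 0" by (intro tendsto_intros tail_sum_lim)
  ultimately have "prob ?N \<le> 0" by (intro LIMSEQ_le_const[of "\<lambda>n. Cs / 1\<^sup>2 * tail_sum n" 0]) auto
  then have "prob ?N = 0" using measure_nonneg[of M ?N] by linarith
  then have "?N \<in> null_sets M" using Nm by (simp add: null_sets_def emeasure_eq_measure)
  then show ?thesis by (rule AE_I') (use Bad(3) in blast)
qed

lemma follows_flow:
  assumes e: "0 < \<epsilon>" and k: "0 < \<kappa>" and w: "\<omega> \<in> space M"
    and N0: "\<And>s. 0 \<le> s \<Longrightarrow> \<bar>noiseX \<epsilon> s \<omega> - \<epsilon>\<bar> \<le> \<kappa> * \<epsilon> * exp (3/4 * lam * s)"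
    and Nn: "\<And>s. real n \<le> s \<Longrightarrow> \<bar>noiseX \<epsilon> s \<omega> - \<epsilon>\<bar> \<le> 1 * \<epsilon> * exp (3/4 * lam * s)"
    and R: "5 * (1 + \<kappa>) * \<epsilon> * exp (lam * (real n + t)) \<le> R" and t: "0 \<le> t"
  shows "\<bar>X \<epsilon> (real n + t) \<omega> - flow t (X \<epsilon> (real n) \<omega>)\<bar> \<le>
    2 * \<epsilon> * exp (3/4 * lam * (real n + t)) + 8 * (lam + C * R) / lam * (\<epsilon> * exp (lam * (real n + t))) * exp (- lam / 4 * real n)"
proof -
  interpret X: sde M B f "\<lambda>x. sqrt (\<epsilon> * \<sigma> x)" \<epsilon> lam "Cs * \<epsilon>" "X \<epsilon>" by (rule X_sde[OF e])
  define \<xi> where "\<xi> = X \<epsilon> (real n) \<omega>"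
  have \<xi>0: "0 \<le> \<xi>" unfolding \<xi>_def by (rule X_nonneg[OF e w]) simp
  define x where "x s = X \<epsilon> (real n + s) \<omega>" for s
  define u where "u s = flow s \<xi>" for s
  define \<nu> where "\<nu> s = X.noise (real n + s) \<omega> - X.noise (real n) \<omega>" for s
  define E where "E s = X.drift_part (real n + s) \<omega> + X.noise (real n) \<omega> - u s" for s
  define L where "L = lam + C * R"
  have xu: "x s - u s = E s + \<nu> s" for s unfolding x_def E_def \<nu>_def using X.Z_split[of "real n + s" \<omega>] by simp
  have R0: "0 \<le> R"
  proof -
    have "0 \<le> 5 * (1 + \<kappa>) * \<epsilon> * exp (lam * (real n + t))" using k e by simp
    then show ?thesis using R by linarith
  qed
  have L0: "0 < L" unfolding L_def using lam_pos C_nonneg R0 by (simp add: add_pos_nonneg)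
  have grow: "5 * (1 + \<kappa>) * \<epsilon> * exp (lam * (real n + s)) \<le> R" if "s \<le> t" for s
  proof -
    have "5 * (1 + \<kappa>) * \<epsilon> * exp (lam * (real n + s)) \<le> 5 * (1 + \<kappa>) * \<epsilon> * exp (lam * (real n + t))"
      using that lam_pos k e by (intro mult_left_mono) auto
    then show ?thesis using R by linarith
  qed
  have xb: "0 \<le> x s" "x s \<le> R" if "0 \<le> s" "s \<le> t" for s
  proof -
    show "0 \<le> x s" unfolding x_def by (rule X_nonneg[OF e w]) (use that in simp)
    have "x s \<le> 5 * (1 + \<kappa>) * \<epsilon> * exp (lam * (real n + s))" unfolding x_def
      by (rule X_growth[OF e k w _ N0]) (use that in auto)
    then show "x s \<le> R" using grow[OF that(2)] by linarith
  qed
  have ub: "0 \<le> u s" "u s \<le> R" if "0 \<le> s" "s \<le> t" for s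
  proof -
    show "0 \<le> u s" unfolding u_def by (rule flow_nonneg[OF \<xi>0 that(1)])
    have "u s \<le> \<xi> * exp (lam * s)" unfolding u_def by (rule flow_growth[OF \<xi>0 that(1)])
    also have "\<xi> \<le> 5 * (1 + \<kappa>) * \<epsilon> * exp (lam * real n)" unfolding \<xi>_def by (rule X_growth[OF e k w _ N0]) auto
    finally have "u s \<le> 5 * (1 + \<kappa>) * \<epsilon> * exp (lam * real n) * exp (lam * s)" by simp
    also have "\<dots> = 5 * (1 + \<kappa>) * \<epsilon> * exp (lam * (real n + s))" by (simp add: distrib_left exp_add)
    finally show "u s \<le> R" using grow[OF that(2)] by linarith
  qed
  define \<rho> where "\<rho> s = 2 * \<epsilon> * exp (3/4 * lam * (real n + s))" for s
  have \<nu>b: "\<bar>\<nu> s\<bar> \<le> \<rho> s" if "0 \<le> s" for s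
  proof -
    have "\<bar>X.noise (real n + s) \<omega> - \<epsilon>\<bar> \<le> 1 * \<epsilon> * exp (3/4 * lam * (real n + s))" by (rule Nn) (use that in simp)
    moreover have "\<bar>X.noise (real n) \<omega> - \<epsilon>\<bar> \<le> 1 * \<epsilon> * exp (3/4 * lam * real n)" by (rule Nn) simp
    moreover have "1 * \<epsilon> * exp (3/4 * lam * real n) \<le> 1 * \<epsilon> * exp (3/4 * lam * (real n + s))" using e lam_pos that by (intro mult_left_mono) auto
    ultimately show ?thesis unfolding \<nu>_def \<rho>_def by linarith
  qed
  have Ed: "(E has_real_derivative f (x s) - f (u s)) (at s)" if s: "0 < s" for s
  proof -
    have "((\<lambda>s. X.drift_part (real n + s) \<omega>) has_real_derivative f (x s)) (at s)"
    proof -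
      have "((\<lambda>t. X.drift_part t \<omega>) has_real_derivative f (x s)) (at (s + real n))"
        unfolding x_def using X.drift_part_deriv'[OF w, of "real n + s"] s by (simp add: add.commute)
      then have "((\<lambda>s. X.drift_part (s + real n) \<omega>) has_real_derivative f (x s)) (at s)" unfolding DERIV_shift .
      then show ?thesis by (simp add: add.commute)
    qed
    moreover have "(u has_real_derivative f (u s)) (at s)" unfolding u_def by (rule is_sol_deriv[OF flow_sol[OF \<xi>0] s])
    ultimately show ?thesis unfolding E_def by (auto intro!: derivative_eq_intros)
  qed
  have EE: "E s * (f (x s) - f (u s)) \<le> lam * (E s)\<^sup>2 + L * \<rho> s * \<bar>E s\<bar>" if s: "0 \<le> s" "s \<le> t" for s
  proof (cases "x s = u s")
    case True
    have "0 \<le> lam * (E s)\<^sup>2 + L * \<rho> s * \<bar>E s\<bar>" using lam_pos L0 e by (auto simp: \<rho>_def)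
    then show ?thesis using True by simp
  next
    case False
    define a where "a = (f (x s) - f (u s)) / (x s - u s)"
    have a: "f (x s) - f (u s) = a * (x s - u s)" using False by (simp add: a_def)
    have "a * (x s - u s)\<^sup>2 \<le> lam * (x s - u s)\<^sup>2"
      using dissip[OF ub(1)[OF s] xb(1)[OF s]] a by (simp add: power2_eq_square mult_ac)
    then have al: "a \<le> lam" using False by simp
    have "\<bar>a\<bar> * \<bar>x s - u s\<bar> \<le> L * \<bar>x s - u s\<bar>"
      using f_lipschitz[OF xb[OF s] ub[OF s]] a by (simp add: L_def abs_mult)
    then have aL: "\<bar>a\<bar> \<le> L" using False by simp
    have "E s * (f (x s) - f (u s)) = a * (E s)\<^sup>2 + a * \<nu> s * E s" unfolding a xu by (simp add: power2_eq_square algebra_simps)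
    also have "a * (E s)\<^sup>2 \<le> lam * (E s)\<^sup>2" by (intro mult_right_mono al) simp
    also have "a * \<nu> s * E s \<le> \<bar>a\<bar> * \<bar>\<nu> s\<bar> * \<bar>E s\<bar>" by (metis abs_ge_self abs_mult)
    also have "\<dots> \<le> L * \<rho> s * \<bar>E s\<bar>" using aL \<nu>b[OF s(1)] L0 by (intro mult_right_mono mult_mono) auto
    finally show ?thesis by simp
  qed
  define q where "q s = 8 * L / lam * \<epsilon> * exp (3/4 * lam * real n) * (1 - exp (- lam / 4 * s))" for s
  have qd: "(q has_real_derivative exp (- lam * s) * (L * \<rho> s)) (at s)" for s
  proof -
    have "(q has_real_derivative 8 * L / lam * \<epsilon> * exp (3/4 * lam * real n) * (exp (- lam / 4 * s) * (lam / 4))) (at s)"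
      unfolding q_def by (auto intro!: derivative_eq_intros)
    moreover have "exp (- lam * s) * exp (3/4 * lam * (real n + s)) = exp (3/4 * lam * real n) * exp (- lam / 4 * s)"
      by (simp add: algebra_simps flip: exp_add)
    then have "exp (- lam * s) * (L * \<rho> s) = 2 * L * \<epsilon> * (exp (3/4 * lam * real n) * exp (- lam / 4 * s))"
      unfolding \<rho>_def by (metis (no_types, opaque_lifting) mult.assoc mult.left_commute)
    moreover have "8 * L / lam * \<epsilon> * exp (3/4 * lam * real n) * (exp (- lam / 4 * s) * (lam / 4)) = 2 * L * \<epsilon> * (exp (3/4 * lam * real n) * exp (- lam / 4 * s))"
      using lam_pos by (simp add: field_simps)
    ultimately show ?thesis by (simp only:)
  qed
  define p where "p s = E s * exp (- lam * s)" for s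
  have pE: "\<bar>p t\<bar> \<le> q t"
  proof (rule field_le_epsilon)
    fix \<eta> :: real assume \<eta>: "0 < \<eta>"
    have sp: "0 < (p s)\<^sup>2 + \<eta>\<^sup>2" for s using \<eta> by (simp add: add_nonneg_pos)
    have pd: "(p has_real_derivative (f (x s) - f (u s)) * exp (- lam * s) + E s * (exp (- lam * s) * (- lam))) (at s)" if "0 < s" for s
      unfolding p_def using Ed[OF that] by (auto intro!: derivative_eq_intros)
    define p' where "p' s = (f (x s) - f (u s)) * exp (- lam * s) + E s * (exp (- lam * s) * (- lam))" for s
    have "sqrt ((p t)\<^sup>2 + \<eta>\<^sup>2) - q t \<le> sqrt ((p 0)\<^sup>2 + \<eta>\<^sup>2) - q 0"
    proof (rule DERIV_nonpos_imp_le[OF t, where p = "\<lambda>s. sqrt ((p s)\<^sup>2 + \<eta>\<^sup>2) - q s" and p' = "\<lambda>s. p s * p' s / sqrt ((p s)\<^sup>2 + \<eta>\<^sup>2) - exp (- lam * s) * (L * \<rho> s)"])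
      have "continuous_on {0..t} (\<lambda>s. X.drift_part (real n + s) \<omega>)"
        by (rule continuous_on_compose2[OF X.drift_part_cont[OF w, of "{0..}"]]) (auto intro!: continuous_intros)
      moreover have "continuous_on {0..t} u" unfolding u_def using flow_cont[OF \<xi>0] by (rule continuous_on_subset) auto
      ultimately have "continuous_on {0..t} E" unfolding E_def by (intro continuous_intros)
      then show "continuous_on {0..t} (\<lambda>s. sqrt ((p s)\<^sup>2 + \<eta>\<^sup>2) - q s)" unfolding p_def q_def by (intro continuous_intros)
      fix s assume s: "0 < s" "s < t"
      have "((\<lambda>s. sqrt ((p s)\<^sup>2 + \<eta>\<^sup>2)) has_real_derivative p s * p' s / sqrt ((p s)\<^sup>2 + \<eta>\<^sup>2)) (at s)"
        using sp[of s] by (auto intro!: derivative_eq_intros pd[OF s(1), folded p'_def] simp: field_simps)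
      from DERIV_diff[OF this qd] show "((\<lambda>s. sqrt ((p s)\<^sup>2 + \<eta>\<^sup>2) - q s) has_real_derivative p s * p' s / sqrt ((p s)\<^sup>2 + \<eta>\<^sup>2) - exp (- lam * s) * (L * \<rho> s)) (at s)" .
      have "p s * p' s = exp (- lam * s) * exp (- lam * s) * (E s * (f (x s) - f (u s)) - lam * (E s)\<^sup>2)"
        unfolding p_def p'_def by (simp add: power2_eq_square algebra_simps)
      also have "\<dots> \<le> exp (- lam * s) * exp (- lam * s) * (L * \<rho> s * \<bar>E s\<bar>)"
        using EE[of s] s by (intro mult_left_mono) auto
      also have "\<dots> = exp (- lam * s) * (L * \<rho> s) * \<bar>p s\<bar>" unfolding p_def by (simp add: abs_mult)
      also have "\<dots> \<le> exp (- lam * s) * (L * \<rho> s) * sqrt ((p s)\<^sup>2 + \<eta>\<^sup>2)"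
        using L0 e by (intro mult_left_mono) (auto simp: \<rho>_def intro!: real_le_rsqrt)
      finally have "p s * p' s / sqrt ((p s)\<^sup>2 + \<eta>\<^sup>2) \<le> exp (- lam * s) * (L * \<rho> s)" using sp[of s] by (simp add: pos_divide_le_eq)
      then show "p s * p' s / sqrt ((p s)\<^sup>2 + \<eta>\<^sup>2) - exp (- lam * s) * (L * \<rho> s) \<le> 0" by simp
    qed
    moreover have "E 0 = 0" using X.Z_split[of "real n" \<omega>] flow_0[OF \<xi>0] by (simp add: E_def u_def) (simp add: \<xi>_def)
    then have "sqrt ((p 0)\<^sup>2 + \<eta>\<^sup>2) - q 0 = \<eta>" using \<eta> by (simp add: p_def q_def)
    moreover have "\<bar>p t\<bar> \<le> sqrt ((p t)\<^sup>2 + \<eta>\<^sup>2)" by (rule real_le_rsqrt) simp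
    ultimately show "\<bar>p t\<bar> \<le> q t + \<eta>" by linarith
  qed
  have "q t \<le> 8 * L / lam * \<epsilon> * exp (3/4 * lam * real n) * 1"
    unfolding q_def using L0 lam_pos e by (intro mult_left_mono) auto
  then have "\<bar>E t\<bar> * exp (- lam * t) \<le> 8 * L / lam * \<epsilon> * exp (3/4 * lam * real n)" using pE by (simp add: p_def abs_mult)
  then have "\<bar>E t\<bar> * exp (- lam * t) * exp (lam * t) \<le> 8 * L / lam * \<epsilon> * exp (3/4 * lam * real n) * exp (lam * t)" by (intro mult_right_mono) auto
  then have "\<bar>E t\<bar> \<le> 8 * L / lam * \<epsilon> * exp (3/4 * lam * real n) * exp (lam * t)" by (simp add: mult.assoc flip: exp_add)
  also have "\<dots> = 8 * L / lam * (\<epsilon> * exp (lam * (real n + t))) * exp (- lam / 4 * real n)"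
  proof -
    have "exp (3/4 * lam * real n) * exp (lam * t) = exp (lam * (real n + t)) * exp (- lam / 4 * real n)" by (simp add: algebra_simps flip: exp_add)
    then show ?thesis by (metis (no_types, opaque_lifting) mult.assoc)
  qed
  finally have "\<bar>E t\<bar> \<le> 8 * L / lam * (\<epsilon> * exp (lam * (real n + t))) * exp (- lam / 4 * real n)" .
  moreover have "\<bar>x t - u t\<bar> \<le> \<bar>E t\<bar> + \<bar>\<nu> t\<bar>" unfolding xu by (rule abs_triangle_ineq)
  ultimately show ?thesis using \<nu>b[OF t] unfolding x_def u_def \<xi>_def \<rho>_def L_def by linarith
qed

lemma good_path_bound:
  assumes e: "0 < \<epsilon>" and k: "0 < \<kappa>" and w: "\<omega> \<in> space M" and t: "0 \<le> t" "t \<le> T"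
    and X0: "\<And>s. 0 \<le> s \<Longrightarrow> \<bar>noiseX \<epsilon> s \<omega> - \<epsilon>\<bar> \<le> \<kappa> * \<epsilon> * exp (3/4 * lam * s)"
    and Xn: "\<And>s. real n \<le> s \<Longrightarrow> \<bar>noiseX \<epsilon> s \<omega> - \<epsilon>\<bar> \<le> 1 * \<epsilon> * exp (3/4 * lam * s)"
    and Y0: "\<And>s. 0 \<le> s \<Longrightarrow> \<bar>noiseY s \<omega> - 1\<bar> \<le> \<kappa> * 1 * exp (3/4 * lam * s)"
    and W: "0 \<le> W" "\<bar>exp (- lam * real n) * Y (real n) \<omega> - W\<bar> \<le> 12 * exp (- lam / 4 * real n)"
    and D: "\<bar>X \<epsilon> (real n) \<omega> / \<epsilon> - Y (real n) \<omega>\<bar> \<le> \<theta>"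
    and \<tau>: "exp (lam * \<tau>) = 1 / \<epsilon>" "real n \<le> \<tau>"
    and H: "\<And>x. 0 \<le> x \<Longrightarrow> x \<le> 5 * (1 + \<kappa>) \<Longrightarrow> \<bar>Hflow (\<tau> - real n) x - Hlim x\<bar> \<le> \<theta>"
  shows "\<bar>X \<epsilon> (\<tau> + t) \<omega> - flow t (Hlim W)\<bar> \<le> 2 * \<epsilon> * exp (3/4 * lam * (\<tau> + T))
     + 8 * (lam + C * (5 * (1 + \<kappa>) * exp (lam * T))) / lam * exp (lam * T) * exp (- lam / 4 * real n)
     + 2 * (exp (lam * T) * \<theta>) + exp (lam * T) * (12 * exp (- lam / 4 * real n))"
proof -
  have et: "exp (lam * t) \<le> exp (lam * T)" using t lam_pos by simp
  have ee: "\<epsilon> * exp (lam * (\<tau> + t)) = exp (lam * t)" using e by (simp add: distrib_left exp_add \<tau>(1))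
  define \<xi> where "\<xi> = X \<epsilon> (real n) \<omega>"
  define y where "y = Y (real n) \<omega>"
  define v where "v = exp (- lam * real n) * y"
  have pos: "0 \<le> \<xi>" "0 \<le> y" "0 \<le> v" unfolding \<xi>_def y_def v_def using X_nonneg[OF e w] Y_nonneg[OF w] by auto
  have tn: "0 \<le> \<tau> - real n" "0 \<le> \<tau> - real n + t" using \<tau>(2) t by auto
  let ?R = "5 * (1 + \<kappa>) * exp (lam * T)"
  let ?L = "8 * (lam + C * ?R) / lam"
  have L0: "0 \<le> ?L" using lam_pos C_nonneg k by simp
  have eq\<tau>: "real n + (\<tau> - real n + t) = \<tau> + t" by simp
  have "\<bar>X \<epsilon> (\<tau> + t) \<omega> - flow (\<tau> - real n + t) \<xi>\<bar> \<le> 2 * \<epsilon> * exp (3/4 * lam * (\<tau> + t)) + ?L * (\<epsilon> * exp (lam * (\<tau> + t))) * exp (- lam / 4 * real n)"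
  proof -
    have "5 * (1 + \<kappa>) * \<epsilon> * exp (lam * (real n + (\<tau> - real n + t))) = 5 * (1 + \<kappa>) * (\<epsilon> * exp (lam * (\<tau> + t)))" unfolding eq\<tau> by simp
    also have "\<dots> \<le> ?R" unfolding ee using et k by (intro mult_left_mono) auto
    finally have "5 * (1 + \<kappa>) * \<epsilon> * exp (lam * (real n + (\<tau> - real n + t))) \<le> ?R" .
    from follows_flow[OF e k w X0 Xn this tn(2)] show ?thesis unfolding \<xi>_def eq\<tau> .
  qed
  moreover have "2 * \<epsilon> * exp (3/4 * lam * (\<tau> + t)) \<le> 2 * \<epsilon> * exp (3/4 * lam * (\<tau> + T))" using e t lam_pos by (intro mult_left_mono) auto
  moreover have "?L * (\<epsilon> * exp (lam * (\<tau> + t))) * exp (- lam / 4 * real n) \<le> ?L * exp (lam * T) * exp (- lam / 4 * real n)"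
    unfolding ee using et L0 by (intro mult_right_mono mult_left_mono) auto
  ultimately have 1: "\<bar>X \<epsilon> (\<tau> + t) \<omega> - flow (\<tau> - real n + t) \<xi>\<bar> \<le> 2 * \<epsilon> * exp (3/4 * lam * (\<tau> + T)) + ?L * exp (lam * T) * exp (- lam / 4 * real n)" by linarith
  have 2: "\<bar>flow (\<tau> - real n + t) \<xi> - flow (\<tau> - real n + t) (\<epsilon> * y)\<bar> \<le> exp (lam * T) * \<theta>"
  proof -
    have "\<bar>flow (\<tau> - real n + t) \<xi> - flow (\<tau> - real n + t) (\<epsilon> * y)\<bar> \<le> exp (lam * (\<tau> - real n + t)) * \<bar>\<xi> - \<epsilon> * y\<bar>"
      using pos e tn by (intro flow_contraction) auto
    also have "\<bar>\<xi> - \<epsilon> * y\<bar> = \<epsilon> * \<bar>\<xi> / \<epsilon> - y\<bar>"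
    proof -
      have "\<xi> - \<epsilon> * y = \<epsilon> * (\<xi> / \<epsilon> - y)" using e by (simp add: right_diff_distrib)
      then show ?thesis using e by (simp add: abs_mult)
    qed
    also have "exp (lam * (\<tau> - real n + t)) * (\<epsilon> * \<bar>\<xi> / \<epsilon> - y\<bar>) = (\<epsilon> * exp (lam * (\<tau> + t))) * exp (- lam * real n) * \<bar>\<xi> / \<epsilon> - y\<bar>"
    proof -
      have "exp (lam * (\<tau> - real n + t)) = exp (lam * (\<tau> + t)) * exp (- lam * real n)" by (simp add: algebra_simps flip: exp_add)
      then show ?thesis by simp
    qed
    also have "\<dots> \<le> exp (lam * T) * 1 * \<theta>"
      unfolding ee \<xi>_def y_def using et lam_pos D by (intro mult_mono) auto
    finally show ?thesis by simp
  qed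
  have 3: "flow (\<tau> - real n + t) (\<epsilon> * y) = flow t (Hflow (\<tau> - real n) v)"
  proof -
    have "exp (- lam * (\<tau> - real n)) = \<epsilon> * exp (lam * real n)"
    proof -
      have "exp (- lam * (\<tau> - real n)) = exp (lam * real n) / exp (lam * \<tau>)" by (simp add: algebra_simps flip: exp_diff)
      then show ?thesis unfolding \<tau>(1) by simp
    qed
    then have "v * exp (- lam * (\<tau> - real n)) = \<epsilon> * y" unfolding v_def by (simp add: mult_ac flip: exp_add)
    then have "Hflow (\<tau> - real n) v = flow (\<tau> - real n) (\<epsilon> * y)" by (simp add: Hflow_def)
    then show ?thesis using flow_semigroup[of "\<epsilon> * y" "\<tau> - real n" t] pos e tn t by simp
  qed
  have vb: "v \<le> 5 * (1 + \<kappa>)"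
  proof -
    have "y \<le> 5 * (1 + \<kappa>) * 1 * exp (lam * real n)" unfolding y_def by (rule Y_growth[OF k w _ Y0]) auto
    then have "exp (- lam * real n) * y \<le> exp (- lam * real n) * (5 * (1 + \<kappa>) * 1 * exp (lam * real n))" by (intro mult_left_mono) auto
    also have "\<dots> = 5 * (1 + \<kappa>)" by (simp add: exp_minus)
    finally show ?thesis by (simp add: v_def)
  qed
  have 4: "\<bar>flow t (Hflow (\<tau> - real n) v) - flow t (Hlim v)\<bar> \<le> exp (lam * T) * \<theta>"
  proof -
    have "\<bar>flow t (Hflow (\<tau> - real n) v) - flow t (Hlim v)\<bar> \<le> exp (lam * t) * \<bar>Hflow (\<tau> - real n) v - Hlim v\<bar>"
      by (intro flow_contraction Hflow_nonneg Hlim_nonneg pos tn t)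
    also have "\<dots> \<le> exp (lam * T) * \<theta>" using et H[OF pos(3) vb] by (intro mult_mono) auto
    finally show ?thesis .
  qed
  have 5: "\<bar>flow t (Hlim v) - flow t (Hlim W)\<bar> \<le> exp (lam * T) * (12 * exp (- lam / 4 * real n))"
  proof -
    have "\<bar>flow t (Hlim v) - flow t (Hlim W)\<bar> \<le> exp (lam * t) * \<bar>Hlim v - Hlim W\<bar>"
      by (intro flow_contraction Hlim_nonneg pos W t)
    also have "\<dots> \<le> exp (lam * T) * (12 * exp (- lam / 4 * real n))"
      using et Hlim_lipschitz[OF pos(3) W(1)] W(2) unfolding v_def y_def by (intro mult_mono) auto
    finally show ?thesis .
  qed
  from 1 2 4 5 show ?thesis unfolding 3 by linarith
qed

lemma fluid_limit:
  assumes T: "0 < T"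
  shows "conv_in_prob M
     (\<lambda>\<epsilon> \<omega>. SUP t\<in>{0..T}. \<bar>X \<epsilon> ((1 / lam) * ln (1 / \<epsilon>) + t) \<omega> - flow t (Hlim (Lim at_top (\<lambda>t. exp (- lam * t) * Y t \<omega>)))\<bar>)
     (\<lambda>_. 0) (at_right 0)"
  unfolding conv_in_prob_def
proof (intro allI impI tendstoI)
  fix \<delta> r :: real assume \<delta>: "0 < \<delta>" and r: "0 < r"
  let ?\<tau> = "\<lambda>\<epsilon>. (1 / lam) * ln (1 / \<epsilon>)"
  let ?W = "\<lambda>\<omega>. Lim at_top (\<lambda>t. exp (- lam * t) * Y t \<omega>)"
  have "((\<lambda>\<kappa>. Cs / \<kappa>\<^sup>2 * tail_sum 0) \<longlongrightarrow> 0) at_top" by real_asymp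
  then have "\<forall>\<^sub>F \<kappa> in at_top. Cs / \<kappa>\<^sup>2 * tail_sum 0 < r / 6" by (rule order_tendstoD) (use r in simp)
  then obtain \<kappa> where \<kappa>: "0 < \<kappa>" "Cs / \<kappa>\<^sup>2 * tail_sum 0 < r / 6"
    using eventually_happens'[OF trivial_limit_at_top_linorder eventually_conj[OF eventually_gt_at_top[of 0]]] by blast
  define L where "L = 8 * (lam + C * (5 * (1 + \<kappa>) * exp (lam * T))) / lam * exp (lam * T)"
  have en: "(\<lambda>n. exp (- lam / 4 * real n)) \<longlonglongrightarrow> 0" using lam_pos by real_asymp
  have "(\<lambda>n. Cs / 1\<^sup>2 * tail_sum n) \<longlonglongrightarrow> Cs / 1\<^sup>2 * 0" by (intro tendsto_intros tail_sum_lim)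
  then have l1: "(\<lambda>n. Cs / 1\<^sup>2 * tail_sum n) \<longlonglongrightarrow> 0" by simp
  have "(\<lambda>n. L * exp (- lam / 4 * real n)) \<longlonglongrightarrow> L * 0" by (intro tendsto_intros en)
  then have l2: "(\<lambda>n. L * exp (- lam / 4 * real n)) \<longlonglongrightarrow> 0" by simp
  have "(\<lambda>n. exp (lam * T) * (12 * exp (- lam / 4 * real n))) \<longlonglongrightarrow> exp (lam * T) * (12 * 0)" by (intro tendsto_intros en)
  then have l3: "(\<lambda>n. exp (lam * T) * (12 * exp (- lam / 4 * real n))) \<longlonglongrightarrow> 0" by simp
  have "\<forall>\<^sub>F n in sequentially. 0 < n \<and> Cs / 1\<^sup>2 * tail_sum n < r / 6 \<and> L * exp (- lam / 4 * real n) < \<delta> / 5 \<and> exp (lam * T) * (12 * exp (- lam / 4 * real n)) < \<delta> / 5"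
    using order_tendstoD(2)[OF l1, of "r / 6"] order_tendstoD(2)[OF l2, of "\<delta> / 5"] order_tendstoD(2)[OF l3, of "\<delta> / 5"] r \<delta> eventually_gt_at_top[of "0::nat"]
    by (intro eventually_conj) auto
  then obtain n where n: "0 < n" "Cs / 1\<^sup>2 * tail_sum n < r / 6" "L * exp (- lam / 4 * real n) < \<delta> / 5" "exp (lam * T) * (12 * exp (- lam / 4 * real n)) < \<delta> / 5"
    using eventually_happens'[OF sequentially_bot] by blast
  define \<theta> where "\<theta> = \<delta> / 5 / exp (lam * T)"
  have \<theta>: "0 < \<theta>" "exp (lam * T) * \<theta> = \<delta> / 5" using \<delta> by (auto simp: \<theta>_def)
  have "\<forall>\<^sub>F \<epsilon> in at_right 0. prob {\<omega>\<in>space M. \<theta> < \<bar>X \<epsilon> (real n) \<omega> / \<epsilon> - Y (real n) \<omega>\<bar>} < r / 6"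
    by (rule order_tendstoD(2)[OF scaled_convergence[OF _ \<theta>(1)]]) (use n r in auto)
  moreover have \<tau>lim: "filterlim ?\<tau> at_top (at_right 0)" using lam_pos by real_asymp
  have "\<forall>\<^sub>F \<epsilon> in at_right 0. real n \<le> ?\<tau> \<epsilon>" using \<tau>lim by (simp add: filterlim_at_top)
  moreover have "\<forall>\<^sub>F \<epsilon> in at_right 0. \<forall>x\<in>{0..5 * (1 + \<kappa>)}. \<bar>Hflow (?\<tau> \<epsilon> - real n) x - Hlim x\<bar> \<le> 3 * (\<theta> / 3)"
  proof -
    have fl: "filterlim (\<lambda>\<epsilon>. ?\<tau> \<epsilon> - real n) at_top (at_right 0)" using lam_pos by real_asymp
    have "\<forall>\<^sub>F t in at_top. \<forall>x\<in>{0..5 * (1 + \<kappa>)}. \<bar>Hflow t x - Hlim x\<bar> \<le> 3 * (\<theta> / 3)"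
      by (rule Hflow_uniform) (use \<theta>(1) in simp)
    then show ?thesis using fl by (rule eventually_compose_filterlim)
  qed
  moreover have "((\<lambda>\<epsilon>. 2 * \<epsilon> * exp (3/4 * lam * (?\<tau> \<epsilon> + T))) \<longlongrightarrow> 0) (at_right 0)" using lam_pos by real_asymp
  then have "\<forall>\<^sub>F \<epsilon> in at_right 0. 2 * \<epsilon> * exp (3/4 * lam * (?\<tau> \<epsilon> + T)) < \<delta> / 5" by (rule order_tendstoD) (use \<delta> in simp)
  ultimately show "\<forall>\<^sub>F \<epsilon> in at_right 0. dist (measure M {\<omega>\<in>space M. \<delta> < \<bar>(SUP t\<in>{0..T}. \<bar>X \<epsilon> (?\<tau> \<epsilon> + t) \<omega> - flow t (Hlim (?W \<omega>))\<bar>) - 0\<bar>}) 0 < r"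
    using eventually_at_right_less[of "0::real"]
  proof eventually_elim
    case (elim \<epsilon>)
    note e = elim(5)
    have \<tau>: "exp (lam * ?\<tau> \<epsilon>) = 1 / \<epsilon>" using lam_pos e by simp
    obtain B1 where B1: "B1 \<in> sets M" "prob B1 \<le> Cs / \<kappa>\<^sup>2 * tail_sum 0"
      "\<And>\<omega> s. \<omega> \<in> space M - B1 \<Longrightarrow> real 0 \<le> s \<Longrightarrow> \<bar>noiseX \<epsilon> s \<omega> - \<epsilon>\<bar> \<le> \<kappa> * \<epsilon> * exp (3/4 * lam * s)"
      using X_tail[OF e \<kappa>(1), of 0] by blast
    obtain B2 where B2: "B2 \<in> sets M" "prob B2 \<le> Cs / 1\<^sup>2 * tail_sum n"
      "\<And>\<omega> s. \<omega> \<in> space M - B2 \<Longrightarrow> real n \<le> s \<Longrightarrow> \<bar>noiseX \<epsilon> s \<omega> - \<epsilon>\<bar> \<le> 1 * \<epsilon> * exp (3/4 * lam * s)"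
      using X_tail[OF e zero_less_one, of n] by blast
    obtain B3 where B3: "B3 \<in> sets M" "prob B3 \<le> Cs / \<kappa>\<^sup>2 * tail_sum 0"
      "\<And>\<omega> s. \<omega> \<in> space M - B3 \<Longrightarrow> real 0 \<le> s \<Longrightarrow> \<bar>noiseY s \<omega> - 1\<bar> \<le> \<kappa> * 1 * exp (3/4 * lam * s)"
      using Y_tail[OF \<kappa>(1), of 0] by blast
    obtain B4 where B4: "B4 \<in> sets M" "prob B4 \<le> Cs / 1\<^sup>2 * tail_sum n"
      "\<And>\<omega> s. \<omega> \<in> space M - B4 \<Longrightarrow> real n \<le> s \<Longrightarrow> \<bar>noiseY s \<omega> - 1\<bar> \<le> 1 * 1 * exp (3/4 * lam * s)"
      using Y_tail[OF zero_less_one, of n] by blast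
    define B5 where "B5 = {\<omega>\<in>space M. \<theta> < \<bar>X \<epsilon> (real n) \<omega> / \<epsilon> - Y (real n) \<omega>\<bar>}"
    have B5: "B5 \<in> sets M"
    proof -
      have [measurable]: "X \<epsilon> (real n) \<in> borel_measurable M" "Y (real n) \<in> borel_measurable M"
        using continuous_adapted_meas[OF X_ca[OF e]] continuous_adapted_meas[OF Y_ca] by auto
      show ?thesis unfolding B5_def by measurable
    qed
    define Bad where "Bad = B1 \<union> (B2 \<union> (B3 \<union> (B4 \<union> B5)))"
    have Badm: "Bad \<in> sets M" unfolding Bad_def using B1 B2 B3 B4 B5 by auto
    have "prob Bad \<le> prob B1 + (prob B2 + (prob B3 + (prob B4 + prob B5)))"
      unfolding Bad_def using B1(1) B2(1) B3(1) B4(1) B5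
      by (intro order_trans[OF measure_Un_le] add_left_mono) auto
    moreover have "prob B5 < r / 6" using elim(1) unfolding B5_def .
    ultimately have Badp: "prob Bad < r" using B1(2) B2(2) B3(2) B4(2) \<kappa>(2) n(2) r by linarith
    let ?A = "{\<omega>\<in>space M. \<delta> < \<bar>(SUP t\<in>{0..T}. \<bar>X \<epsilon> (?\<tau> \<epsilon> + t) \<omega> - flow t (Hlim (?W \<omega>))\<bar>) - 0\<bar>}"
    have sub: "?A \<subseteq> Bad"
    proof (rule subsetI, rule ccontr)
      fix \<omega> assume a: "\<omega> \<in> ?A" "\<omega> \<notin> Bad"
      then have w: "\<omega> \<in> space M" "\<omega> \<in> space M - B1" "\<omega> \<in> space M - B2" "\<omega> \<in> space M - B3" "\<omega> \<in> space M - B4" "\<omega> \<notin> B5"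
        by (auto simp: Bad_def)
      obtain W where W: "((\<lambda>t. exp (- lam * t) * Y t \<omega>) \<longlongrightarrow> W) at_top" "0 \<le> W"
        "\<And>u. real n \<le> u \<Longrightarrow> \<bar>exp (- lam * u) * Y u \<omega> - W\<bar> \<le> 12 * exp (- lam / 4 * u)"
        using Y_limit[OF w(1) B4(3)[OF w(5)]] by blast
      have WW: "?W \<omega> = W" by (rule tendsto_Lim[OF _ W(1)]) simp
      have D: "\<bar>X \<epsilon> (real n) \<omega> / \<epsilon> - Y (real n) \<omega>\<bar> \<le> \<theta>" using w(1,6) by (simp add: B5_def not_less)
      have bd: "\<bar>X \<epsilon> (?\<tau> \<epsilon> + t) \<omega> - flow t (Hlim (?W \<omega>))\<bar> \<le> \<delta>" if t: "t \<in> {0..T}" for t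
      proof -
        have "\<bar>X \<epsilon> (?\<tau> \<epsilon> + t) \<omega> - flow t (Hlim W)\<bar> \<le> 2 * \<epsilon> * exp (3/4 * lam * (?\<tau> \<epsilon> + T)) + L * exp (- lam / 4 * real n)
           + 2 * (exp (lam * T) * \<theta>) + exp (lam * T) * (12 * exp (- lam / 4 * real n))"
          unfolding L_def
        proof (rule good_path_bound[OF e \<kappa>(1) w(1) _ _ _ B2(3)[OF w(3)] _ W(2) W(3)[OF order_refl] D \<tau> elim(2)])
          show "\<bar>Hflow (?\<tau> \<epsilon> - real n) x - Hlim x\<bar> \<le> \<theta>" if "0 \<le> x" "x \<le> 5 * (1 + \<kappa>)" for x
            using elim(3) that by simp
        qed (use t B1(3)[OF w(2)] B3(3)[OF w(4)] in auto)
        then show ?thesis using elim(4) n(3,4) \<theta>(2) unfolding WW by linarith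
      qed
      have "(SUP t\<in>{0..T}. \<bar>X \<epsilon> (?\<tau> \<epsilon> + t) \<omega> - flow t (Hlim (?W \<omega>))\<bar>) \<le> \<delta>"
        by (rule cSUP_least) (use T bd in auto)
      moreover have "\<bar>X \<epsilon> (?\<tau> \<epsilon> + 0) \<omega> - flow 0 (Hlim (?W \<omega>))\<bar> \<le> (SUP t\<in>{0..T}. \<bar>X \<epsilon> (?\<tau> \<epsilon> + t) \<omega> - flow t (Hlim (?W \<omega>))\<bar>)"
        by (rule cSUP_upper) (use T bd in \<open>auto intro!: bdd_aboveI[of _ \<delta>]\<close>)
      then have "0 \<le> (SUP t\<in>{0..T}. \<bar>X \<epsilon> (?\<tau> \<epsilon> + t) \<omega> - flow t (Hlim (?W \<omega>))\<bar>)" using abs_ge_zero order_trans by blast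
      ultimately show False using a(1) by simp
    qed
    have "measure M ?A \<le> prob Bad"
    proof (cases "?A \<in> sets M")
      case True then show ?thesis using sub Badm by (intro finite_measure_mono)
    next
      case False then show ?thesis by (simp add: measure_notin_sets)
    qed
    then show ?case using Badp by simp
  qed
qed

end

lemma derivative_bound_quadratic:
  fixes f f' f'' :: "real \<Rightarrow> real"
  assumes d1: "\<And>x. 0 \<le> x \<Longrightarrow> (f has_real_derivative f' x) (at x within {0..})"
    and d2: "\<And>x. 0 \<le> x \<Longrightarrow> (f' has_real_derivative f'' x) (at x within {0..})"
    and b: "\<And>x. 0 \<le> x \<Longrightarrow> \<bar>f'' x\<bar> \<le> K" and f0: "f 0 = 0" and x: "0 \<le> x"
  shows "\<bar>f' x - f' 0\<bar> \<le> K * x" "\<bar>f x - f' 0 * x\<bar> \<le> K * x\<^sup>2"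
proof -
  have K: "0 \<le> K" using b[of 0] by simp
  have l: "\<bar>f' y - f' 0\<bar> \<le> K * y" if y: "0 \<le> y" for y
  proof -
    have "norm (f' y - f' 0) \<le> K * norm (y - 0)"
    proof (rule field_differentiable_bound[where S = "{0..}"])
      show "(f' has_field_derivative f'' z) (at z within {0..})" if "z \<in> {0..}" for z using d2 that by simp
      show "norm (f'' z) \<le> K" if "z \<in> {0..}" for z using b that by simp
    qed (use y in auto)
    then show ?thesis using y by simp
  qed
  then show "\<bar>f' x - f' 0\<bar> \<le> K * x" using x by blast
  have "norm ((f x - f' 0 * x) - (f 0 - f' 0 * 0)) \<le> (K * x) * norm (x - 0)"
  proof (rule field_differentiable_bound[where S = "{0..x}" and f = "\<lambda>z. f z - f' 0 * z" and f' = "\<lambda>z. f' z - f' 0"])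
    fix z assume z: "z \<in> {0..x}"
    have "(f has_real_derivative f' z) (at z within {0..x})" using d1[of z] z by (auto intro: has_field_derivative_subset)
    then show "((\<lambda>z. f z - f' 0 * z) has_field_derivative f' z - f' 0) (at z within {0..x})" by (auto intro!: derivative_eq_intros)
    have "\<bar>f' z - f' 0\<bar> \<le> K * z" using l z by simp
    also have "\<dots> \<le> K * x" using z K by (intro mult_left_mono) auto
    finally show "norm (f' z - f' 0) \<le> K * x" by simp
  qed (use x in auto)
  then show "\<bar>f x - f' 0 * x\<bar> \<le> K * x\<^sup>2" using f0 x by (simp add: power2_eq_square mult.assoc)
qed

theorem theorem2:
  fixes M :: "'a measure" and B :: "real \<Rightarrow> 'a \<Rightarrow> real"
    and f f' f'' \<sigma> \<sigma>' \<sigma>'' :: "real \<Rightarrow> real"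
    and X :: "real \<Rightarrow> real \<Rightarrow> 'a \<Rightarrow> real" and Y :: "real \<Rightarrow> 'a \<Rightarrow> real"
    and T :: real
  assumes BM: "brownian_motion M B"
    and f_d1: "\<And>x. x \<ge> 0 \<Longrightarrow> (f has_real_derivative f' x) (at x within {0..})"
    and f_d2: "\<And>x. x \<ge> 0 \<Longrightarrow> (f' has_real_derivative f'' x) (at x within {0..})"
    and f''_cont: "continuous_on {0..} f''"
    and f''_bdd: "bounded (f'' ` {0..})"
    and s_d1: "\<And>x. x \<ge> 0 \<Longrightarrow> (\<sigma> has_real_derivative \<sigma>' x) (at x within {0..})"
    and s_d2: "\<And>x. x \<ge> 0 \<Longrightarrow> (\<sigma>' has_real_derivative \<sigma>'' x) (at x within {0..})"
    and s''_cont: "continuous_on {0..} \<sigma>''"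
    and s''_bdd: "bounded (\<sigma>'' ` {0..})"
    and s_nonneg: "\<And>x. x \<ge> 0 \<Longrightarrow> \<sigma> x \<ge> 0"
    and f0: "f 0 = 0" and s0: "\<sigma> 0 = 0"
    and f'0: "f' 0 > 0" and s'0: "\<sigma>' 0 > 0"
    and s_bdd: "bounded (\<sigma> ` {0..})" and s'_bdd: "bounded (\<sigma>' ` {0..})"
    and drift: "\<And>x y. x \<ge> 0 \<Longrightarrow> y \<ge> 0 \<Longrightarrow> (y - x) * (f y - f x) \<le> f' 0 * (y - x)^2"
    and X_sol: "\<And>\<epsilon>. \<epsilon> > 0 \<Longrightarrow> sde_solution M B f (\<lambda>x. sqrt (\<epsilon> * \<sigma> x)) \<epsilon> (X \<epsilon>)"
    and Y_sol: "sde_solution M B (\<lambda>y. f' 0 * y) (\<lambda>y. sqrt (\<sigma>' 0 * y)) 1 Y"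
    and T_pos: "T > 0"
  shows "(\<forall>x\<ge>0. \<exists>L. ((\<lambda>t. ode_flow f t (x * exp (- f' 0 * t))) \<longlongrightarrow> L) at_top)
    \<and> (AE \<omega> in M. \<exists>L. ((\<lambda>t. exp (- f' 0 * t) * Y t \<omega>) \<longlongrightarrow> L) at_top)
    \<and> (let H = (\<lambda>x. Lim at_top (\<lambda>t. ode_flow f t (x * exp (- f' 0 * t))));
           W = (\<lambda>\<omega>. Lim at_top (\<lambda>t. exp (- f' 0 * t) * Y t \<omega>));
           T\<^sub>\<epsilon> = (\<lambda>\<epsilon>. (1 / f' 0) * ln (1 / \<epsilon>))
       in conv_in_prob M
            (\<lambda>\<epsilon> \<omega>. SUP t\<in>{0..T}. \<bar>X \<epsilon> (T\<^sub>\<epsilon> \<epsilon> + t) \<omega> - ode_flow f t (H (W \<omega>))\<bar>)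
            (\<lambda>_. 0) (at_right 0))"
proof -
  obtain Kf where Kf: "\<And>x. 0 \<le> x \<Longrightarrow> \<bar>f'' x\<bar> \<le> Kf"
    using f''_bdd unfolding bounded_iff by (metis atLeast_iff imageI real_norm_def)
  obtain Ks where Ks: "\<And>x. 0 \<le> x \<Longrightarrow> \<bar>\<sigma>'' x\<bar> \<le> Ks"
    using s''_bdd unfolding bounded_iff by (metis atLeast_iff imageI real_norm_def)
  obtain Cs where Cs: "\<And>x. 0 \<le> x \<Longrightarrow> \<bar>\<sigma>' x\<bar> \<le> Cs"
    using s'_bdd unfolding bounded_iff by (metis atLeast_iff imageI real_norm_def)
  note qf = derivative_bound_quadratic[OF f_d1 f_d2 Kf f0]
  note qs = derivative_bound_quadratic[OF s_d1 s_d2 Ks s0]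
  have Kf0: "0 \<le> Kf" using Kf[of 0] by simp
  have s_le: "\<sigma> x \<le> Cs * x" if x: "0 \<le> x" for x
  proof -
    have "norm (\<sigma> x - \<sigma> 0) \<le> Cs * norm (x - 0)"
    proof (rule field_differentiable_bound[where S = "{0..}"])
      show "(\<sigma> has_field_derivative \<sigma>' z) (at z within {0..})" if "z \<in> {0..}" for z using s_d1 that by simp
      show "norm (\<sigma>' z) \<le> Cs" if "z \<in> {0..}" for z using Cs that by simp
    qed (use x in auto)
    then show ?thesis using x s0 by simp
  qed
  interpret near_critical M B f f' "f' 0" Kf \<sigma> X Y "\<sigma>' 0" Cs "max Kf Ks"
  proof (unfold_locales)
    show "\<bar>f' x\<bar> \<le> f' 0 + Kf * x" if "0 \<le> x" for x using qf(1)[OF _ _ _ that] f'0 by linarith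
    show "\<bar>f x - f' 0 * x\<bar> \<le> max Kf Ks * x\<^sup>2" if "0 \<le> x" for x
      by (rule order_trans[OF qf(2)[OF _ _ _ that]]) (auto intro: mult_right_mono)
    show "\<bar>\<sigma> x - \<sigma>' 0 * x\<bar> \<le> max Kf Ks * x\<^sup>2" if "0 \<le> x" for x
      by (rule order_trans[OF qs(2)[OF _ _ _ that]]) (auto intro: mult_right_mono)
    show "continuous_on {0..} \<sigma>" by (rule DERIV_continuous_on[of "{0..}" \<sigma> \<sigma>']) (use s_d1 in auto)
    show "\<sigma>' 0 \<le> Cs" using Cs[of 0] by simp
  qed (use BM f_d1 f0 f'0 Kf0 drift s_nonneg s_le s'0 X_sol Y_sol in auto)
  show ?thesis
    unfolding Let_def using Hflow_convergent Y_converges_AE fluid_limit[OF T_pos]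
    unfolding Hflow_def Hlim_def by blast
qed

end
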